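(* Let $(M,\varphi)$ be a compact integrable $G_2$ manifold with closed torsion, $dT=0$. The following conditions are equivalent: a) The characteristic connection is Ricci flat, $Ric=0$; b) The $G_2$ structure is a Gauduchon $G_2$ structure, $\delta\theta=0$; c) The norm of the torsion is constant, $d\|T\|^2=0$; d) The Riemannian scalar curvature is a non-negative constant, $Scal^g=const.\ge 0$. In each of these cases, the torsion is a harmonic 3-form.
   Context: Manifolds are connected. A $G_2$ structure on a smooth 7-manifold $M$ is a 3-form $\varphi$ which near each point has, in a suitable local coframe $e_1,\dots,e_7$, the form $\varphi=e_{127}+e_{135}-e_{146}-e_{236}-e_{245}+e_{347}+e_{567}$, where $e_{ijk}=e_i\wedge e_j\wedge e_k$. It determines a Riemannian metric $g$ and an orientation for which such coframes are oriented orthonormal; $*$ is the Hodge star, $\nabla^g$ the Levi-Civita connection, $Scal^g$ the scalar curvature of $g$, and $\delta=(-1)^p*d*$ the codifferential on $p$-forms. $(d\varphi,*\varphi)$ is the pointwise scalar product of 4-forms, so $d\varphi\wedge\varphi=(d\varphi,*\varphi)\,vol$; $\|T\|^2=\sum_{i,j,k}T_{ijk}^2$ in an orthonormal frame. A 3-form $T$ is harmonic if $dT=\delta T=0$. The Lee form is $\theta=-\frac13*( *d\varphi\wedge\varphi)$. The $G_2$ structure is integrable if $d{*}\varphi=\theta\wedge{*}\varphi$. On an integrable $G_2$ manifold there is a unique metric connection $\nabla$ with $\nabla\varphi=0$ whose torsion $T(X,Y,Z)=g(\nabla_XY-\nabla_YX-[X,Y],Z)$ is a 3-form (the characteristic connection;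 "the torsion" always means this $T$); $g(\nabla_XY,Z)=g(\nabla^g_XY,Z)+\frac12T(X,Y,Z)$ and $T=-*d\varphi+*(\theta\wedge\varphi)+\frac16(d\varphi,*\varphi)\varphi$. Curvature of $\nabla$: $R(X,Y)Z=[\nabla_X,\nabla_Y]Z-\nabla_{[X,Y]}Z$, $R(X,Y,Z,V)=g(R(X,Y)Z,V)$, $Ric(X,Y)=\sum_iR(e_i,X,Y,e_i)$. *)

theory Defs
  imports "HOL-Analysis.Analysis"
begin

section \<open>Smooth maps and smooth 7-manifolds\<close>

text \<open>Only used for open \<open>S\<close>.\<close>

primrec Ck_on :: "nat \<Rightarrow> 'a::real_normed_vector set \<Rightarrow> ('a \<Rightarrow> 'b::real_normed_vector) \<Rightarrow> bool" where
  "Ck_on 0 S f \<longleftrightarrow> continuous_on S f"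
| "Ck_on (Suc k) S f \<longleftrightarrow> (\<forall>x\<in>S. f differentiable (at x)) \<and>
     (\<forall>v. Ck_on k S (\<lambda>x. frechet_derivative f (at x) v))"

definition smooth_on :: "'a::real_normed_vector set \<Rightarrow> ('a \<Rightarrow> 'b::real_normed_vector) \<Rightarrow> bool" where
  "smooth_on S f \<longleftrightarrow> (\<forall>k. Ck_on k S f)"

text \<open>
  The numeral type \<open>7\<close> has the elements \<open>1, ..., 7\<close> (with \<open>7 = 0\<close>); they index the coordinates
  of \<open>real^7\<close>.
\<close>

definition partial :: "7 \<Rightarrow> (real^7 \<Rightarrow> 'b::real_normed_vector) \<Rightarrow> real^7 \<Rightarrow> 'b" where
  "partial i f y = frechet_derivative f (at y) (axis i 1)"

type_synonym 'a chart = "'a set \<times> ('a \<Rightarrow> real^7)"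

definition chart_image :: "'a chart \<Rightarrow> (real^7) set" where
  "chart_image c = snd c ` fst c"

definition chart_on :: "'a topology \<Rightarrow> 'a chart \<Rightarrow> bool" where
  "chart_on X c \<longleftrightarrow> openin X (fst c) \<and> open (chart_image c) \<and>
     homeomorphic_map (subtopology X (fst c)) (top_of_set (chart_image c)) (snd c)"

definition overlap :: "'a chart \<Rightarrow> 'a chart \<Rightarrow> (real^7) set" where
  "overlap c d = snd c ` (fst c \<inter> fst d)"

definition transition :: "'a chart \<Rightarrow> 'a chart \<Rightarrow> real^7 \<Rightarrow> real^7" where
  "transition c d = snd d \<circ> inv_into (fst c) (snd c)"

text \<open>\<open>jac c d y a i\<close> is the derivative of the \<open>a\<close>-th coordinate of \<open>d\<close> by the \<open>i\<close>-th one of \<open>c\<close>.\<close>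

definition jac :: "'a chart \<Rightarrow> 'a chart \<Rightarrow> real^7 \<Rightarrow> 7 \<Rightarrow> 7 \<Rightarrow> real" where
  "jac c d y a i = partial i (transition c d) y $ a"

definition smooth_manifold7 :: "'a topology \<Rightarrow> 'a chart set \<Rightarrow> bool" where
  "smooth_manifold7 X A \<longleftrightarrow>
     Hausdorff_space X \<and> second_countable X \<and> connected_space X \<and>
     (\<forall>c\<in>A. chart_on X c) \<and> (\<Union>c\<in>A. fst c) = topspace X \<and>
     (\<forall>c\<in>A. \<forall>d\<in>A. smooth_on (overlap c d) (transition c d))"

section \<open>Pointwise exterior algebra in coordinates\<close>

text \<open>
  A covariant \<open>p\<close>-tensor at a point is given by its components: its value at a list
  \<open>[i\<^sub>1, ..., i\<^sub>p]\<close> is its value at the coordinate vectors with these indices.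
\<close>

type_synonym tens = "7 list \<Rightarrow> real"

definition alt_form :: "nat \<Rightarrow> tens \<Rightarrow> bool" where
  "alt_form p \<alpha> \<longleftrightarrow> (\<forall>l. length l \<noteq> p \<longrightarrow> \<alpha> l = 0) \<and>
     (\<forall>l \<sigma>. length l = p \<and> \<sigma> permutes {..<p} \<longrightarrow> \<alpha> (permute_list \<sigma> l) = of_int (sign \<sigma>) * \<alpha> l)"

definition wedge :: "nat \<Rightarrow> nat \<Rightarrow> tens \<Rightarrow> tens \<Rightarrow> tens" where
  "wedge p q \<alpha> \<beta> l =
     (if length l = p + q
      then (\<Sum>\<sigma> | \<sigma> permutes {..<p + q}.
              of_int (sign \<sigma>) * \<alpha> (take p (permute_list \<sigma> l)) * \<beta> (drop p (permute_list \<sigma> l)))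
           / (fact p * fact q)
      else 0)"

definition covector :: "real^7 \<Rightarrow> tens" where
  "covector v l = (if length l = 1 then v $ hd l else 0)"

primrec wedge_list :: "(real^7) list \<Rightarrow> tens" where
  "wedge_list [] = (\<lambda>l. if l = [] then 1 else 0)"
| "wedge_list (e # es) = wedge 1 (length es) (covector e) (wedge_list es)"

text \<open>In what follows \<open>g\<close> is the Gram matrix of a metric and \<open>w\<close> its volume form.\<close>

definition raise :: "real^7^7 \<Rightarrow> nat \<Rightarrow> tens \<Rightarrow> tens" where
  "raise g p \<alpha> l = (\<Sum>m | length m = p. (\<Prod>k<p. matrix_inv g $ (l ! k) $ (m ! k)) * \<alpha> m)"

text \<open>
  The full contraction: in an orthonormal frame, the sum of the squares of all components.
\<close>

definition norm_sq :: "real^7^7 \<Rightarrow> nat \<Rightarrow> tens \<Rightarrow> real" where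
  "norm_sq g p \<alpha> = (\<Sum>l | length l = p. raise g p \<alpha> l * \<alpha> l)"

text \<open>
  The convention is \<open>*(e\<^sub>1 \<and> ... \<and> e\<^sub>p) = e\<^sub>p\<^sub>+\<^sub>1 \<and> ... \<and> e\<^sub>7\<close> for oriented orthonormal coframes, that is
  \<open>\<alpha> \<and> *\<beta> = (\<alpha>, \<beta>) vol\<close>.
\<close>

definition hodge :: "real^7^7 \<Rightarrow> tens \<Rightarrow> nat \<Rightarrow> tens \<Rightarrow> tens" where
  "hodge g w p \<alpha> l =
     (if length l + p = 7 then (\<Sum>m | length m = p. raise g p \<alpha> m * w (m @ l)) / fact p else 0)"

section \<open>Differential forms and connections in a coordinate domain\<close>

definition ext_d :: "nat \<Rightarrow> (real^7 \<Rightarrow> tens) \<Rightarrow> real^7 \<Rightarrow> tens" where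
  "ext_d p \<alpha> y l =
     (if length l = Suc p
      then (\<Sum>k\<le>p. (- 1) ^ k * partial (l ! k) (\<lambda>z. \<alpha> z (take k l @ drop (Suc k) l)) y)
      else 0)"

definition codiff :: "(real^7 \<Rightarrow> real^7^7) \<Rightarrow> (real^7 \<Rightarrow> tens) \<Rightarrow> nat \<Rightarrow> (real^7 \<Rightarrow> tens) \<Rightarrow> real^7 \<Rightarrow> tens" where
  "codiff g w p \<alpha> y l =
     (- 1) ^ p * hodge (g y) (w y) (8 - p) (ext_d (7 - p) (\<lambda>z. hodge (g z) (w z) p (\<alpha> z)) y) l"

text \<open>
  A connection is given by its coefficients: \<open>\<Gamma> y i j\<close> is the covariant derivative at \<open>y\<close> of the
  \<open>j\<close>-th coordinate field in the direction of the \<open>i\<close>-th one.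
\<close>

type_synonym conn = "real^7 \<Rightarrow> 7 \<Rightarrow> 7 \<Rightarrow> real^7"

definition coord_field :: "7 \<Rightarrow> real^7 \<Rightarrow> real^7" where
  "coord_field i = (\<lambda>y. axis i 1)"

definition lie_bracket :: "(real^7 \<Rightarrow> real^7) \<Rightarrow> (real^7 \<Rightarrow> real^7) \<Rightarrow> real^7 \<Rightarrow> real^7" where
  "lie_bracket V W y = frechet_derivative W (at y) (V y) - frechet_derivative V (at y) (W y)"

definition cov :: "conn \<Rightarrow> (real^7 \<Rightarrow> real^7) \<Rightarrow> (real^7 \<Rightarrow> real^7) \<Rightarrow> real^7 \<Rightarrow> real^7" where
  "cov \<Gamma> V W y = frechet_derivative W (at y) (V y) + (\<Sum>i\<in>UNIV. \<Sum>j\<in>UNIV. (V y $ i * W y $ j) *\<^sub>R \<Gamma> y i j)"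

definition cov_tensor :: "conn \<Rightarrow> nat \<Rightarrow> (real^7 \<Rightarrow> tens) \<Rightarrow> real^7 \<Rightarrow> 7 \<Rightarrow> tens" where
  "cov_tensor \<Gamma> p \<alpha> y i l =
     partial i (\<lambda>z. \<alpha> z l) y - (\<Sum>m<p. \<Sum>a\<in>UNIV. \<Gamma> y i (l ! m) $ a * \<alpha> y (l[m := a]))"

definition metric_tensor :: "(real^7 \<Rightarrow> real^7^7) \<Rightarrow> real^7 \<Rightarrow> tens" where
  "metric_tensor g y l = g y $ (l ! 0) $ (l ! 1)"

definition torsion :: "(real^7 \<Rightarrow> real^7^7) \<Rightarrow> conn \<Rightarrow> real^7 \<Rightarrow> tens" where
  "torsion g \<Gamma> y l =
     (if length l = 3
      then let V = coord_field (l ! 0); W = coord_field (l ! 1); Z = coord_field (l ! 2)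
           in (g y *v (cov \<Gamma> V W y - cov \<Gamma> W V y - lie_bracket V W y)) \<bullet> Z y
      else 0)"

definition curv_op ::
  "conn \<Rightarrow> (real^7 \<Rightarrow> real^7) \<Rightarrow> (real^7 \<Rightarrow> real^7) \<Rightarrow> (real^7 \<Rightarrow> real^7) \<Rightarrow> real^7 \<Rightarrow> real^7" where
  "curv_op \<Gamma> V W Z y =
     cov \<Gamma> V (cov \<Gamma> W Z) y - cov \<Gamma> W (cov \<Gamma> V Z) y - cov \<Gamma> (lie_bracket V W) Z y"

definition curv :: "(real^7 \<Rightarrow> real^7^7) \<Rightarrow> conn \<Rightarrow> real^7 \<Rightarrow> 7 \<Rightarrow> 7 \<Rightarrow> 7 \<Rightarrow> 7 \<Rightarrow> real" where
  "curv g \<Gamma> y i j k l =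
     (g y *v curv_op \<Gamma> (coord_field i) (coord_field j) (coord_field k) y) \<bullet> coord_field l y"

text \<open>Contraction with the inverse metric is the sum over an orthonormal frame.\<close>

definition ricci :: "(real^7 \<Rightarrow> real^7^7) \<Rightarrow> conn \<Rightarrow> real^7 \<Rightarrow> 7 \<Rightarrow> 7 \<Rightarrow> real" where
  "ricci g \<Gamma> y i j = (\<Sum>a\<in>UNIV. \<Sum>b\<in>UNIV. matrix_inv (g y) $ a $ b * curv g \<Gamma> y a i j b)"

definition scal :: "(real^7 \<Rightarrow> real^7^7) \<Rightarrow> conn \<Rightarrow> real^7 \<Rightarrow> real" where
  "scal g \<Gamma> y = (\<Sum>a\<in>UNIV. \<Sum>b\<in>UNIV. matrix_inv (g y) $ a $ b * ricci g \<Gamma> y a b)"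

text \<open>The Christoffel symbols.\<close>

definition levi_civita :: "(real^7 \<Rightarrow> real^7^7) \<Rightarrow> conn" where
  "levi_civita g y i j = (\<chi> k. (\<Sum>l\<in>UNIV. matrix_inv (g y) $ k $ l *
     (partial i (\<lambda>z. g z $ j $ l) y + partial j (\<lambda>z. g z $ i $ l) y - partial l (\<lambda>z. g z $ i $ j) y)) / 2)"

section \<open>The metric, volume form and Lee form of a \<open>G\<^sub>2\<close> form\<close>

text \<open>The rows \<open>E $ 1, ..., E $ 7\<close> of a matrix \<open>E\<close> are the covectors of a coframe.\<close>

definition g2_form :: "real^7^7 \<Rightarrow> tens" where
  "g2_form E =
     (let e = (\<lambda>i j k. wedge_list [E $ i, E $ j, E $ k])
      in (\<lambda>l. e 1 2 7 l + e 1 3 5 l - e 1 4 6 l - e 2 3 6 l - e 2 4 5 l + e 3 4 7 l + e 5 6 7 l))"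

definition adapted :: "real^7^7 \<Rightarrow> tens \<Rightarrow> bool" where
  "adapted E f \<longleftrightarrow> invertible E \<and> f = g2_form E"

text \<open>
  The stabilizer of the normal form lies in \<open>SO(7)\<close>, so all coframes adapted to \<open>f\<close> give the same
  metric and the same volume form.
\<close>

definition g2_metric :: "tens \<Rightarrow> real^7^7" where
  "g2_metric f = (THE g. \<forall>E. adapted E f \<longrightarrow> g = transpose E ** E)"

definition g2_vol :: "tens \<Rightarrow> tens" where
  "g2_vol f = (THE w. \<forall>E. adapted E f \<longrightarrow> w = wedge_list [E $ 1, E $ 2, E $ 3, E $ 4, E $ 5, E $ 6, E $ 7])"

definition g2_star :: "(real^7 \<Rightarrow> tens) \<Rightarrow> nat \<Rightarrow> (real^7 \<Rightarrow> tens) \<Rightarrow> real^7 \<Rightarrow> tens" where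
  "g2_star \<phi> p \<alpha> y = hodge (g2_metric (\<phi> y)) (g2_vol (\<phi> y)) p (\<alpha> y)"

definition g2_codiff :: "(real^7 \<Rightarrow> tens) \<Rightarrow> nat \<Rightarrow> (real^7 \<Rightarrow> tens) \<Rightarrow> real^7 \<Rightarrow> tens" where
  "g2_codiff \<phi> = codiff (\<lambda>y. g2_metric (\<phi> y)) (\<lambda>y. g2_vol (\<phi> y))"

definition lee_form :: "(real^7 \<Rightarrow> tens) \<Rightarrow> real^7 \<Rightarrow> tens" where
  "lee_form \<phi> y l =
     - (1 / 3) * g2_star \<phi> 6 (\<lambda>z. wedge 3 3 (g2_star \<phi> 4 (ext_d 3 \<phi>) z) (\<phi> z)) y l"

definition g2_torsion :: "(real^7 \<Rightarrow> tens) \<Rightarrow> conn \<Rightarrow> real^7 \<Rightarrow> tens" where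
  "g2_torsion \<phi> = torsion (\<lambda>y. g2_metric (\<phi> y))"

definition g2_ricci :: "(real^7 \<Rightarrow> tens) \<Rightarrow> conn \<Rightarrow> real^7 \<Rightarrow> 7 \<Rightarrow> 7 \<Rightarrow> real" where
  "g2_ricci \<phi> = ricci (\<lambda>y. g2_metric (\<phi> y))"

definition g2_scal :: "(real^7 \<Rightarrow> tens) \<Rightarrow> real^7 \<Rightarrow> real" where
  "g2_scal \<phi> = (let g = (\<lambda>y. g2_metric (\<phi> y)) in scal g (levi_civita g))"

definition g2_norm_sq :: "(real^7 \<Rightarrow> tens) \<Rightarrow> nat \<Rightarrow> (real^7 \<Rightarrow> tens) \<Rightarrow> real^7 \<Rightarrow> real" where
  "g2_norm_sq \<phi> p \<alpha> y = norm_sq (g2_metric (\<phi> y)) p (\<alpha> y)"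

section \<open>Fields on the manifold\<close>

text \<open>
  A tensor field or a connection on the manifold is a family, indexed by the charts of the atlas, of
  coordinate expressions which are smooth on the chart images and related by the transformation law.
  Values outside the chart images are irrelevant.
\<close>

definition form_field :: "'a chart set \<Rightarrow> nat \<Rightarrow> ('a chart \<Rightarrow> real^7 \<Rightarrow> tens) \<Rightarrow> bool" where
  "form_field A p \<alpha> \<longleftrightarrow>
     (\<forall>c\<in>A. (\<forall>y\<in>chart_image c. alt_form p (\<alpha> c y)) \<and> (\<forall>l. smooth_on (chart_image c) (\<lambda>y. \<alpha> c y l))) \<and>
     (\<forall>c\<in>A. \<forall>d\<in>A. \<forall>y\<in>overlap c d. \<forall>l. length l = p \<longrightarrow>
        \<alpha> c y l = (\<Sum>m | length m = p. (\<Prod>k<p. jac c d y (m ! k) (l ! k)) * \<alpha> d (transition c d y) m))"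

definition connection :: "'a chart set \<Rightarrow> ('a chart \<Rightarrow> conn) \<Rightarrow> bool" where
  "connection A \<Gamma> \<longleftrightarrow>
     (\<forall>c\<in>A. \<forall>i j. smooth_on (chart_image c) (\<lambda>y. \<Gamma> c y i j)) \<and>
     (\<forall>c\<in>A. \<forall>d\<in>A. \<forall>y\<in>overlap c d. \<forall>i j m.
        (\<Sum>k\<in>UNIV. jac c d y m k * \<Gamma> c y i j $ k) =
        partial i (\<lambda>z. jac c d z m j) y +
        (\<Sum>a\<in>UNIV. \<Sum>b\<in>UNIV. jac c d y a i * jac c d y b j * \<Gamma> d (transition c d y) a b $ m))"

text \<open>
  \<open>E\<close> is the local coframe near the point \<open>x\<close>, expressed in the coordinates of the chart \<open>c\<close>.
\<close>

definition g2_structure :: "'a topology \<Rightarrow> 'a chart set \<Rightarrow> ('a chart \<Rightarrow> real^7 \<Rightarrow> tens) \<Rightarrow> bool" where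
  "g2_structure X A \<phi> \<longleftrightarrow> form_field A 3 \<phi> \<and>
     (\<forall>x\<in>topspace X. \<exists>c\<in>A. x \<in> fst c \<and>
        (\<exists>W E. open W \<and> snd c x \<in> W \<and> W \<subseteq> chart_image c \<and> smooth_on W E \<and>
           (\<forall>y\<in>W. adapted (E y) (\<phi> c y))))"

definition integrable_g2 :: "'a chart set \<Rightarrow> ('a chart \<Rightarrow> real^7 \<Rightarrow> tens) \<Rightarrow> bool" where
  "integrable_g2 A \<phi> \<longleftrightarrow> (\<forall>c\<in>A. \<forall>y\<in>chart_image c.
     ext_d 4 (g2_star (\<phi> c) 3 (\<phi> c)) y = wedge 1 4 (lee_form (\<phi> c) y) (g2_star (\<phi> c) 3 (\<phi> c) y))"

definition characteristic_connection ::
  "'a chart set \<Rightarrow> ('a chart \<Rightarrow> real^7 \<Rightarrow> tens) \<Rightarrow> ('a chart \<Rightarrow> conn) \<Rightarrow> bool" where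
  "characteristic_connection A \<phi> \<Gamma> \<longleftrightarrow> connection A \<Gamma> \<and>
     (\<forall>c\<in>A. \<forall>y\<in>chart_image c.
        (\<forall>i l. length l = 2 \<longrightarrow> cov_tensor (\<Gamma> c) 2 (metric_tensor (\<lambda>z. g2_metric (\<phi> c z))) y i l = 0) \<and>
        (\<forall>i l. length l = 3 \<longrightarrow> cov_tensor (\<Gamma> c) 3 (\<phi> c) y i l = 0)) \<and>
     form_field A 3 (\<lambda>c. g2_torsion (\<phi> c) (\<Gamma> c))"

definition closed_form :: "'a chart set \<Rightarrow> nat \<Rightarrow> ('a chart \<Rightarrow> real^7 \<Rightarrow> tens) \<Rightarrow> bool" where
  "closed_form A p \<alpha> \<longleftrightarrow> (\<forall>c\<in>A. \<forall>y\<in>chart_image c. \<forall>l. ext_d p (\<alpha> c) y l = 0)"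

definition coclosed_form ::
  "'a chart set \<Rightarrow> ('a chart \<Rightarrow> real^7 \<Rightarrow> tens) \<Rightarrow> nat \<Rightarrow> ('a chart \<Rightarrow> real^7 \<Rightarrow> tens) \<Rightarrow> bool" where
  "coclosed_form A \<phi> p \<alpha> \<longleftrightarrow> (\<forall>c\<in>A. \<forall>y\<in>chart_image c. \<forall>l. g2_codiff (\<phi> c) p (\<alpha> c) y l = 0)"

definition harmonic_form ::
  "'a chart set \<Rightarrow> ('a chart \<Rightarrow> real^7 \<Rightarrow> tens) \<Rightarrow> nat \<Rightarrow> ('a chart \<Rightarrow> real^7 \<Rightarrow> tens) \<Rightarrow> bool" where
  "harmonic_form A \<phi> p \<alpha> \<longleftrightarrow> closed_form A p \<alpha> \<and> coclosed_form A \<phi> p \<alpha>"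

definition ricci_flat :: "'a chart set \<Rightarrow> ('a chart \<Rightarrow> real^7 \<Rightarrow> tens) \<Rightarrow> ('a chart \<Rightarrow> conn) \<Rightarrow> bool" where
  "ricci_flat A \<phi> \<Gamma> \<longleftrightarrow> (\<forall>c\<in>A. \<forall>y\<in>chart_image c. \<forall>i j. g2_ricci (\<phi> c) (\<Gamma> c) y i j = 0)"

definition gauduchon_g2 :: "'a chart set \<Rightarrow> ('a chart \<Rightarrow> real^7 \<Rightarrow> tens) \<Rightarrow> bool" where
  "gauduchon_g2 A \<phi> \<longleftrightarrow> coclosed_form A \<phi> 1 (\<lambda>c. lee_form (\<phi> c))"

definition torsion_norm_constant ::
  "'a chart set \<Rightarrow> ('a chart \<Rightarrow> real^7 \<Rightarrow> tens) \<Rightarrow> ('a chart \<Rightarrow> conn) \<Rightarrow> bool" where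
  "torsion_norm_constant A \<phi> \<Gamma> \<longleftrightarrow> (\<forall>c\<in>A. \<forall>y\<in>chart_image c. \<forall>i.
     partial i (g2_norm_sq (\<phi> c) 3 (g2_torsion (\<phi> c) (\<Gamma> c))) y = 0)"

definition scal_nonneg_constant :: "'a chart set \<Rightarrow> ('a chart \<Rightarrow> real^7 \<Rightarrow> tens) \<Rightarrow> bool" where
  "scal_nonneg_constant A \<phi> \<longleftrightarrow> (\<exists>k\<ge>0. \<forall>c\<in>A. \<forall>y\<in>chart_image c. g2_scal (\<phi> c) y = k)"

end

(*
  The characteristic connection is metric and parallelizes phi, so on each chart its curvature takes
  values in g_2. With dT = 0 the first Bianchi identity gives Ric = - nabla theta, where theta is the
  Lee form, expressed through T and phi, and it makes the function tau = (T, phi) constant. Hence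
  the trace of Ric is S = - tr nabla theta = delta theta, and a quadratic identity for 3-forms gives
  S = |T|^2/6 - |theta|^2 - tau^2/36, while Scal^g = S + |T|^2/4. Commuting derivatives yields
    tr nabla^2 |theta|^2 = 2 |nabla theta|^2 - 2 theta(S) - theta(|theta|^2).
  Each of the conditions S = 0, |T|^2 constant and Scal^g constant makes dS a constant multiple of
  d|theta|^2, so the strong maximum principle forces |theta|^2 to be constant, whence nabla theta = 0.
  Conversely nabla theta = 0 gives Ric = 0, S = 0 and constant |theta|^2, so |T|^2 and Scal^g are
  constant. Finally the divergence of T is the antisymmetric part of Ric.
*)
theory Submission
  imports Defs "HOL-Combinatorics.Multiset_Permutations"
begin

section \<open>Sums over index lists\<close>

text \<open>Ric becomes a derivative of theta through an eigenvalue: contraction with the dual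
  4-form multiplies 2-forms in g_2 by -2. So contracting the Bianchi identity in its last three
  arguments with that 4-form isolates Ric, and contracting it with phi gives 0. The formula for the
  Laplacian of |theta|^2 closes because the double divergence of T cancels exactly the torsion term
  produced by commuting two derivatives. Only a first order term along theta is left over, a drift
  that the maximum principle tolerates. The inequality is therefore used in one chart at a time:
  compactness supplies a maximum point, connectedness spreads it, and nothing has to be integrated.
  Metric and form are parallel, so contractions with them commute with the covariant derivative, and
  pointwise identities may be checked in an adapted coframe chosen separately at each point. The
  factors mu in dS = mu d|theta|^2 are 0, -1 and -3/5. They come from dS = d|T|^2/6 - d|theta|^2; in
  the last case d|T|^2 = -4 dS.\<close>

lemma finite_length_eq: "finite {m::7 list. length m = n}"
  using finite_lists_length_eq[of "UNIV::7 set" n] by simp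

lemma sum_length_0: "(\<Sum>m::7 list | length m = 0. f m) = f []"
proof -
  have "{m::7 list. length m = 0} = {[]}" by auto
  then show ?thesis by simp
qed

lemma sum_length_Suc:
  "(\<Sum>m::7 list | length m = Suc n. f m) = (\<Sum>a\<in>UNIV. \<Sum>m | length m = n. f (a # m))"
proof -
  have "(\<Sum>a\<in>UNIV. \<Sum>m::7 list | length m = n. f (a # m)) =
      (\<Sum>x\<in>UNIV \<times> {m. length m = n}. f (fst x # snd x))"
    by (simp add: sum.cartesian_product case_prod_beta)
  also have "\<dots> = (\<Sum>m | length m = Suc n. f m)"
    by (rule sum.reindex_bij_witness[of _ "\<lambda>m. (hd m, tl m)" "\<lambda>x. fst x # snd x"])
      (auto simp: length_Suc_conv)
  finally show ?thesis by simp
qed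

lemma sum_length_add:
  "(\<Sum>m::7 list | length m = p + q. f m) = (\<Sum>a | length a = p. \<Sum>b | length b = q. f (a @ b))"
  by (induction p arbitrary: f) (simp_all add: sum_length_0 sum_length_Suc)

lemma length_numeral_sums:
  "(\<Sum>m::7 list | length m = 1. f m) = (\<Sum>a\<in>UNIV. f [a])"
  "(\<Sum>m::7 list | length m = Suc 0. f m) = (\<Sum>a\<in>UNIV. f [a])"
  "(\<Sum>m::7 list | length m = 2. f m) = (\<Sum>a\<in>UNIV. \<Sum>b\<in>UNIV. f [a, b])"
  "(\<Sum>m::7 list | length m = 3. f m) = (\<Sum>a\<in>UNIV. \<Sum>b\<in>UNIV. \<Sum>c\<in>UNIV. f [a, b, c])"
  "(\<Sum>m::7 list | length m = 4. f m) = (\<Sum>a\<in>UNIV. \<Sum>b\<in>UNIV. \<Sum>c\<in>UNIV. \<Sum>d\<in>UNIV. f [a, b, c, d])"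
  by (simp_all add: numeral_eq_Suc sum_length_Suc sum_length_0 del: sum.cong)

lemma UNIV7: "(UNIV::7 set) = {1, 2, 3, 4, 5, 6, 7}"
proof -
  have "card {1, 2, 3, 4, 5, 6, 7::7} = CARD(7)" by simp
  then show ?thesis by (metis card_subset_eq finite subset_UNIV)
qed

section \<open>Kernels, pullbacks and contractions\<close>

text \<open>The kernel of a tensor power of a matrix. With a Jacobian for \<open>P\<close> it pulls
  back, with an inverse metric it raises all indices. The degree is read off the second list, so one
  definition serves all degrees.\<close>

definition lk :: "real^7^7 \<Rightarrow> 7 list \<Rightarrow> 7 list \<Rightarrow> real" where
  "lk P m l = (\<Prod>k<length l. P $ (m ! k) $ (l ! k))"

lemma lk_Nil [simp]: "lk P m [] = 1"
  by (simp add: lk_def)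

lemma lk_Cons [simp]: "lk P (a # m) (b # l) = P $ a $ b * lk P m l"
  by (simp add: lk_def prod.lessThan_Suc_shift del: prod.lessThan_Suc)

lemma lk_append: "length m1 = length l1 \<Longrightarrow> lk P (m1 @ m2) (l1 @ l2) = lk P m1 l1 * lk P m2 l2"
  by (induction m1 l1 rule: list_induct2) simp_all

lemma lk_mat_1: "length a = length b \<Longrightarrow> lk (mat 1) a b = (if a = b then 1 else 0)"
  by (induction a b rule: list_induct2) (simp_all add: mat_def)

lemma lk_transpose: "length a = length b \<Longrightarrow> lk (transpose A) a b = lk A b a"
  by (induction a b rule: list_induct2) (simp_all add: transpose_def)

text \<open>Functoriality of the tensor power. Composition of pullbacks and the transport of the
  inverse metric both reduce to it.\<close>

lemma lk_mult:
  "length a = length b \<Longrightarrow> (\<Sum>m | length m = length b. lk A a m * lk B m b) = lk (A ** B) a b"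
proof (induction a b rule: list_induct2)
  case Nil
  show ?case by (simp add: sum_length_0[simplified])
next
  case (Cons x xs y ys)
  have "(\<Sum>m | length m = length (y # ys). lk A (x # xs) m * lk B m (y # ys)) =
      (\<Sum>c\<in>UNIV. \<Sum>m | length m = length ys. (A $ x $ c * B $ c $ y) * (lk A xs m * lk B m ys))"
    by (simp add: sum_length_Suc mult_ac)
  also have "\<dots> = (\<Sum>c\<in>UNIV. (A $ x $ c * B $ c $ y) * lk (A ** B) xs ys)"
    by (simp add: sum_distrib_left[symmetric] Cons.IH)
  also have "\<dots> = lk (A ** B) (x # xs) (y # ys)"
    by (simp add: matrix_matrix_mult_def sum_distrib_right)
  finally show ?case .
qed

lemma lk_permute_list:
  assumes "\<sigma> permutes {..<length l}" "length m = length l"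
  shows "lk P (permute_list \<sigma> m) (permute_list \<sigma> l) = lk P m l"
proof -
  have "lk P (permute_list \<sigma> m) (permute_list \<sigma> l) = (\<Prod>k<length l. P $ (m ! \<sigma> k) $ (l ! \<sigma> k))"
    using assms by (simp add: lk_def permute_list_nth)
  also have "\<dots> = lk P m l"
    unfolding lk_def using prod.permute[OF assms(1), of "\<lambda>k. P $ (m ! k) $ (l ! k)"] by (simp add: o_def)
  finally show ?thesis .
qed

definition pull :: "real^7^7 \<Rightarrow> tens \<Rightarrow> tens" where
  "pull P \<alpha> l = (\<Sum>m | length m = length l. lk P m l * \<alpha> m)"

lemma pull_Nil [simp]: "pull P \<alpha> [] = \<alpha> []"
  by (simp add: pull_def sum_length_0[simplified])

lemma pull_mat_1 [simp]: "pull (mat 1) \<alpha> = \<alpha>"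
proof
  fix l
  have "pull (mat 1) \<alpha> l = (\<Sum>m | length m = length l. if m = l then \<alpha> m else 0)"
    unfolding pull_def by (rule sum.cong) (auto simp: lk_mat_1)
  then show "pull (mat 1) \<alpha> l = \<alpha> l"
    by (simp add: finite_length_eq sum.delta)
qed

lemma pull_pull: "pull P (pull Q \<alpha>) = pull (Q ** P) \<alpha>"
proof
  fix l
  have "pull P (pull Q \<alpha>) l =
      (\<Sum>m | length m = length l. \<Sum>n | length n = length l. lk P m l * (lk Q n m * \<alpha> n))"
    by (simp add: pull_def sum_distrib_left)
  also have "\<dots> = (\<Sum>n | length n = length l. \<Sum>m | length m = length l. lk P m l * (lk Q n m * \<alpha> n))"
    by (rule sum.swap)
  also have "\<dots> = (\<Sum>n | length n = length l. (\<Sum>m | length m = length l. lk Q n m * lk P m l) * \<alpha> n)"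
    by (simp add: sum_distrib_left sum_distrib_right mult_ac)
  also have "\<dots> = pull (Q ** P) \<alpha> l"
    unfolding pull_def by (rule sum.cong) (auto simp: lk_mult)
  finally show "pull P (pull Q \<alpha>) l = pull (Q ** P) \<alpha> l" .
qed

lemma pull_append:
  "pull P \<alpha> (l1 @ l2) =
     (\<Sum>a | length a = length l1. \<Sum>b | length b = length l2. lk P a l1 * lk P b l2 * \<alpha> (a @ b))"
  unfolding pull_def length_append sum_length_add
  by (intro sum.cong refl) (simp add: lk_append)

lemma pull_explicit:
  "pull P \<alpha> [i] = (\<Sum>a\<in>UNIV. P $ a $ i * \<alpha> [a])"
  "pull P \<alpha> [i, j] = (\<Sum>a\<in>UNIV. \<Sum>b\<in>UNIV. P $ a $ i * P $ b $ j * \<alpha> [a, b])"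
  by (simp_all add: pull_def sum_length_Suc sum_length_0[simplified] mult.assoc)

text \<open>The last \<open>k\<close> slots of \<open>\<alpha>\<close> are paired with the first
  \<open>k\<close> slots of \<open>\<beta>\<close>. A \<open>tens\<close> does not record its
  degree, so \<open>p\<close> says how many of the free indices belong to \<open>\<alpha>\<close>.
  The Hodge star, norms and traces are instances.\<close>

definition contr :: "real^7^7 \<Rightarrow> nat \<Rightarrow> nat \<Rightarrow> tens \<Rightarrow> tens \<Rightarrow> tens" where
  "contr h p k \<alpha> \<beta> l =
     (\<Sum>m | length m = k. \<Sum>n | length n = k. lk h n m * \<alpha> (take p l @ m) * \<beta> (n @ drop p l))"

text \<open>Naturality of contraction: the kernel of \<open>h\<close> factors through that of
  \<open>h'\<close>, and each factor \<open>P\<close> is absorbed by the tensor it meets. It is used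
  with an adapted frame, where \<open>h'\<close> is the identity, and with the Jacobian of a
  coordinate change.\<close>

lemma contr_pull:
  assumes h: "h = P ** h' ** transpose P" and pl: "p \<le> length l"
  shows "pull P (contr h p k \<alpha> \<beta>) l = contr h' p k (pull P \<alpha>) (pull P \<beta>) l"
proof -
  define l1 l2 where "l1 = take p l" and "l2 = drop p l"
  have l: "l = l1 @ l2" and l1: "length l1 = p" using pl by (auto simp: l1_def l2_def)
  let ?S = "\<lambda>n. {m::7 list. length m = n}"
  have hk: "lk h s r = (\<Sum>n\<in>?S k. \<Sum>m\<in>?S k. lk P s n * lk h' n m * lk P r m)"
    if "length r = k" "length s = k" for r s
  proof -
    have "lk h s r = (\<Sum>m\<in>?S k. lk (P ** h') s m * lk (transpose P) m r)"
      unfolding h using lk_mult[of s r "P ** h'" "transpose P"] that by simp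
    also have "\<dots> = (\<Sum>m\<in>?S k. (\<Sum>n\<in>?S k. lk P s n * lk h' n m) * lk P r m)"
    proof (rule sum.cong[OF refl])
      fix m assume "m \<in> ?S k"
      then show "lk (P ** h') s m * lk (transpose P) m r = (\<Sum>n\<in>?S k. lk P s n * lk h' n m) * lk P r m"
        using lk_mult[of s m P h'] lk_transpose[of m r P] that by simp
    qed
    also have "\<dots> = (\<Sum>m\<in>?S k. \<Sum>n\<in>?S k. lk P s n * lk h' n m * lk P r m)"
      by (simp add: sum_distrib_right)
    also have "\<dots> = (\<Sum>n\<in>?S k. \<Sum>m\<in>?S k. lk P s n * lk h' n m * lk P r m)"
      by (rule sum.swap)
    finally show ?thesis .
  qed
  have "pull P (contr h p k \<alpha> \<beta>) l =
      (\<Sum>a\<in>?S p. \<Sum>b\<in>?S (length l2). \<Sum>r\<in>?S k. \<Sum>s\<in>?S k.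
          lk P a l1 * lk P b l2 * (lk h s r * \<alpha> (a @ r) * \<beta> (s @ b)))"
    unfolding l pull_append l1
    by (intro sum.cong refl) (simp add: contr_def sum_distrib_left)
  also have "\<dots> = (\<Sum>a\<in>?S p. \<Sum>b\<in>?S (length l2). \<Sum>r\<in>?S k. \<Sum>s\<in>?S k. \<Sum>n\<in>?S k. \<Sum>m\<in>?S k.
          lk h' n m * (lk P a l1 * lk P r m * \<alpha> (a @ r)) * (lk P s n * lk P b l2 * \<beta> (s @ b)))"
    by (intro sum.cong refl) (simp add: hk sum_distrib_left sum_distrib_right mult_ac)
  also have "\<dots> = (\<Sum>m\<in>?S k. \<Sum>n\<in>?S k. \<Sum>a\<in>?S p. \<Sum>r\<in>?S k. \<Sum>s\<in>?S k. \<Sum>b\<in>?S (length l2).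
          lk h' n m * (lk P a l1 * lk P r m * \<alpha> (a @ r)) * (lk P s n * lk P b l2 * \<beta> (s @ b)))"
    (is "?A = ?B")
  proof -
    \<comment> \<open>The six sums are permuted in one reindexing of the product set.\<close>
    let ?G = "\<lambda>a b r s n m. lk h' n m * (lk P a l1 * lk P r m * \<alpha> (a @ r)) * (lk P s n * lk P b l2 * \<beta> (s @ b))"
    have "?A = (\<Sum>(a,b,r,s,n,m)\<in>?S p \<times> ?S (length l2) \<times> ?S k \<times> ?S k \<times> ?S k \<times> ?S k. ?G a b r s n m)"
      by (simp add: sum.cartesian_product case_prod_beta)
    also have "\<dots> = (\<Sum>(m,n,a,r,s,b)\<in>?S k \<times> ?S k \<times> ?S p \<times> ?S k \<times> ?S k \<times> ?S (length l2). ?G a b r s n m)"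
      by (rule sum.reindex_bij_witness[of _ "\<lambda>(m,n,a,r,s,b). (a,b,r,s,n,m)" "\<lambda>(a,b,r,s,n,m). (m,n,a,r,s,b)"]) auto
    also have "\<dots> = ?B" by (simp add: sum.cartesian_product case_prod_beta)
    finally show ?thesis .
  qed
  also have "\<dots> = (\<Sum>m\<in>?S k. \<Sum>n\<in>?S k. lk h' n m * pull P \<alpha> (l1 @ m) * pull P \<beta> (n @ l2))"
  proof (intro sum.cong refl)
    fix m n assume "m \<in> ?S k" "n \<in> ?S k"
    then have "pull P \<alpha> (l1 @ m) = (\<Sum>a\<in>?S p. \<Sum>r\<in>?S k. lk P a l1 * lk P r m * \<alpha> (a @ r))"
      and "pull P \<beta> (n @ l2) = (\<Sum>s\<in>?S k. \<Sum>b\<in>?S (length l2). lk P s n * lk P b l2 * \<beta> (s @ b))"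
      by (simp_all add: pull_append l1)
    moreover have "(\<Sum>a\<in>A. \<Sum>r\<in>R. \<Sum>s\<in>S. \<Sum>b\<in>B. c * f a r * g s b) =
        c * (\<Sum>a\<in>A. \<Sum>r\<in>R. f a r) * (\<Sum>s\<in>S. \<Sum>b\<in>B. g s b)"
      for c :: real and A R S B :: "7 list set" and f g
    proof -
      have "(\<Sum>a\<in>A. \<Sum>r\<in>R. \<Sum>s\<in>S. \<Sum>b\<in>B. c * f a r * g s b) =
          (\<Sum>a\<in>A. \<Sum>r\<in>R. c * f a r * (\<Sum>s\<in>S. \<Sum>b\<in>B. g s b))"
        by (simp add: sum_distrib_left[symmetric])
      then show ?thesis by (simp add: sum_distrib_left[symmetric] sum_distrib_right[symmetric])
    qed
    ultimately show "(\<Sum>a\<in>?S p. \<Sum>r\<in>?S k. \<Sum>s\<in>?S k. \<Sum>b\<in>?S (length l2).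
          lk h' n m * (lk P a l1 * lk P r m * \<alpha> (a @ r)) * (lk P s n * lk P b l2 * \<beta> (s @ b))) =
        lk h' n m * pull P \<alpha> (l1 @ m) * pull P \<beta> (n @ l2)"
      by simp
  qed
  also have "\<dots> = contr h' p k (pull P \<alpha>) (pull P \<beta>) l"
    by (simp add: contr_def l1_def l2_def)
  finally show ?thesis .
qed

section \<open>Alternating tensors\<close>

text \<open>Adjacent swaps, at every position and every length: no degree is fixed, and the
  condition matches literal index lists. \<open>alt_form\<close> implies it.\<close>

definition alternating :: "tens \<Rightarrow> bool" where
  "alternating \<alpha> \<longleftrightarrow> (\<forall>xs a b ys. \<alpha> (xs @ a # b # ys) = - \<alpha> (xs @ b # a # ys))"

lemma alternatingD: "alternating \<alpha> \<Longrightarrow> \<alpha> (xs @ a # b # ys) = - \<alpha> (xs @ b # a # ys)"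
  unfolding alternating_def by blast

lemma alternating_affix:
  assumes "alternating \<alpha>" shows "alternating (\<lambda>l. \<alpha> (us @ l @ vs))"
  unfolding alternating_def
proof (intro allI)
  fix xs ys and a b :: 7
  show "\<alpha> (us @ (xs @ a # b # ys) @ vs) = - \<alpha> (us @ (xs @ b # a # ys) @ vs)"
    using alternatingD[OF assms, of "us @ xs" a b "ys @ vs"] by (simp only: append_assoc append_Cons)
qed

lemma alternating_Cons: "alternating \<alpha> \<Longrightarrow> alternating (\<lambda>l. \<alpha> (x # l))"
  using alternating_affix[of \<alpha> "[x]" "[]"] by simp

lemma alternating_suffix: "alternating \<alpha> \<Longrightarrow> alternating (\<lambda>l. \<alpha> (l @ ys))"
  using alternating_affix[of \<alpha> "[]" ys] by simp

lemma alternating_move: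
  assumes "alternating \<alpha>"
  shows "\<alpha> (xs @ x # ys @ zs) = (- 1) ^ length ys * \<alpha> (xs @ ys @ x # zs)"
proof (induction ys arbitrary: xs)
  case (Cons y ys)
  have "\<alpha> (xs @ x # (y # ys) @ zs) = - \<alpha> ((xs @ [y]) @ x # ys @ zs)"
    using alternatingD[OF assms, of xs x y "ys @ zs"] by simp
  then show ?case using Cons.IH[of "xs @ [y]"] by simp
qed simp

lemma alternating_swap:
  assumes "alternating \<alpha>"
  shows "\<alpha> (xs @ x # ys @ y # zs) = - \<alpha> (xs @ y # ys @ x # zs)"
proof -
  have "\<alpha> (xs @ x # ys @ y # zs) = (- 1) ^ length ys * \<alpha> (xs @ ys @ x # y # zs)"
    by (rule alternating_move[OF assms])
  also have "\<alpha> (xs @ ys @ x # y # zs) = - \<alpha> (xs @ ys @ y # x # zs)"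
    using alternatingD[OF assms, of "xs @ ys" x y zs] by simp
  also have "(- 1) ^ length ys * - \<alpha> (xs @ ys @ y # x # zs) = - \<alpha> (xs @ y # ys @ x # zs)"
    using alternating_move[OF assms, of xs y ys "x # zs"] by simp
  finally show ?thesis .
qed

lemma alternating_not_distinct:
  assumes "alternating \<alpha>" "\<not> distinct l"
  shows "\<alpha> l = 0"
proof -
  obtain xs ys zs x where "l = xs @ [x] @ ys @ [x] @ zs"
    using not_distinct_decomp[OF assms(2)] by blast
  then show ?thesis using alternating_swap[OF assms(1), of xs x ys x zs] by simp
qed

text \<open>The sign is found before the tensor, so one \<open>s\<close> serves all alternating
  tensors. Hence a product of two of them does not change when both arguments are rearranged alike,
  because \<open>s * s = 1\<close>.\<close>

lemma alternating_mset:
  assumes "mset a = mset b"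
  shows "\<exists>s\<in>{1, - 1}. \<forall>\<alpha>. alternating \<alpha> \<longrightarrow> \<alpha> a = s * \<alpha> b"
  using assms
proof (induction a arbitrary: b)
  case (Cons x a)
  from Cons.prems have "x \<in> set b" by (metis list.set_intros(1) mset_eq_setD)
  then obtain u v where b: "b = u @ x # v" by (meson split_list)
  then have "mset a = mset (u @ v)" using Cons.prems by simp
  from Cons.IH[OF this] obtain s where s: "s \<in> {1, - 1}"
    "\<And>\<alpha>. alternating \<alpha> \<Longrightarrow> \<alpha> a = s * \<alpha> (u @ v)" by blast
  have "\<alpha> (x # a) = s * (- 1) ^ length u * \<alpha> b" if "alternating \<alpha>" for \<alpha>
    using s(2)[OF alternating_Cons[OF that], of x] alternating_move[OF that, of "[]" x u v]
    by (simp add: b)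
  moreover have "s * (- 1) ^ length u \<in> {1, - 1}"
    using s(1) by (cases "even (length u)") auto
  ultimately show ?case by blast
qed simp

lemma permute_list_transpose:
  assumes "a < length l" "b < length l"
  shows "permute_list (Transposition.transpose a b) l = l[a := l ! b, b := l ! a]"
proof (rule nth_equalityI)
  fix i assume "i < length (permute_list (Transposition.transpose a b) l)"
  then have i: "i < length l" by simp
  have p: "Transposition.transpose a b permutes {..<length l}"
    using assms by (simp add: permutes_swap_id)
  show "permute_list (Transposition.transpose a b) l ! i = l[a := l ! b, b := l ! a] ! i"
    using i assms by (auto simp: permute_list_nth[OF p] nth_list_update Transposition.transpose_def)
qed simp

lemma alternating_update_swap:
  assumes "alternating \<alpha>" "a < length l" "b < length l" "a \<noteq> b"
  shows "\<alpha> (l[a := l ! b, b := l ! a]) = - \<alpha> l"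
proof -
  have *: "\<alpha> (l[a := l ! b, b := l ! a]) = - \<alpha> l" if "a < b" "b < length l" for a b
  proof -
    define xs ys zs where "xs = take a l" and "ys = take (b - Suc a) (drop (Suc a) l)" and "zs = drop (Suc b) l"
    have l: "l = xs @ l ! a # ys @ l ! b # zs"
      using that unfolding xs_def ys_def zs_def
      by (smt (verit, ccfv_threshold) Cons_nth_drop_Suc Suc_leI append_take_drop_id drop_drop id_take_nth_drop
          le_add_diff_inverse2 order.strict_trans)
    have lx: "length xs = a" "length ys = b - Suc a" using that by (auto simp: xs_def ys_def)
    have "l[a := l ! b, b := l ! a] = xs @ l ! b # ys @ l ! a # zs"
    proof -
      have "l[a := l ! b, b := l ! a] = (xs @ l ! a # ys @ l ! b # zs)[a := l ! b, b := l ! a]"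
        using l by simp
      also have "\<dots> = xs @ l ! b # ys @ l ! a # zs"
        using that lx by (simp add: list_update_append split: nat.splits) (metis Suc_diff_Suc lx(1) lx(2) diff_is_0_eq list_update_code(2) list_update_length not_less_eq_eq nle_le)
      finally show ?thesis .
    qed
    then show ?thesis using alternating_swap[OF assms(1), of xs "l ! b" ys "l ! a" zs] l by simp
  qed
  show ?thesis
  proof (cases "a < b")
    case True then show ?thesis using * assms by blast
  next
    case False
    then have "b < a" using assms by simp
    then have "\<alpha> (l[b := l ! a, a := l ! b]) = - \<alpha> l" using * assms by blast
    then show ?thesis using assms by (simp add: list_update_swap)
  qed
qed

text \<open>Induction over transpositions. The set \<open>S\<close> of movable positions is kept
  general because the Laplace expansion needs permutations that fix position 0.\<close>

lemma sign_permute_list: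
  fixes F :: "'a list \<Rightarrow> real"
  assumes F: "\<And>l a b. a \<in> S \<Longrightarrow> b \<in> S \<Longrightarrow> a \<noteq> b \<Longrightarrow> length l = n \<Longrightarrow>
      F (l[a := l ! b, b := l ! a]) = - F l"
    and S: "S \<subseteq> {..<n}" and q: "q permutes S" and l: "length l = n"
  shows "F (permute_list q l) = of_int (sign q) * F l"
proof -
  have fin: "finite S" using S finite_subset by blast
  have *: "\<forall>l. length l = n \<longrightarrow> F (permute_list q l) = of_int (sign q) * F l" using q fin
  proof (induction rule: permutes_induct)
    case id
    then show ?case by (simp add: sign_id)
  next
    case (swap a b p)
    show ?case
    proof (intro allI impI)
      fix l :: "'a list" assume l: "length l = n"
      have pn: "p permutes {..<length l}" using permutes_subset[OF swap(4)] S l by simp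
      have ab: "a < length l" "b < length l" using swap(1,2) S l by auto
      have "permute_list (Transposition.transpose a b \<circ> p) l =
          permute_list p (l[a := l ! b, b := l ! a])"
        using permute_list_compose[OF pn, of "Transposition.transpose a b"] ab
        by (simp add: permute_list_transpose)
      moreover have "F (l[a := l ! b, b := l ! a]) = of_int (sign (Transposition.transpose a b)) * F l"
      proof (cases "a = b")
        case False
        then show ?thesis using F[OF swap(1,2,3) l] by (simp add: sign_swap_id)
      qed (simp add: sign_id[unfolded id_def])
      moreover have "sign (Transposition.transpose a b \<circ> p) = sign (Transposition.transpose a b) * sign p"
        using swap(4) fin by (intro sign_compose) (auto simp: permutation_swap_id permutes_imp_permutation)
      ultimately show "F (permute_list (Transposition.transpose a b \<circ> p) l) =
          of_int (sign (Transposition.transpose a b \<circ> p)) * F l"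
        using swap(5) l by simp
    qed
  qed
  then show ?thesis using l by blast
qed

lemma alternating_permute_list:
  assumes "alternating \<alpha>" "q permutes {..<length l}"
  shows "\<alpha> (permute_list q l) = of_int (sign q) * \<alpha> l"
  by (rule sign_permute_list[of "{..<length l}" "length l" \<alpha>])
    (use assms alternating_update_swap in auto)

lemma alternatingI_permute:
  assumes "\<And>(l::7 list) \<sigma>. \<sigma> permutes {..<length l} \<Longrightarrow> \<alpha> (permute_list \<sigma> l) = of_int (sign \<sigma>) * \<alpha> l"
  shows "alternating \<alpha>"
  unfolding alternating_def
proof (intro allI)
  fix xs ys :: "7 list" and a b :: 7
  let ?l = "xs @ b # a # ys" and ?i = "length xs" and ?j = "Suc (length xs)"
  have p: "Transposition.transpose ?i ?j permutes {..<length ?l}"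
    by (rule permutes_swap_id) auto
  have "permute_list (Transposition.transpose ?i ?j) ?l = xs @ a # b # ys"
    by (subst permute_list_transpose) (simp_all add: nth_append list_update_append)
  then show "\<alpha> (xs @ a # b # ys) = - \<alpha> (xs @ b # a # ys)"
    using assms[OF p] by (simp add: sign_swap_id)
qed

lemma alt_form_alternating:
  assumes "alt_form p \<alpha>" shows "alternating \<alpha>"
proof (rule alternatingI_permute)
  fix l :: "7 list" and \<sigma> assume "\<sigma> permutes {..<length l}"
  then show "\<alpha> (permute_list \<sigma> l) = of_int (sign \<sigma>) * \<alpha> l"
    using assms unfolding alt_form_def by (cases "length l = p") auto
qed

lemma alternating_pull:
  assumes "alternating \<alpha>" shows "alternating (pull P \<alpha>)"
proof (rule alternatingI_permute)
  fix l :: "7 list" and \<sigma> assume s: "\<sigma> permutes {..<length l}"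
  let ?S = "{m::7 list. length m = length l}"
  have "pull P \<alpha> (permute_list \<sigma> l) = (\<Sum>m\<in>?S. lk P m (permute_list \<sigma> l) * \<alpha> m)"
    by (simp add: pull_def)
  also have "\<dots> = (\<Sum>m\<in>?S. lk P (permute_list \<sigma> m) (permute_list \<sigma> l) * \<alpha> (permute_list \<sigma> m))"
  proof (rule sum.reindex_bij_witness[symmetric, of _ "permute_list (inv \<sigma>)" "permute_list \<sigma>"])
    fix m assume "m \<in> ?S"
    then show "permute_list \<sigma> (permute_list (inv \<sigma>) m) = m" "permute_list (inv \<sigma>) (permute_list \<sigma> m) = m"
      using permute_list_compose[of "inv \<sigma>" m \<sigma>] permute_list_compose[of \<sigma> m "inv \<sigma>"] s
        permutes_inv[OF s] by (simp_all add: permutes_inv_o[OF s])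
  qed auto
  also have "\<dots> = (\<Sum>m\<in>?S. lk P m l * (of_int (sign \<sigma>) * \<alpha> m))"
    by (intro sum.cong refl) (use s alternating_permute_list[OF assms] in \<open>simp add: lk_permute_list\<close>)
  also have "\<dots> = of_int (sign \<sigma>) * pull P \<alpha> l"
    by (simp add: pull_def sum_distrib_left mult_ac)
  finally show "pull P \<alpha> (permute_list \<sigma> l) = of_int (sign \<sigma>) * pull P \<alpha> l" .
qed

text \<open>Permuting the arguments by \<open>\<sigma>\<close> only shifts the sum over all
  permutations by composition with \<open>\<sigma>\<close>.\<close>

lemma alternating_wedge: "alternating (wedge p q \<alpha> \<beta>)"
proof (rule alternatingI_permute)
  fix l :: "7 list" and \<sigma> assume s: "\<sigma> permutes {..<length l}"
  show "wedge p q \<alpha> \<beta> (permute_list \<sigma> l) = of_int (sign \<sigma>) * wedge p q \<alpha> \<beta> l"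
  proof (cases "length l = p + q")
    case True
    let ?A = "{\<tau>. \<tau> permutes {..<p + q}}"
    let ?F = "\<lambda>m. \<alpha> (take p m) * \<beta> (drop p m)"
    have s': "\<sigma> permutes {..<p + q}" using s True by simp
    have "(\<Sum>\<tau>\<in>?A. of_int (sign \<tau>) * ?F (permute_list \<tau> (permute_list \<sigma> l))) =
        (\<Sum>\<tau>\<in>?A. of_int (sign \<sigma>) * (of_int (sign (\<sigma> \<circ> \<tau>)) * ?F (permute_list (\<sigma> \<circ> \<tau>) l)))"
    proof (rule sum.cong[OF refl])
      fix \<tau> assume "\<tau> \<in> ?A"
      then have t: "\<tau> permutes {..<p + q}" by simp
      have "sign (\<sigma> \<circ> \<tau>) = sign \<sigma> * sign \<tau>"
        using s' t by (intro sign_compose) (auto intro: permutes_imp_permutation)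
      then have "of_int (sign \<sigma>) * (of_int (sign (\<sigma> \<circ> \<tau>)) :: real) = of_int (sign \<tau>)"
        by (simp add: sign_def)
      moreover have "permute_list \<tau> (permute_list \<sigma> l) = permute_list (\<sigma> \<circ> \<tau>) l"
        using permute_list_compose[of \<tau> l \<sigma>] t True by simp
      ultimately show "of_int (sign \<tau>) * ?F (permute_list \<tau> (permute_list \<sigma> l)) =
          of_int (sign \<sigma>) * (of_int (sign (\<sigma> \<circ> \<tau>)) * ?F (permute_list (\<sigma> \<circ> \<tau>) l))"
        by (simp add: mult.assoc[symmetric])
    qed
    also have "\<dots> = of_int (sign \<sigma>) * (\<Sum>\<tau>\<in>?A. of_int (sign (\<sigma> \<circ> \<tau>)) * ?F (permute_list (\<sigma> \<circ> \<tau>) l))"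
      by (simp add: sum_distrib_left)
    also have "(\<Sum>\<tau>\<in>?A. of_int (sign (\<sigma> \<circ> \<tau>)) * ?F (permute_list (\<sigma> \<circ> \<tau>) l)) =
        (\<Sum>\<tau>\<in>?A. of_int (sign \<tau>) * ?F (permute_list \<tau> l))"
      by (rule setum_permutations_compose_left[OF s', symmetric])
    finally show ?thesis by (simp add: wedge_def True mult.assoc)
  qed (simp add: wedge_def)
qed

lemma alternating_wedge_list: "alternating (wedge_list es)"
proof (cases es)
  case (Cons e es)
  then show ?thesis by (simp add: alternating_wedge)
qed (simp add: alternating_def)

lemma pull_permute_list:
  assumes s: "\<sigma> permutes {..<length l}"
  shows "pull P \<alpha> (permute_list \<sigma> l) = (\<Sum>m | length m = length l. lk P m l * \<alpha> (permute_list \<sigma> m))"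
proof -
  let ?S = "{m::7 list. length m = length l}"
  have "pull P \<alpha> (permute_list \<sigma> l) = (\<Sum>m\<in>?S. lk P m (permute_list \<sigma> l) * \<alpha> m)"
    by (simp add: pull_def)
  also have "\<dots> = (\<Sum>m\<in>?S. lk P (permute_list \<sigma> m) (permute_list \<sigma> l) * \<alpha> (permute_list \<sigma> m))"
  proof (rule sum.reindex_bij_witness[symmetric, of _ "permute_list (inv \<sigma>)" "permute_list \<sigma>"])
    fix m assume "m \<in> ?S"
    then show "permute_list \<sigma> (permute_list (inv \<sigma>) m) = m" "permute_list (inv \<sigma>) (permute_list \<sigma> m) = m"
      using permute_list_compose[of "inv \<sigma>" m \<sigma>] permute_list_compose[of \<sigma> m "inv \<sigma>"] s
        permutes_inv[OF s] by (simp_all add: permutes_inv_o[OF s])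
  qed auto
  also have "\<dots> = (\<Sum>m\<in>?S. lk P m l * \<alpha> (permute_list \<sigma> m))"
    by (intro sum.cong refl) (use s in \<open>simp add: lk_permute_list\<close>)
  finally show ?thesis .
qed

text \<open>A wedge is a signed sum of permuted tensor products, and pullback respects both the
  permutation of slots and tensor products.\<close>

lemma pull_wedge: "pull P (wedge p q \<alpha> \<beta>) = wedge p q (pull P \<alpha>) (pull P \<beta>)"
proof
  fix l :: "7 list"
  show "pull P (wedge p q \<alpha> \<beta>) l = wedge p q (pull P \<alpha>) (pull P \<beta>) l"
  proof (cases "length l = p + q")
    case True
    let ?S = "{m::7 list. length m = length l}"
    let ?A = "{\<tau>. \<tau> permutes {..<p + q}}"
    let ?F = "\<lambda>m. \<alpha> (take p m) * \<beta> (drop p m)"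
    have 1: "pull P \<alpha> (take p m) * pull P \<beta> (drop p m) = pull P ?F m" if "length m = p + q" for m
    proof -
      have "pull P ?F m = pull P ?F (take p m @ drop p m)" by simp
      also have "\<dots> = (\<Sum>a | length a = p. \<Sum>b | length b = q.
          (lk P a (take p m) * \<alpha> a) * (lk P b (drop p m) * \<beta> b))"
        unfolding pull_append using that by (intro sum.cong) (auto simp: mult_ac)
      also have "\<dots> = pull P \<alpha> (take p m) * pull P \<beta> (drop p m)"
        using that by (simp add: pull_def sum_product)
      finally show ?thesis by simp
    qed
    have "pull P (wedge p q \<alpha> \<beta>) l =
        (\<Sum>m\<in>?S. lk P m l * (\<Sum>\<sigma>\<in>?A. of_int (sign \<sigma>) * ?F (permute_list \<sigma> m))) / (fact p * fact q)"
      unfolding pull_def sum_divide_distrib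
      by (intro sum.cong refl) (simp add: wedge_def True mult.assoc)
    also have "(\<Sum>m\<in>?S. lk P m l * (\<Sum>\<sigma>\<in>?A. of_int (sign \<sigma>) * ?F (permute_list \<sigma> m))) =
        (\<Sum>m\<in>?S. \<Sum>\<sigma>\<in>?A. of_int (sign \<sigma>) * (lk P m l * ?F (permute_list \<sigma> m)))"
      by (simp add: sum_distrib_left mult_ac)
    also have "\<dots> = (\<Sum>\<sigma>\<in>?A. \<Sum>m\<in>?S. of_int (sign \<sigma>) * (lk P m l * ?F (permute_list \<sigma> m)))"
      by (rule sum.swap)
    also have "\<dots> = (\<Sum>\<sigma>\<in>?A. of_int (sign \<sigma>) * pull P ?F (permute_list \<sigma> l))"
      using True by (intro sum.cong refl) (simp add: pull_permute_list sum_distrib_left)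
    also have "\<dots> = (\<Sum>\<sigma>\<in>?A. of_int (sign \<sigma>) * (pull P \<alpha> (take p (permute_list \<sigma> l)) * pull P \<beta> (drop p (permute_list \<sigma> l))))"
      using True by (intro sum.cong refl) (simp add: 1)
    finally show ?thesis
      unfolding wedge_def[of p q "pull P \<alpha>"] using True by (simp add: mult.assoc)
  next
    case False
    then have "pull P (wedge p q \<alpha> \<beta>) l = 0"
      unfolding pull_def by (intro sum.neutral) (simp add: wedge_def)
    then show ?thesis using False by (simp add: wedge_def)
  qed
qed

lemma pull_covector: "pull P (covector v) = covector (v v* P)"
proof
  fix l :: "7 list"
  show "pull P (covector v) l = covector (v v* P) l"
  proof (cases "length l = 1")
    case True
    then obtain i where "l = [i]" by (auto simp: length_Suc_conv)
    then show ?thesis by (simp add: pull_explicit covector_def vector_matrix_mult_def mult.commute)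
  next
    case False
    then have "pull P (covector v) l = 0"
      unfolding pull_def by (intro sum.neutral) (simp add: covector_def)
    then show ?thesis using False by (simp add: covector_def)
  qed
qed

lemma pull_wedge_list: "pull P (wedge_list es) = wedge_list (map (\<lambda>v. v v* P) es)"
proof (induction es)
  case Nil
  show ?case
  proof
    fix l :: "7 list"
    show "pull P (wedge_list []) l = wedge_list (map (\<lambda>v. v v* P) []) l"
    proof (cases l)
      case (Cons a m)
      then have "pull P (wedge_list []) l = 0"
        unfolding pull_def by (intro sum.neutral) auto
      then show ?thesis using Cons by simp
    qed simp
  qed
next
  case (Cons e es)
  then show ?case by (simp add: pull_wedge pull_covector)
qed

text \<open>Laplace expansion, with transpositions instead of cycles.\<close>

lemma wedge_covector:
  assumes \<beta>: "alternating \<beta>" and l: "length l = Suc n"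
  shows "wedge 1 n (covector v) \<beta> l =
    (\<Sum>b\<le>n. (if b = 0 then 1 else - 1) * v $ (l ! b) * \<beta> (tl (l[0 := l ! b, b := l ! 0])))"
proof -
  let ?G = "\<lambda>m::7 list. v $ (m ! 0) * \<beta> (tl m)"
  \<comment> \<open>A permutation that fixes position 0 only rearranges the arguments of
    \<open>\<beta>\<close>. So the \<open>fact n\<close> permutations with a given first argument
    all contribute the same term.\<close>
  have G: "?G (permute_list q m) = of_int (sign q) * ?G m" if q: "q permutes {1..n}" "length m = Suc n" for q m
  proof (rule sign_permute_list[OF _ _ q])
    fix m :: "7 list" and a b assume ab: "a \<in> {1..n}" "b \<in> {1..n}" "a \<noteq> b" "length m = Suc n"
    have tl: "tl (m[a := x]) = (tl m)[a - 1 := x]" if "a \<ge> 1" for m :: "7 list" and a x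
      using that by (cases m; cases a) auto
    have nt: "tl m ! (a - 1) = m ! a" if "a \<in> {1..n}" for a
      using that ab(4) by (cases m; cases a) auto
    have "\<beta> (tl (m[a := m ! b, b := m ! a])) = \<beta> ((tl m)[a - 1 := tl m ! (b - 1), b - 1 := tl m ! (a - 1)])"
      using ab nt[OF ab(1)] nt[OF ab(2)] by (simp add: tl)
    also have "\<dots> = - \<beta> (tl m)"
      by (rule alternating_update_swap[OF \<beta>]) (use ab in auto)
    finally show "?G (m[a := m ! b, b := m ! a]) = - ?G m"
      using ab by simp
  qed auto
  have set: "{..<1 + n} = insert 0 {1..n}" "{..n} = insert 0 {1..n}" by auto
  have "(\<Sum>\<sigma> | \<sigma> permutes {..<1 + n}. of_int (sign \<sigma>) * covector v (take 1 (permute_list \<sigma> l)) * \<beta> (drop 1 (permute_list \<sigma> l)))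
      = (\<Sum>\<sigma> | \<sigma> permutes insert 0 {1..n}. of_int (sign \<sigma>) * ?G (permute_list \<sigma> l))"
    unfolding set
  proof (intro sum.cong refl)
    fix \<sigma>
    obtain a m where "permute_list \<sigma> l = a # m"
      using l by (cases "permute_list \<sigma> l") (auto dest: arg_cong[of _ _ length])
    then show "of_int (sign \<sigma>) * covector v (take 1 (permute_list \<sigma> l)) * \<beta> (drop 1 (permute_list \<sigma> l)) =
        of_int (sign \<sigma>) * ?G (permute_list \<sigma> l)" by (simp add: covector_def)
  qed
  also have "\<dots> = (\<Sum>b\<in>insert 0 {1..n}. \<Sum>q | q permutes {1..n}.
      of_int (sign (Transposition.transpose 0 b \<circ> q)) * ?G (permute_list (Transposition.transpose 0 b \<circ> q) l))"
    by (rule sum_over_permutations_insert) auto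
  also have "\<dots> = (\<Sum>b\<in>insert 0 {1..n}. \<Sum>q | q permutes {1..n}.
      (if b = 0 then 1 else - 1) * ?G (l[0 := l ! b, b := l ! 0]))"
  proof (intro sum.cong refl)
    fix b q assume b: "b \<in> insert 0 {1..n}" and "q \<in> {q. q permutes {1..n}}"
    then have q: "q permutes {1..n}" by simp
    have q': "q permutes {..<length l}" by (rule permutes_subset[OF q]) (use l in auto)
    have "permute_list (Transposition.transpose 0 b \<circ> q) l = permute_list q (l[0 := l ! b, b := l ! 0])"
      using permute_list_compose[OF q', of "Transposition.transpose 0 b"] b l
      by (subst permute_list_transpose[symmetric]) auto
    moreover have "sign (Transposition.transpose 0 b \<circ> q) = (if b = 0 then 1 else - 1) * sign q"
      using permutes_imp_permutation[OF _ q]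
      by (subst sign_compose) (auto simp: permutation_swap_id sign_swap_id)
    ultimately show "of_int (sign (Transposition.transpose 0 b \<circ> q)) * ?G (permute_list (Transposition.transpose 0 b \<circ> q) l) =
        (if b = 0 then 1 else - 1) * ?G (l[0 := l ! b, b := l ! 0])"
      using G[OF q, of "l[0 := l ! b, b := l ! 0]"] l by (simp add: sign_def)
  qed
  also have "\<dots> = fact n * (\<Sum>b\<in>insert 0 {1..n}. (if b = 0 then 1 else - 1) * ?G (l[0 := l ! b, b := l ! 0]))"
    using card_permutations[of "{1..n}" n] by (simp add: sum_distrib_left del: sum.insert)
  also have "(\<Sum>b\<in>insert 0 {1..n}. (if b = 0 then 1 else - 1) * ?G (l[0 := l ! b, b := l ! 0])) =
      (\<Sum>b\<le>n. (if b = 0 then 1 else - 1) * v $ (l ! b) * \<beta> (tl (l[0 := l ! b, b := l ! 0])))"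
    unfolding set by (intro sum.cong refl) (use l in \<open>auto simp: nth_list_update\<close>)
  finally show ?thesis using l by (simp add: wedge_def)
qed

text \<open>In \<open>\<epsilon>\<close> only arrangements of the complement of \<open>r\<close>,
  that is of \<open>set c\<close>, survive. Each of the \<open>fact p\<close> arrangements changes
  both factors by the same sign.\<close>

lemma sum_alternating_mult:
  assumes \<alpha>: "alternating \<alpha>" and \<epsilon>: "alternating \<epsilon>"
    and c: "distinct (c @ r)" "length (c @ r) = 7" "length c = p"
  shows "(\<Sum>m | length m = p. \<alpha> m * \<epsilon> (m @ r)) = fact p * (\<alpha> c * \<epsilon> (c @ r))"
proof -
  have "card (set (c @ r)) = CARD(7)" using c distinct_card by fastforce
  then have U: "set c \<union> set r = UNIV" "set c \<inter> set r = {}"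
    using c card_subset_eq[of "UNIV::7 set" "set (c @ r)"] by auto
  let ?P = "permutations_of_set (set c)"
  have cc: "card (set c) = p" using c distinct_card by auto
  have "(\<Sum>m | length m = p. \<alpha> m * \<epsilon> (m @ r)) = (\<Sum>m\<in>?P. \<alpha> m * \<epsilon> (m @ r))"
  proof (rule sum.mono_neutral_right)
    show "?P \<subseteq> {m. length m = p}"
      using cc by (auto simp: length_finite_permutations_of_set)
    show "\<forall>m\<in>{m. length m = p} - ?P. \<alpha> m * \<epsilon> (m @ r) = 0"
    proof
      fix m assume m: "m \<in> {m. length m = p} - ?P"
      have "\<not> distinct (m @ r)"
      proof
        assume d: "distinct (m @ r)"
        then have "set m \<subseteq> set c" using U by auto
        moreover have "card (set m) = card (set c)" using d m cc distinct_card by fastforce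
        ultimately have "set m = set c" by (simp add: card_subset_eq)
        then show False using m d by (auto simp: permutations_of_set_def)
      qed
      then show "\<alpha> m * \<epsilon> (m @ r) = 0" using alternating_not_distinct[OF \<epsilon>] by simp
    qed
  qed (rule finite_length_eq)
  also have "\<dots> = (\<Sum>m\<in>?P. \<alpha> c * \<epsilon> (c @ r))"
  proof (rule sum.cong[OF refl])
    fix m assume "m \<in> ?P"
    then have "mset m = mset c"
      using c by (metis distinct_append permutations_of_setD set_eq_iff_mset_eq_distinct)
    then obtain s where s: "s \<in> {1, - 1}" "\<And>\<alpha>. alternating \<alpha> \<Longrightarrow> \<alpha> m = s * \<alpha> c"
      using alternating_mset by blast
    then show "\<alpha> m * \<epsilon> (m @ r) = \<alpha> c * \<epsilon> (c @ r)"
      using s(2)[OF \<alpha>] s(2)[OF alternating_suffix[OF \<epsilon>], of r] by auto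
  qed
  also have "\<dots> = fact p * (\<alpha> c * \<epsilon> (c @ r))"
    using cc by simp
  finally show ?thesis .
qed

section \<open>Traces and the algebra of the \<open>G\<^sub>2\<close> form\<close>

text \<open>Contraction as a binder: its two variables, usually \<open>a\<close> and
  \<open>a'\<close>, are the ends of one contracted pair. Nested binders express any full
  contraction, and \<open>tr_comm\<close> reorders them without touching matrix entries.\<close>

definition tr :: "real^7^7 \<Rightarrow> (7 \<Rightarrow> 7 \<Rightarrow> real) \<Rightarrow> real" where
  "tr h F = (\<Sum>a\<in>UNIV. \<Sum>b\<in>UNIV. h $ a $ b * F a b)"

lemma tr_add: "tr h (\<lambda>a b. F a b + G a b) = tr h F + tr h G"
  by (simp add: tr_def algebra_simps sum.distrib)

lemma tr_diff: "tr h (\<lambda>a b. F a b - G a b) = tr h F - tr h G"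
  by (simp add: tr_def algebra_simps sum_subtractf)

lemma tr_uminus: "tr h (\<lambda>a b. - F a b) = - tr h F"
  by (simp add: tr_def sum_negf)

lemma tr_0: "tr h (\<lambda>a b. 0) = 0"
  by (simp add: tr_def)

lemma tr_cong: "(\<And>a b. F a b = G a b) \<Longrightarrow> tr h F = tr h G"
  by (simp add: tr_def)

lemma tr_cmult: "tr h (\<lambda>a b. c * F a b) = c * tr h F"
  unfolding tr_def sum_distrib_left by (simp only: mult.left_commute)

lemma tr_multc: "tr h (\<lambda>a b. F a b * c) = tr h F * c"
  unfolding tr_def sum_distrib_right by (simp only: mult.assoc)

lemma tr_divc: "tr h (\<lambda>a b. F a b / c) = tr h F / c"
  by (simp add: tr_def sum_divide_distrib)

lemmas tr_linear = tr_add tr_diff tr_uminus tr_0 tr_cmult tr_multc tr_divc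

lemma tr_comm: "tr h (\<lambda>a b. tr h' (\<lambda>c d. F a b c d)) = tr h' (\<lambda>c d. tr h (\<lambda>a b. F a b c d))"
proof -
  let ?U = "UNIV :: (7 \<times> 7) set"
  have tr_pair: "tr h F = (\<Sum>x\<in>?U. h $ fst x $ snd x * F (fst x) (snd x))" for h F
    by (simp add: tr_def sum.cartesian_product case_prod_beta UNIV_Times_UNIV)
  have "tr h (\<lambda>a b. tr h' (\<lambda>c d. F a b c d)) =
      (\<Sum>x\<in>?U. \<Sum>y\<in>?U. h $ fst x $ snd x * (h' $ fst y $ snd y * F (fst x) (snd x) (fst y) (snd y)))"
    by (simp only: tr_pair sum_distrib_left)
  also have "\<dots> = (\<Sum>y\<in>?U. \<Sum>x\<in>?U. h $ fst x $ snd x * (h' $ fst y $ snd y * F (fst x) (snd x) (fst y) (snd y)))"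
    by (rule sum.swap)
  also have "\<dots> = tr h' (\<lambda>c d. tr h (\<lambda>a b. F a b c d))"
    by (simp only: tr_pair sum_distrib_left mult.left_commute)
  finally show ?thesis .
qed

lemma tr_mat_1: "tr (mat 1) F = (\<Sum>a\<in>UNIV. F a a)"
  by (simp add: tr_def mat_def if_distrib[of "\<lambda>x. x * _"] cong: if_cong)

locale metric_pt =
  fixes h g :: "real^7^7"
  assumes h_sym: "h $ a $ b = h $ b $ a" and g_sym: "g $ a $ b = g $ b $ a"
    and gh: "g ** h = mat 1"
begin

lemma hg: "h ** g = mat 1"
  using gh matrix_left_right_inverse by blast

abbreviation "t \<equiv> tr h"

lemma tr_swap: "t F = t (\<lambda>a b. F b a)"
  unfolding tr_def by (subst sum.swap) (simp add: h_sym)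

lemma sum_hg: "(\<Sum>a\<in>UNIV. h $ i $ a * g $ a $ j) = (if i = j then 1 else 0)"
  using hg by (simp add: matrix_matrix_mult_def mat_def vec_eq_iff)

lemma tr_metric1: "t (\<lambda>a b. g $ i $ a * F b) = F i"
proof -
  have "t (\<lambda>a b. g $ i $ a * F b) = (\<Sum>b\<in>UNIV. (\<Sum>a\<in>UNIV. h $ b $ a * g $ a $ i) * F b)"
    unfolding tr_def by (subst sum.swap, unfold sum_distrib_right, intro sum.cong refl)
      (simp add: h_sym[of _ "_ :: 7"] g_sym[of i])
  then show ?thesis by (simp add: sum_hg if_distrib[of "\<lambda>x. x * _"] cong: if_cong)
qed

lemma tr_metric:
  "t (\<lambda>a b. g $ i $ a * F b) = F i" "t (\<lambda>a b. g $ i $ b * F a) = F i"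
  "t (\<lambda>a b. g $ a $ i * F b) = F i" "t (\<lambda>a b. g $ b $ i * F a) = F i"
  "t (\<lambda>a b. F b * g $ i $ a) = F i" "t (\<lambda>a b. F a * g $ i $ b) = F i"
  "t (\<lambda>a b. F b * g $ a $ i) = F i" "t (\<lambda>a b. F a * g $ b $ i) = F i"
  using tr_metric1[of i F] tr_swap[of "\<lambda>a b. g $ i $ b * F a"]
  by (simp_all add: g_sym mult.commute)

lemma tr_g: "t (\<lambda>a b. g $ a $ b) = 7"
proof -
  have "t (\<lambda>a b. g $ a $ b) = (\<Sum>a\<in>UNIV. \<Sum>b\<in>UNIV. h $ a $ b * g $ b $ a)"
    by (simp add: tr_def g_sym)
  also have "\<dots> = 7" by (simp add: sum_hg)
  finally show ?thesis .
qed

lemma tr_antisym: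
  assumes "\<And>a b. F a b = - F b a" shows "t F = 0"
proof -
  have "t F = t (\<lambda>a b. - F b a)" by (rule tr_cong) (rule assms)
  also have "\<dots> = - t F" by (simp only: tr_uminus tr_swap[of F, symmetric])
  finally show ?thesis by simp
qed

lemma tr_tr_antisym:
  assumes "\<And>a a' b b'. F a a' b b' = - F b b' a a'"
  shows "t (\<lambda>a a'. t (\<lambda>b b'. F a a' b b')) = 0"
proof -
  have "t (\<lambda>a a'. t (\<lambda>b b'. F a a' b b')) = t (\<lambda>b b'. t (\<lambda>a a'. F a a' b b'))"
    by (rule tr_comm)
  also have "\<dots> = t (\<lambda>b b'. t (\<lambda>a a'. - F b b' a a'))"
    by (intro tr_cong) (rule assms)
  also have "\<dots> = - t (\<lambda>a a'. t (\<lambda>b b'. F a a' b b'))"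
    by (simp add: tr_uminus)
  finally show ?thesis by simp
qed

end

text \<open>Besides skew symmetry, \<open>phi_phi\<close> is all that the curvature algebra at a
  point uses of the form; \<open>psi\<close> stands for the dual 4-form. No orthonormal frame is
  assumed, so the results apply to coordinate components.\<close>

locale g2_pt = metric_pt +
  fixes phi :: "7 \<Rightarrow> 7 \<Rightarrow> 7 \<Rightarrow> real" and psi :: "7 \<Rightarrow> 7 \<Rightarrow> 7 \<Rightarrow> 7 \<Rightarrow> real"
  assumes phi_swap: "phi i j k = - phi j i k" "phi i j k = - phi i k j"
    and psi_swap: "psi i j k l = - psi j i k l" "psi i j k l = - psi i k j l" "psi i j k l = - psi i j l k"
    and phi_phi: "t (\<lambda>a b. phi i j a * phi k l b) = g $ i $ k * g $ j $ l - g $ i $ l * g $ j $ k + psi i j k l"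
begin

lemma phi_cyc: "phi i j k = phi j k i"
  using phi_swap(1)[of i j k] phi_swap(2)[of j i k] by simp

text \<open>A trace of \<open>phi_phi\<close>: the metric terms give 7 - 1, and \<open>psi\<close>
  is traceless by skew symmetry.\<close>

lemma phi_phi2: "t (\<lambda>j j'. t (\<lambda>k k'. phi a j k * phi b j' k')) = 6 * g $ a $ b"
proof -
  have "t (\<lambda>k k'. phi a j k * phi b j' k') = g $ a $ b * g $ j $ j' - g $ a $ j' * g $ j $ b + psi a j b j'" for j j'
    by (rule phi_phi)
  moreover have "t (\<lambda>j j'. psi a j b j') = 0"
  proof (rule tr_antisym)
    fix j j'
    show "psi a j b j' = - psi a j' b j"
      using psi_swap(2)[of a j b j'] psi_swap(3)[of a b j j'] psi_swap(2)[of a b j' j] by simp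
  qed
  ultimately show ?thesis
    by (simp add: tr_linear tr_g tr_metric)
qed

text \<open>With \<open>psi\<close> expressed by \<open>phi_phi\<close>, the product of three phi
  gives 6 by \<open>phi_phi2\<close>, and each of the two metric terms removes 1.\<close>

lemma psi_phi: "t (\<lambda>i i'. t (\<lambda>l l'. psi j s i l * phi i' l' m)) = 4 * phi j s m"
proof -
  have H: "psi j s i l = t (\<lambda>a b. phi j s a * phi i l b) - g $ j $ i * g $ s $ l + g $ j $ l * g $ s $ i" for i l
    using phi_phi[of j s i l] by simp
  have "psi j s i l * phi i' l' m = t (\<lambda>a b. phi j s a * phi i l b) * phi i' l' m
        - g $ j $ i * (g $ s $ l * phi i' l' m) + g $ s $ i * (g $ j $ l * phi i' l' m)" for i l i' l'
    unfolding H by (simp only: algebra_simps)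
  then have "t (\<lambda>i i'. t (\<lambda>l l'. psi j s i l * phi i' l' m)) =
      t (\<lambda>i i'. t (\<lambda>l l'. t (\<lambda>a b. phi j s a * phi i l b) * phi i' l' m
        - g $ j $ i * (g $ s $ l * phi i' l' m) + g $ s $ i * (g $ j $ l * phi i' l' m)))"
    by (simp only:)
  also have "\<dots> = t (\<lambda>i i'. t (\<lambda>l l'. t (\<lambda>a b. phi j s a * phi i l b) * phi i' l' m))
      - phi j s m + phi s j m"
    by (simp only: tr_linear tr_metric)
  also have "t (\<lambda>i i'. t (\<lambda>l l'. t (\<lambda>a b. phi j s a * phi i l b) * phi i' l' m)) =
      t (\<lambda>i i'. t (\<lambda>l l'. t (\<lambda>a b. phi j s a * (phi i l b * phi i' l' m))))"
    by (simp only: tr_multc[symmetric] mult.assoc)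
  also have "\<dots> = t (\<lambda>i i'. t (\<lambda>a b. t (\<lambda>l l'. phi j s a * (phi i l b * phi i' l' m))))"
    by (rule tr_cong) (rule tr_comm)
  also have "\<dots> = t (\<lambda>a b. t (\<lambda>i i'. t (\<lambda>l l'. phi j s a * (phi i l b * phi i' l' m))))"
    by (rule tr_comm)
  also have "\<dots> = t (\<lambda>a b. phi j s a * (6 * g $ b $ m))"
  proof -
    have "t (\<lambda>i i'. t (\<lambda>l l'. phi i l b * phi i' l' m)) = 6 * g $ b $ m" for b
      using phi_phi2[of b m] unfolding phi_cyc[of b] phi_cyc[of m] .
    then show ?thesis by (simp only: tr_cmult)
  qed
  also have "\<dots> = 6 * phi j s m"
    by (simp add: tr_cmult tr_metric mult.left_commute[of _ 6])
  finally show ?thesis using phi_swap(1)[of s j m] by simp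
qed

text \<open>The hypothesis \<open>act\<close> says that the 2-form \<open>A\<close> lies in g_2.
  Contracted with one more phi, its first term becomes \<open>6 * A i l\<close> and each of the
  others \<open>- A i l\<close> plus the \<open>psi\<close> contraction, so that contraction is -2
  times \<open>A\<close>.\<close>

lemma g2_algebra:
  assumes A: "\<And>i j. A i j = - A j i"
    and act: "\<And>i j k. t (\<lambda>a b. A i a * phi b j k) + t (\<lambda>a b. A j a * phi i b k) + t (\<lambda>a b. A k a * phi i j b) = 0"
  shows "t (\<lambda>j j'. t (\<lambda>a b. A j a * psi j' b i l)) = - 2 * A i l"
    and "t (\<lambda>j j'. t (\<lambda>a b. A j a * phi j' b m)) = 0"
proof -
  have X: "t (\<lambda>j j'. t (\<lambda>a b. A j a * psi j' b i l)) = - 2 * A i l" for i l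
  proof -
    let ?Y = "t (\<lambda>j j'. t (\<lambda>a b. A j a * psi j' b i l))"
    have 1: "t (\<lambda>j j'. t (\<lambda>k k'. t (\<lambda>a b. A i a * phi b j k) * phi l j' k')) = 6 * A i l"
    proof -
      have "t (\<lambda>j j'. t (\<lambda>k k'. t (\<lambda>a b. A i a * phi b j k) * phi l j' k')) =
          t (\<lambda>j j'. t (\<lambda>k k'. t (\<lambda>a b. A i a * (phi b j k * phi l j' k'))))"
        by (simp only: tr_multc[symmetric] mult.assoc)
      also have "\<dots> = t (\<lambda>j j'. t (\<lambda>a b. t (\<lambda>k k'. A i a * (phi b j k * phi l j' k'))))"
        by (rule tr_cong) (rule tr_comm)
      also have "\<dots> = t (\<lambda>a b. t (\<lambda>j j'. t (\<lambda>k k'. A i a * (phi b j k * phi l j' k'))))"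
        by (rule tr_comm)
      also have "\<dots> = 6 * A i l"
        by (simp add: phi_phi2 tr_cmult tr_metric mult.left_commute[of _ 6])
      finally show ?thesis .
    qed
    have 2: "t (\<lambda>j j'. t (\<lambda>k k'. t (\<lambda>a b. A j a * phi i b k) * phi l j' k')) = - A i l + ?Y"
    proof -
      have "t (\<lambda>j j'. t (\<lambda>k k'. t (\<lambda>a b. A j a * phi i b k) * phi l j' k')) =
          t (\<lambda>j j'. t (\<lambda>k k'. t (\<lambda>a b. A j a * (phi i b k * phi l j' k'))))"
        by (simp only: tr_multc[symmetric] mult.assoc)
      also have "\<dots> = t (\<lambda>j j'. t (\<lambda>a b. t (\<lambda>k k'. A j a * (phi i b k * phi l j' k'))))"
        by (rule tr_cong) (rule tr_comm)
      also have "\<dots> = t (\<lambda>j j'. t (\<lambda>a b. A j a * (g $ i $ l * g $ b $ j' - g $ i $ j' * g $ b $ l + psi i b l j')))"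
        by (simp only: tr_cmult phi_phi)
      also have "\<dots> = t (\<lambda>j j'. t (\<lambda>a b. g $ i $ l * (A j a * g $ b $ j') - g $ i $ j' * (A j a * g $ b $ l) + A j a * psi j' b i l))"
      proof -
        have "psi i b l j' = psi j' b i l" for b j'
          using psi_swap(1)[of i b l j'] psi_swap(2)[of b i l j'] psi_swap(3)[of b l i j']
            psi_swap(2)[of b l j' i] psi_swap(1)[of b j' l i] psi_swap(3)[of j' b l i] by simp
        then show ?thesis by (simp add: algebra_simps)
      qed
      also have "\<dots> = g $ i $ l * t (\<lambda>j j'. A j j') - A i l + ?Y"
        by (simp only: tr_linear tr_metric)
      also have "t (\<lambda>j j'. A j j') = 0" by (rule tr_antisym) (rule A)
      finally show ?thesis by simp
    qed
    have 3: "t (\<lambda>j j'. t (\<lambda>k k'. t (\<lambda>a b. A k a * phi i j b) * phi l j' k')) = - A i l + ?Y"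
    proof -
      have "t (\<lambda>j j'. t (\<lambda>k k'. t (\<lambda>a b. A k a * phi i j b) * phi l j' k')) =
          t (\<lambda>j j'. t (\<lambda>k k'. t (\<lambda>a b. A k a * phi i b j) * phi l k' j'))"
      proof -
        have "t (\<lambda>a b. A k a * phi i j b) * phi l j' k' = t (\<lambda>a b. A k a * phi i b j) * phi l k' j'" for j j' k k'
        proof -
          have "t (\<lambda>a b. A k a * phi i j b) = - t (\<lambda>a b. A k a * phi i b j)"
            using phi_swap(2)[of i j] by (simp add: tr_uminus)
          then show ?thesis using phi_swap(2)[of l j' k'] by simp
        qed
        then show ?thesis by simp
      qed
      also have "\<dots> = t (\<lambda>k k'. t (\<lambda>j j'. t (\<lambda>a b. A k a * phi i b j) * phi l k' j'))"
        by (rule tr_comm)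
      finally show ?thesis using 2 by simp
    qed
    have "0 = t (\<lambda>j j'. t (\<lambda>k k'. (t (\<lambda>a b. A i a * phi b j k) + t (\<lambda>a b. A j a * phi i b k)
        + t (\<lambda>a b. A k a * phi i j b)) * phi l j' k'))"
      by (simp add: act tr_0)
    also have "\<dots> = 6 * A i l + (- A i l + ?Y) + (- A i l + ?Y)"
      by (simp only: distrib_right tr_add 1 2 3)
    finally show ?thesis by simp
  qed
  then show "t (\<lambda>j j'. t (\<lambda>a b. A j a * psi j' b i l)) = - 2 * A i l" .
  \<comment> \<open>Contracting the eigenvalue equation with phi and applying \<open>psi_phi\<close>
    shows that the contraction x of \<open>A\<close> with phi satisfies -2 x = 4 x.\<close>
  have "- 2 * t (\<lambda>i i'. t (\<lambda>l l'. A i l * phi i' l' m)) =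
      t (\<lambda>i i'. t (\<lambda>l l'. t (\<lambda>j j'. t (\<lambda>a b. A j a * psi j' b i l)) * phi i' l' m))"
    by (simp only: X tr_cmult mult.assoc)
  also have "\<dots> = t (\<lambda>i i'. t (\<lambda>l l'. t (\<lambda>j j'. t (\<lambda>a b. A j a * (psi j' b i l * phi i' l' m)))))"
    by (simp only: tr_multc[symmetric] mult.assoc)
  also have "\<dots> = t (\<lambda>j j'. t (\<lambda>a b. t (\<lambda>i i'. t (\<lambda>l l'. A j a * (psi j' b i l * phi i' l' m)))))"
    (is "?L = _")
  proof -
    have "?L = t (\<lambda>i i'. t (\<lambda>j j'. t (\<lambda>l l'. t (\<lambda>a b. A j a * (psi j' b i l * phi i' l' m)))))"
      by (rule tr_cong) (rule tr_comm)
    also have "\<dots> = t (\<lambda>i i'. t (\<lambda>j j'. t (\<lambda>a b. t (\<lambda>l l'. A j a * (psi j' b i l * phi i' l' m)))))"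
      by (rule tr_cong, rule tr_cong) (rule tr_comm)
    also have "\<dots> = t (\<lambda>j j'. t (\<lambda>i i'. t (\<lambda>a b. t (\<lambda>l l'. A j a * (psi j' b i l * phi i' l' m)))))"
      by (rule tr_comm)
    also have "\<dots> = t (\<lambda>j j'. t (\<lambda>a b. t (\<lambda>i i'. t (\<lambda>l l'. A j a * (psi j' b i l * phi i' l' m)))))"
      by (rule tr_cong) (rule tr_comm)
    finally show ?thesis .
  qed
  also have "\<dots> = 4 * t (\<lambda>j j'. t (\<lambda>a b. A j a * phi j' b m))"
    by (simp only: tr_cmult psi_phi mult.left_commute[of _ 4])
  finally show "t (\<lambda>j j'. t (\<lambda>a b. A j a * phi j' b m)) = 0" by simp
qed

end

subsection \<open>The standard form\<close>

definition det3 :: "(7 \<Rightarrow> real) \<Rightarrow> (7 \<Rightarrow> real) \<Rightarrow> (7 \<Rightarrow> real) \<Rightarrow> 7 \<Rightarrow> 7 \<Rightarrow> 7 \<Rightarrow> real" where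
  "det3 x y z a b c = x a * (y b * z c - y c * z b) - x b * (y a * z c - y c * z a) + x c * (y a * z b - y b * z a)"

text \<open>The form as a polynomial in the components of three vectors, so that identities can be
  settled by \<open>algebra\<close>. At the basis vectors \<open>kd i\<close> it gives the
  components of \<open>phi0\<close>.\<close>

definition std3 :: "(7 \<Rightarrow> real) \<Rightarrow> (7 \<Rightarrow> real) \<Rightarrow> (7 \<Rightarrow> real) \<Rightarrow> real" where
  "std3 x y z = det3 x y z 1 2 7 + det3 x y z 1 3 5 - det3 x y z 1 4 6 - det3 x y z 2 3 6
     - det3 x y z 2 4 5 + det3 x y z 3 4 7 + det3 x y z 5 6 7"

definition kd :: "7 \<Rightarrow> 7 \<Rightarrow> real" where "kd i r = (if r = i then 1 else 0)"

definition phi0 :: tens where "phi0 = g2_form (mat 1)"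

definition eps0 :: tens where
  "eps0 = wedge_list [axis 1 1, axis 2 1, axis 3 1, axis 4 1, axis 5 1, axis 6 1, axis 7 1]"

lemma wedge_list_Cons:
  assumes "length l = Suc n" "length es = n"
  shows "wedge_list (v # es) l =
    (\<Sum>b\<le>n. (if b = 0 then 1 else - 1) * v $ (l ! b) * wedge_list es (tl (l[0 := l ! b, b := l ! 0])))"
  using wedge_covector[OF alternating_wedge_list assms(1), of v es] assms(2) by simp

lemma wedge_list_1: "wedge_list [u] [i] = u $ i"
  by (subst wedge_list_Cons[of _ 0]) auto

lemma wedge_list_2: "wedge_list [u, v] [i, j] = u $ i * v $ j - u $ j * v $ i"
  by (subst wedge_list_Cons[of _ 1]) (simp_all add: wedge_list_1 del: wedge_list.simps)

lemma wedge_list_3: "wedge_list [u, v, w] [i, j, k] =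
    u $ i * (v $ j * w $ k - v $ k * w $ j) - u $ j * (v $ i * w $ k - v $ k * w $ i)
    - u $ k * (v $ j * w $ i - v $ i * w $ j)"
  by (subst wedge_list_Cons[of _ 2]) (simp_all add: wedge_list_2 numeral_2_eq_2 del: wedge_list.simps)

lemma wedge_list_axis3: "wedge_list [axis a 1, axis b 1, axis c 1] [i, j, k] = det3 (kd i) (kd j) (kd k) a b c"
  unfolding wedge_list_3 det3_def by (simp add: axis_def kd_def algebra_simps)

lemma mat_1_row: "(mat 1 :: real^7^7) $ i = axis i 1"
  by (simp add: vec_eq_iff mat_def axis_def)

lemma phi0_eq: "phi0 [i, j, k] = std3 (kd i) (kd j) (kd k)"
  unfolding phi0_def g2_form_def std3_def Let_def mat_1_row wedge_list_axis3 ..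

lemma alternating_add: "alternating \<alpha> \<Longrightarrow> alternating \<beta> \<Longrightarrow> alternating (\<lambda>l. \<alpha> l + \<beta> l)"
  unfolding alternating_def by (metis minus_add_distrib)

lemma alternating_diff: "alternating \<alpha> \<Longrightarrow> alternating \<beta> \<Longrightarrow> alternating (\<lambda>l. \<alpha> l - \<beta> l)"
  unfolding alternating_def by (metis minus_diff_eq minus_diff_minus)

lemma alternating_g2_form: "alternating (g2_form E)"
  unfolding g2_form_def Let_def by (intro alternating_add alternating_diff alternating_wedge_list)

lemma alternating_phi0: "alternating phi0"
  unfolding phi0_def by (rule alternating_g2_form)

lemma alternating_eps0: "alternating eps0"
  unfolding eps0_def by (rule alternating_wedge_list)

lemma axis_vector_matrix: "axis i 1 v* E = E $ i"
  by (simp add: vec_eq_iff vector_matrix_mult_def axis_def if_distrib[of "\<lambda>x. x * _"] cong: if_cong)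

text \<open>Row \<open>E $ i\<close> is the pullback of the i-th standard covector. Every adapted
  form is therefore the pullback of one fixed form, and pointwise questions reduce to
  \<open>phi0\<close>.\<close>

lemma g2_form_pull: "g2_form E = pull E phi0"
proof
  fix l
  have w: "wedge_list [E $ i, E $ j, E $ k] l = pull E (wedge_list [axis i 1, axis j 1, axis k 1]) l" for i j k
    by (simp only: pull_wedge_list list.map axis_vector_matrix)
  show "g2_form E l = pull E phi0 l"
    unfolding g2_form_def phi0_def Let_def mat_1_row w
    by (simp only: pull_def distrib_left right_diff_distrib sum.distrib sum_subtractf)
qed

lemma vol_pull: "wedge_list [E $ 1, E $ 2, E $ 3, E $ 4, E $ 5, E $ 6, E $ 7] = pull E eps0"
  by (simp only: eps0_def pull_wedge_list list.map axis_vector_matrix)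

text \<open>Taken as the remainder in the contraction identity, which then holds by definition. The
  content moves to the skew symmetry of \<open>psi0\<close> in its middle slots.\<close>

definition psi0 :: "7 \<Rightarrow> 7 \<Rightarrow> 7 \<Rightarrow> 7 \<Rightarrow> real" where
  "psi0 i j k l = (\<Sum>a\<in>UNIV. phi0 [i, j, a] * phi0 [k, l, a]) - kd i k * kd j l + kd i l * kd j k"

lemma sum_UNIV7: "(\<Sum>a\<in>(UNIV::7 set). f a) = f 1 + f 2 + f 3 + f 4 + f 5 + f 6 + f 7" for f :: "7 \<Rightarrow> real"
  unfolding UNIV7 by simp

lemma std3_kd:
  "std3 x y (kd 1) = x 2 * y 7 - x 7 * y 2 + x 3 * y 5 - x 5 * y 3 - x 4 * y 6 + x 6 * y 4"
  "std3 x y (kd 2) = x 7 * y 1 - x 1 * y 7 - x 3 * y 6 + x 6 * y 3 - x 4 * y 5 + x 5 * y 4"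
  "std3 x y (kd 3) = x 5 * y 1 - x 1 * y 5 + x 2 * y 6 - x 6 * y 2 + x 4 * y 7 - x 7 * y 4"
  "std3 x y (kd 4) = x 1 * y 6 - x 6 * y 1 + x 2 * y 5 - x 5 * y 2 - x 3 * y 7 + x 7 * y 3"
  "std3 x y (kd 5) = x 1 * y 3 - x 3 * y 1 - x 2 * y 4 + x 4 * y 2 + x 6 * y 7 - x 7 * y 6"
  "std3 x y (kd 6) = x 4 * y 1 - x 1 * y 4 - x 2 * y 3 + x 3 * y 2 - x 5 * y 7 + x 7 * y 5"
  "std3 x y (kd 7) = x 1 * y 2 - x 2 * y 1 + x 3 * y 4 - x 4 * y 3 + x 5 * y 6 - x 6 * y 5"
  unfolding std3_def det3_def kd_def by (simp_all add: algebra_simps)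

text \<open>A polarization of |v|^2 = |x|^2 |y|^2 - (x,y)^2, where v is the cross product of x and y
  defined by the form, symmetrized in \<open>y\<close> and \<open>z\<close>. At basis vectors it is
  the skew symmetry of \<open>psi0\<close> in its middle slots.\<close>

lemma std3_identity:
  "(\<Sum>a\<in>UNIV. std3 x y (kd a) * std3 z u (kd a)) + (\<Sum>a\<in>UNIV. std3 x z (kd a) * std3 y u (kd a)) =
    (\<Sum>a\<in>UNIV. x a * z a) * (\<Sum>a\<in>UNIV. y a * u a) - 2 * (\<Sum>a\<in>UNIV. x a * u a) * (\<Sum>a\<in>UNIV. y a * z a)
    + (\<Sum>a\<in>UNIV. x a * y a) * (\<Sum>a\<in>UNIV. z a * u a)"
  unfolding sum_UNIV7 std3_kd by algebra

lemma sum_kd: "(\<Sum>a\<in>UNIV. kd i a * kd j a) = kd i j" for i j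
  by (simp add: kd_def if_distrib[of "\<lambda>x. x * _"] cong: if_cong)

lemma kd_sym: "kd i j = kd j i"
  by (simp add: kd_def)

lemma phi0_swap: "phi0 [i, j, k] = - phi0 [j, i, k]" "phi0 [i, j, k] = - phi0 [i, k, j]"
  using alternatingD[OF alternating_phi0, of "[]" i j "[k]"]
    alternatingD[OF alternating_phi0, of "[i]" j k "[]"] by simp_all

lemma psi0_swap: "psi0 i j k l = - psi0 j i k l" "psi0 i j k l = - psi0 i k j l" "psi0 i j k l = - psi0 i j l k"
proof -
  show "psi0 i j k l = - psi0 j i k l"
    unfolding psi0_def phi0_swap(1)[of i j] by (simp add: sum_negf)
  show "psi0 i j k l = - psi0 i j l k"
    unfolding psi0_def phi0_swap(1)[of k l] by (simp add: sum_negf)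
  show "psi0 i j k l = - psi0 i k j l"
    using std3_identity[of "kd i" "kd j" "kd k" "kd l"]
    unfolding psi0_def phi0_eq sum_kd by (simp add: kd_sym[of k j] algebra_simps)
qed

lemma mat_1_sym: "(mat 1 :: real^7^7) $ a $ b = mat 1 $ b $ a"
  by (cases "a = b") (simp_all add: mat_def)

lemma std_g2_pt: "g2_pt (mat 1) (mat 1) (\<lambda>i j k. phi0 [i, j, k]) psi0"
proof
  fix i j k l
  show "tr (mat 1) (\<lambda>a b. phi0 [i, j, a] * phi0 [k, l, b]) =
      mat 1 $ i $ k * mat 1 $ j $ l - mat 1 $ i $ l * mat 1 $ j $ k + psi0 i j k l"
    unfolding psi0_def tr_mat_1 by (simp add: mat_def kd_def)
qed (rule mat_1_sym matrix_mul_lid phi0_swap psi0_swap)+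

interpretation std: g2_pt "mat 1" "mat 1" "\<lambda>i j k. phi0 [i, j, k]" psi0
  by (rule std_g2_pt)

lemma wedge_list_axis_self: "distinct l \<Longrightarrow> wedge_list (map (\<lambda>i. axis i 1) l) l = 1"
proof (induction l)
  case (Cons a l)
  have "wedge_list (map (\<lambda>i. axis i 1) (a # l)) (a # l) =
      (\<Sum>b\<le>length l. (if b = 0 then 1 else - 1) * axis a 1 $ ((a # l) ! b) *
        wedge_list (map (\<lambda>i. axis i 1) l) (tl ((a # l)[0 := (a # l) ! b, b := (a # l) ! 0])))"
    unfolding list.map by (rule wedge_list_Cons) simp_all
  also have "\<dots> = (\<Sum>b\<le>length l. if b = 0 then 1 else 0)"
  proof (rule sum.cong[OF refl])
    fix b assume b: "b \<in> {..length l}"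
    show "(if b = 0 then 1 else - 1) * axis a 1 $ ((a # l) ! b) *
        wedge_list (map (\<lambda>i. axis i 1) l) (tl ((a # l)[0 := (a # l) ! b, b := (a # l) ! 0])) =
        (if b = 0 then 1 else 0)"
    proof (cases b)
      case (Suc c)
      then have "l ! c \<noteq> a" using b Cons.prems nth_mem[of c l] by auto
      then show ?thesis using Suc by (simp add: axis_def)
    qed (use Cons in simp)
  qed
  finally show ?case by simp
qed simp

section \<open>Sorted index lists and the dual 4-form of the standard form\<close>

lemma eps0_1: "eps0 [1, 2, 3, 4, 5, 6, 7] = 1"
  using wedge_list_axis_self[of "[1, 2, 3, 4, 5, 6, 7]"] by (simp add: eps0_def del: wedge_list.simps)

text \<open>The numeral 7 denotes 0 in the index type. \<open>rk\<close> provides the order 1 < ...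
  < 7 through natural numbers that the simplifier can compare.\<close>

definition rk :: "7 \<Rightarrow> nat" where
  "rk i = (if i = 1 then 1 else if i = 2 then 2 else if i = 3 then 3 else if i = 4 then 4
     else if i = 5 then 5 else if i = 6 then 6 else 7)"

lemma rk_simps: "rk 1 = 1" "rk 2 = 2" "rk 3 = 3" "rk 4 = 4" "rk 5 = 5" "rk 6 = 6" "rk 7 = 7"
  by (simp_all add: rk_def)

lemma all_7: "(\<forall>i::7. P i) \<longleftrightarrow> P 1 \<and> P 2 \<and> P 3 \<and> P 4 \<and> P 5 \<and> P 6 \<and> P 7"
proof -
  have "(\<forall>i::7. P i) \<longleftrightarrow> (\<forall>i\<in>{1, 2, 3, 4, 5, 6, 7}. P i)" unfolding UNIV7[symmetric] by simp
  then show ?thesis by simp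
qed

lemma rk_inj: "rk i = rk j \<Longrightarrow> i = j"
proof -
  have "\<forall>i j. rk i = rk j \<longrightarrow> i = j" unfolding all_7 rk_simps by simp
  then show "rk i = rk j \<Longrightarrow> i = j" by blast
qed

lemma kd_rk: "kd i j = (if rk i = rk j then 1 else 0)"
  using rk_inj by (auto simp: kd_def)

text \<open>A common sign sorts both sides, so increasing lists suffice: 35 instead of 7^4 for
  4-forms.\<close>

lemma alternating_sorted_eqI:
  assumes \<alpha>: "alternating \<alpha>" and \<beta>: "alternating \<beta>"
    and eq: "\<And>l. sorted_wrt (\<lambda>i j. rk i < rk j) l \<Longrightarrow> length l = n \<Longrightarrow> \<alpha> l = \<beta> l"
    and l: "length l = n"
  shows "\<alpha> l = \<beta> l"
proof (cases "distinct l")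
  case True
  let ?m = "sort_key rk l"
  have "distinct (map rk ?m)"
    using True by (auto simp: distinct_map inj_on_def dest: rk_inj)
  then have "sorted_wrt (\<lambda>i j. rk i < rk j) ?m"
    using sorted_sort_key[of rk l] strict_sorted_iff[of "map rk ?m"] by (simp add: sorted_wrt_map)
  then have "\<alpha> ?m = \<beta> ?m" using eq l by simp
  moreover obtain s where s: "\<And>\<gamma>. alternating \<gamma> \<Longrightarrow> \<gamma> l = s * \<gamma> ?m"
    using alternating_mset[OF mset_sort[symmetric, of l rk]] by blast
  ultimately show ?thesis using s[OF \<alpha>] s[OF \<beta>] by simp
next
  case False
  then show ?thesis using alternating_not_distinct[OF \<alpha>] alternating_not_distinct[OF \<beta>] by simp
qed

text \<open>As rewrite rules guarded by \<open>rk\<close> these sort the arguments of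
  \<open>eps0\<close>, ending at \<open>eps0_1\<close> or at a repeated index.\<close>

lemma eps0_sort:
  "rk a > rk b \<Longrightarrow> eps0 [a, b, c, d, e, f, k] = - eps0 [b, a, c, d, e, f, k]"
  "rk b > rk c \<Longrightarrow> eps0 [a, b, c, d, e, f, k] = - eps0 [a, c, b, d, e, f, k]"
  "rk c > rk d \<Longrightarrow> eps0 [a, b, c, d, e, f, k] = - eps0 [a, b, d, c, e, f, k]"
  "rk d > rk e \<Longrightarrow> eps0 [a, b, c, d, e, f, k] = - eps0 [a, b, c, e, d, f, k]"
  "rk e > rk f \<Longrightarrow> eps0 [a, b, c, d, e, f, k] = - eps0 [a, b, c, d, f, e, k]"
  "rk f > rk k \<Longrightarrow> eps0 [a, b, c, d, e, f, k] = - eps0 [a, b, c, d, e, k, f]"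
  using alternatingD[OF alternating_eps0, of "[]" a b] alternatingD[OF alternating_eps0, of "[a]" b c]
    alternatingD[OF alternating_eps0, of "[a, b]" c d] alternatingD[OF alternating_eps0, of "[a, b, c]" d e]
    alternatingD[OF alternating_eps0, of "[a, b, c, d]" e f] alternatingD[OF alternating_eps0, of "[a, b, c, d, e]" f k]
  by simp_all

definition psi_list :: tens where
  "psi_list l = (if length l = 4 then psi0 (l ! 0) (l ! 1) (l ! 2) (l ! 3) else 0)"

lemma length_4E: assumes "length l = 4" obtains a b c d where "l = [a, b, c, d]"
  using assms by (auto simp: numeral_eq_Suc length_Suc_conv)

lemma alternating_4I:
  assumes "\<And>l. length l \<noteq> 4 \<Longrightarrow> \<alpha> l = 0"
    and "\<And>a b c d. \<alpha> [a, b, c, d] = - \<alpha> [b, a, c, d]" "\<And>a b c d. \<alpha> [a, b, c, d] = - \<alpha> [a, c, b, d]"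
      "\<And>a b c d. \<alpha> [a, b, c, d] = - \<alpha> [a, b, d, c]"
  shows "alternating \<alpha>"
  unfolding alternating_def
proof (intro allI)
  fix xs ys :: "7 list" and a b :: 7
  show "\<alpha> (xs @ a # b # ys) = - \<alpha> (xs @ b # a # ys)"
  proof (cases "length xs + length ys = 2")
    case True
    then consider "length xs = 0" "length ys = 2" | "length xs = 1" "length ys = 1" | "length xs = 2" "length ys = 0"
      by linarith
    then show ?thesis
      by cases (auto simp: numeral_2_eq_2 length_Suc_conv intro: assms)
  qed (simp add: assms(1))
qed

lemma alternating_psi_list: "alternating psi_list"
proof (rule alternating_4I)
  fix a b c d
  show "psi_list [a, b, c, d] = - psi_list [b, a, c, d]" "psi_list [a, b, c, d] = - psi_list [a, c, b, d]"
    "psi_list [a, b, c, d] = - psi_list [a, b, d, c]"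
    using psi0_swap(1)[of a b c d] psi0_swap(2)[of a b c d] psi0_swap(3)[of a b c d]
    by (simp_all add: psi_list_def)
qed (simp add: psi_list_def)

lemma eps0_eq_0: "eps0 (a # a # l) = 0" "eps0 (a # b # b # l) = 0" "eps0 (a # b # c # c # l) = 0"
  "eps0 (a # b # c # d # d # l) = 0" "eps0 (a # b # c # d # e # e # l) = 0"
  "eps0 (a # b # c # d # e # f # f # l) = 0"
  by (rule alternating_not_distinct[OF alternating_eps0], simp)+

lemma sum_kd_mult: "(\<Sum>a\<in>UNIV. kd a p * F a) = F p"
  by (simp add: kd_def if_distrib[of "\<lambda>x. x * _"] cong: if_cong)

lemma sum_det3_mult:
  assumes F: "alternating F"
  shows "(\<Sum>a\<in>UNIV. \<Sum>b\<in>UNIV. \<Sum>c\<in>UNIV. det3 (kd a) (kd b) (kd c) p q r * F [a, b, c]) = 6 * F [p, q, r]"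
proof -
  have "det3 (kd a) (kd b) (kd c) p q r * F [a, b, c] =
      kd a p * (kd b q * (kd c r * F [a, b, c])) - kd a p * (kd b r * (kd c q * F [a, b, c]))
      - kd a q * (kd b p * (kd c r * F [a, b, c])) + kd a q * (kd b r * (kd c p * F [a, b, c]))
      + kd a r * (kd b p * (kd c q * F [a, b, c])) - kd a r * (kd b q * (kd c p * F [a, b, c]))" for a b c
    unfolding det3_def by (simp add: algebra_simps)
  then have "(\<Sum>a\<in>UNIV. \<Sum>b\<in>UNIV. \<Sum>c\<in>UNIV. det3 (kd a) (kd b) (kd c) p q r * F [a, b, c]) =
      F [p, q, r] - F [p, r, q] - F [q, p, r] + F [r, p, q] + F [q, r, p] - F [r, q, p]"
    by (simp add: sum.distrib sum_subtractf sum_distrib_left[symmetric] sum_kd_mult)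
  moreover have "F [p, r, q] = - F [p, q, r]" "F [q, p, r] = - F [p, q, r]" "F [r, p, q] = - F [p, r, q]"
    "F [q, r, p] = - F [q, p, r]" "F [r, q, p] = - F [r, p, q]"
    using alternatingD[OF F, of "[p]" r q "[]"] alternatingD[OF F, of "[]" q p "[r]"]
      alternatingD[OF F, of "[]" r p "[q]"] alternatingD[OF F, of "[q]" r p "[]"] alternatingD[OF F, of "[r]" q p "[]"]
    by simp_all
  ultimately show ?thesis by simp
qed

lemma sum_phi0_mult:
  assumes F: "alternating F"
  shows "(\<Sum>m | length m = 3. phi0 m * F m) =
    6 * (F [1, 2, 7] + F [1, 3, 5] - F [1, 4, 6] - F [2, 3, 6] - F [2, 4, 5] + F [3, 4, 7] + F [5, 6, 7])"
  unfolding length_numeral_sums phi0_eq std3_def distrib_right left_diff_distrib sum.distrib sum_subtractf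
    sum_det3_mult[OF F] by simp

text \<open>Identifies the algebraically defined \<open>psi0\<close> with the Hodge dual of
  \<open>phi0\<close>; the 6 is 3!. Both sides are alternating, so the increasing lists
  decide.\<close>

lemma sum_phi0_eps0:
  assumes "length l = 4"
  shows "(\<Sum>m | length m = 3. phi0 m * eps0 (m @ l)) = 6 * psi_list l"
proof (rule alternating_sorted_eqI[OF _ _ _ assms])
  show "alternating (\<lambda>l. \<Sum>m | length m = 3. phi0 m * eps0 (m @ l))"
    unfolding alternating_def
  proof (intro allI)
    fix xs ys :: "7 list" and a b :: 7
    have "eps0 (m @ xs @ a # b # ys) = - eps0 (m @ xs @ b # a # ys)" for m
      using alternatingD[OF alternating_eps0, of "m @ xs" a b ys] by simp
    then show "(\<Sum>m | length m = 3. phi0 m * eps0 (m @ xs @ a # b # ys)) =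
        - (\<Sum>m | length m = 3. phi0 m * eps0 (m @ xs @ b # a # ys))"
      by (simp add: sum_negf)
  qed
  show "alternating (\<lambda>l. 6 * psi_list l)"
    using alternating_psi_list unfolding alternating_def by (metis mult_minus_right)
  note ev = psi_list_def psi0_def phi0_eq sum_UNIV7 std3_kd kd_rk eps0_sort eps0_eq_0 eps0_1 rk_simps
  fix l :: "7 list" assume "sorted_wrt (\<lambda>i j. rk i < rk j) l" "length l = 4"
  then obtain i j k m where l: "l = [i, j, k, m]" and r: "rk i < rk j" "rk j < rk k" "rk k < rk m"
    by (auto elim!: length_4E)
  have "\<forall>i j k m. rk i < rk j \<longrightarrow> rk j < rk k \<longrightarrow> rk k < rk m \<longrightarrow>
      eps0 [1, 2, 7, i, j, k, m] + eps0 [1, 3, 5, i, j, k, m] - eps0 [1, 4, 6, i, j, k, m]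
      - eps0 [2, 3, 6, i, j, k, m] - eps0 [2, 4, 5, i, j, k, m] + eps0 [3, 4, 7, i, j, k, m]
      + eps0 [5, 6, 7, i, j, k, m] = psi_list [i, j, k, m]"
    unfolding all_7 rk_simps by (simp, simp add: ev)
  then have "eps0 [1, 2, 7, i, j, k, m] + eps0 [1, 3, 5, i, j, k, m] - eps0 [1, 4, 6, i, j, k, m]
      - eps0 [2, 3, 6, i, j, k, m] - eps0 [2, 4, 5, i, j, k, m] + eps0 [3, 4, 7, i, j, k, m]
      + eps0 [5, 6, 7, i, j, k, m] = psi_list [i, j, k, m]"
    using r by blast
  then show "(\<Sum>m | length m = 3. phi0 m * eps0 (m @ l)) = 6 * psi_list l"
    using sum_phi0_mult[OF alternating_suffix[OF alternating_eps0], of "[i, j, k, m]"] l by simp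
qed

lemma length_3E: assumes "length l = 3" obtains a b c where "l = [a, b, c]"
  using assms by (auto simp: numeral_eq_Suc length_Suc_conv)

section \<open>The stabilizer of the standard form is orthogonal\<close>

lemma mat_1_kd: "mat 1 $ i $ j = kd i j"
  by (simp add: mat_def kd_def)

text \<open>This triple product recovers the metric, so a matrix that fixes the standard form is orthogonal
  up to a factor.\<close>

lemma eps0_phi0_phi0_phi0:
  "(\<Sum>a\<in>UNIV. \<Sum>b\<in>UNIV. \<Sum>c\<in>UNIV. \<Sum>d\<in>UNIV. \<Sum>m | length m = 3.
      eps0 ([a, b, c, d] @ m) * (phi0 [i, a, b] * (phi0 [j, c, d] * phi0 m))) = 144 * kd i j"
proof -
  interpret std: g2_pt "mat 1" "mat 1" "\<lambda>i j k. phi0 [i, j, k]" psi0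
    by (rule std_g2_pt)
  \<comment> \<open>Four indices pass a block of three: twelve transpositions, hence no
    sign.\<close>
  have "eps0 ([a, b, c, d] @ m) = eps0 (m @ [a, b, c, d])" if "length m = 3" for a b c d m
  proof -
    have "eps0 (d # m @ []) = (- 1) ^ length m * eps0 ([] @ m @ d # [])" if "length m = 6" for m d
      using alternating_move[OF alternating_eps0, of "[]" d m "[]"] by simp
    have *: "eps0 (xs @ x # m @ zs) = - eps0 (xs @ m @ x # zs)" for xs x zs
      using alternating_move[OF alternating_eps0, of xs x m zs] that by simp
    show ?thesis
      using *[of "[a, b, c]" d "[]"] *[of "[a, b]" c "[d]"] *[of "[a]" b "[c, d]"] *[of "[]" a "[b, c, d]"]
      by simp
  qed
  then have 1: "(\<Sum>m | length m = 3. eps0 ([a, b, c, d] @ m) * (phi0 [i, a, b] * (phi0 [j, c, d] * phi0 m))) =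
      6 * (phi0 [i, a, b] * (phi0 [j, c, d] * psi0 a b c d))" for a b c d
  proof -
    have "(\<Sum>m | length m = 3. eps0 ([a, b, c, d] @ m) * (phi0 [i, a, b] * (phi0 [j, c, d] * phi0 m))) =
        (\<Sum>m | length m = 3. phi0 [i, a, b] * phi0 [j, c, d] * (phi0 m * eps0 (m @ [a, b, c, d])))"
      using \<open>\<And>m d c b a. length m = 3 \<Longrightarrow> eps0 ([a, b, c, d] @ m) = eps0 (m @ [a, b, c, d])\<close>
      by (intro sum.cong refl) simp
    also have "\<dots> = phi0 [i, a, b] * phi0 [j, c, d] * (6 * psi_list [a, b, c, d])"
      unfolding sum_distrib_left[symmetric] by (subst sum_phi0_eps0) simp_all
    finally show ?thesis by (simp add: psi_list_def)
  qed
  \<comment> \<open>The three contractions contribute the factors 6, 4 and 6, whose product is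
    144.\<close>
  have 2: "(\<Sum>c\<in>UNIV. \<Sum>d\<in>UNIV. phi0 [j, c, d] * psi0 a b c d) = 4 * phi0 [a, b, j]" for a b
    using std.psi_phi[of a b j] std.phi_cyc[of j] by (simp add: tr_mat_1 mult.commute)
  have 3: "(\<Sum>a\<in>UNIV. \<Sum>b\<in>UNIV. phi0 [i, a, b] * phi0 [a, b, j]) = 6 * kd i j"
    using std.phi_phi2[of i j] std.phi_cyc[of j] by (simp add: tr_mat_1 mat_1_kd)
  have "(\<Sum>a\<in>UNIV. \<Sum>b\<in>UNIV. \<Sum>c\<in>UNIV. \<Sum>d\<in>UNIV. \<Sum>m | length m = 3.
      eps0 ([a, b, c, d] @ m) * (phi0 [i, a, b] * (phi0 [j, c, d] * phi0 m))) =
      (\<Sum>a\<in>UNIV. \<Sum>b\<in>UNIV. 6 * (phi0 [i, a, b] * (\<Sum>c\<in>UNIV. \<Sum>d\<in>UNIV. phi0 [j, c, d] * psi0 a b c d)))"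
    unfolding 1 by (simp only: sum_distrib_left)
  also have "\<dots> = 24 * (\<Sum>a\<in>UNIV. \<Sum>b\<in>UNIV. phi0 [i, a, b] * phi0 [a, b, j])"
    unfolding 2 by (simp add: sum_distrib_left mult_ac)
  finally show ?thesis unfolding 3 by simp
qed

lemma sum_phi0_sq: "(\<Sum>m | length m = 3. phi0 m * phi0 m) = 42"
proof -
  interpret std: g2_pt "mat 1" "mat 1" "\<lambda>i j k. phi0 [i, j, k]" psi0
    by (rule std_g2_pt)
  have "(\<Sum>b\<in>UNIV. \<Sum>c\<in>UNIV. phi0 [a, b, c] * phi0 [a, b, c]) = 6" for a
    using std.phi_phi2[of a a] by (simp add: tr_mat_1 mat_1_kd) (simp add: kd_def)
  then show ?thesis by (simp add: length_numeral_sums)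
qed

lemma eps0_length: "length l \<noteq> 7 \<Longrightarrow> eps0 l = 0"
  by (simp add: eps0_def wedge_def)

lemma alternating_7_eq:
  assumes \<alpha>: "alternating \<alpha>" and l: "length l = 7"
  shows "\<alpha> l = \<alpha> [1, 2, 3, 4, 5, 6, 7] * eps0 l"
proof (cases "distinct l")
  case True
  let ?L = "[1, 2, 3, 4, 5, 6, 7::7]"
  have "card (set l) = CARD(7)" using True l distinct_card by fastforce
  then have "set l = UNIV" using card_subset_eq[of "UNIV::7 set" "set l"] by auto
  then have "set l = set ?L" using UNIV7 by simp
  moreover have "distinct ?L" by simp
  ultimately have "mset l = mset ?L" using True set_eq_iff_mset_eq_distinct by blast
  then obtain s where s: "s \<in> {1, - 1}" "\<And>\<gamma>. alternating \<gamma> \<Longrightarrow> \<gamma> l = s * \<gamma> ?L"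
    using alternating_mset by blast
  show ?thesis unfolding s(2)[OF \<alpha>] s(2)[OF alternating_eps0] eps0_1 by simp
next
  case False
  then show ?thesis using alternating_not_distinct[OF \<alpha>] alternating_not_distinct[OF alternating_eps0] by simp
qed

lemma lk_scaled: "length a = length b \<Longrightarrow> A = c *\<^sub>R mat 1 \<Longrightarrow> lk A a b = (if a = b then c ^ length b else 0)"
  by (induction a b rule: list_induct2) (auto simp: mat_def)

text \<open>Pulling the triple product back by \<open>M\<close> leaves \<open>phi0\<close> alone and
  multiplies the volume form by d = det M, so d times \<open>transpose M ** M\<close> is the
  identity. Comparing the norms of \<open>phi0\<close> and of its pullback then forces d^3 = 1, and
  d is real.\<close>

lemma pull_phi0_eq_imp_orthogonal:
  assumes M: "pull M phi0 = phi0"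
  shows "transpose M ** M = mat 1" "pull M eps0 = eps0"
proof -
  define d where "d = pull (transpose M) eps0 [1, 2, 3, 4, 5, 6, 7]"
  let ?S = "\<lambda>n. {m::7 list. length m = n}"
  have d: "(\<Sum>m\<in>?S 7. eps0 m * lk M n m) = d * eps0 n" if "length n = 7" for n
  proof -
    have "(\<Sum>m\<in>?S 7. eps0 m * lk M n m) = pull (transpose M) eps0 n"
      unfolding pull_def that by (intro sum.cong refl) (simp add: lk_transpose that mult.commute)
    then show ?thesis
      using alternating_7_eq[OF alternating_pull[OF alternating_eps0] that] by (simp add: d_def)
  qed
  define F where "F i j m = phi0 [i, m ! 0, m ! 1] * (phi0 [j, m ! 2, m ! 3] * phi0 (drop 4 m))" for i j m
  have sumF: "(\<Sum>m\<in>?S 7. eps0 m * F i j m) = 144 * kd i j" for i j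
  proof -
    have "(\<Sum>m\<in>?S 7. eps0 m * F i j m) = (\<Sum>m\<in>?S (4 + 3). eps0 m * F i j m)" by simp
    also have "\<dots> = 144 * kd i j"
      unfolding sum_length_add length_numeral_sums(5) eps0_phi0_phi0_phi0[symmetric] by (simp add: F_def)
    finally show ?thesis .
  qed
  \<comment> \<open>Each factor \<open>phi0\<close> is replaced by its pullback. The slots
    \<open>i\<close> and \<open>j\<close> are expanded separately; the other seven stay together as
    the kernel \<open>lk M\<close>, ready to act on \<open>eps0\<close>.\<close>
  have Fpull: "F i j m = (\<Sum>r\<in>UNIV. \<Sum>s\<in>UNIV. M $ r $ i * (M $ s $ j * (\<Sum>n\<in>?S 7. lk M n m * F r s n)))"
    if m: "length m = 7" for i j m
  proof -
    obtain a b c d e where m_eq: "m = [a, b, c, d] @ e" and e: "length e = 3"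
    proof -
      have "length (take 4 m) = 4" using m by simp
      then obtain a b c d where "take 4 m = [a, b, c, d]" by (rule length_4E)
      then have "m = [a, b, c, d] @ drop 4 m" by (metis append_take_drop_id)
      then show ?thesis using that[of a b c d "drop 4 m"] m by simp
    qed
    have "F i j m = pull M phi0 [i, a, b] * (pull M phi0 [j, c, d] * pull M phi0 e)"
      by (simp add: F_def m_eq M)
    also have "\<dots> = (\<Sum>r\<in>UNIV. \<Sum>a'\<in>UNIV. \<Sum>b'\<in>UNIV. M $ r $ i * M $ a' $ a * M $ b' $ b * phi0 [r, a', b']) *
        ((\<Sum>s\<in>UNIV. \<Sum>c'\<in>UNIV. \<Sum>d'\<in>UNIV. M $ s $ j * M $ c' $ c * M $ d' $ d * phi0 [s, c', d']) *
         (\<Sum>n\<in>?S 3. lk M n e * phi0 n))"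
      by (simp add: pull_def e sum_length_Suc sum_length_0[simplified] mult.assoc)
    also have "\<dots> = (\<Sum>r\<in>UNIV. \<Sum>s\<in>UNIV. \<Sum>a'\<in>UNIV. \<Sum>b'\<in>UNIV. \<Sum>c'\<in>UNIV. \<Sum>d'\<in>UNIV. \<Sum>n\<in>?S 3.
        (M $ r $ i * M $ a' $ a * M $ b' $ b * phi0 [r, a', b']) *
        ((M $ s $ j * M $ c' $ c * M $ d' $ d * phi0 [s, c', d']) * (lk M n e * phi0 n)))"
    proof -
      have sw: "(\<Sum>r\<in>UNIV. \<Sum>a\<in>UNIV. \<Sum>b\<in>UNIV. f r a b) * ((\<Sum>s\<in>UNIV. \<Sum>c\<in>UNIV. \<Sum>d\<in>UNIV. g s c d) * (\<Sum>n\<in>N. k n)) =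
          (\<Sum>r\<in>UNIV. \<Sum>s\<in>UNIV. \<Sum>a\<in>UNIV. \<Sum>b\<in>UNIV. \<Sum>c\<in>UNIV. \<Sum>d\<in>UNIV. \<Sum>n\<in>N. f r a b * (g s c d * k n))"
        for f g :: "7 \<Rightarrow> 7 \<Rightarrow> 7 \<Rightarrow> real" and k :: "7 list \<Rightarrow> real" and N
      proof -
        have "(\<Sum>r\<in>UNIV. \<Sum>a\<in>UNIV. \<Sum>b\<in>UNIV. f r a b) * ((\<Sum>s\<in>UNIV. \<Sum>c\<in>UNIV. \<Sum>d\<in>UNIV. g s c d) * (\<Sum>n\<in>N. k n))
          = (\<Sum>r\<in>UNIV. \<Sum>s\<in>UNIV. (\<Sum>a\<in>UNIV. \<Sum>b\<in>UNIV. f r a b) * ((\<Sum>c\<in>UNIV. \<Sum>d\<in>UNIV. g s c d) * (\<Sum>n\<in>N. k n)))"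
        proof -
          have "(\<Sum>r\<in>UNIV. A r) * ((\<Sum>s\<in>UNIV. B s) * K) = (\<Sum>r\<in>UNIV. \<Sum>s\<in>UNIV. A r * (B s * K))"
            for A B :: "7 \<Rightarrow> real" and K
            unfolding sum_distrib_left sum_distrib_right by (rule sum.swap)
          then show ?thesis .
        qed
        also have "\<dots> = (\<Sum>r\<in>UNIV. \<Sum>s\<in>UNIV. \<Sum>a\<in>UNIV. \<Sum>b\<in>UNIV. f r a b * (\<Sum>c\<in>UNIV. \<Sum>d\<in>UNIV. g s c d * (\<Sum>n\<in>N. k n)))"
          by (simp only: sum_distrib_right)
        finally show ?thesis by (simp only: sum_distrib_left)
      qed
      show ?thesis by (rule sw)
    qed
    also have "\<dots> = (\<Sum>r\<in>UNIV. \<Sum>s\<in>UNIV. M $ r $ i * (M $ s $ j * (\<Sum>n\<in>?S (4 + 3). lk M n m * F r s n)))"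
      unfolding sum_length_add length_numeral_sums(5) sum_distrib_left
      by (intro sum.cong refl) (simp add: F_def m_eq lk_append)
    finally show ?thesis by simp
  qed
  have key: "d * (transpose M ** M) $ i $ j = mat 1 $ i $ j" for i j
  proof -
    have "144 * kd i j = (\<Sum>m\<in>?S 7. eps0 m * F i j m)" by (simp add: sumF)
    also have "\<dots> = (\<Sum>m\<in>?S 7. \<Sum>r\<in>UNIV. \<Sum>s\<in>UNIV. M $ r $ i * (M $ s $ j * (\<Sum>n\<in>?S 7. eps0 m * lk M n m * F r s n)))"
      by (intro sum.cong refl, subst Fpull) (simp_all add: sum_distrib_left mult_ac)
    also have "\<dots> = (\<Sum>r\<in>UNIV. \<Sum>s\<in>UNIV. M $ r $ i * (M $ s $ j * (\<Sum>m\<in>?S 7. \<Sum>n\<in>?S 7. eps0 m * lk M n m * F r s n)))"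
      unfolding sum_distrib_left by (subst sum.swap, rule sum.cong[OF refl], subst sum.swap) simp
    also have "\<dots> = (\<Sum>r\<in>UNIV. \<Sum>s\<in>UNIV. M $ r $ i * (M $ s $ j * (d * (144 * kd r s))))"
    proof -
      have "(\<Sum>m\<in>?S 7. \<Sum>n\<in>?S 7. eps0 m * lk M n m * F r s n) = d * (144 * kd r s)" for r s
      proof -
        have "(\<Sum>m\<in>?S 7. \<Sum>n\<in>?S 7. eps0 m * lk M n m * F r s n) =
            (\<Sum>n\<in>?S 7. (\<Sum>m\<in>?S 7. eps0 m * lk M n m) * F r s n)"
          by (subst sum.swap) (simp only: sum_distrib_right)
        also have "\<dots> = (\<Sum>n\<in>?S 7. d * (eps0 n * F r s n))"
          by (intro sum.cong refl) (simp add: d)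
        finally show ?thesis by (simp only: sum_distrib_left[symmetric] sumF)
      qed
      then show ?thesis by simp
    qed
    also have "\<dots> = 144 * (d * (\<Sum>r\<in>UNIV. M $ r $ i * M $ r $ j))"
    proof -
      have "(\<Sum>s\<in>UNIV. M $ r $ i * (M $ s $ j * (d * (144 * kd r s)))) = 144 * (d * (M $ r $ i * M $ r $ j))" for r
        by (simp add: kd_def if_distrib[of "\<lambda>x. _ * x"] cong: if_cong)
      then show ?thesis by (simp only: sum_distrib_left[symmetric])
    qed
    finally have "kd i j = d * (\<Sum>r\<in>UNIV. M $ r $ i * M $ r $ j)" by simp
    then show ?thesis
      by (simp add: matrix_matrix_mult_def transpose_def mat_def kd_def eq_commute)
  qed
  have d0: "d \<noteq> 0" using key[of 1 1] by (auto simp: mat_def)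
  have MM: "transpose M ** M = (1 / d) *\<^sub>R mat 1"
    using key d0 by (simp add: vec_eq_iff field_simps)
  then have "(d *\<^sub>R transpose M) ** M = mat 1"
    using d0 by (simp add: scalar_matrix_assoc[symmetric])
  then have "M ** (d *\<^sub>R transpose M) = mat 1"
    by (simp add: matrix_left_right_inverse)
  then have MM': "M ** transpose M = (1 / d) *\<^sub>R mat 1"
    using d0 by (simp add: matrix_scalar_ac scalar_matrix_assoc[symmetric] vec_eq_iff field_simps)
  \<comment> \<open>The norm of \<open>phi0\<close> computed from its pullback: three factors
    \<open>M ** transpose M\<close> produce \<open>(1 / d) ^ 3\<close>.\<close>
  have "42 = (\<Sum>m\<in>?S 3. pull M phi0 m * pull M phi0 m)" by (simp add: M sum_phi0_sq)
  also have "\<dots> = (\<Sum>m\<in>?S 3. \<Sum>a\<in>?S 3. \<Sum>b\<in>?S 3. lk M a m * lk M b m * (phi0 a * phi0 b))"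
    by (intro sum.cong refl) (simp add: pull_def sum_product mult_ac)
  also have "\<dots> = (\<Sum>a\<in>?S 3. \<Sum>b\<in>?S 3. (\<Sum>m\<in>?S 3. lk M a m * lk (transpose M) m b) * (phi0 a * phi0 b))"
    unfolding sum_distrib_right
    by (subst sum.swap, rule sum.cong[OF refl], subst sum.swap, intro sum.cong refl) (simp add: lk_transpose)
  also have "\<dots> = (\<Sum>a\<in>?S 3. \<Sum>b\<in>?S 3. lk (M ** transpose M) a b * (phi0 a * phi0 b))"
  proof (intro sum.cong refl)
    fix a b assume "a \<in> ?S 3" "b \<in> ?S 3"
    then show "(\<Sum>m\<in>?S 3. lk M a m * lk (transpose M) m b) * (phi0 a * phi0 b) =
        lk (M ** transpose M) a b * (phi0 a * phi0 b)"
      using lk_mult[of a b M "transpose M"] by simp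
  qed
  also have "\<dots> = (\<Sum>a\<in>?S 3. \<Sum>b\<in>?S 3. if a = b then (1 / d) ^ 3 * (phi0 a * phi0 a) else 0)"
    by (intro sum.cong refl) (auto simp: lk_scaled[OF _ MM'])
  also have "\<dots> = (1 / d) ^ 3 * 42"
    by (simp add: finite_length_eq sum_distrib_left[symmetric] sum_phi0_sq)
  finally have "d ^ 3 = 1 ^ 3" using d0 by (simp add: field_simps)
  then have d1: "d = 1"
    using odd_real_root_power_cancel[of 3 d] odd_real_root_power_cancel[of 3 1] by simp
  then show MM1: "transpose M ** M = mat 1" using MM by simp
  have "pull (transpose M) eps0 l = eps0 l" for l
  proof (cases "length l = 7")
    case True
    then show ?thesis
      using alternating_7_eq[OF alternating_pull[OF alternating_eps0] True, of "transpose M"] d1 by (simp add: d_def)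
  next
    case False
    then show ?thesis unfolding pull_def by (simp add: eps0_length)
  qed
  then have "pull (transpose M) eps0 = eps0" by blast
  then have "pull M eps0 = pull M (pull (transpose M) eps0)" by simp
  also have "\<dots> = eps0" by (simp add: pull_pull MM1)
  finally show "pull M eps0 = eps0" .
qed

lemma invertible_matrix_inv:
  assumes "invertible (A :: real^'n^'n)"
  shows "A ** matrix_inv A = mat 1" "matrix_inv A ** A = mat 1"
proof -
  obtain B where "A ** B = mat 1 \<and> B ** A = mat 1" using assms unfolding invertible_def by blast
  then have "A ** matrix_inv A = mat 1 \<and> matrix_inv A ** A = mat 1"
    unfolding matrix_inv_def by (rule someI)
  then show "A ** matrix_inv A = mat 1" "matrix_inv A ** A = mat 1" by auto
qed

lemma matrix_inv_unique:
  assumes "(A :: real^'n^'n) ** B = mat 1" shows "matrix_inv A = B"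
proof -
  have "B ** A = mat 1" using assms by (simp add: matrix_left_right_inverse)
  then have "invertible A" using assms unfolding invertible_def by blast
  then have "matrix_inv A = (matrix_inv A ** A) ** B"
    using assms by (simp add: matrix_mul_assoc[symmetric])
  then show ?thesis using invertible_matrix_inv(2)[OF \<open>invertible A\<close>] by simp
qed

text \<open>The change \<open>M\<close> from one coframe to the other fixes \<open>phi0\<close>,
  hence is orthogonal and preserves the volume form. This is what gives the definite descriptions of
  metric and volume form a value.\<close>

lemma adapted_unique:
  assumes "adapted E f" "adapted E' f"
  shows "transpose E' ** E' = transpose E ** E" "pull E' eps0 = pull E eps0"
proof -
  define P M where "P = matrix_inv E" and "M = E' ** P"
  have E: "E ** P = mat 1" "P ** E = mat 1"
    using assms(1) invertible_matrix_inv unfolding adapted_def P_def by auto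
  have "pull E phi0 = pull E' phi0" using assms unfolding adapted_def by (simp add: g2_form_pull)
  then have "pull P (pull E phi0) = pull P (pull E' phi0)" by simp
  then have "pull M phi0 = phi0" by (simp add: pull_pull E M_def)
  note M = pull_phi0_eq_imp_orthogonal[OF this]
  have E': "E' = M ** E" by (simp add: M_def matrix_mul_assoc[symmetric] E)
  have "transpose E' ** E' = transpose E ** (transpose M ** M) ** E"
    unfolding E' by (simp add: matrix_transpose_mul matrix_mul_assoc)
  then show "transpose E' ** E' = transpose E ** E" by (simp add: M)
  show "pull E' eps0 = pull E eps0" unfolding E' pull_pull[symmetric] by (simp add: M)
qed

lemma adapted_metric_vol:
  assumes "adapted E f"
  shows "g2_metric f = transpose E ** E" "g2_vol f = pull E eps0"
proof -
  show "g2_metric f = transpose E ** E" unfolding g2_metric_def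
    by (rule the_equality) (use assms adapted_unique in blast)+
  show "g2_vol f = pull E eps0" unfolding g2_vol_def vol_pull
    by (rule the_equality) (use assms adapted_unique in blast)+
qed

subsection \<open>Quadratic invariants of 3-forms\<close>

lemma phi0_kd:
  "phi0 [a, b, 1] = kd a 2 * kd b 7 - kd a 7 * kd b 2 + kd a 3 * kd b 5 - kd a 5 * kd b 3 - kd a 4 * kd b 6 + kd a 6 * kd b 4"
  "phi0 [a, b, 2] = kd a 7 * kd b 1 - kd a 1 * kd b 7 - kd a 3 * kd b 6 + kd a 6 * kd b 3 - kd a 4 * kd b 5 + kd a 5 * kd b 4"
  "phi0 [a, b, 3] = kd a 5 * kd b 1 - kd a 1 * kd b 5 + kd a 2 * kd b 6 - kd a 6 * kd b 2 + kd a 4 * kd b 7 - kd a 7 * kd b 4"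
  "phi0 [a, b, 4] = kd a 1 * kd b 6 - kd a 6 * kd b 1 + kd a 2 * kd b 5 - kd a 5 * kd b 2 - kd a 3 * kd b 7 + kd a 7 * kd b 3"
  "phi0 [a, b, 5] = kd a 1 * kd b 3 - kd a 3 * kd b 1 - kd a 2 * kd b 4 + kd a 4 * kd b 2 + kd a 6 * kd b 7 - kd a 7 * kd b 6"
  "phi0 [a, b, 6] = kd a 4 * kd b 1 - kd a 1 * kd b 4 - kd a 2 * kd b 3 + kd a 3 * kd b 2 - kd a 5 * kd b 7 + kd a 7 * kd b 5"
  "phi0 [a, b, 7] = kd a 1 * kd b 2 - kd a 2 * kd b 1 + kd a 3 * kd b 4 - kd a 4 * kd b 3 + kd a 5 * kd b 6 - kd a 6 * kd b 5"
  unfolding phi0_eq std3_kd by simp_all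

lemma sum_phi0_mult2:
  fixes F :: "7 \<Rightarrow> 7 \<Rightarrow> real"
  shows
  "(\<Sum>a\<in>UNIV. \<Sum>b\<in>UNIV. F a b * phi0 [a, b, 1]) = F 2 7 - F 7 2 + F 3 5 - F 5 3 - F 4 6 + F 6 4"
  "(\<Sum>a\<in>UNIV. \<Sum>b\<in>UNIV. F a b * phi0 [a, b, 2]) = F 7 1 - F 1 7 - F 3 6 + F 6 3 - F 4 5 + F 5 4"
  "(\<Sum>a\<in>UNIV. \<Sum>b\<in>UNIV. F a b * phi0 [a, b, 3]) = F 5 1 - F 1 5 + F 2 6 - F 6 2 + F 4 7 - F 7 4"
  "(\<Sum>a\<in>UNIV. \<Sum>b\<in>UNIV. F a b * phi0 [a, b, 4]) = F 1 6 - F 6 1 + F 2 5 - F 5 2 - F 3 7 + F 7 3"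
  "(\<Sum>a\<in>UNIV. \<Sum>b\<in>UNIV. F a b * phi0 [a, b, 5]) = F 1 3 - F 3 1 - F 2 4 + F 4 2 + F 6 7 - F 7 6"
  "(\<Sum>a\<in>UNIV. \<Sum>b\<in>UNIV. F a b * phi0 [a, b, 6]) = F 4 1 - F 1 4 - F 2 3 + F 3 2 - F 5 7 + F 7 5"
  "(\<Sum>a\<in>UNIV. \<Sum>b\<in>UNIV. F a b * phi0 [a, b, 7]) = F 1 2 - F 2 1 + F 3 4 - F 4 3 + F 5 6 - F 6 5"
proof -
  have s: "(\<Sum>a\<in>UNIV. \<Sum>b\<in>UNIV. F a b * (kd a p * kd b q)) = F p q" for p q
  proof -
    have "(\<Sum>a\<in>UNIV. \<Sum>b\<in>UNIV. F a b * (kd a p * kd b q)) = (\<Sum>a\<in>UNIV. kd a p * (\<Sum>b\<in>UNIV. kd b q * F a b))"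
      by (simp only: sum_distrib_left mult_ac)
    then show ?thesis by (simp only: sum_kd_mult)
  qed
  show
  "(\<Sum>a\<in>UNIV. \<Sum>b\<in>UNIV. F a b * phi0 [a, b, 1]) = F 2 7 - F 7 2 + F 3 5 - F 5 3 - F 4 6 + F 6 4"
  "(\<Sum>a\<in>UNIV. \<Sum>b\<in>UNIV. F a b * phi0 [a, b, 2]) = F 7 1 - F 1 7 - F 3 6 + F 6 3 - F 4 5 + F 5 4"
  "(\<Sum>a\<in>UNIV. \<Sum>b\<in>UNIV. F a b * phi0 [a, b, 3]) = F 5 1 - F 1 5 + F 2 6 - F 6 2 + F 4 7 - F 7 4"
  "(\<Sum>a\<in>UNIV. \<Sum>b\<in>UNIV. F a b * phi0 [a, b, 4]) = F 1 6 - F 6 1 + F 2 5 - F 5 2 - F 3 7 + F 7 3"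
  "(\<Sum>a\<in>UNIV. \<Sum>b\<in>UNIV. F a b * phi0 [a, b, 5]) = F 1 3 - F 3 1 - F 2 4 + F 4 2 + F 6 7 - F 7 6"
  "(\<Sum>a\<in>UNIV. \<Sum>b\<in>UNIV. F a b * phi0 [a, b, 6]) = F 4 1 - F 1 4 - F 2 3 + F 3 2 - F 5 7 + F 7 5"
  "(\<Sum>a\<in>UNIV. \<Sum>b\<in>UNIV. F a b * phi0 [a, b, 7]) = F 1 2 - F 2 1 + F 3 4 - F 4 3 + F 5 6 - F 6 5"
    unfolding phi0_kd distrib_left right_diff_distrib sum.distrib sum_subtractf s by simp_all
qed

lemma sum_kd_mult': "(\<Sum>a\<in>UNIV. kd p a * F a) = F p"
  using sum_kd_mult[of p F] by (simp only: kd_sym[of p])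

lemma alternating_3_sort:
  assumes T: "alternating T"
  shows "rk a > rk b \<Longrightarrow> T [a, b, c] = - T [b, a, c]" "rk b > rk c \<Longrightarrow> T [a, b, c] = - T [a, c, b]"
    "T [a, a, c] = 0" "T [a, c, c] = 0" "T [c, a, c] = 0"
  using alternatingD[OF T, of "[]" a b "[c]"] alternatingD[OF T, of "[a]" b c "[]"]
  by (simp_all add: alternating_not_distinct[OF T])

lemma sum_sq_3:
  assumes T: "alternating T"
  shows "(\<Sum>a\<in>UNIV. \<Sum>b\<in>UNIV. \<Sum>c\<in>UNIV. T [a, b, c] * T [a, b, c]) =
    6 * ((T [1,2,3])^2 + (T [1,2,4])^2 + (T [1,2,5])^2 + (T [1,2,6])^2 + (T [1,2,7])^2
    + (T [1,3,4])^2 + (T [1,3,5])^2 + (T [1,3,6])^2 + (T [1,3,7])^2 + (T [1,4,5])^2 + (T [1,4,6])^2 + (T [1,4,7])^2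
    + (T [1,5,6])^2 + (T [1,5,7])^2 + (T [1,6,7])^2
    + (T [2,3,4])^2 + (T [2,3,5])^2 + (T [2,3,6])^2 + (T [2,3,7])^2 + (T [2,4,5])^2 + (T [2,4,6])^2 + (T [2,4,7])^2
    + (T [2,5,6])^2 + (T [2,5,7])^2 + (T [2,6,7])^2
    + (T [3,4,5])^2 + (T [3,4,6])^2 + (T [3,4,7])^2 + (T [3,5,6])^2 + (T [3,5,7])^2 + (T [3,6,7])^2
    + (T [4,5,6])^2 + (T [4,5,7])^2 + (T [4,6,7])^2 + (T [5,6,7])^2)"
  unfolding sum_UNIV7 by (simp add: alternating_3_sort[OF T] rk_simps power2_eq_square)

text \<open>Three-forms split into invariant parts of dimensions 1, 7 and 27, so the invariant |U|^2
  is a combination of |T|^2 and the squares of the first two parts. The coefficients are verified as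
  a polynomial identity in the 35 components of \<open>T\<close>.\<close>

lemma std_quadratic:
  assumes T: "alternating T"
  defines "U \<equiv> \<lambda>s e. \<Sum>a\<in>UNIV. \<Sum>b\<in>UNIV. T [a, b, s] * phi0 [a, b, e]"
  shows "9 * (\<Sum>s\<in>UNIV. \<Sum>e\<in>UNIV. U s e * U s e) = 12 * (\<Sum>a\<in>UNIV. \<Sum>b\<in>UNIV. \<Sum>c\<in>UNIV. T [a, b, c] * T [a, b, c])
    + (\<Sum>i\<in>UNIV. (\<Sum>c\<in>UNIV. \<Sum>e\<in>UNIV. U c e * phi0 [c, e, i])\<^sup>2)
    + (\<Sum>s\<in>UNIV. U s s)\<^sup>2"
  unfolding sum_sq_3[OF T] sum_UNIV7[of "\<lambda>i. (_ i)\<^sup>2"] sum_phi0_mult2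
  unfolding sum_UNIV7
  unfolding U_def sum_phi0_mult2
  by (simp add: alternating_3_sort[OF T] rk_simps) algebra

section \<open>Contractions as nested traces, and the adapted frame at a point\<close>

lemma contr_mat_1:
  "contr (mat 1) p k \<alpha> \<beta> l = (\<Sum>m | length m = k. \<alpha> (take p l @ m) * \<beta> (m @ drop p l))"
  unfolding contr_def
proof (rule sum.cong[OF refl])
  fix m :: "7 list" assume "m \<in> {m. length m = k}"
  then have "(\<Sum>n | length n = k. lk (mat 1) n m * \<alpha> (take p l @ m) * \<beta> (n @ drop p l)) =
      (\<Sum>n | length n = k. if n = m then \<alpha> (take p l @ m) * \<beta> (m @ drop p l) else 0)"
    by (intro sum.cong refl) (simp add: lk_mat_1)
  then show "(\<Sum>n | length n = k. lk (mat 1) n m * \<alpha> (take p l @ m) * \<beta> (n @ drop p l)) =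
      \<alpha> (take p l @ m) * \<beta> (m @ drop p l)"
    using \<open>m \<in> _\<close> by (simp add: finite_length_eq)
qed

lemma contr_cong:
  assumes "\<And>m. length m = length (take p l) + k \<Longrightarrow> \<alpha> m = \<alpha>' m"
    and "\<And>m. length m = k + length (drop p l) \<Longrightarrow> \<beta> m = \<beta>' m"
  shows "contr h p k \<alpha> \<beta> l = contr h p k \<alpha>' \<beta>' l"
  unfolding contr_def by (intro sum.cong refl) (simp add: assms)

lemma contr_0: "contr h 0 0 \<alpha> \<beta> l = \<alpha> [] * \<beta> l"
  by (simp add: contr_def sum_length_0[simplified])

lemma (in metric_pt) contr_Suc:
  "contr h 0 (Suc k) \<alpha> \<beta> l = t (\<lambda>a b. contr h 0 k (\<lambda>m. \<alpha> (a # m)) (\<lambda>n. \<beta> (b # n)) l)"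
proof -
  have "contr h 0 (Suc k) \<alpha> \<beta> l = (\<Sum>a\<in>UNIV. \<Sum>m | length m = k. \<Sum>b\<in>UNIV. \<Sum>n | length n = k.
      h $ b $ a * (lk h n m * \<alpha> (a # m) * \<beta> (b # n @ l)))"
    by (simp add: contr_def sum_length_Suc mult.assoc)
  also have "\<dots> = (\<Sum>a\<in>UNIV. \<Sum>b\<in>UNIV. \<Sum>m | length m = k. \<Sum>n | length n = k.
      h $ b $ a * (lk h n m * \<alpha> (a # m) * \<beta> (b # n @ l)))"
    by (intro sum.cong refl) (rule sum.swap)
  also have "\<dots> = t (\<lambda>a b. contr h 0 k (\<lambda>m. \<alpha> (a # m)) (\<lambda>n. \<beta> (b # n)) l)"
    unfolding tr_def contr_def sum_distrib_left by (simp add: h_sym)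
  finally show ?thesis .
qed

lemma contr_prefix:
  "length xs = p \<Longrightarrow> contr h p k \<alpha> \<beta> (xs @ l) = contr h 0 k (\<lambda>m. \<alpha> (xs @ m)) \<beta> l"
  by (simp add: contr_def)

text \<open>The list form of a contraction suits naturality and derivatives, the nested form suits
  algebra; this translates between them in the degrees that occur.\<close>

lemma (in metric_pt) contr_tr:
  "contr h 0 (Suc 0) \<alpha> \<beta> l = t (\<lambda>a b. \<alpha> [a] * \<beta> (b # l))"
  "contr h 0 1 \<alpha> \<beta> l = t (\<lambda>a b. \<alpha> [a] * \<beta> (b # l))"
  "contr h 0 2 \<alpha> \<beta> l = t (\<lambda>a b. t (\<lambda>c d. \<alpha> [a, c] * \<beta> (b # d # l)))"
  "contr h 0 3 \<alpha> \<beta> l = t (\<lambda>a b. t (\<lambda>c d. t (\<lambda>e f. \<alpha> [a, c, e] * \<beta> (b # d # f # l))))"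
  "contr h (Suc 0) (Suc 0) \<alpha> \<beta> (x # l) = t (\<lambda>a b. \<alpha> [x, a] * \<beta> (b # l))"
  "contr h 1 1 \<alpha> \<beta> (x # l) = t (\<lambda>a b. \<alpha> [x, a] * \<beta> (b # l))"
  "contr h 1 2 \<alpha> \<beta> (x # l) = t (\<lambda>a b. t (\<lambda>c d. \<alpha> [x, a, c] * \<beta> (b # d # l)))"
  "contr h (Suc 0) 2 \<alpha> \<beta> (x # l) = t (\<lambda>a b. t (\<lambda>c d. \<alpha> [x, a, c] * \<beta> (b # d # l)))"
  "contr h 2 1 \<alpha> \<beta> (x # y # l) = t (\<lambda>a b. \<alpha> [x, y, a] * \<beta> (b # l))"
  using contr_prefix[of "[x]" 1] contr_prefix[of "[x, y]" 2]
  by (simp_all add: contr_Suc contr_0 numeral_2_eq_2 numeral_3_eq_3)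

text \<open>When \<open>T\<close> is the torsion of the characteristic connection, this is the Lee form.\<close>

definition th :: "real^7^7 \<Rightarrow> tens \<Rightarrow> tens \<Rightarrow> tens" where
  "th h f T l = - (1 / 6) * contr h 0 2 (contr h 1 2 T f) f l"

text \<open>The columns of \<open>P\<close> are the orthonormal frame dual to the coframe
  \<open>E\<close>, so pulling back by \<open>P\<close> gives frame components.\<close>

locale adapted_pt =
  fixes E P g h :: "real^7^7" and f :: tens
  assumes adapted: "adapted E f"
  defines "P \<equiv> matrix_inv E" and "g \<equiv> transpose E ** E" and "h \<equiv> matrix_inv (transpose E ** E)"
begin

lemma EP: "E ** P = mat 1" "P ** E = mat 1"
  using adapted invertible_matrix_inv unfolding adapted_def P_def by auto

lemma g_PP: "transpose E ** E ** (P ** transpose P) = mat 1"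
proof -
  have "transpose E ** E ** (P ** transpose P) = transpose E ** (E ** P) ** transpose P"
    by (simp add: matrix_mul_assoc)
  also have "\<dots> = transpose E ** transpose P" by (simp add: EP)
  also have "\<dots> = transpose (P ** E)" by (simp only: matrix_transpose_mul)
  finally show ?thesis by (simp add: EP)
qed

lemma h_eq: "h = P ** transpose P"
  unfolding h_def by (rule matrix_inv_unique[OF g_PP])

lemma h_eq': "h = P ** mat 1 ** transpose P"
  by (simp add: h_eq)

lemma mat_1_eq: "mat 1 = E ** h ** transpose E"
proof -
  have "E ** h ** transpose E = (E ** P) ** transpose (E ** P)"
    unfolding h_eq by (simp add: matrix_transpose_mul matrix_mul_assoc)
  then show ?thesis by (simp add: EP)
qed

lemma pull_f: "pull P f = phi0"
  using adapted unfolding adapted_def by (simp add: g2_form_pull pull_pull EP)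

lemma f_eq: "f = pull E phi0"
  using adapted unfolding adapted_def by (simp add: g2_form_pull)

lemma pull_inverse: "pull E (pull P \<alpha>) = \<alpha>" "pull P (pull E \<alpha>) = \<alpha>"
  by (simp_all add: pull_pull EP)

lemma alternating_f: "alternating f"
  unfolding f_eq by (intro alternating_pull alternating_phi0)

lemma gh: "g ** h = mat 1"
  unfolding h_eq g_def by (rule g_PP)

text \<open>\<open>std_quadratic\<close> read in the adapted frame. The factor 36 undoes the square
  of the 1/6 in \<open>th\<close>.\<close>

lemma quadratic:
  assumes T: "alternating T"
  shows "9 * contr h 0 2 (contr h 1 2 T f) (contr h 1 2 T f) [] =
    12 * contr h 0 3 T T [] + 36 * contr h 0 1 (th h f T) (th h f T) [] + (contr h 0 3 T f [])\<^sup>2"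
proof -
  let ?T = "pull P T" and ?U = "contr (mat 1) 1 2 (pull P T) phi0"
  have T': "alternating ?T" by (rule alternating_pull[OF T])
  have cyc: "?T [s, a, b] = ?T [a, b, s]" for a b s
    using alternatingD[OF T', of "[]" s a "[b]"] alternatingD[OF T', of "[a]" s b "[]"] by simp
  have U: "pull P (contr h 1 2 T f) m = ?U m" if "length m = 2" for m
    using contr_pull[OF h_eq', of 1 m 2 T f] that pull_f by simp
  have "contr h 0 2 (contr h 1 2 T f) (contr h 1 2 T f) [] = pull P (contr h 0 2 (contr h 1 2 T f) (contr h 1 2 T f)) []"
    by simp
  also have "\<dots> = contr (mat 1) 0 2 (pull P (contr h 1 2 T f)) (pull P (contr h 1 2 T f)) []"
    by (rule contr_pull[OF h_eq']) simp
  also have "\<dots> = contr (mat 1) 0 2 ?U ?U []" by (rule contr_cong; rule U; simp)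
  finally have 1: "contr h 0 2 (contr h 1 2 T f) (contr h 1 2 T f) [] = contr (mat 1) 0 2 ?U ?U []" .
  have 2: "contr h 0 3 T T [] = contr (mat 1) 0 3 ?T ?T []"
    using contr_pull[OF h_eq', of 0 "[]" 3 T T] by simp
  have 3: "contr h 0 3 T f [] = contr (mat 1) 0 3 ?T phi0 []"
    using contr_pull[OF h_eq', of 0 "[]" 3 T f] by (simp add: pull_f)
  have th: "pull P (th h f T) m = - (1 / 6) * contr (mat 1) 0 2 ?U phi0 m" if "length m = 1" for m
  proof -
    have "pull P (th h f T) m = - (1 / 6) * pull P (contr h 0 2 (contr h 1 2 T f) f) m"
      by (simp add: pull_def th_def sum_distrib_left sum_negf)
    also have "pull P (contr h 0 2 (contr h 1 2 T f) f) m = contr (mat 1) 0 2 (pull P (contr h 1 2 T f)) (pull P f) m"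
      by (rule contr_pull[OF h_eq']) simp
    also have "\<dots> = contr (mat 1) 0 2 ?U phi0 m" unfolding pull_f by (rule contr_cong; (rule U, simp)?) simp
    finally show ?thesis .
  qed
  have "contr h 0 1 (th h f T) (th h f T) [] = contr (mat 1) 0 1 (pull P (th h f T)) (pull P (th h f T)) []"
    using contr_pull[OF h_eq', of 0 "[]" 1 "th h f T" "th h f T"] by simp
  also have "\<dots> = (\<Sum>i\<in>UNIV. (- (1 / 6) * contr (mat 1) 0 2 ?U phi0 [i])\<^sup>2)"
    by (simp add: contr_mat_1 sum_length_Suc sum_length_0[simplified] th power2_eq_square)
  also have "\<dots> = (\<Sum>i\<in>UNIV. (contr (mat 1) 0 2 ?U phi0 [i])\<^sup>2) / 36"
    by (simp add: power_mult_distrib power_divide sum_divide_distrib)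
  finally have 4: "36 * contr h 0 1 (th h f T) (th h f T) [] = (\<Sum>i\<in>UNIV. (contr (mat 1) 0 2 ?U phi0 [i])\<^sup>2)"
    by simp
  have u: "?U [s, e] = (\<Sum>a\<in>UNIV. \<Sum>b\<in>UNIV. ?T [a, b, s] * phi0 [a, b, e])" for s e
    by (simp add: contr_mat_1 length_numeral_sums cyc)
  have s: "(\<Sum>s\<in>UNIV. \<Sum>a\<in>UNIV. \<Sum>b\<in>UNIV. ?T [a, b, s] * phi0 [a, b, s]) =
      (\<Sum>a\<in>UNIV. \<Sum>b\<in>UNIV. \<Sum>s\<in>UNIV. ?T [a, b, s] * phi0 [a, b, s])"
    by (subst sum.swap, rule sum.cong[OF refl], rule sum.swap)
  show ?thesis
    unfolding 1 2 3 4 using std_quadratic[OF T']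
    by (simp add: contr_mat_1[of 0] length_numeral_sums u[unfolded One_nat_def] s)
qed

text \<open>This is \<open>*f\<close>, defined by the contraction identity of \<open>f\<close> with itself.\<close>

definition psi :: "7 \<Rightarrow> 7 \<Rightarrow> 7 \<Rightarrow> 7 \<Rightarrow> real" where
  "psi i j k l = tr h (\<lambda>a b. f [i, j, a] * f [k, l, b]) - g $ i $ k * g $ j $ l + g $ i $ l * g $ j $ k"

lemma h_sym: "h $ a $ b = h $ b $ a"
  by (simp add: h_eq matrix_matrix_mult_def transpose_def mult.commute)

lemma g_sym: "g $ a $ b = g $ b $ a"
  by (simp add: g_def matrix_matrix_mult_def transpose_def mult.commute)

lemma f_swap: "f [i, j, k] = - f [j, i, k]" "f [i, j, k] = - f [i, k, j]"
  using alternatingD[OF alternating_f, of "[]" i j "[k]"] alternatingD[OF alternating_f, of "[i]" j k "[]"]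
  by simp_all

lemma g_eq: "g $ i $ j = (\<Sum>a\<in>UNIV. E $ a $ i * E $ a $ j)"
  by (simp add: g_def matrix_matrix_mult_def transpose_def)

text \<open>Transfers the skew symmetry of \<open>psi0\<close> to coordinate components.\<close>

lemma psi_pull: "psi i j k l = pull E psi_list [i, j, k, l]"
proof -
  have p4: "pull E \<alpha> [i, j, k, l] = (\<Sum>a\<in>UNIV. \<Sum>b\<in>UNIV. \<Sum>c\<in>UNIV. \<Sum>d\<in>UNIV.
      E $ a $ i * (E $ b $ j * (E $ c $ k * (E $ d $ l * \<alpha> [a, b, c, d]))))" for \<alpha>
    by (simp add: pull_def sum_length_Suc sum_length_0[simplified] mult.assoc)
  have f_cyc: "f [k, l, b] = f [b, k, l]" for b
    using f_swap(2)[of k l b] f_swap(1)[of k b l] by simp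
  have phi0_cyc: "phi0 [k, l, b] = phi0 [b, k, l]" for b k l
    using phi0_swap(2)[of k l b] phi0_swap(1)[of k b l] by simp
  have "tr h (\<lambda>a b. f [i, j, a] * f [k, l, b]) = contr h 2 1 f f [i, j, k, l]"
  proof -
    have "contr h 2 1 f f [i, j, k, l] = (\<Sum>a\<in>UNIV. \<Sum>b\<in>UNIV. h $ b $ a * f [i, j, a] * f [b, k, l])"
      by (simp add: contr_def sum_length_Suc sum_length_0[simplified])
    then show ?thesis by (simp add: tr_def f_cyc h_sym mult.assoc)
  qed
  also have "\<dots> = pull E (contr (mat 1) 2 1 phi0 phi0) [i, j, k, l]"
    unfolding f_eq by (rule contr_pull[OF mat_1_eq, symmetric]) simp
  finally have 1: "tr h (\<lambda>a b. f [i, j, a] * f [k, l, b]) = \<dots>" .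
  have 2: "pull E (\<lambda>m. kd (m ! 0) (m ! 2) * kd (m ! 1) (m ! 3)) [i, j, k, l] = g $ i $ k * g $ j $ l"
  proof -
    have "pull E (\<lambda>m. kd (m ! 0) (m ! 2) * kd (m ! 1) (m ! 3)) [i, j, k, l] =
      (\<Sum>a\<in>UNIV. \<Sum>b\<in>UNIV. E $ a $ i * (E $ b $ j * (\<Sum>c\<in>UNIV. kd a c * (E $ c $ k * (\<Sum>d\<in>UNIV. kd b d * E $ d $ l)))))"
      unfolding p4 sum_distrib_left by (simp add: mult_ac)
    also have "\<dots> = (\<Sum>a\<in>UNIV. \<Sum>b\<in>UNIV. (E $ a $ i * E $ a $ k) * (E $ b $ j * E $ b $ l))"
      by (simp only: sum_kd_mult' mult_ac)
    also have "\<dots> = g $ i $ k * g $ j $ l" by (simp only: g_eq sum_product)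
    finally show ?thesis .
  qed
  have 3: "pull E (\<lambda>m. kd (m ! 0) (m ! 3) * kd (m ! 1) (m ! 2)) [i, j, k, l] = g $ i $ l * g $ j $ k"
  proof -
    have "pull E (\<lambda>m. kd (m ! 0) (m ! 3) * kd (m ! 1) (m ! 2)) [i, j, k, l] =
      (\<Sum>a\<in>UNIV. \<Sum>b\<in>UNIV. E $ a $ i * (E $ b $ j * (\<Sum>c\<in>UNIV. kd b c * (E $ c $ k * (\<Sum>d\<in>UNIV. kd a d * E $ d $ l)))))"
      unfolding p4 sum_distrib_left by (simp add: mult_ac)
    also have "\<dots> = (\<Sum>a\<in>UNIV. \<Sum>b\<in>UNIV. (E $ a $ i * E $ a $ l) * (E $ b $ j * E $ b $ k))"
      by (simp only: sum_kd_mult' mult_ac)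
    also have "\<dots> = g $ i $ l * g $ j $ k" by (simp only: g_eq sum_product)
    finally show ?thesis .
  qed
  have "pull E psi_list [i, j, k, l] = pull E (\<lambda>m. contr (mat 1) 2 1 phi0 phi0 m
      - kd (m ! 0) (m ! 2) * kd (m ! 1) (m ! 3) + kd (m ! 0) (m ! 3) * kd (m ! 1) (m ! 2)) [i, j, k, l]"
    unfolding p4
    by (intro sum.cong refl)
      (simp add: psi_list_def psi0_def contr_mat_1 sum_length_Suc sum_length_0[simplified] phi0_cyc)
  also have "\<dots> = pull E (contr (mat 1) 2 1 phi0 phi0) [i, j, k, l] - g $ i $ k * g $ j $ l + g $ i $ l * g $ j $ k"
    unfolding 2[symmetric] 3[symmetric] pull_def
    by (simp add: distrib_left right_diff_distrib sum.distrib sum_subtractf)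
  finally show ?thesis unfolding psi_def 1 by simp
qed

sublocale g2_pt h g "\<lambda>i j k. f [i, j, k]" psi
proof
  have *: "alternating (pull E psi_list)" by (intro alternating_pull alternating_psi_list)
  fix i j k l
  show "psi i j k l = - psi j i k l" "psi i j k l = - psi i k j l" "psi i j k l = - psi i j l k"
    unfolding psi_pull using alternatingD[OF *, of "[]" i j "[k, l]"] alternatingD[OF *, of "[i]" j k "[l]"]
      alternatingD[OF *, of "[i, j]" k l "[]"] by simp_all
  show "tr h (\<lambda>a b. f [i, j, a] * f [k, l, b]) = g $ i $ k * g $ j $ l - g $ i $ l * g $ j $ k + psi i j k l"
    by (simp add: psi_def)
qed (rule h_sym g_sym gh f_swap)+

end

text \<open>For parallel phi, \<open>\<eta>\<close> is d phi written through the torsion. The three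
  terms with \<open>i\<close> in the phi factor agree up to sign, which gives the 3. Those with
  \<open>i\<close> in the torsion factor contract two phi to a multiple of the metric, and
  \<open>T\<close> has no trace.\<close>

lemma (in g2_pt) lee_algebra:
  fixes T :: "7 \<Rightarrow> 7 \<Rightarrow> 7 \<Rightarrow> real"
  assumes T: "\<And>a b c. T a b c = - T b a c" "\<And>a b c. T a b c = - T a c b"
  defines "S \<equiv> \<lambda>a b c d. t (\<lambda>s s'. T a b s * phi s' c d)"
  assumes \<eta>: "\<And>a b c d. \<eta> a b c d = S a b c d - S a c b d + S a d b c + S b c a d - S b d a c + S c d a b"
  shows "t (\<lambda>a a'. t (\<lambda>b b'. t (\<lambda>c c'. phi a b c * \<eta> a' b' c' i))) =
    3 * t (\<lambda>s s'. t (\<lambda>c c'. t (\<lambda>a a'. t (\<lambda>b b'. T s a b * phi a' b' c)) * phi s' c' i))"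
proof -
  let ?R = "t (\<lambda>s s'. t (\<lambda>c c'. t (\<lambda>a a'. t (\<lambda>b b'. T s a b * phi a' b' c)) * phi s' c' i))"
  have A: "t (\<lambda>a a'. t (\<lambda>b b'. t (\<lambda>c c'. phi a b c * S a' b' c' i))) = ?R"
  proof -
    have "t (\<lambda>a a'. t (\<lambda>b b'. t (\<lambda>c c'. phi a b c * S a' b' c' i))) =
        t (\<lambda>a a'. t (\<lambda>b b'. t (\<lambda>c c'. t (\<lambda>s s'. (T s a' b' * phi a b c) * phi s' c' i))))"
    proof -
      have "phi a b c * S a' b' c' i = t (\<lambda>s s'. (T s a' b' * phi a b c) * phi s' c' i)" for a b c a' b' c'
      proof -
        have "T a' b' s = T s a' b'" for s using T(2)[of a' b' s] T(1)[of a' s b'] by simp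
        then show ?thesis by (simp add: S_def tr_cmult[symmetric] mult_ac)
      qed
      then show ?thesis by simp
    qed
    also have "\<dots> = t (\<lambda>a a'. t (\<lambda>b b'. t (\<lambda>s s'. t (\<lambda>c c'. (T s a' b' * phi a b c) * phi s' c' i))))"
      by (rule tr_cong, rule tr_cong) (rule tr_comm)
    also have "\<dots> = t (\<lambda>a a'. t (\<lambda>s s'. t (\<lambda>b b'. t (\<lambda>c c'. (T s a' b' * phi a b c) * phi s' c' i))))"
      by (rule tr_cong) (rule tr_comm)
    also have "\<dots> = t (\<lambda>s s'. t (\<lambda>a a'. t (\<lambda>b b'. t (\<lambda>c c'. (T s a' b' * phi a b c) * phi s' c' i))))"
      by (rule tr_comm)
    also have "\<dots> = t (\<lambda>s s'. t (\<lambda>a a'. t (\<lambda>c c'. t (\<lambda>b b'. (T s a' b' * phi a b c) * phi s' c' i))))"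
      by (rule tr_cong, rule tr_cong) (rule tr_comm)
    also have "\<dots> = t (\<lambda>s s'. t (\<lambda>c c'. t (\<lambda>a a'. t (\<lambda>b b'. (T s a' b' * phi a b c) * phi s' c' i))))"
      by (rule tr_cong) (rule tr_comm)
    also have "\<dots> = t (\<lambda>s s'. t (\<lambda>c c'. t (\<lambda>a a'. t (\<lambda>b b'. T s a' b' * phi a b c)) * phi s' c' i))"
      by (simp only: tr_multc)
    also have "\<dots> = ?R"
    proof -
      have "t (\<lambda>a a'. t (\<lambda>b b'. T s a' b' * phi a b c)) = t (\<lambda>a a'. t (\<lambda>b b'. T s a b * phi a' b' c))" for s c
      proof -
        have "t (\<lambda>a a'. t (\<lambda>b b'. T s a' b' * phi a b c)) = t (\<lambda>a a'. t (\<lambda>b b'. T s a b' * phi a' b c))"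
          by (rule tr_swap)
        also have "\<dots> = t (\<lambda>a a'. t (\<lambda>b b'. T s a b * phi a' b' c))"
          by (rule tr_cong) (rule tr_swap)
        finally show ?thesis .
      qed
      then show ?thesis by simp
    qed
    finally show ?thesis .
  qed
  have A0: "t (\<lambda>a a'. t (\<lambda>b b'. t (\<lambda>c c'. phi a b c * S a' i b' c'))) = 0"
  proof -
    have "phi a b c * S a' i b' c' = t (\<lambda>s s'. - T i a' s * (phi a b c * phi s' b' c'))" for a b c a' b' c'
      using T(1)[of a' i] by (simp add: S_def tr_cmult[symmetric] mult_ac)
    then have "t (\<lambda>a a'. t (\<lambda>b b'. t (\<lambda>c c'. phi a b c * S a' i b' c'))) =
        t (\<lambda>a a'. t (\<lambda>b b'. t (\<lambda>c c'. t (\<lambda>s s'. - T i a' s * (phi a b c * phi s' b' c')))))"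
      by simp
    also have "\<dots> = t (\<lambda>a a'. t (\<lambda>b b'. t (\<lambda>s s'. t (\<lambda>c c'. - T i a' s * (phi a b c * phi s' b' c')))))"
      by (rule tr_cong, rule tr_cong) (rule tr_comm)
    also have "\<dots> = t (\<lambda>a a'. t (\<lambda>s s'. t (\<lambda>b b'. t (\<lambda>c c'. - T i a' s * (phi a b c * phi s' b' c')))))"
      by (rule tr_cong) (rule tr_comm)
    also have "\<dots> = t (\<lambda>a a'. t (\<lambda>s s'. - T i a' s * (6 * g $ a $ s')))"
      by (simp only: tr_cmult phi_phi2)
    also have "\<dots> = t (\<lambda>a a'. - 6 * T i a' a)"
      by (simp add: tr_linear tr_metric mult.left_commute[of _ 6])
    also have "\<dots> = 0"
    proof (rule tr_antisym)
      show "- 6 * T i b a = - (- 6 * T i a b)" for a b using T(2)[of i b a] by simp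
    qed
    finally show ?thesis .
  qed
  have p1: "t (\<lambda>a a'. t (\<lambda>b b'. t (\<lambda>c c'. phi a b c * F a' c' b'))) = - t (\<lambda>a a'. t (\<lambda>b b'. t (\<lambda>c c'. phi a b c * F a' b' c')))" for F
  proof -
    have "t (\<lambda>b b'. t (\<lambda>c c'. phi a b c * F a' c' b')) = t (\<lambda>c c'. t (\<lambda>b b'. phi a b c * F a' c' b'))" for a a'
      by (rule tr_comm)
    also have "\<dots> a a' = - t (\<lambda>b b'. t (\<lambda>c c'. phi a b c * F a' b' c'))" for a a'
    proof -
      have "t (\<lambda>c c'. t (\<lambda>b b'. phi a b c * F a' c' b')) = t (\<lambda>c c'. t (\<lambda>b b'. - (phi a c b * F a' c' b')))"
      proof (intro tr_cong)
        show "phi a b c * F a' c' b' = - (phi a c b * F a' c' b')" for b b' c c'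
          using phi_swap(2)[of a b c] by simp
      qed
      then show ?thesis by (simp only: tr_uminus)
    qed
    finally show ?thesis by (simp only: tr_uminus)
  qed
  have p2: "t (\<lambda>a a'. t (\<lambda>b b'. t (\<lambda>c c'. phi a b c * F b' a' c'))) = - t (\<lambda>a a'. t (\<lambda>b b'. t (\<lambda>c c'. phi a b c * F a' b' c')))" for F
  proof -
    have "t (\<lambda>a a'. t (\<lambda>b b'. t (\<lambda>c c'. phi a b c * F b' a' c'))) = t (\<lambda>b b'. t (\<lambda>a a'. t (\<lambda>c c'. phi a b c * F b' a' c')))"
      by (rule tr_comm)
    also have "\<dots> = t (\<lambda>b b'. t (\<lambda>a a'. t (\<lambda>c c'. - (phi b a c * F b' a' c'))))"
    proof (intro tr_cong)
      show "phi a b c * F b' a' c' = - (phi b a c * F b' a' c')" for a a' b b' c c'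
        using phi_swap(1)[of a b c] by simp
    qed
    finally show ?thesis by (simp only: tr_uminus)
  qed
  let ?F = "\<lambda>F. t (\<lambda>a a'. t (\<lambda>b b'. t (\<lambda>c c'. phi a b c * F a' b' c')))"
  have "?F (\<lambda>a b c. \<eta> a b c i) = ?F (\<lambda>a b c. S a b c i) - ?F (\<lambda>a b c. S a c b i) + ?F (\<lambda>a b c. S a i b c)
      + ?F (\<lambda>a b c. S b c a i) - ?F (\<lambda>a b c. S b i a c) + ?F (\<lambda>a b c. S c i a b)"
    unfolding \<eta> distrib_left right_diff_distrib tr_add tr_diff ..
  also have "?F (\<lambda>a b c. S a c b i) = - ?R"
    using p1[of "\<lambda>a b c. S a b c i"] A by simp
  also have "?F (\<lambda>a b c. S b c a i) = ?R"
    using p2[of "\<lambda>a b c. S a c b i"] p1[of "\<lambda>a b c. S a b c i"] A by simp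
  also have "?F (\<lambda>a b c. S b i a c) = 0"
    using p2[of "\<lambda>a b c. S a i b c"] A0 by simp
  also have "?F (\<lambda>a b c. S c i a b) = 0"
    using p1[of "\<lambda>a b c. S b i a c"] p2[of "\<lambda>a b c. S a i b c"] A0 by simp
  finally show ?thesis using A A0 by simp
qed

subsection \<open>The Hodge star and the Lee form\<close>

lemma hodge_contr:
  "length l + p = 7 \<Longrightarrow> hodge g w p \<alpha> l = contr (matrix_inv g) 0 p \<alpha> w l / fact p"
proof -
  assume l: "length l + p = 7"
  have "(\<Sum>m | length m = p. raise g p \<alpha> m * w (m @ l)) =
      (\<Sum>m | length m = p. \<Sum>n | length n = p. lk (matrix_inv g) m n * \<alpha> n * w (m @ l))"
    unfolding raise_def by (intro sum.cong refl) (simp add: lk_def sum_distrib_right)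
  also have "\<dots> = (\<Sum>n | length n = p. \<Sum>m | length m = p. lk (matrix_inv g) m n * \<alpha> n * w (m @ l))"
    by (rule sum.swap)
  finally show ?thesis using l by (simp add: hodge_def contr_def)
qed

lemma hodge_length: "length l + p \<noteq> 7 \<Longrightarrow> hodge g w p \<alpha> l = 0"
  by (simp add: hodge_def)

lemma norm_sq_contr: "norm_sq g p \<alpha> = contr (matrix_inv g) 0 p \<alpha> \<alpha> []"
proof -
  have "norm_sq g p \<alpha> = (\<Sum>m | length m = p. \<Sum>n | length n = p. lk (matrix_inv g) m n * \<alpha> n * \<alpha> m)"
    unfolding norm_sq_def raise_def by (intro sum.cong refl) (simp add: lk_def sum_distrib_right)
  also have "\<dots> = (\<Sum>n | length n = p. \<Sum>m | length m = p. lk (matrix_inv g) m n * \<alpha> n * \<alpha> m)"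
    by (rule sum.swap)
  finally show ?thesis by (simp add: contr_def)
qed

lemma matrix_inv_mat_1: "matrix_inv (mat 1 :: real^'n^'n) = mat 1"
  by (rule matrix_inv_unique) simp

lemma alternating_contr_0:
  assumes "alternating \<beta>" shows "alternating (contr h 0 k \<alpha> \<beta>)"
  unfolding alternating_def
proof (intro allI)
  fix xs ys :: "7 list" and a b :: 7
  have "\<beta> (n @ xs @ a # b # ys) = - \<beta> (n @ xs @ b # a # ys)" for n
    using alternatingD[OF assms, of "n @ xs" a b ys] by simp
  then show "contr h 0 k \<alpha> \<beta> (xs @ a # b # ys) = - contr h 0 k \<alpha> \<beta> (xs @ b # a # ys)"
    by (simp add: contr_def sum_negf)
qed

lemma alternating_hodge:
  assumes "alternating w" shows "alternating (hodge g w p \<alpha>)"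
  unfolding alternating_def
proof (intro allI)
  fix xs ys :: "7 list" and a b :: 7
  show "hodge g w p \<alpha> (xs @ a # b # ys) = - hodge g w p \<alpha> (xs @ b # a # ys)"
    using alternatingD[OF alternating_contr_0[OF assms], of "matrix_inv g" p \<alpha> xs a b ys]
    by (cases "length xs + length ys + 2 + p = 7") (simp_all add: hodge_contr hodge_length)
qed

lemma hodge_pull:
  assumes h: "matrix_inv g = P ** transpose P"
  shows "pull P (hodge g w p \<alpha>) = hodge (mat 1) (pull P w) p (pull P \<alpha>)"
proof
  fix l
  show "pull P (hodge g w p \<alpha>) l = hodge (mat 1) (pull P w) p (pull P \<alpha>) l"
  proof (cases "length l + p = 7")
    case True
    then have "pull P (hodge g w p \<alpha>) l = pull P (contr (matrix_inv g) 0 p \<alpha> w) l / fact p"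
      unfolding pull_def sum_divide_distrib by (intro sum.cong refl) (simp add: hodge_contr)
    also have "pull P (contr (matrix_inv g) 0 p \<alpha> w) l = contr (mat 1) 0 p (pull P \<alpha>) (pull P w) l"
      by (rule contr_pull) (simp_all add: h)
    finally show ?thesis using True by (simp add: hodge_contr matrix_inv_mat_1)
  next
    case False
    then show ?thesis by (simp add: pull_def hodge_length)
  qed
qed

lemma eps0_sq:
  assumes "distinct l" "length l = 7"
  shows "eps0 l * eps0 l = 1"
proof -
  let ?L = "[1, 2, 3, 4, 5, 6, 7::7]"
  have "card (set l) = CARD(7)" using assms distinct_card by fastforce
  then have "set l = UNIV" using card_subset_eq[of "UNIV::7 set" "set l"] by auto
  then have "set l = set ?L" using UNIV7 by simp
  moreover have "distinct ?L" by simp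
  ultimately have "mset l = mset ?L" using assms set_eq_iff_mset_eq_distinct by blast
  then obtain s where s: "s \<in> {1, - 1}" "\<And>\<gamma>. alternating \<gamma> \<Longrightarrow> \<gamma> l = s * \<gamma> ?L"
    using alternating_mset by blast
  then show ?thesis using s(2)[OF alternating_eps0] eps0_1 by auto
qed

lemma eps0_rotate: "length a = 4 \<Longrightarrow> length c = 3 \<Longrightarrow> eps0 (c @ a) = eps0 (a @ c)"
proof -
  assume a: "length a = 4" and c: "length c = 3"
  obtain p q r s where a': "a = [p, q, r, s]" using a by (rule length_4E)
  have *: "eps0 (xs @ x # c @ zs) = - eps0 (xs @ c @ x # zs)" for xs x zs
    using alternating_move[OF alternating_eps0, of xs x c zs] c by simp
  show "eps0 (c @ a) = eps0 (a @ c)"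
    using *[of "[p, q, r]" s "[]"] *[of "[p, q]" r "[s]"] *[of "[p]" q "[r, s]"] *[of "[]" p "[q, r, s]"]
    by (simp add: a')
qed

text \<open>Each permutation in the wedge is absorbed by the skew \<open>eps0\<close>, so all 720
  terms agree; 20 is 720 / (3! 3!).\<close>

lemma wedge_eps0:
  "(\<Sum>m | length m = 6. wedge 3 3 \<alpha> \<beta> m * eps0 (m @ [i])) =
    20 * (\<Sum>a | length a = 3. \<Sum>b | length b = 3. \<alpha> a * \<beta> b * eps0 (a @ b @ [i]))"
proof -
  let ?S = "{m::7 list. length m = 6}" and ?A = "{\<sigma>. \<sigma> permutes {..<6::nat}}"
  let ?G = "\<lambda>m. \<alpha> (take 3 m) * \<beta> (drop 3 m)"
  have s: "(\<Sum>m\<in>?S. of_int (sign \<sigma>) * ?G (permute_list \<sigma> m) * eps0 (m @ [i])) = (\<Sum>m\<in>?S. ?G m * eps0 (m @ [i]))"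
    if "\<sigma> \<in> ?A" for \<sigma>
  proof -
    have \<sigma>: "\<sigma> permutes {..<6}" using that by simp
    have "(\<Sum>m\<in>?S. of_int (sign \<sigma>) * ?G (permute_list \<sigma> m) * eps0 (m @ [i])) =
        (\<Sum>m\<in>?S. ?G (permute_list \<sigma> m) * eps0 (permute_list \<sigma> m @ [i]))"
    proof (rule sum.cong[OF refl])
      fix m assume "m \<in> ?S"
      then have "eps0 (permute_list \<sigma> m @ [i]) = of_int (sign \<sigma>) * eps0 (m @ [i])"
        using alternating_permute_list[OF alternating_suffix[OF alternating_eps0], of \<sigma> m] \<sigma> by simp
      then show "of_int (sign \<sigma>) * ?G (permute_list \<sigma> m) * eps0 (m @ [i]) =
          ?G (permute_list \<sigma> m) * eps0 (permute_list \<sigma> m @ [i])" by simp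
    qed
    also have "\<dots> = (\<Sum>m\<in>?S. ?G m * eps0 (m @ [i]))"
    proof (rule sum.reindex_bij_witness[of _ "permute_list (inv \<sigma>)" "permute_list \<sigma>"])
      fix m assume "m \<in> ?S"
      then show "permute_list \<sigma> (permute_list (inv \<sigma>) m) = m" "permute_list (inv \<sigma>) (permute_list \<sigma> m) = m"
        using permute_list_compose[of "inv \<sigma>" m \<sigma>] permute_list_compose[of \<sigma> m "inv \<sigma>"] \<sigma>
          permutes_inv[OF \<sigma>] by (simp_all add: permutes_inv_o[OF \<sigma>])
    qed auto
    finally show ?thesis .
  qed
  have "(\<Sum>m\<in>?S. wedge 3 3 \<alpha> \<beta> m * eps0 (m @ [i])) =
      (\<Sum>m\<in>?S. \<Sum>\<sigma>\<in>?A. of_int (sign \<sigma>) * ?G (permute_list \<sigma> m) * eps0 (m @ [i])) / 36"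
    unfolding sum_divide_distrib
    by (intro sum.cong refl) (simp add: wedge_def sum_distrib_right mult.assoc fact_numeral sum_divide_distrib)
  also have "\<dots> = (\<Sum>\<sigma>\<in>?A. \<Sum>m\<in>?S. of_int (sign \<sigma>) * ?G (permute_list \<sigma> m) * eps0 (m @ [i])) / 36"
    by (subst sum.swap) simp
  also have "\<dots> = (\<Sum>\<sigma>\<in>?A. \<Sum>m\<in>?S. ?G m * eps0 (m @ [i])) / 36"
    using s by simp
  also have "\<dots> = 20 * (\<Sum>m\<in>?S. ?G m * eps0 (m @ [i]))"
    using card_permutations[of "{..<6::nat}" 6] by (simp add: fact_numeral)
  also have "(\<Sum>m\<in>?S. ?G m * eps0 (m @ [i])) = (\<Sum>m | length m = 3 + 3. ?G m * eps0 (m @ [i]))"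
    by simp
  also have "\<dots> = (\<Sum>a | length a = 3. \<Sum>b | length b = 3. \<alpha> a * \<beta> b * eps0 (a @ b @ [i]))"
    unfolding sum_length_add by (intro sum.cong refl) simp
  finally show ?thesis .
qed

text \<open>The star of a 4-form, contracted again with the volume form, returns the 4-form. What
  remains of the Lee form expression is a contraction of \<open>phi0\<close> with
  \<open>\<eta>\<close>.\<close>

lemma std_lee:
  assumes \<eta>: "alternating \<eta>"
  shows "hodge (mat 1) eps0 6 (wedge 3 3 (hodge (mat 1) eps0 4 \<eta>) phi0) [i] =
    (\<Sum>b | length b = 3. phi0 b * \<eta> (b @ [i])) / 6"
proof -
  let ?\<beta> = "hodge (mat 1) eps0 4 \<eta>"
  have \<beta>: "alternating ?\<beta>" by (rule alternating_hodge[OF alternating_eps0])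
  \<comment> \<open>Both sums reduce to one arrangement \<open>c\<close> of the complement of
    \<open>b @ [i]\<close>; exchanging blocks of lengths 3 and 4 costs no sign.\<close>
  have key: "(\<Sum>a | length a = 3. ?\<beta> a * eps0 (a @ b @ [i])) = 6 * \<eta> (b @ [i])" if b: "length b = 3" for b
  proof (cases "distinct (b @ [i])")
    case True
    have "card (UNIV - set (b @ [i])) = 3"
      using True b by (subst card_Diff_subset) (auto simp: distinct_card simp del: distinct.simps)
    moreover obtain c where c: "set c = UNIV - set (b @ [i])" "distinct c"
      using finite_distinct_list[of "UNIV - set (b @ [i])"] by auto
    ultimately have lc: "length c = 3" by (metis distinct_card)
    have d: "distinct (c @ b @ [i])" "distinct ((b @ [i]) @ c)" using True c by auto
    have "(\<Sum>a | length a = 3. ?\<beta> a * eps0 (a @ b @ [i])) = 6 * (?\<beta> c * eps0 (c @ b @ [i]))"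
      using sum_alternating_mult[OF \<beta> alternating_eps0 d(1) _ lc] b lc by (simp add: fact_numeral)
    also have "?\<beta> c = (\<Sum>m | length m = 4. \<eta> m * eps0 (m @ c)) / 24"
      using lc by (simp add: hodge_contr matrix_inv_mat_1 contr_mat_1 fact_numeral)
    also have "\<dots> = \<eta> (b @ [i]) * eps0 ((b @ [i]) @ c)"
      using sum_alternating_mult[OF \<eta> alternating_eps0 d(2), of 4] b lc by (simp add: fact_numeral)
    also have "eps0 ((b @ [i]) @ c) = eps0 (c @ b @ [i])"
      using eps0_rotate[of "b @ [i]" c] b lc by simp
    finally show ?thesis using eps0_sq[OF d(1)] b lc by simp
  next
    case False
    then have "\<eta> (b @ [i]) = 0" by (rule alternating_not_distinct[OF \<eta>])
    moreover have "eps0 (a @ b @ [i]) = 0" for a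
      by (rule alternating_not_distinct[OF alternating_eps0]) (use False in auto)
    ultimately show ?thesis by simp
  qed
  have "hodge (mat 1) eps0 6 (wedge 3 3 ?\<beta> phi0) [i] =
      (\<Sum>m | length m = 6. wedge 3 3 ?\<beta> phi0 m * eps0 (m @ [i])) / 720"
    by (simp add: hodge_contr matrix_inv_mat_1 contr_mat_1 fact_numeral)
  also have "\<dots> = (\<Sum>a | length a = 3. \<Sum>b | length b = 3. phi0 b * (?\<beta> a * eps0 (a @ b @ [i]))) / 36"
    unfolding wedge_eps0 by (simp add: mult_ac)
  also have "\<dots> = (\<Sum>b | length b = 3. phi0 b * (\<Sum>a | length a = 3. ?\<beta> a * eps0 (a @ b @ [i]))) / 36"
    by (subst sum.swap) (simp only: sum_distrib_left)
  also have "\<dots> = (\<Sum>b | length b = 3. phi0 b * \<eta> (b @ [i])) / 6"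
    by (simp add: key sum_distrib_left sum_divide_distrib)
  finally show ?thesis .
qed

context adapted_pt
begin

lemma metric_f: "g2_metric f = g"
  using adapted_metric_vol(1)[OF adapted] by (simp add: g_def)

lemma vol_f: "g2_vol f = pull E eps0"
  using adapted_metric_vol(2)[OF adapted] .

lemma matrix_inv_g: "matrix_inv g = h"
  by (simp add: h_def g_def)

lemma pull_vol: "pull P (pull E eps0) = eps0"
  by (rule pull_inverse)

text \<open>The 1/18 is the 1/3 in the Lee form times the 1/6 of \<open>std_lee\<close>.\<close>

lemma lee_contr:
  assumes \<eta>: "alternating \<eta>"
  shows "- (1 / 3) * hodge g (pull E eps0) 6 (wedge 3 3 (hodge g (pull E eps0) 4 \<eta>) f) [i] =
    - (1 / 18) * contr h 0 3 f \<eta> [i]"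
proof -
  let ?L = "hodge g (pull E eps0) 6 (wedge 3 3 (hodge g (pull E eps0) 4 \<eta>) f)"
  have h: "matrix_inv g = P ** transpose P" by (simp add: matrix_inv_g h_eq)
  have "pull P ?L = hodge (mat 1) eps0 6 (wedge 3 3 (hodge (mat 1) eps0 4 (pull P \<eta>)) phi0)"
    by (simp only: hodge_pull[OF h] pull_wedge pull_f pull_vol)
  then have 1: "pull P ?L m = contr (mat 1) 0 3 phi0 (pull P \<eta>) m / 6" if "length m = 1" for m
    using that std_lee[OF alternating_pull[OF \<eta>], of P] by (auto simp: length_Suc_conv contr_mat_1)
  have "contr (mat 1) 0 3 phi0 (pull P \<eta>) m = pull P (contr h 0 3 f \<eta>) m" for m
    using contr_pull[OF h_eq', of 0 m 3 f \<eta>] by (simp add: pull_f)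
  then have "pull P ?L m = pull P (\<lambda>l. contr h 0 3 f \<eta> l / 6) m" if "length m = 1" for m
    using 1[OF that] by (simp add: pull_def sum_divide_distrib)
  then have "pull E (pull P ?L) [i] = pull E (pull P (\<lambda>l. contr h 0 3 f \<eta> l / 6)) [i]"
    unfolding pull_def[of E] by (intro sum.cong refl) simp
  then show ?thesis by (simp add: pull_inverse)
qed

text \<open>Summing over ordered indices gives 7!. That the value is constant is what makes the
  volume form parallel later.\<close>

lemma norm_vol: "contr h 0 7 (pull E eps0) (pull E eps0) [] = 5040"
proof -
  have "contr h 0 7 (pull E eps0) (pull E eps0) [] = contr (mat 1) 0 7 eps0 eps0 []"
    using contr_pull[OF h_eq', of 0 "[]" 7 "pull E eps0" "pull E eps0"] by (simp add: pull_vol)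
  also have "\<dots> = (\<Sum>m | length m = 7. eps0 m * eps0 (m @ []))" by (simp add: contr_mat_1)
  also have "\<dots> = 5040"
    using sum_alternating_mult[OF alternating_eps0 alternating_eps0, of "[1, 2, 3, 4, 5, 6, 7]" "[]" 7] eps0_1
    by (simp add: fact_numeral)
  finally show ?thesis .
qed

end

section \<open>Calculus in coordinate domains\<close>

lemma Ck_on_Suc_imp: "Ck_on (Suc k) S f \<Longrightarrow> Ck_on k S f"
proof (induction k arbitrary: f)
  case 0
  then show ?case
    by (auto intro!: continuous_at_imp_continuous_on differentiable_imp_continuous_within)
qed auto

lemma has_derivative_cong_open:
  assumes "open S" "x \<in> S" "\<And>y. y \<in> S \<Longrightarrow> f y = g y"
  shows "(f has_derivative f') (at x) \<longleftrightarrow> (g has_derivative f') (at x)"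
  using has_derivative_transform_within_open[of f f' x UNIV S g]
    has_derivative_transform_within_open[of g f' x UNIV S f] assms by auto

lemma Ck_on_cong:
  assumes S: "open S" and eq: "\<And>x. x \<in> S \<Longrightarrow> f x = g x"
  shows "Ck_on k S f \<longleftrightarrow> Ck_on k S g"
  using eq
proof (induction k arbitrary: f g)
  case 0
  then show ?case using continuous_on_cong[of S S f g] by simp
next
  case (Suc k)
  have d: "(f has_derivative f') (at x) \<longleftrightarrow> (g has_derivative f') (at x)" if "x \<in> S" for x f'
    by (rule has_derivative_cong_open[OF S that Suc.prems])
  then have "f differentiable (at x) \<longleftrightarrow> g differentiable (at x)" if "x \<in> S" for x
    using that unfolding differentiable_def by blast
  moreover have "frechet_derivative f (at x) = frechet_derivative g (at x)" if "x \<in> S" for x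
    using d[OF that] unfolding frechet_derivative_def by simp
  ultimately show ?case
    using Suc.IH[of "\<lambda>x. frechet_derivative f (at x) _" "\<lambda>x. frechet_derivative g (at x) _"] by simp
qed

lemma frechet_derivative_eqI: "(f has_derivative f') (at x) \<Longrightarrow> frechet_derivative f (at x) = f'"
  using frechet_derivative_at by metis

lemma Ck_on_const: "Ck_on k S (\<lambda>x. c)"
  by (induction k arbitrary: c) (simp_all add: frechet_derivative_eqI[OF has_derivative_const])

lemma Ck_on_add:
  assumes S: "open S" shows "Ck_on k S f \<Longrightarrow> Ck_on k S g \<Longrightarrow> Ck_on k S (\<lambda>x. f x + g x)"
proof (induction k arbitrary: f g)
  case (Suc k)
  have d: "((\<lambda>x. f x + g x) has_derivative (\<lambda>v. frechet_derivative f (at x) v + frechet_derivative g (at x) v)) (at x)"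
    if "x \<in> S" for x
    using that Suc.prems by (auto intro!: has_derivative_add simp: frechet_derivative_works[symmetric])
  show ?case
    using Suc d Ck_on_cong[OF S, of "\<lambda>x. frechet_derivative (\<lambda>x. f x + g x) (at x) _"
        "\<lambda>x. frechet_derivative f (at x) _ + frechet_derivative g (at x) _"]
    by (auto simp: differentiable_def frechet_derivative_eqI[OF d])
qed (auto intro: continuous_on_add)

lemma Ck_on_mult:
  fixes f g :: "'a::real_normed_vector \<Rightarrow> real"
  assumes S: "open S" shows "Ck_on k S f \<Longrightarrow> Ck_on k S g \<Longrightarrow> Ck_on k S (\<lambda>x. f x * g x)"
proof (induction k arbitrary: f g)
  case (Suc k)
  have d: "((\<lambda>x. f x * g x) has_derivative (\<lambda>v. f x * frechet_derivative g (at x) v + frechet_derivative f (at x) v * g x)) (at x)"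
    if "x \<in> S" for x
    using that Suc.prems by (auto intro!: has_derivative_mult simp: frechet_derivative_works[symmetric])
  have "Ck_on k S (\<lambda>x. f x * frechet_derivative g (at x) v + frechet_derivative f (at x) v * g x)" for v
    using Suc.prems by (intro Ck_on_add[OF S] Suc.IH) (auto intro: Ck_on_Suc_imp)
  then show ?case
    using d Ck_on_cong[OF S, of "\<lambda>x. frechet_derivative (\<lambda>x. f x * g x) (at x) _"
        "\<lambda>x. f x * frechet_derivative g (at x) _ + frechet_derivative f (at x) _ * g x"]
    by (auto simp: differentiable_def frechet_derivative_eqI[OF d])
qed (auto intro: continuous_on_mult)

lemma Ck_on_linear:
  assumes S: "open S" and l: "bounded_linear l"
  shows "Ck_on k S f \<Longrightarrow> Ck_on k S (\<lambda>x. l (f x))"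
proof (induction k arbitrary: f)
  case (Suc k)
  have d: "((\<lambda>x. l (f x)) has_derivative (\<lambda>v. l (frechet_derivative f (at x) v))) (at x)"
    if "x \<in> S" for x
    using that Suc.prems by (auto intro!: bounded_linear.has_derivative[OF l] simp: frechet_derivative_works[symmetric])
  show ?case
    using Suc d Ck_on_cong[OF S, of "\<lambda>x. frechet_derivative (\<lambda>x. l (f x)) (at x) _"
        "\<lambda>x. l (frechet_derivative f (at x) _)"]
    by (auto simp: differentiable_def frechet_derivative_eqI[OF d])
qed (auto intro: bounded_linear.continuous_on[OF l])

lemma smooth_on_cong: "open S \<Longrightarrow> (\<And>x. x \<in> S \<Longrightarrow> f x = g x) \<Longrightarrow> smooth_on S f \<longleftrightarrow> smooth_on S g"
  unfolding smooth_on_def using Ck_on_cong by blast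

lemma smooth_on_const: "smooth_on S (\<lambda>x. c)"
  by (simp add: smooth_on_def Ck_on_const)

lemma smooth_on_add: "open S \<Longrightarrow> smooth_on S f \<Longrightarrow> smooth_on S g \<Longrightarrow> smooth_on S (\<lambda>x. f x + g x)"
  by (simp add: smooth_on_def Ck_on_add)

lemma smooth_on_mult:
  fixes f g :: "'a::real_normed_vector \<Rightarrow> real"
  shows "open S \<Longrightarrow> smooth_on S f \<Longrightarrow> smooth_on S g \<Longrightarrow> smooth_on S (\<lambda>x. f x * g x)"
  by (simp add: smooth_on_def Ck_on_mult)

lemma smooth_on_linear: "open S \<Longrightarrow> bounded_linear l \<Longrightarrow> smooth_on S f \<Longrightarrow> smooth_on S (\<lambda>x. l (f x))"
  by (simp add: smooth_on_def Ck_on_linear)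

lemma smooth_on_uminus: "open S \<Longrightarrow> smooth_on S f \<Longrightarrow> smooth_on S (\<lambda>x. - f x)"
  by (rule smooth_on_linear) (auto intro: bounded_linear_minus bounded_linear_ident)

lemma smooth_on_diff:
  assumes "open S" "smooth_on S f" "smooth_on S g" shows "smooth_on S (\<lambda>x. f x - g x)"
  using smooth_on_add[OF assms(1,2) smooth_on_uminus[OF assms(1,3)]] by simp

lemma smooth_on_sum:
  assumes "open S" "\<And>i. i \<in> I \<Longrightarrow> smooth_on S (f i)"
  shows "smooth_on S (\<lambda>x. \<Sum>i\<in>I. f i x)"
  using assms(2) by (induction I rule: infinite_finite_induct) (auto intro: smooth_on_const smooth_on_add[OF assms(1)])

lemma smooth_on_prod:
  fixes f :: "'b \<Rightarrow> 'a::real_normed_vector \<Rightarrow> real"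
  assumes "open S" "\<And>i. i \<in> I \<Longrightarrow> smooth_on S (f i)"
  shows "smooth_on S (\<lambda>x. \<Prod>i\<in>I. f i x)"
  using assms(2) by (induction I rule: infinite_finite_induct) (auto intro: smooth_on_const smooth_on_mult[OF assms(1)])

lemma smooth_on_vec_nth: "open S \<Longrightarrow> smooth_on S f \<Longrightarrow> smooth_on S (\<lambda>x. f x $ i)"
  by (rule smooth_on_linear) (auto intro: bounded_linear_vec_nth)

lemma smooth_on_differentiable: "smooth_on S f \<Longrightarrow> x \<in> S \<Longrightarrow> f differentiable (at x)"
  unfolding smooth_on_def using Ck_on.simps(2)[of 0 S f] by blast

lemma smooth_on_continuous_on: "smooth_on S f \<Longrightarrow> continuous_on S f"
  unfolding smooth_on_def using Ck_on.simps(1)[of S f] by blast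

lemma smooth_on_partial: "smooth_on S f \<Longrightarrow> smooth_on S (partial i f)"
  unfolding smooth_on_def partial_def[abs_def] using Ck_on.simps(2)[of _ S f] by blast

lemma has_derivative_partial:
  fixes f :: "real^7 \<Rightarrow> real"
  assumes "f differentiable (at x)"
  shows "(f has_derivative (\<lambda>v. \<Sum>i\<in>UNIV. v $ i * partial i f x)) (at x)"
proof -
  have D: "(f has_derivative frechet_derivative f (at x)) (at x)"
    using assms by (simp add: frechet_derivative_works)
  then interpret bounded_linear "frechet_derivative f (at x)" by (rule has_derivative_bounded_linear)
  have "frechet_derivative f (at x) v = (\<Sum>i\<in>UNIV. v $ i * partial i f x)" for v
  proof -
    have "frechet_derivative f (at x) v = frechet_derivative f (at x) (\<Sum>i\<in>UNIV. v $ i *\<^sub>R axis i 1)"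
      by (simp add: basis_expansion scalar_mult_eq_scaleR[symmetric])
    also have "\<dots> = (\<Sum>i\<in>UNIV. v $ i * frechet_derivative f (at x) (axis i 1))"
      by (simp add: sum scaleR)
    finally show ?thesis by (simp add: partial_def)
  qed
  then have "frechet_derivative f (at x) = (\<lambda>v. \<Sum>i\<in>UNIV. v $ i * partial i f x)" by blast
  then show ?thesis using D by simp
qed

lemma partial_eqI:
  assumes "(f has_derivative f') (at x)" shows "partial i f x = f' (axis i 1)"
  using frechet_derivative_eqI[OF assms] by (simp add: partial_def)

text \<open>Allows regularity to be bootstrapped from a first order system for the coordinate
  derivatives, as for the metric and its inverse.\<close>

lemma smooth_onI_partial:
  fixes f :: "real^7 \<Rightarrow> real"
  assumes S: "open S" and f: "\<And>x. x \<in> S \<Longrightarrow> f differentiable (at x)" and k: "\<And>i. Ck_on k S (partial i f)"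
  shows "Ck_on (Suc k) S f"
proof -
  have "Ck_on k S (\<lambda>x. \<Sum>i\<in>I. v $ i * partial i f x)" for v and I :: "7 set"
    by (induction I rule: infinite_finite_induct)
      (auto intro!: Ck_on_const Ck_on_add[OF S] Ck_on_mult[OF S] k)
  moreover have "frechet_derivative f (at x) v = (\<Sum>i\<in>UNIV. v $ i * partial i f x)" if "x \<in> S" for x v
    using frechet_derivative_eqI[OF has_derivative_partial[OF f[OF that]]] by simp
  ultimately have "Ck_on k S (\<lambda>x. frechet_derivative f (at x) v)" for v
    using Ck_on_cong[OF S, of "\<lambda>x. frechet_derivative f (at x) v" "\<lambda>x. \<Sum>i\<in>UNIV. v $ i * partial i f x"] by simp
  then show ?thesis using f by simp
qed

lemma has_derivative_frechet: "f differentiable (at x) \<Longrightarrow> (f has_derivative frechet_derivative f (at x)) (at x)"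
  by (simp add: frechet_derivative_works)

lemma partial_add:
  assumes "f differentiable (at x)" "g differentiable (at x)"
  shows "partial i (\<lambda>y. f y + g y) x = partial i f x + partial i g x"
  using partial_eqI[OF has_derivative_add[OF assms[THEN has_derivative_frechet]]] by (simp add: partial_def)

lemma partial_diff:
  assumes "f differentiable (at x)" "g differentiable (at x)"
  shows "partial i (\<lambda>y. f y - g y) x = partial i f x - partial i g x"
  using partial_eqI[OF has_derivative_diff[OF assms[THEN has_derivative_frechet]]] by (simp add: partial_def)

lemma partial_uminus:
  assumes "f differentiable (at x)"
  shows "partial i (\<lambda>y. - f y) x = - partial i f x"
  using partial_eqI[OF has_derivative_minus[OF assms[THEN has_derivative_frechet]]] by (simp add: partial_def)

lemma partial_mult:
  fixes f g :: "real^7 \<Rightarrow> real"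
  assumes "f differentiable (at x)" "g differentiable (at x)"
  shows "partial i (\<lambda>y. f y * g y) x = partial i f x * g x + f x * partial i g x"
  using partial_eqI[OF has_derivative_mult[OF assms[THEN has_derivative_frechet]]] by (simp add: partial_def)

lemma partial_const: "partial i (\<lambda>y. c) x = 0"
  using partial_eqI[OF has_derivative_const[of c "at x"], of i] by simp

lemma partial_cmult:
  fixes f :: "real^7 \<Rightarrow> real"
  assumes "f differentiable (at x)"
  shows "partial i (\<lambda>y. c * f y) x = c * partial i f x"
  using partial_mult[of "\<lambda>y. c" x f i] assms by (simp add: partial_const)

lemma partial_sum:
  assumes "\<And>j. j \<in> I \<Longrightarrow> f j differentiable (at x)"
  shows "partial i (\<lambda>y. \<Sum>j\<in>I. f j y) x = (\<Sum>j\<in>I. partial i (f j) x)"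
proof -
  have "((\<lambda>y. \<Sum>j\<in>I. f j y) has_derivative (\<lambda>v. \<Sum>j\<in>I. frechet_derivative (f j) (at x) v)) (at x)"
    using assms by (intro has_derivative_sum has_derivative_frechet)
  from partial_eqI[OF this] show ?thesis by (simp add: partial_def)
qed

lemma partial_vec_nth:
  assumes "f differentiable (at x)"
  shows "partial i (\<lambda>y. f y $ j) x = partial i f x $ j"
  using partial_eqI[OF bounded_linear.has_derivative[OF bounded_linear_vec_nth has_derivative_frechet[OF assms]]]
  by (simp add: partial_def)

lemma partial_cong_open:
  assumes "open S" "x \<in> S" "\<And>y. y \<in> S \<Longrightarrow> f y = g y"
  shows "partial i f x = partial i g x"
proof -
  have "(f has_derivative f') (at x) \<longleftrightarrow> (g has_derivative f') (at x)" for f'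
    by (rule has_derivative_cong_open[OF assms])
  then show ?thesis by (simp add: partial_def frechet_derivative_def)
qed

lemma line_has_derivative:
  fixes f :: "real^7 \<Rightarrow> real"
  assumes "f differentiable (at (z + s *\<^sub>R v))"
  shows "((\<lambda>s. f (z + s *\<^sub>R v)) has_real_derivative (\<Sum>i\<in>UNIV. v $ i * partial i f (z + s *\<^sub>R v))) (at s)"
proof -
  have "((\<lambda>s. z + s *\<^sub>R v) has_derivative (\<lambda>t. t *\<^sub>R v)) (at s)"
    by (auto intro!: derivative_eq_intros)
  from has_derivative_compose[OF this has_derivative_partial[OF assms]]
  have "((\<lambda>s. f (z + s *\<^sub>R v)) has_derivative (\<lambda>t. t * (\<Sum>i\<in>UNIV. v $ i * partial i f (z + s *\<^sub>R v)))) (at s)"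
    by (simp add: sum_distrib_left[symmetric] mult.assoc o_def)
  moreover have "(\<lambda>t. t * K) = (*) K" for K :: real by (rule ext) (rule mult.commute)
  ultimately show ?thesis by (simp only: has_field_derivative_def)
qed

lemma axis_line_has_derivative:
  fixes f :: "real^7 \<Rightarrow> real"
  assumes "f differentiable (at (z + s *\<^sub>R axis i 1))"
  shows "((\<lambda>s. f (z + s *\<^sub>R axis i 1)) has_real_derivative partial i f (z + s *\<^sub>R axis i 1)) (at s)"
proof -
  have "(\<Sum>j\<in>UNIV. axis i 1 $ j * partial j f x) = partial i f x" for x
    by (simp add: axis_def if_distrib[of "\<lambda>x. x * _"] cong: if_cong)
  then show ?thesis using line_has_derivative[OF assms] by simp
qed

text \<open>The second difference quotient is a value of either mixed derivative at a nearby point.\<close>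

lemma partial_commute:
  fixes f :: "real^7 \<Rightarrow> real"
  assumes S: "open S" and f: "smooth_on S f" and y: "y \<in> S"
  shows "partial i (partial j f) y = partial j (partial i f) y"
proof (rule ccontr)
  assume ne: "partial i (partial j f) y \<noteq> partial j (partial i f) y"
  define e where "e = \<bar>partial i (partial j f) y - partial j (partial i f) y\<bar> / 2"
  have e: "e > 0" using ne by (simp add: e_def)
  have cont: "isCont (partial k (partial l f)) y" for k l
    using smooth_on_continuous_on[OF smooth_on_partial[OF smooth_on_partial[OF f]]] S y
    by (simp add: continuous_on_eq_continuous_at)
  obtain r0 where r0: "r0 > 0" "ball y r0 \<subseteq> S" using S y open_contains_ball by blast
  obtain r1 where r1: "r1 > 0" "\<And>x. dist x y < r1 \<Longrightarrow> dist (partial i (partial j f) x) (partial i (partial j f) y) < e"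
    using cont[of i j] e unfolding continuous_at_eps_delta by blast
  obtain r2 where r2: "r2 > 0" "\<And>x. dist x y < r2 \<Longrightarrow> dist (partial j (partial i f) x) (partial j (partial i f) y) < e"
    using cont[of j i] e unfolding continuous_at_eps_delta by blast
  define h where "h = min r0 (min r1 r2) / 3"
  have h: "h > 0" "3 * h \<le> r0" "3 * h \<le> r1" "3 * h \<le> r2" using r0(1) r1(1) r2(1) by (auto simp: h_def)
  let ?p = "\<lambda>k l s t. y + s *\<^sub>R axis k 1 + t *\<^sub>R axis l (1::real)"
  have near: "dist (?p k l s t) y < 3 * h" if "0 \<le> s" "s \<le> h" "0 \<le> t" "t \<le> h" for k l :: 7 and s t
  proof -
    have "dist (?p k l s t) y = norm (s *\<^sub>R axis k 1 + t *\<^sub>R axis l (1::real) :: real^7)" by (simp add: dist_norm)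
    also have "\<dots> \<le> norm (s *\<^sub>R axis k (1::real) :: real^7) + norm (t *\<^sub>R axis l (1::real) :: real^7)" by (rule norm_triangle_ineq)
    also have "\<dots> \<le> 2 * h" using that by (simp add: norm_axis_1)
    finally show ?thesis using h by simp
  qed
  have inS: "?p k l s t \<in> S" if "0 \<le> s" "s \<le> h" "0 \<le> t" "t \<le> h" for k l :: 7 and s t
    using near[OF that, of k l] h(2) r0(2) by (force simp: dist_commute)
  \<comment> \<open>The mean value theorem twice, first in direction \<open>k\<close>, then in
    direction \<open>l\<close>. Exchanging their roles gives the other mixed derivative.\<close>
  have *: "\<exists>s t. 0 < s \<and> s < h \<and> 0 < t \<and> t < h \<and>
      f (?p k l h h) - f (?p k l h 0) - f (?p k l 0 h) + f y = h * h * partial l (partial k f) (?p k l s t)" for k l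
  proof -
    have "((\<lambda>s. f (?p k l s h) - f (?p k l s 0)) has_real_derivative
        partial k f (?p k l s h) - partial k f (?p k l s 0)) (at s)" if "0 \<le> s" "s \<le> h" for s
    proof (rule DERIV_diff)
      have 1: "?p k l s t = (y + t *\<^sub>R axis l 1) + s *\<^sub>R axis k 1" for s t by simp
      show "((\<lambda>s. f (?p k l s h)) has_real_derivative partial k f (?p k l s h)) (at s)"
        unfolding 1 by (rule axis_line_has_derivative, fold 1, rule smooth_on_differentiable[OF f])
          (use inS that h in auto)
      show "((\<lambda>s. f (?p k l s 0)) has_real_derivative partial k f (?p k l s 0)) (at s)"
        unfolding 1 by (rule axis_line_has_derivative, fold 1, rule smooth_on_differentiable[OF f])
          (use inS[of s 0 k l] that h in auto)
    qed
    from MVT2[OF h(1) this] obtain s where s: "0 < s" "s < h"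
      "(f (?p k l h h) - f (?p k l h 0)) - (f (?p k l 0 h) - f (?p k l 0 0)) =
        (h - 0) * (partial k f (?p k l s h) - partial k f (?p k l s 0))"
      by blast
    have "((\<lambda>t. partial k f (?p k l s t)) has_real_derivative partial l (partial k f) (?p k l s t)) (at t)"
      if "0 \<le> t" "t \<le> h" for t
      by (rule axis_line_has_derivative, rule smooth_on_differentiable[OF smooth_on_partial[OF f]])
        (use inS that h s in auto)
    from MVT2[OF h(1) this] obtain t where t: "0 < t" "t < h"
      "partial k f (?p k l s h) - partial k f (?p k l s 0) = (h - 0) * partial l (partial k f) (?p k l s t)"
      by blast
    show ?thesis using s t by (intro exI[of _ s] exI[of _ t]) (simp add: algebra_simps)
  qed
  obtain s t where st: "0 < s" "s < h" "0 < t" "t < h"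
    "f (?p i j h h) - f (?p i j h 0) - f (?p i j 0 h) + f y = h * h * partial j (partial i f) (?p i j s t)"
    using * by blast
  obtain s' t' where st': "0 < s'" "s' < h" "0 < t'" "t' < h"
    "f (?p j i h h) - f (?p j i h 0) - f (?p j i 0 h) + f y = h * h * partial i (partial j f) (?p j i s' t')"
    using * by blast
  have "f (?p i j h h) - f (?p i j h 0) - f (?p i j 0 h) + f y = f (?p j i h h) - f (?p j i h 0) - f (?p j i 0 h) + f y"
    by (simp add: algebra_simps)
  then have "partial j (partial i f) (?p i j s t) = partial i (partial j f) (?p j i s' t')"
    unfolding st(5) st'(5) using h(1) by simp
  moreover have "dist (partial j (partial i f) (?p i j s t)) (partial j (partial i f) y) < e"
    using r2(2) near[of s t i j] st h by simp
  moreover have "dist (partial i (partial j f) (?p j i s' t')) (partial i (partial j f) y) < e"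
    using r1(2) near[of s' t' j i] st' h by simp
  ultimately show False unfolding e_def dist_real_def by argo
qed

section \<open>Covariant derivatives\<close>

text \<open>The derivation of tensors induced by a matrix, that is, up to the order of indices, the
  linearization of \<open>pull\<close> at the identity. Connection terms and curvature terms are
  both of this kind.\<close>

definition act :: "(7 \<Rightarrow> 7 \<Rightarrow> real) \<Rightarrow> tens \<Rightarrow> tens" where
  "act G \<alpha> l = (\<Sum>m<length l. \<Sum>a\<in>UNIV. G (l ! m) a * \<alpha> (l[m := a]))"

lemma act_Nil [simp]: "act G \<alpha> [] = 0"
  by (simp add: act_def)

lemma act_Cons: "act G \<alpha> (b # l) = (\<Sum>a\<in>UNIV. G b a * \<alpha> (a # l)) + act G (\<lambda>m. \<alpha> (b # m)) l"
  by (simp add: act_def sum.lessThan_Suc_shift del: sum.lessThan_Suc)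

lemma act_append: "act G \<alpha> (l1 @ l2) = act G (\<lambda>m. \<alpha> (m @ l2)) l1 + act G (\<lambda>m. \<alpha> (l1 @ m)) l2"
  by (induction l1 arbitrary: \<alpha>) (simp_all add: act_Cons)

lemma act_add: "act G (\<lambda>m. \<alpha> m + \<beta> m) l = act G \<alpha> l + act G \<beta> l"
  by (simp add: act_def distrib_left sum.distrib)

lemma act_diff: "act G (\<lambda>m. \<alpha> m - \<beta> m) l = act G \<alpha> l - act G \<beta> l"
  by (simp add: act_def right_diff_distrib sum_subtractf)

lemma act_cmult: "act G (\<lambda>m. c * \<alpha> m) l = c * act G \<alpha> l"
  unfolding act_def sum_distrib_left by (simp only: mult.left_commute)

lemma act_sum: "act G (\<lambda>m. \<Sum>i\<in>I. \<alpha> i m) l = (\<Sum>i\<in>I. act G (\<alpha> i) l)"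
proof -
  have "act G (\<lambda>m. \<Sum>i\<in>I. \<alpha> i m) l = (\<Sum>m<length l. \<Sum>i\<in>I. \<Sum>a\<in>UNIV. G (l ! m) a * \<alpha> i (l[m := a]))"
    unfolding act_def sum_distrib_left by (intro sum.cong refl) (rule sum.swap)
  also have "\<dots> = (\<Sum>i\<in>I. act G (\<alpha> i) l)"
    unfolding act_def by (rule sum.swap)
  finally show ?thesis .
qed

lemma act_diff_left: "act (\<lambda>j a. G j a - H j a) \<alpha> l = act G \<alpha> l - act H \<alpha> l"
  by (simp add: act_def left_diff_distrib sum_subtractf)

lemma act_cong: "(\<And>m. length m = length l \<Longrightarrow> \<alpha> m = \<beta> m) \<Longrightarrow> act G \<alpha> l = act G \<beta> l"
  by (simp add: act_def)

text \<open>Derivations in different slots commute, so only compositions within one slot survive.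
  The quadratic part of the curvature arises here.\<close>

lemma act_commutator:
  "act G (act H \<alpha>) l - act H (act G \<alpha>) l =
    act (\<lambda>j a. (\<Sum>s\<in>UNIV. G j s * H s a) - (\<Sum>s\<in>UNIV. H j s * G s a)) \<alpha> l"
proof (induction l arbitrary: \<alpha>)
  case (Cons b l)
  have 1: "act G (act H \<alpha>) (b # l) = (\<Sum>c\<in>UNIV. (\<Sum>s\<in>UNIV. G b s * H s c) * \<alpha> (c # l))
      + (\<Sum>a\<in>UNIV. G b a * act H (\<lambda>m. \<alpha> (a # m)) l) + (\<Sum>a\<in>UNIV. H b a * act G (\<lambda>m. \<alpha> (a # m)) l)
      + act G (act H (\<lambda>m. \<alpha> (b # m))) l" for G H
  proof -
    have "(\<Sum>a\<in>UNIV. G b a * (\<Sum>c\<in>UNIV. H a c * \<alpha> (c # l))) = (\<Sum>c\<in>UNIV. (\<Sum>s\<in>UNIV. G b s * H s c) * \<alpha> (c # l))"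
      unfolding sum_distrib_left sum_distrib_right by (subst sum.swap) (simp only: mult.assoc)
    then show ?thesis
      by (simp add: act_Cons act_add act_sum act_cmult distrib_left sum.distrib)
  qed
  show ?case
    unfolding 1[of G H] 1[of H G] using Cons.IH[of "\<lambda>m. \<alpha> (b # m)"]
    by (simp add: act_Cons left_diff_distrib sum_subtractf)
qed simp

text \<open>Moving a derivation from one factor of a contraction to the other transposes it.\<close>

lemma sum_act_transpose:
  "(\<Sum>m | length m = k. act (\<lambda>j a. G a j) F m * K m) = (\<Sum>m | length m = k. F m * act G K m)"
proof (induction k arbitrary: F K)
  case 0
  show ?case by (simp add: sum_length_0[simplified])
next
  case (Suc k)
  have "(\<Sum>m | length m = Suc k. act (\<lambda>j a. G a j) F m * K m) =
      (\<Sum>b\<in>UNIV. \<Sum>m | length m = k. \<Sum>a\<in>UNIV. G a b * F (a # m) * K (b # m))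
      + (\<Sum>b\<in>UNIV. \<Sum>m | length m = k. act (\<lambda>j a. G a j) (\<lambda>m. F (b # m)) m * K (b # m))"
    by (simp add: sum_length_Suc act_Cons distrib_right sum.distrib sum_distrib_right)
  also have "(\<Sum>b\<in>UNIV. \<Sum>m | length m = k. \<Sum>a\<in>UNIV. G a b * F (a # m) * K (b # m)) =
      (\<Sum>a\<in>UNIV. \<Sum>m | length m = k. \<Sum>b\<in>UNIV. G a b * F (a # m) * K (b # m))"
  proof -
    have "(\<Sum>b\<in>UNIV. \<Sum>m | length m = k. \<Sum>a\<in>UNIV. G a b * F (a # m) * K (b # m)) =
        (\<Sum>m | length m = k. \<Sum>b\<in>UNIV. \<Sum>a\<in>UNIV. G a b * F (a # m) * K (b # m))"
      by (rule sum.swap)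
    also have "\<dots> = (\<Sum>m | length m = k. \<Sum>a\<in>UNIV. \<Sum>b\<in>UNIV. G a b * F (a # m) * K (b # m))"
      by (rule sum.cong[OF refl]) (rule sum.swap)
    also have "\<dots> = (\<Sum>a\<in>UNIV. \<Sum>m | length m = k. \<Sum>b\<in>UNIV. G a b * F (a # m) * K (b # m))"
      by (rule sum.swap)
    finally show ?thesis .
  qed
  also have "(\<Sum>b\<in>UNIV. \<Sum>m | length m = k. act (\<lambda>j a. G a j) (\<lambda>m. F (b # m)) m * K (b # m)) =
      (\<Sum>b\<in>UNIV. \<Sum>m | length m = k. F (b # m) * act G (\<lambda>m. K (b # m)) m)"
    by (simp only: Suc.IH)
  finally show ?case
    by (simp add: sum_length_Suc act_Cons distrib_left sum.distrib sum_distrib_left mult_ac)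
qed

lemma alternating_act:
  assumes \<alpha>: "alternating \<alpha>" shows "alternating (act G \<alpha>)"
proof (rule alternatingI_permute)
  fix l :: "7 list" and \<sigma> assume s: "\<sigma> permutes {..<length l}"
  have upd: "(permute_list \<sigma> l)[m := a] = permute_list \<sigma> (l[\<sigma> m := a])" if "m < length l" for m and a :: 7
  proof (rule nth_equalityI)
    fix n assume "n < length ((permute_list \<sigma> l)[m := a])"
    then have n: "n < length l" by simp
    have "\<sigma> m = \<sigma> n \<longleftrightarrow> m = n" using permutes_inj[OF s] by (auto dest: injD)
    moreover have "\<sigma> n < length l" "\<sigma> m < length l" using permutes_in_image[OF s] n that by auto
    ultimately show "(permute_list \<sigma> l)[m := a] ! n = permute_list \<sigma> (l[\<sigma> m := a]) ! n"
      using n that s by (auto simp: permute_list_nth nth_list_update)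
  qed simp
  have "act G \<alpha> (permute_list \<sigma> l) =
      (\<Sum>m<length l. \<Sum>a\<in>UNIV. G (l ! \<sigma> m) a * (of_int (sign \<sigma>) * \<alpha> (l[\<sigma> m := a])))"
    unfolding act_def length_permute_list
  proof (intro sum.cong refl)
    fix m a assume "m \<in> {..<length l}"
    then show "G (permute_list \<sigma> l ! m) a * \<alpha> ((permute_list \<sigma> l)[m := a]) =
        G (l ! \<sigma> m) a * (of_int (sign \<sigma>) * \<alpha> (l[\<sigma> m := a]))"
      using s alternating_permute_list[OF \<alpha>, of \<sigma> "l[\<sigma> m := a]"] by (simp add: upd permute_list_nth)
  qed
  also have "\<dots> = (\<Sum>m<length l. \<Sum>a\<in>UNIV. G (l ! m) a * (of_int (sign \<sigma>) * \<alpha> (l[m := a])))"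
    using sum.permute[OF s, of "\<lambda>m. \<Sum>a\<in>UNIV. G (l ! m) a * (of_int (sign \<sigma>) * \<alpha> (l[m := a]))"]
    by (simp add: o_def)
  also have "\<dots> = of_int (sign \<sigma>) * act G \<alpha> l"
    unfolding act_def sum_distrib_left by (simp only: mult.left_commute)
  finally show "act G \<alpha> (permute_list \<sigma> l) = of_int (sign \<sigma>) * act G \<alpha> l" .
qed

definition cf :: "conn \<Rightarrow> real^7 \<Rightarrow> 7 \<Rightarrow> 7 \<Rightarrow> 7 \<Rightarrow> real" where
  "cf \<Gamma> y i j a = \<Gamma> y i j $ a"

text \<open>The direction is put in front of the index list, so the derivative is again a
  \<open>tens\<close>, of one degree more, and can be iterated. The value at \<open>[]\<close> is a
  placeholder.\<close>

definition nabla :: "conn \<Rightarrow> (real^7 \<Rightarrow> tens) \<Rightarrow> real^7 \<Rightarrow> tens" where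
  "nabla \<Gamma> \<alpha> y l = (case l of [] \<Rightarrow> 0 | i # m \<Rightarrow> partial i (\<lambda>z. \<alpha> z m) y - act (cf \<Gamma> y i) (\<alpha> y) m)"

lemma nabla_Cons: "nabla \<Gamma> \<alpha> y (i # l) = partial i (\<lambda>z. \<alpha> z l) y - act (cf \<Gamma> y i) (\<alpha> y) l"
  by (simp add: nabla_def)

lemma cov_tensor_nabla: "cov_tensor \<Gamma> (length l) \<alpha> y i l = nabla \<Gamma> \<alpha> y (i # l)"
  by (simp add: nabla_Cons cov_tensor_def act_def cf_def)

lemma partial_nabla: "partial i (\<lambda>z. \<alpha> z l) y = nabla \<Gamma> \<alpha> y (i # l) + act (cf \<Gamma> y i) (\<alpha> y) l"
  by (simp add: nabla_Cons)

definition smooth_tens :: "(real^7) set \<Rightarrow> (real^7 \<Rightarrow> tens) \<Rightarrow> bool" where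
  "smooth_tens U \<alpha> \<longleftrightarrow> (\<forall>l. smooth_on U (\<lambda>y. \<alpha> y l))"

definition tors :: "conn \<Rightarrow> real^7 \<Rightarrow> 7 \<Rightarrow> 7 \<Rightarrow> 7 \<Rightarrow> real" where
  "tors \<Gamma> y i j a = cf \<Gamma> y i j a - cf \<Gamma> y j i a"

definition Kc :: "conn \<Rightarrow> real^7 \<Rightarrow> 7 \<Rightarrow> 7 \<Rightarrow> 7 \<Rightarrow> 7 \<Rightarrow> real" where
  "Kc \<Gamma> y i j k a = partial i (\<lambda>z. cf \<Gamma> z j k a) y - partial j (\<lambda>z. cf \<Gamma> z i k a) y
     + (\<Sum>s\<in>UNIV. cf \<Gamma> y j k s * cf \<Gamma> y i s a) - (\<Sum>s\<in>UNIV. cf \<Gamma> y i k s * cf \<Gamma> y j s a)"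

locale conn_chart =
  fixes U :: "(real^7) set" and \<Gamma> :: conn
  assumes U: "open U" and cf: "smooth_on U (\<lambda>y. cf \<Gamma> y i j a)"
begin

lemma smooth_tens_differentiable: "smooth_tens U \<alpha> \<Longrightarrow> y \<in> U \<Longrightarrow> (\<lambda>z. \<alpha> z l) differentiable (at y)"
  unfolding smooth_tens_def using smooth_on_differentiable by blast

lemma cf_differentiable: "y \<in> U \<Longrightarrow> (\<lambda>z. cf \<Gamma> z i j a) differentiable (at y)"
  using smooth_on_differentiable[OF cf] by blast

lemma smooth_act: "smooth_tens U \<alpha> \<Longrightarrow> smooth_on U (\<lambda>y. act (cf \<Gamma> y i) (\<alpha> y) l)"
  unfolding act_def smooth_tens_def by (intro smooth_on_sum smooth_on_mult U cf) auto

lemma smooth_nabla: assumes "smooth_tens U \<alpha>" shows "smooth_tens U (nabla \<Gamma> \<alpha>)"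
  unfolding smooth_tens_def
proof
  fix l
  show "smooth_on U (\<lambda>y. nabla \<Gamma> \<alpha> y l)"
  proof (cases l)
    case Nil
    then show ?thesis by (simp add: nabla_def smooth_on_const)
  next
    case (Cons i m)
    have "smooth_on U (partial i (\<lambda>z. \<alpha> z m))"
      using assms smooth_on_partial unfolding smooth_tens_def by blast
    then show ?thesis unfolding Cons nabla_Cons by (intro smooth_on_diff U smooth_act assms)
  qed
qed

lemma partial_act:
  assumes \<alpha>: "smooth_tens U \<alpha>" and y: "y \<in> U"
  shows "partial i (\<lambda>z. act (cf \<Gamma> z j) (\<alpha> z) l) y =
    act (\<lambda>k a. partial i (\<lambda>z. cf \<Gamma> z j k a) y) (\<alpha> y) l + act (cf \<Gamma> y j) (\<lambda>m. partial i (\<lambda>z. \<alpha> z m) y) l"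
proof -
  have d: "(\<lambda>z. cf \<Gamma> z j (l ! m) a * \<alpha> z (l[m := a])) differentiable (at y)" for m a
    by (intro differentiable_mult cf_differentiable smooth_tens_differentiable \<alpha> y)
  have "partial i (\<lambda>z. act (cf \<Gamma> z j) (\<alpha> z) l) y =
      (\<Sum>m<length l. \<Sum>a\<in>UNIV. partial i (\<lambda>z. cf \<Gamma> z j (l ! m) a * \<alpha> z (l[m := a])) y)"
  proof -
    have "partial i (\<lambda>z. act (cf \<Gamma> z j) (\<alpha> z) l) y =
        (\<Sum>m<length l. partial i (\<lambda>z. \<Sum>a\<in>UNIV. cf \<Gamma> z j (l ! m) a * \<alpha> z (l[m := a])) y)"
      unfolding act_def by (rule partial_sum) (simp add: differentiable_sum d)
    also have "\<dots> = (\<Sum>m<length l. \<Sum>a\<in>UNIV. partial i (\<lambda>z. cf \<Gamma> z j (l ! m) a * \<alpha> z (l[m := a])) y)"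
      by (rule sum.cong[OF refl]) (rule partial_sum, rule d)
    finally show ?thesis .
  qed
  also have "\<dots> = (\<Sum>m<length l. \<Sum>a\<in>UNIV. partial i (\<lambda>z. cf \<Gamma> z j (l ! m) a) y * \<alpha> y (l[m := a])
      + cf \<Gamma> y j (l ! m) a * partial i (\<lambda>z. \<alpha> z (l[m := a])) y)"
    by (intro sum.cong refl partial_mult cf_differentiable smooth_tens_differentiable \<alpha> y)
  finally show ?thesis by (simp add: act_def sum.distrib)
qed

text \<open>Mixed partial derivatives commute. The curl of the coefficients and their commutator
  remain, which make up \<open>Kc\<close>, and the skew part in the two direction slots, which is
  the torsion.\<close>

lemma ricci_identity:
  assumes \<alpha>: "smooth_tens U \<alpha>" and y: "y \<in> U"
  shows "nabla \<Gamma> (nabla \<Gamma> \<alpha>) y (i # j # l) - nabla \<Gamma> (nabla \<Gamma> \<alpha>) y (j # i # l) =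
    - act (Kc \<Gamma> y i j) (\<alpha> y) l - (\<Sum>a\<in>UNIV. tors \<Gamma> y i j a * nabla \<Gamma> \<alpha> y (a # l))"
proof -
  let ?d = "\<lambda>i m. partial i (\<lambda>z. \<alpha> z m) y"
  have 1: "nabla \<Gamma> (nabla \<Gamma> \<alpha>) y (i # j # l) = partial i (partial j (\<lambda>z. \<alpha> z l)) y
      - act (\<lambda>k a. partial i (\<lambda>z. cf \<Gamma> z j k a) y) (\<alpha> y) l - act (cf \<Gamma> y j) (?d i) l
      - (\<Sum>a\<in>UNIV. cf \<Gamma> y i j a * nabla \<Gamma> \<alpha> y (a # l)) - act (cf \<Gamma> y i) (?d j) l
      + act (cf \<Gamma> y i) (act (cf \<Gamma> y j) (\<alpha> y)) l" for i j
  proof -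
    have s: "smooth_on U (\<lambda>z. \<alpha> z l)" using \<alpha> by (simp add: smooth_tens_def)
    have "partial i (\<lambda>z. nabla \<Gamma> \<alpha> z (j # l)) y =
        partial i (partial j (\<lambda>z. \<alpha> z l)) y - partial i (\<lambda>z. act (cf \<Gamma> z j) (\<alpha> z) l) y"
      unfolding nabla_Cons
      by (intro partial_diff smooth_on_differentiable[OF smooth_on_partial[OF s] y] smooth_on_differentiable[OF smooth_act[OF \<alpha>] y])
    then show ?thesis
      by (simp add: nabla_Cons[of \<Gamma> "nabla \<Gamma> \<alpha>"] act_Cons nabla_Cons[of \<Gamma> \<alpha> y j] act_diff partial_act[OF \<alpha> y])
  qed
  have c: "partial i (partial j (\<lambda>z. \<alpha> z l)) y = partial j (partial i (\<lambda>z. \<alpha> z l)) y"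
    using \<alpha> by (intro partial_commute[OF U _ y]) (simp add: smooth_tens_def)
  have k: "act (Kc \<Gamma> y i j) (\<alpha> y) l = act (\<lambda>k a. partial i (\<lambda>z. cf \<Gamma> z j k a) y) (\<alpha> y) l
      - act (\<lambda>k a. partial j (\<lambda>z. cf \<Gamma> z i k a) y) (\<alpha> y) l
      - (act (cf \<Gamma> y i) (act (cf \<Gamma> y j) (\<alpha> y)) l - act (cf \<Gamma> y j) (act (cf \<Gamma> y i) (\<alpha> y)) l)"
    unfolding act_commutator act_diff_left[symmetric] by (simp add: Kc_def[abs_def] algebra_simps)
  show ?thesis
    unfolding 1[of i j] 1[of j i] c k tors_def
    by (simp add: left_diff_distrib sum_subtractf)
qed

end

text \<open>Stated for differentiability at one point so that it also covers the volume form, for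
  which only that much is available.\<close>

lemma alternating_nabla:
  assumes U: "open U" "y \<in> U" and \<alpha>: "\<And>z. z \<in> U \<Longrightarrow> alternating (\<alpha> z)"
    and d: "\<And>l. (\<lambda>z. \<alpha> z l) differentiable (at y)"
  shows "alternating (\<lambda>l. nabla \<Gamma> \<alpha> y (i # l))"
  unfolding alternating_def nabla_Cons
proof (intro allI)
  fix xs ys :: "7 list" and a b :: 7
  have "partial i (\<lambda>z. \<alpha> z (xs @ a # b # ys)) y = partial i (\<lambda>z. - \<alpha> z (xs @ b # a # ys)) y"
    by (rule partial_cong_open[OF U]) (rule alternatingD[OF \<alpha>])
  also have "\<dots> = - partial i (\<lambda>z. \<alpha> z (xs @ b # a # ys)) y" by (rule partial_uminus[OF d])
  finally show "partial i (\<lambda>z. \<alpha> z (xs @ a # b # ys)) y - act (cf \<Gamma> y i) (\<alpha> y) (xs @ a # b # ys) =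
      - (partial i (\<lambda>z. \<alpha> z (xs @ b # a # ys)) y - act (cf \<Gamma> y i) (\<alpha> y) (xs @ b # a # ys))"
    using alternatingD[OF alternating_act[OF \<alpha>[OF U(2)]], of "cf \<Gamma> y i" xs a b ys] by simp
qed

text \<open>Antisymmetrized connection coefficients are torsion; one such term appears for each of
  the six pairs of slots.\<close>

lemma ext_d_3:
  fixes \<Gamma> :: conn
  assumes \<alpha>: "alternating (\<alpha> y)"
  defines "S \<equiv> \<lambda>a b c d. \<Sum>s\<in>UNIV. tors \<Gamma> y a b s * \<alpha> y [s, c, d]"
  shows "ext_d 3 \<alpha> y [a, b, c, d] =
    nabla \<Gamma> \<alpha> y [a, b, c, d] - nabla \<Gamma> \<alpha> y [b, a, c, d] + nabla \<Gamma> \<alpha> y [c, a, b, d] - nabla \<Gamma> \<alpha> y [d, a, b, c]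
    + (S a b c d - S a c b d + S a d b c + S b c a d - S b d a c + S c d a b)"
proof -
  let ?G = "\<lambda>i j c d. \<Sum>s\<in>UNIV. cf \<Gamma> y i j s * \<alpha> y [s, c, d]"
  have s1: "\<alpha> y [c, s, d] = - \<alpha> y [s, c, d]" for c d s
    using alternatingD[OF \<alpha>, of "[]" c s "[d]"] by simp
  have s2: "\<alpha> y [c, d, s] = \<alpha> y [s, c, d]" for c d s
    using alternatingD[OF \<alpha>, of "[c]" d s "[]"] s1[of c s d] by simp
  have act: "act (cf \<Gamma> y i) (\<alpha> y) [j, k, l] = ?G i j k l - ?G i k j l + ?G i l j k" for i j k l
    by (simp add: act_Cons s1[of j] s2 sum_negf)
  have S: "S a b c d = ?G a b c d - ?G b a c d" for a b c d
    by (simp add: S_def tors_def left_diff_distrib sum_subtractf)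
  have "ext_d 3 \<alpha> y [a, b, c, d] = partial a (\<lambda>z. \<alpha> z [b, c, d]) y - partial b (\<lambda>z. \<alpha> z [a, c, d]) y
      + partial c (\<lambda>z. \<alpha> z [a, b, d]) y - partial d (\<lambda>z. \<alpha> z [a, b, c]) y"
    by (simp add: ext_d_def eval_nat_numeral)
  then show ?thesis
    unfolding partial_nabla[of _ \<alpha> _ y \<Gamma>] act S by simp
qed

subsection \<open>Metric connections\<close>

lemma differentiable_prod:
  fixes f :: "'b \<Rightarrow> 'a::real_normed_vector \<Rightarrow> real"
  assumes "finite I" "\<And>i. i \<in> I \<Longrightarrow> f i differentiable (at x)"
  shows "(\<lambda>y. \<Prod>i\<in>I. f i y) differentiable (at x)"
  using assms by (induction I rule: finite_induct) (auto intro: differentiable_mult)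

lemma differentiable_det:
  fixes A :: "'a::real_normed_vector \<Rightarrow> real^'n^'n"
  assumes "\<And>i j. (\<lambda>y. A y $ i $ j) differentiable (at x)"
  shows "(\<lambda>y. det (A y)) differentiable (at x)"
  unfolding det_def
  by (intro differentiable_sum ballI differentiable_mult differentiable_const differentiable_prod assms)
    (auto simp: finite_permutations)

text \<open>By Cramer's rule the entries of the inverse are quotients of determinants.\<close>

lemma differentiable_matrix_inv:
  fixes A :: "real^7 \<Rightarrow> real^7^7"
  assumes U: "open U" "x \<in> U" and inv: "\<And>y. y \<in> U \<Longrightarrow> invertible (A y)"
    and d: "\<And>i j. (\<lambda>y. A y $ i $ j) differentiable (at x)"
  shows "(\<lambda>y. matrix_inv (A y) $ k $ j) differentiable (at x)"
proof -
  define B where "B y = (\<chi> i l. if l = k then axis j 1 $ i else A y $ i $ l)" for y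
  have eq: "matrix_inv (A y) $ k $ j = det (B y) / det (A y)" if "y \<in> U" for y
  proof -
    have "A y *v (matrix_inv (A y) *v axis j 1) = axis j 1"
      using invertible_matrix_inv(1)[OF inv[OF that]] by (simp add: matrix_vector_mul_assoc)
    then have "matrix_inv (A y) *v axis j 1 = (\<chi> k. det (\<chi> i l. if l = k then axis j 1 $ i else A y $ i $ l) / det (A y))"
      using inv[OF that] by (subst (asm) cramer) (simp_all add: invertible_det_nz)
    then have "(matrix_inv (A y) *v axis j 1) $ k = det (B y) / det (A y)"
      by (simp add: B_def)
    then show ?thesis
      by (simp add: matrix_vector_mult_def axis_def if_distrib[of "\<lambda>x. _ * x"] cong: if_cong)
  qed
  have b: "(\<lambda>y. det (B y)) differentiable (at x)"
  proof (rule differentiable_det)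
    fix i l
    show "(\<lambda>y. B y $ i $ l) differentiable (at x)" by (cases "l = k") (simp_all add: B_def d)
  qed
  have nz: "det (A x) \<noteq> 0" using inv[OF U(2)] by (simp add: invertible_det_nz)
  have "(\<lambda>y. det (B y) / det (A y)) differentiable (at x)"
    by (rule differentiable_divide[OF b differentiable_det[OF d] nz])
  then show ?thesis
    unfolding differentiable_def
    using has_derivative_cong_open[OF U, of "\<lambda>y. matrix_inv (A y) $ k $ j", OF eq] by simp
qed

lemma Ck_on_sum:
  assumes "open S" "\<And>i. i \<in> I \<Longrightarrow> Ck_on k S (f i)"
  shows "Ck_on k S (\<lambda>x. \<Sum>i\<in>I. f i x)"
  using assms(2) by (induction I rule: infinite_finite_induct) (auto intro: Ck_on_const Ck_on_add[OF assms(1)])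

text \<open>Only differentiability of \<open>g\<close> is assumed. \<open>compat\<close> expresses
  its derivatives through \<open>g\<close> and the smooth coefficients, and smoothness follows by
  induction on the order.\<close>

locale metric_chart = conn_chart +
  fixes g :: "real^7 \<Rightarrow> real^7^7"
  assumes g_sym: "y \<in> U \<Longrightarrow> g y $ i $ j = g y $ j $ i"
    and g_inv: "y \<in> U \<Longrightarrow> invertible (g y)"
    and g_diff: "y \<in> U \<Longrightarrow> (\<lambda>z. g z $ i $ j) differentiable (at y)"
    and compat: "y \<in> U \<Longrightarrow> nabla \<Gamma> (metric_tensor g) y [i, j, k] = 0"
begin

definition h :: "real^7 \<Rightarrow> real^7^7" where "h y = matrix_inv (g y)"

lemma gh: "y \<in> U \<Longrightarrow> g y ** h y = mat 1" and hg: "y \<in> U \<Longrightarrow> h y ** g y = mat 1"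
  using invertible_matrix_inv[OF g_inv] by (auto simp: h_def)

lemma transpose_g: "y \<in> U \<Longrightarrow> transpose (g y) = g y"
  by (simp add: vec_eq_iff transpose_def g_sym[of y])

lemma h_sym: assumes y: "y \<in> U" shows "h y $ i $ j = h y $ j $ i"
proof -
  have "g y ** transpose (h y) = transpose (h y ** g y)" by (simp add: matrix_transpose_mul transpose_g[OF y])
  also have "\<dots> = mat 1" by (simp add: hg[OF y])
  finally have "h y = transpose (h y)" unfolding h_def by (rule matrix_inv_unique)
  then have "h y $ i $ j = transpose (h y) $ i $ j" by (rule arg_cong)
  then show ?thesis by (simp add: transpose_def)
qed

lemma metric_pt: "y \<in> U \<Longrightarrow> metric_pt (h y) (g y)"
  by unfold_locales (auto intro: h_sym g_sym gh)

lemma partial_g: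
  assumes y: "y \<in> U"
  shows "partial i (\<lambda>z. g z $ j $ k) y =
    (\<Sum>a\<in>UNIV. cf \<Gamma> y i j a * g y $ a $ k) + (\<Sum>a\<in>UNIV. cf \<Gamma> y i k a * g y $ j $ a)"
  using compat[OF y, of i j k] by (simp add: nabla_Cons act_Cons metric_tensor_def)

lemma smooth_g: "smooth_on U (\<lambda>z. g z $ j $ k)"
proof -
  have "\<forall>j k. Ck_on n U (\<lambda>z. g z $ j $ k)" for n
  proof (induction n)
    case 0
    show ?case using g_diff
      by (auto intro!: continuous_at_imp_continuous_on differentiable_imp_continuous_within)
  next
    case (Suc n)
    show ?case
    proof (intro allI smooth_onI_partial U g_diff)
      fix i j k
      have c: "Ck_on n U (\<lambda>z. cf \<Gamma> z i j a)" for i j a using cf by (simp add: smooth_on_def)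
      have "Ck_on n U (\<lambda>y. (\<Sum>a\<in>UNIV. cf \<Gamma> y i j a * g y $ a $ k) + (\<Sum>a\<in>UNIV. cf \<Gamma> y i k a * g y $ j $ a))"
        using Suc by (intro Ck_on_add Ck_on_sum Ck_on_mult U c) auto
      then show "Ck_on n U (partial i (\<lambda>z. g z $ j $ k))"
        using Ck_on_cong[OF U partial_g] by simp
    qed
  qed
  then show ?thesis by (simp add: smooth_on_def)
qed

lemma h_diff: "y \<in> U \<Longrightarrow> (\<lambda>z. h z $ i $ j) differentiable (at y)"
  unfolding h_def by (rule differentiable_matrix_inv[OF U]) (auto intro: g_inv g_diff)

text \<open>Differentiates \<open>g y ** h y = mat 1\<close> and inserts \<open>partial_g\<close>.
  The result says that the inverse metric is parallel.\<close>

lemma partial_h: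
  assumes y: "y \<in> U"
  shows "partial i (\<lambda>z. h z $ a $ b) y =
    - (\<Sum>c\<in>UNIV. cf \<Gamma> y i c a * h y $ c $ b) - (\<Sum>c\<in>UNIV. cf \<Gamma> y i c b * h y $ a $ c)"
proof -
  interpret pt: metric_pt "h y" "g y" by (rule metric_pt[OF y])
  have gh': "(\<Sum>s\<in>UNIV. g z $ r $ s * h z $ s $ b) = (if r = b then 1 else 0)" if "z \<in> U" for z r b
    using gh[OF that] by (simp add: matrix_matrix_mult_def mat_def vec_eq_iff)
  have hg': "(\<Sum>r\<in>UNIV. h y $ a $ r * g y $ r $ s) = (if a = s then 1 else 0)" for a s
    by (rule pt.sum_hg)
  have "0 = partial i (\<lambda>z. \<Sum>s\<in>UNIV. g z $ r $ s * h z $ s $ b) y" for r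
    using partial_cong_open[OF U y gh'[of _ r b], where i = i] by (simp add: partial_const)
  also have "\<dots> r = (\<Sum>s\<in>UNIV. partial i (\<lambda>z. g z $ r $ s) y * h y $ s $ b + g y $ r $ s * partial i (\<lambda>z. h z $ s $ b) y)" for r
    by (subst partial_sum) (auto intro!: sum.cong partial_mult differentiable_mult g_diff h_diff y)
  finally have 1: "(\<Sum>s\<in>UNIV. g y $ r $ s * partial i (\<lambda>z. h z $ s $ b) y) =
      - (\<Sum>s\<in>UNIV. partial i (\<lambda>z. g z $ r $ s) y * h y $ s $ b)" for r
    by (simp add: sum.distrib eq_neg_iff_add_eq_0 add.commute)
  have "partial i (\<lambda>z. h z $ a $ b) y = (\<Sum>s\<in>UNIV. (\<Sum>r\<in>UNIV. h y $ a $ r * g y $ r $ s) * partial i (\<lambda>z. h z $ s $ b) y)"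
    by (simp add: hg' if_distrib[of "\<lambda>x. x * _"] cong: if_cong)
  also have "\<dots> = (\<Sum>r\<in>UNIV. h y $ a $ r * (\<Sum>s\<in>UNIV. g y $ r $ s * partial i (\<lambda>z. h z $ s $ b) y))"
    unfolding sum_distrib_left sum_distrib_right by (subst sum.swap) (simp only: mult.assoc)
  also have "\<dots> = - (\<Sum>r\<in>UNIV. h y $ a $ r * (\<Sum>s\<in>UNIV. (\<Sum>c\<in>UNIV. cf \<Gamma> y i r c * g y $ c $ s) * h y $ s $ b))
      - (\<Sum>r\<in>UNIV. h y $ a $ r * (\<Sum>s\<in>UNIV. (\<Sum>c\<in>UNIV. cf \<Gamma> y i s c * g y $ r $ c) * h y $ s $ b))"
    unfolding 1 partial_g[OF y] by (simp add: sum.distrib distrib_right distrib_left right_diff_distrib sum_negf sum_subtractf)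
  also have "(\<Sum>r\<in>UNIV. h y $ a $ r * (\<Sum>s\<in>UNIV. (\<Sum>c\<in>UNIV. cf \<Gamma> y i r c * g y $ c $ s) * h y $ s $ b)) =
      (\<Sum>c\<in>UNIV. cf \<Gamma> y i c b * h y $ a $ c)"
  proof -
    have "(\<Sum>s\<in>UNIV. (\<Sum>c\<in>UNIV. cf \<Gamma> y i r c * g y $ c $ s) * h y $ s $ b) = cf \<Gamma> y i r b" for r
    proof -
      have "(\<Sum>s\<in>UNIV. (\<Sum>c\<in>UNIV. cf \<Gamma> y i r c * g y $ c $ s) * h y $ s $ b) =
          (\<Sum>c\<in>UNIV. cf \<Gamma> y i r c * (\<Sum>s\<in>UNIV. g y $ c $ s * h y $ s $ b))"
        unfolding sum_distrib_left sum_distrib_right by (subst sum.swap) (simp only: mult.assoc)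
      then show ?thesis by (simp add: gh'[OF y] if_distrib[of "\<lambda>x. _ * x"] cong: if_cong)
    qed
    then show ?thesis by (simp add: mult.commute)
  qed
  also have "(\<Sum>r\<in>UNIV. h y $ a $ r * (\<Sum>s\<in>UNIV. (\<Sum>c\<in>UNIV. cf \<Gamma> y i s c * g y $ r $ c) * h y $ s $ b)) =
      (\<Sum>c\<in>UNIV. cf \<Gamma> y i c a * h y $ c $ b)"
  proof -
    have "(\<Sum>r\<in>UNIV. h y $ a $ r * (\<Sum>s\<in>UNIV. (\<Sum>c\<in>UNIV. cf \<Gamma> y i s c * g y $ r $ c) * h y $ s $ b)) =
        (\<Sum>s\<in>UNIV. (\<Sum>r\<in>UNIV. \<Sum>c\<in>UNIV. cf \<Gamma> y i s c * (h y $ a $ r * g y $ r $ c)) * h y $ s $ b)"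
      unfolding sum_distrib_left sum_distrib_right by (subst sum.swap) (simp only: mult_ac)
    also have "\<dots> = (\<Sum>s\<in>UNIV. (\<Sum>c\<in>UNIV. cf \<Gamma> y i s c * (\<Sum>r\<in>UNIV. h y $ a $ r * g y $ r $ c)) * h y $ s $ b)"
      unfolding sum_distrib_left by (subst (2) sum.swap) simp
    finally show ?thesis by (simp add: hg' if_distrib[of "\<lambda>x. _ * x"] cong: if_cong)
  qed
  finally show ?thesis by simp
qed

lemma smooth_h: "smooth_on U (\<lambda>z. h z $ j $ k)"
proof -
  have "\<forall>j k. Ck_on n U (\<lambda>z. h z $ j $ k)" for n
  proof (induction n)
    case 0
    show ?case using h_diff
      by (auto intro!: continuous_at_imp_continuous_on differentiable_imp_continuous_within)
  next
    case (Suc n)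
    show ?case
    proof (intro allI smooth_onI_partial U h_diff)
      fix i a b
      have c: "Ck_on n U (\<lambda>z. cf \<Gamma> z i j a)" for i j a using cf by (simp add: smooth_on_def)
      have "Ck_on n U (\<lambda>y. (\<Sum>c\<in>UNIV. - 1 * (cf \<Gamma> y i c a * h y $ c $ b)) + (\<Sum>c\<in>UNIV. - 1 * (cf \<Gamma> y i c b * h y $ a $ c)))"
        using Suc by (intro Ck_on_add Ck_on_sum Ck_on_mult Ck_on_const U c) auto
      then show "Ck_on n U (partial i (\<lambda>z. h z $ a $ b))"
        using Ck_on_cong[OF U partial_h[of _ i a b], where k = n] by (simp add: sum_negf)
    qed
  qed
  then show ?thesis by (simp add: smooth_on_def)
qed

lemma smooth_lk: "smooth_on U (\<lambda>z. lk (h z) n m)"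
  unfolding lk_def by (intro smooth_on_prod U smooth_h)

lemma partial_lk:
  assumes y: "y \<in> U" and l: "length n = length m"
  shows "partial i (\<lambda>z. lk (h z) n m) y =
    - act (\<lambda>j a. cf \<Gamma> y i a j) (\<lambda>n. lk (h y) n m) n - act (\<lambda>j a. cf \<Gamma> y i a j) (\<lambda>m. lk (h y) n m) m"
  using l
proof (induction n m rule: list_induct2)
  case Nil
  show ?case by (simp add: partial_const)
next
  case (Cons a n b m)
  have "partial i (\<lambda>z. lk (h z) (a # n) (b # m)) y =
      partial i (\<lambda>z. h z $ a $ b) y * lk (h y) n m + h y $ a $ b * partial i (\<lambda>z. lk (h z) n m) y"
    unfolding lk_Cons by (intro partial_mult h_diff smooth_on_differentiable[OF smooth_lk] y)
  then show ?case
    unfolding Cons.IH partial_h[OF y]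
    by (simp only: act_Cons lk_Cons act_cmult mult.assoc[symmetric] sum_distrib_right[symmetric])
      (simp add: algebra_simps)
qed

lemma smooth_contr:
  assumes "smooth_tens U \<alpha>" "smooth_tens U \<beta>"
  shows "smooth_tens U (\<lambda>z. contr (h z) p k (\<alpha> z) (\<beta> z))"
  using assms unfolding smooth_tens_def contr_def
  by (intro allI smooth_on_sum smooth_on_mult U smooth_lk) auto

text \<open>The derivative of the inverse metric yields two derivation terms. By
  \<open>sum_act_transpose\<close> they cancel the connection terms of the contracted slots on
  either side, and a Leibniz rule remains.\<close>

lemma nabla_contr_diff:
  assumes \<alpha>: "\<And>m. (\<lambda>z. \<alpha> z m) differentiable (at y)" and \<beta>: "\<And>m. (\<lambda>z. \<beta> z m) differentiable (at y)"
    and y: "y \<in> U" and pl: "p \<le> length l"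
  shows "nabla \<Gamma> (\<lambda>z. contr (h z) p k (\<alpha> z) (\<beta> z)) y (i # l) =
    contr (h y) p k (\<lambda>m. nabla \<Gamma> \<alpha> y (i # m)) (\<beta> y) l + contr (h y) p k (\<alpha> y) (\<lambda>n. nabla \<Gamma> \<beta> y (i # n)) l"
proof -
  define l1 l2 where "l1 = take p l" and "l2 = drop p l"
  have l: "l = l1 @ l2" and l1: "length l1 = p" using pl by (auto simp: l1_def l2_def)
  let ?S = "{m::7 list. length m = k}" and ?G = "cf \<Gamma> y i" and ?lk = "lk (h y)"
  let ?GT = "\<lambda>j a. cf \<Gamma> y i a j"
  define A where "A m = \<alpha> y (l1 @ m)" for m
  define B where "B n = \<beta> y (n @ l2)" for n
  define A' where "A' m = nabla \<Gamma> \<alpha> y (i # l1 @ m)" for m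
  define B' where "B' n = nabla \<Gamma> \<beta> y (i # n @ l2)" for n
  have pA: "partial i (\<lambda>z. \<alpha> z (l1 @ m)) y = A' m + act ?G (\<lambda>x. \<alpha> y (x @ m)) l1 + act ?G A m" for m
    unfolding partial_nabla[of _ \<alpha> _ _ \<Gamma>] act_append by (simp add: A'_def A_def[abs_def])
  have pB: "partial i (\<lambda>z. \<beta> z (n @ l2)) y = B' n + act ?G B n + act ?G (\<lambda>x. \<beta> y (n @ x)) l2" for n
    unfolding partial_nabla[of _ \<beta> _ _ \<Gamma>] act_append by (simp add: B'_def B_def[abs_def])
  have c: "contr (h z) p k (\<alpha> z) (\<beta> z) l = (\<Sum>m\<in>?S. \<Sum>n\<in>?S. lk (h z) n m * \<alpha> z (l1 @ m) * \<beta> z (n @ l2))" for z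
    by (simp add: contr_def l1_def l2_def)
  have d: "(\<lambda>z. lk (h z) n m) differentiable (at y)" "(\<lambda>z. \<alpha> z m) differentiable (at y)"
    "(\<lambda>z. \<beta> z m) differentiable (at y)" for n m
    using smooth_on_differentiable[OF smooth_lk y] \<alpha> \<beta> by auto
  have "partial i (\<lambda>z. contr (h z) p k (\<alpha> z) (\<beta> z) l) y =
      (\<Sum>m\<in>?S. \<Sum>n\<in>?S. partial i (\<lambda>z. lk (h z) n m * \<alpha> z (l1 @ m) * \<beta> z (n @ l2)) y)"
  proof -
    have "partial i (\<lambda>z. contr (h z) p k (\<alpha> z) (\<beta> z) l) y =
        (\<Sum>m\<in>?S. partial i (\<lambda>z. \<Sum>n\<in>?S. lk (h z) n m * \<alpha> z (l1 @ m) * \<beta> z (n @ l2)) y)"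
      unfolding c by (rule partial_sum) (auto intro!: differentiable_sum differentiable_mult d finite_length_eq)
    also have "\<dots> = (\<Sum>m\<in>?S. \<Sum>n\<in>?S. partial i (\<lambda>z. lk (h z) n m * \<alpha> z (l1 @ m) * \<beta> z (n @ l2)) y)"
      by (rule sum.cong[OF refl]) (rule partial_sum, intro differentiable_mult d)
    finally show ?thesis .
  qed
  also have "\<dots> = (\<Sum>m\<in>?S. \<Sum>n\<in>?S.
      (- act ?GT (\<lambda>n. ?lk n m) n - act ?GT (\<lambda>m. ?lk n m) m) * A m * B n
      + ?lk n m * (A' m + act ?G (\<lambda>x. \<alpha> y (x @ m)) l1 + act ?G A m) * B n
      + ?lk n m * A m * (B' n + act ?G B n + act ?G (\<lambda>x. \<beta> y (n @ x)) l2))"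
  proof (intro sum.cong refl)
    fix m n assume mn: "m \<in> ?S" "n \<in> ?S"
    have "partial i (\<lambda>z. lk (h z) n m * \<alpha> z (l1 @ m) * \<beta> z (n @ l2)) y =
        (partial i (\<lambda>z. lk (h z) n m) y * \<alpha> y (l1 @ m) + ?lk n m * partial i (\<lambda>z. \<alpha> z (l1 @ m)) y) * \<beta> y (n @ l2)
        + ?lk n m * \<alpha> y (l1 @ m) * partial i (\<lambda>z. \<beta> z (n @ l2)) y"
      by (simp add: partial_mult differentiable_mult d)
    then show "partial i (\<lambda>z. lk (h z) n m * \<alpha> z (l1 @ m) * \<beta> z (n @ l2)) y =
      (- act ?GT (\<lambda>n. ?lk n m) n - act ?GT (\<lambda>m. ?lk n m) m) * A m * B n
      + ?lk n m * (A' m + act ?G (\<lambda>x. \<alpha> y (x @ m)) l1 + act ?G A m) * B n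
      + ?lk n m * A m * (B' n + act ?G B n + act ?G (\<lambda>x. \<beta> y (n @ x)) l2)"
      using mn by (simp add: pA pB partial_lk[OF y] A_def B_def distrib_right)
  qed
  also have "\<dots> = - (\<Sum>m\<in>?S. \<Sum>n\<in>?S. act ?GT (\<lambda>n. ?lk n m) n * A m * B n)
      - (\<Sum>m\<in>?S. \<Sum>n\<in>?S. act ?GT (\<lambda>m. ?lk n m) m * A m * B n)
      + (\<Sum>m\<in>?S. \<Sum>n\<in>?S. ?lk n m * A' m * B n) + (\<Sum>m\<in>?S. \<Sum>n\<in>?S. ?lk n m * act ?G (\<lambda>x. \<alpha> y (x @ m)) l1 * B n)
      + (\<Sum>m\<in>?S. \<Sum>n\<in>?S. ?lk n m * act ?G A m * B n)
      + (\<Sum>m\<in>?S. \<Sum>n\<in>?S. ?lk n m * A m * B' n) + (\<Sum>m\<in>?S. \<Sum>n\<in>?S. ?lk n m * A m * act ?G B n)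
      + (\<Sum>m\<in>?S. \<Sum>n\<in>?S. ?lk n m * A m * act ?G (\<lambda>x. \<beta> y (n @ x)) l2)"
    by (simp only: distrib_left distrib_right left_diff_distrib minus_mult_left[symmetric] sum.distrib sum_subtractf sum_negf)
  also have "(\<Sum>m\<in>?S. \<Sum>n\<in>?S. act ?GT (\<lambda>n. ?lk n m) n * A m * B n) = (\<Sum>m\<in>?S. \<Sum>n\<in>?S. ?lk n m * A m * act ?G B n)"
  proof (rule sum.cong[OF refl])
    fix m
    have "(\<Sum>n\<in>?S. act ?GT (\<lambda>n. ?lk n m) n * A m * B n) = A m * (\<Sum>n\<in>?S. act ?GT (\<lambda>n. ?lk n m) n * B n)"
      by (simp only: sum_distrib_left mult_ac)
    also have "\<dots> = A m * (\<Sum>n\<in>?S. ?lk n m * act ?G B n)" by (simp only: sum_act_transpose)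
    finally show "(\<Sum>n\<in>?S. act ?GT (\<lambda>n. ?lk n m) n * A m * B n) = (\<Sum>n\<in>?S. ?lk n m * A m * act ?G B n)"
      by (simp only: sum_distrib_left mult_ac)
  qed
  also have "(\<Sum>m\<in>?S. \<Sum>n\<in>?S. act ?GT (\<lambda>m. ?lk n m) m * A m * B n) = (\<Sum>m\<in>?S. \<Sum>n\<in>?S. ?lk n m * act ?G A m * B n)"
  proof -
    have "(\<Sum>m\<in>?S. act ?GT (\<lambda>m. ?lk n m) m * A m * B n) = (\<Sum>m\<in>?S. ?lk n m * act ?G A m * B n)" for n
      using sum_act_transpose[where k = k and G = ?G and F = "\<lambda>m. ?lk n m" and K = A] by (simp only: sum_distrib_right[symmetric])
    then show ?thesis by (subst sum.swap, subst (2) sum.swap) simp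
  qed
  also have "(\<Sum>m\<in>?S. \<Sum>n\<in>?S. ?lk n m * act ?G (\<lambda>x. \<alpha> y (x @ m)) l1 * B n) =
      act ?G (\<lambda>x. contr (h y) p k (\<alpha> y) (\<beta> y) (x @ l2)) l1"
  proof -
    have "act ?G (\<lambda>x. contr (h y) p k (\<alpha> y) (\<beta> y) (x @ l2)) l1 =
        act ?G (\<lambda>x. \<Sum>m\<in>?S. \<Sum>n\<in>?S. (?lk n m * B n) * \<alpha> y (x @ m)) l1"
      by (rule act_cong) (simp add: contr_def l1 B_def mult_ac)
    then show ?thesis by (simp only: act_sum act_cmult) (simp only: mult_ac)
  qed
  also have "(\<Sum>m\<in>?S. \<Sum>n\<in>?S. ?lk n m * A m * act ?G (\<lambda>x. \<beta> y (n @ x)) l2) =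
      act ?G (\<lambda>x. contr (h y) p k (\<alpha> y) (\<beta> y) (l1 @ x)) l2"
  proof -
    have "act ?G (\<lambda>x. contr (h y) p k (\<alpha> y) (\<beta> y) (l1 @ x)) l2 =
        act ?G (\<lambda>x. \<Sum>m\<in>?S. \<Sum>n\<in>?S. (?lk n m * A m) * \<beta> y (n @ x)) l2"
      by (rule act_cong) (simp add: contr_def l1 A_def mult_ac)
    then show ?thesis by (simp add: act_sum act_cmult)
  qed
  finally have "nabla \<Gamma> (\<lambda>z. contr (h z) p k (\<alpha> z) (\<beta> z)) y (i # l) =
      (\<Sum>m\<in>?S. \<Sum>n\<in>?S. ?lk n m * A' m * B n) + (\<Sum>m\<in>?S. \<Sum>n\<in>?S. ?lk n m * A m * B' n)"
    unfolding nabla_Cons by (simp add: l act_append)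
  then show ?thesis
    by (simp add: contr_def A_def B_def A'_def B'_def l1_def l2_def)
qed

lemma nabla_contr:
  assumes "smooth_tens U \<alpha>" "smooth_tens U \<beta>" "y \<in> U" "p \<le> length l"
  shows "nabla \<Gamma> (\<lambda>z. contr (h z) p k (\<alpha> z) (\<beta> z)) y (i # l) =
    contr (h y) p k (\<lambda>m. nabla \<Gamma> \<alpha> y (i # m)) (\<beta> y) l + contr (h y) p k (\<alpha> y) (\<lambda>n. nabla \<Gamma> \<beta> y (i # n)) l"
  using assms by (intro nabla_contr_diff smooth_tens_differentiable)

end

section \<open>Curvature algebra at a point\<close>

text \<open>Curvature, torsion, its covariant derivative \<open>DT\<close> and the torsion square
  \<open>S\<close> at one point. \<open>closed\<close> is dT = 0, and \<open>action\<close> says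
  that the curvature operators annihilate phi.\<close>

locale curv_pt = g2_pt +
  fixes R :: "7 \<Rightarrow> 7 \<Rightarrow> 7 \<Rightarrow> 7 \<Rightarrow> real" and T :: "7 \<Rightarrow> 7 \<Rightarrow> 7 \<Rightarrow> real"
    and DT :: "7 \<Rightarrow> 7 \<Rightarrow> 7 \<Rightarrow> 7 \<Rightarrow> real"
    and S :: "7 \<Rightarrow> 7 \<Rightarrow> 7 \<Rightarrow> 7 \<Rightarrow> real"
  assumes S_def: "S = (\<lambda>a b c d. t (\<lambda>s s'. T a b s * T s' c d))"
    and R12: "R i j k l = - R j i k l" and R34: "R i j k l = - R i j l k"
    and T12: "T i j k = - T j i k" and T23: "T i j k = - T i k j"
    and DT23: "DT i j k l = - DT i k j l" and DT34: "DT i j k l = - DT i j l k"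
    and bianchi: "R x j k l + R j k x l + R k x j l =
      DT x j k l + DT j k x l + DT k x j l + (S x j k l + S j k x l + S k x j l)"
    and closed: "DT a b c d - DT b a c d + DT c a b d - DT d a b c
      + (S a b c d - S a c b d + S a d b c + S b c a d - S b d a c + S c d a b) = 0"
    and action: "t (\<lambda>a b. R i j k a * phi b l m) + t (\<lambda>a b. R i j l a * phi k b m)
      + t (\<lambda>a b. R i j m a * phi k l b) = 0"
begin

section \<open>The first Bianchi identity for closed skew torsion\<close>

lemma T_cyc: "T i j k = T j k i"
  using T12[of i j k] T23[of j i k] by simp

lemma S12: "S a b c d = - S b a c d"
  unfolding S_def using T12[of a b] by (simp add: tr_uminus)

lemma S34: "S a b c d = - S a b d c"
proof -
  have "T s c d = - T s d c" for s by (rule T23)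
  then have "t (\<lambda>s s'. T a b s * T s' c d) = t (\<lambda>s s'. - (T a b s * T s' d c))"
    by (intro tr_cong) simp
  then show ?thesis unfolding S_def by (simp only: tr_uminus)
qed

lemma S_pair: "S a b c d = S c d a b"
proof -
  have "t (\<lambda>s s'. T a b s * T s' c d) = t (\<lambda>s s'. T a b s' * T s c d)" by (rule tr_swap)
  also have "\<dots> = t (\<lambda>s s'. T c d s * T s' a b)"
    by (intro tr_cong) (simp only: T_cyc[of _ c d] T_cyc[of _ a b] mult.commute)
  finally show ?thesis unfolding S_def .
qed

text \<open>Unlike \<open>S\<close>, this cyclic sum is skew in all four slots.\<close>

definition sigma :: "7 \<Rightarrow> 7 \<Rightarrow> 7 \<Rightarrow> 7 \<Rightarrow> real" where
  "sigma x y z v = S x y z v + S y z x v + S z x y v"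

lemma sigma_swap: "sigma x y z v = - sigma y x z v" "sigma x y z v = - sigma x z y v" "sigma x y z v = - sigma x y v z"
proof -
  show "sigma x y z v = - sigma y x z v"
    unfolding sigma_def using S12[of x y z v] S12[of y z x v] S12[of z x y v] by simp
  show "sigma x y z v = - sigma x z y v"
    unfolding sigma_def using S12[of x y z v] S12[of y z x v] S12[of z x y v] by simp
  show "sigma x y z v = - sigma x y v z"
    unfolding sigma_def using S34[of x y z v] S12[of y v x z] S_pair[of y v x z] S12[of z x y v] S34[of x z y v]
      S12[of v x y z] S_pair[of y z x v] S34[of x v y z] S12[of x v y z] by simp
qed

text \<open>dT = 0 trades the cyclic sum of \<open>DT\<close> for the single term with
  \<open>v\<close> in front, at the cost of two copies of \<open>sigma\<close>. One of them cancels
  against the torsion square in \<open>bianchi\<close>.\<close>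

lemma bianchi': "R x y z v + R y z x v + R z x y v = DT v x y z - sigma x y z v"
  using bianchi[of x y z v] closed[of x y z v] DT23[of y x z v] S_pair[of z v x y] S_pair[of y v x z]
    S_pair[of x v y z] S12[of z x y v] unfolding sigma_def by simp

text \<open>The octahedron argument transfers the Bianchi identity to the last three arguments.\<close>

lemma bianchi_last: "R v x y z + R v y z x + R v z x y = DT v x y z"
proof -
  \<comment> \<open>Four Bianchi sums, each with another argument in the last place. With the skew
    symmetry of the curvature in either pair they form a linear system that yields the
    claim.\<close>
  note b = bianchi'[of x y z v] bianchi'[of y z v x] bianchi'[of z v x y] bianchi'[of v x y z]
  note r = R12[of y z v x] R34[of y z v x] R12[of z v y x] R34[of z v y x] R34[of v z y x] R12[of v y z x]
    R12[of z v x y] R12[of v x z y] R34[of v x z y] R12[of x z v y] R34[of x z v y] R34[of z x v y]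
    R34[of x y v z] R12[of y v x z] R34[of v y x z]
  note s = sigma_swap(3)[of y z v x] sigma_swap(2)[of y z x v] sigma_swap(1)[of y x z v]
    sigma_swap(2)[of z v x y] sigma_swap(3)[of z x v y] sigma_swap(1)[of z x y v] sigma_swap(2)[of x z y v]
    sigma_swap(1)[of v x y z] sigma_swap(2)[of x v y z] sigma_swap(3)[of x y v z]
  note d = closed[of v x y z] DT23[of x v y z] DT34[of x y v z] DT34[of x v y z] DT23[of x y z v] DT23[of x y v z]
    DT23[of y v x z] DT34[of y x v z] DT23[of y x z v] DT34[of y z v x] DT23[of y z v x] DT34[of y v x z]
    DT23[of z v x y] DT34[of z x v y] DT34[of z v x y]
  note q = S_pair[of v x y z] S_pair[of v y x z] S_pair[of v z x y] S_pair[of x y v z] S_pair[of x z v y] S_pair[of y z v x]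
    S12[of y z x v] S34[of y z x v] S34[of x y z v] S12[of z x y v] S34[of z x y v] S34[of x z y v]
  show ?thesis using b r s d q unfolding sigma_def by argo
qed

definition Ric :: "7 \<Rightarrow> 7 \<Rightarrow> real" where "Ric i j = t (\<lambda>a b. R a i j b)"

lemma Ric_eq: "t (\<lambda>a b. R i a b j) = Ric i j" "t (\<lambda>a b. R a i b j) = - Ric i j" "t (\<lambda>a b. R i a j b) = - Ric i j"
proof -
  have "t (\<lambda>a b. R i a b j) = t (\<lambda>a b. R a i j b)"
    using R12[of i _ _ j] R34[of _ i _ j] by (intro tr_cong) simp
  then show 1: "t (\<lambda>a b. R i a b j) = Ric i j" by (simp add: Ric_def)
  have "t (\<lambda>a b. R a i b j) = t (\<lambda>a b. - R i a b j)" by (intro tr_cong) (rule R12)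
  then show "t (\<lambda>a b. R a i b j) = - Ric i j" by (simp add: tr_uminus 1)
  have "t (\<lambda>a b. R i a j b) = t (\<lambda>a b. - R i a b j)" by (intro tr_cong) (rule R34)
  then show "t (\<lambda>a b. R i a j b) = - Ric i j" by (simp add: tr_uminus 1)
qed

text \<open>A trace of \<open>bianchi'\<close>: \<open>sigma\<close> and the trace over the skew
  last pair drop out, and the divergence of the torsion is left.\<close>

lemma Ric_antisym: "Ric y z - Ric z y = t (\<lambda>a b. DT a b y z)"
proof -
  have "t (\<lambda>a b. R a y z b + R y z a b + R z a y b) = t (\<lambda>a b. DT b a y z - sigma a y z b)"
    by (simp only: bianchi')
  then have "Ric y z + t (\<lambda>a b. R y z a b) - Ric z y = t (\<lambda>a b. DT b a y z) - t (\<lambda>a b. sigma a y z b)"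
    by (simp add: tr_linear Ric_eq Ric_def[symmetric])
  moreover have "t (\<lambda>a b. R y z a b) = 0" by (rule tr_antisym) (rule R34)
  moreover have "t (\<lambda>a b. sigma a y z b) = 0"
  proof (rule tr_antisym)
    show "sigma a y z b = - sigma b y z a" for a b
      using sigma_swap(1)[of a y z b] sigma_swap(2)[of y a z b] sigma_swap(3)[of y z a b]
        sigma_swap(2)[of y z b a] sigma_swap(1)[of y b z a] by simp
  qed
  moreover have "t (\<lambda>a b. DT b a y z) = t (\<lambda>a b. DT a b y z)" by (rule tr_swap)
  ultimately show ?thesis by simp
qed

lemma g2_R:
  "t (\<lambda>j j'. t (\<lambda>a b. R v w j a * psi j' b i l)) = - 2 * R v w i l"
  "t (\<lambda>j j'. t (\<lambda>a b. R v w j a * phi j' b m)) = 0"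
  by (rule g2_algebra; (rule R34 | rule action))+

section \<open>The Ricci tensor from the derivative of the torsion\<close>

definition c3 :: "(7 \<Rightarrow> 7 \<Rightarrow> 7 \<Rightarrow> real) \<Rightarrow> (7 \<Rightarrow> 7 \<Rightarrow> 7 \<Rightarrow> real) \<Rightarrow> real" where
  "c3 A B = t (\<lambda>a a'. t (\<lambda>b b'. t (\<lambda>c c'. A a b c * B a' b' c')))"

lemma c3_add: "c3 (\<lambda>a b c. A a b c + A' a b c) B = c3 A B + c3 A' B"
  by (simp only: c3_def distrib_right tr_add)

lemma c3_cyc: "c3 (\<lambda>a b c. A b c a) (\<lambda>a b c. B b c a) = c3 A B"
proof -
  have "c3 (\<lambda>a b c. A b c a) (\<lambda>a b c. B b c a) = t (\<lambda>b b'. t (\<lambda>a a'. t (\<lambda>c c'. A b c a * B b' c' a')))"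
    unfolding c3_def by (rule tr_comm)
  also have "\<dots> = c3 A B" unfolding c3_def by (rule tr_cong) (rule tr_comm)
  finally show ?thesis .
qed

lemma c3_cyc_sum:
  assumes "\<And>a b c. B a b c = B b c a"
  shows "c3 (\<lambda>a b c. A a b c + A b c a + A c a b) B = 3 * c3 A B"
proof -
  have B: "(\<lambda>a b c. B b c a) = B" using assms by (intro ext) (rule sym)
  have 1: "c3 (\<lambda>a b c. A b c a) B = c3 A B" for A using c3_cyc[of A B] unfolding B .
  show ?thesis unfolding c3_add using 1[of A] 1[of "\<lambda>a b c. A b c a"] by simp
qed

lemma psi_cyc: "psi a b c j = psi b c a j"
  using psi_swap(1)[of a b c j] psi_swap(2)[of b a c j] by simp

text \<open>\<open>bianchi_last\<close> writes \<open>DT v\<close> as a cyclic sum of curvature, and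
  a cyclic second factor makes the three terms equal.\<close>

lemma c3_DT:
  assumes B: "\<And>a b c. B a b c = B b c a"
  shows "c3 (DT v) B = 3 * t (\<lambda>a a'. t (\<lambda>b b'. t (\<lambda>c c'. R v a b c * B b' c' a')))"
proof -
  have "c3 (DT v) B = c3 (\<lambda>a b c. R v a b c + R v b c a + R v c a b) B"
    by (simp only: bianchi_last)
  also have "\<dots> = 3 * c3 (\<lambda>a b c. R v a b c) B" using B by (rule c3_cyc_sum)
  also have "c3 (\<lambda>a b c. R v a b c) B = c3 (\<lambda>a b c. R v a b c) (\<lambda>a b c. B b c a)"
  proof -
    have "(\<lambda>a b c. B b c a) = B" by (intro ext) (rule B[symmetric])
    then show ?thesis by (simp only:)
  qed
  finally show ?thesis by (simp only: c3_def)
qed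

text \<open>The -6 is 3 from the cyclic sum times the eigenvalue -2 in \<open>g2_R\<close>.\<close>

lemma c3_DT_psi: "c3 (DT v) (\<lambda>a b c. psi a b c j) = - 6 * Ric v j"
proof -
  have "c3 (DT v) (\<lambda>a b c. psi a b c j) = 3 * t (\<lambda>a a'. t (\<lambda>b b'. t (\<lambda>c c'. R v a b c * psi b' c' a' j)))"
    by (rule c3_DT) (rule psi_cyc)
  also have "\<dots> = 3 * t (\<lambda>a a'. - 2 * R v a a' j)" by (simp only: g2_R)
  finally show ?thesis by (simp add: tr_linear Ric_eq)
qed

text \<open>Curvature in g_2 contracts to 0 with phi. Because phi is parallel, this makes (T, phi)
  constant.\<close>

lemma c3_DT_phi: "c3 (DT v) phi = 0"
proof -
  have "c3 (DT v) phi = 3 * t (\<lambda>a a'. t (\<lambda>b b'. t (\<lambda>c c'. R v a b c * phi b' c' a')))"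
    by (rule c3_DT) (rule phi_cyc)
  also have "\<dots> = 0" by (simp only: g2_R tr_0 mult_zero_right)
  finally show ?thesis .
qed

definition Um :: "(7 \<Rightarrow> 7 \<Rightarrow> 7 \<Rightarrow> real) \<Rightarrow> 7 \<Rightarrow> 7 \<Rightarrow> real" where
  "Um A s e = t (\<lambda>a a'. t (\<lambda>b b'. A s a b * phi a' b' e))"

text \<open>\<open>psi\<close> is traded for two phi, and skew symmetry removes the metric terms.
  The result has the shape of the contraction in \<open>th\<close>, so the formula for Ric becomes
  one for the Lee form.\<close>

lemma c3_psi:
  assumes A: "\<And>a b c. A a b c = - A b a c" "\<And>a b c. A a b c = - A a c b"
  shows "c3 A (\<lambda>a b c. psi a b c j) = - t (\<lambda>c c'. t (\<lambda>e e'. Um A c e * phi c' e' j))"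
proof -
  have A_cyc: "A a b c = A c a b" for a b c using A(2)[of a b c] A(1)[of a c b] by simp
  have psi: "psi a b c j = - t (\<lambda>e e'. phi a b e * phi c e' j) - g $ a $ c * g $ b $ j + g $ a $ j * g $ b $ c" for a b c
  proof -
    have "t (\<lambda>e e'. phi a b e * phi c j e') = t (\<lambda>e e'. - (phi a b e * phi c e' j))"
    proof (intro tr_cong)
      show "phi a b e * phi c j e' = - (phi a b e * phi c e' j)" for e e'
        using phi_swap(2)[of c j e'] by simp
    qed
    then show ?thesis using phi_phi[of a b c j] by (simp add: tr_uminus)
  qed
  have e: "A a b c * psi a' b' c' j = - (t (\<lambda>e e'. A c a b * phi a' b' e * phi c' e' j))
      - A a b c * g $ a' $ c' * g $ b' $ j + A a b c * g $ b' $ c' * g $ a' $ j" for a b c a' b' c'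
    unfolding psi by (simp only: A_cyc[of a b c] tr_cmult mult.assoc) (simp add: algebra_simps)
  have z1: "t (\<lambda>a a'. t (\<lambda>b b'. t (\<lambda>c c'. A a b c * g $ a' $ c' * g $ b' $ j))) = 0"
  proof -
    have "t (\<lambda>a a'. t (\<lambda>b b'. t (\<lambda>c c'. A a b c * g $ a' $ c' * g $ b' $ j))) = t (\<lambda>a a'. t (\<lambda>b b'. A a b a' * g $ b' $ j))"
      by (simp only: tr_multc tr_metric)
    also have "\<dots> = t (\<lambda>a a'. A a j a')" by (simp only: tr_metric)
    also have "\<dots> = 0"
    proof (rule tr_antisym)
      show "A a j b = - A b j a" for a b using A(1)[of a j b] A(2)[of j a b] A(1)[of j b a] by simp
    qed
    finally show ?thesis .
  qed
  have z2: "t (\<lambda>a a'. t (\<lambda>b b'. t (\<lambda>c c'. A a b c * g $ b' $ c' * g $ a' $ j))) = 0"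
  proof -
    have "t (\<lambda>a a'. t (\<lambda>b b'. t (\<lambda>c c'. A a b c * g $ b' $ c' * g $ a' $ j))) = t (\<lambda>a a'. t (\<lambda>b b'. A a b b') * g $ a' $ j)"
      by (simp only: tr_multc tr_metric)
    also have "\<dots> = t (\<lambda>a a'. 0 * g $ a' $ j)"
      by (intro tr_cong arg_cong2[where f = "(*)"] tr_antisym A(2) refl)
    finally show ?thesis by (simp add: tr_0)
  qed
  have "c3 A (\<lambda>a b c. psi a b c j) = - t (\<lambda>a a'. t (\<lambda>b b'. t (\<lambda>c c'. t (\<lambda>e e'. A c a b * phi a' b' e * phi c' e' j))))"
    unfolding c3_def e tr_add tr_diff tr_uminus z1 z2 by simp
  also have "t (\<lambda>a a'. t (\<lambda>b b'. t (\<lambda>c c'. t (\<lambda>e e'. A c a b * phi a' b' e * phi c' e' j)))) =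
      t (\<lambda>a a'. t (\<lambda>c c'. t (\<lambda>b b'. t (\<lambda>e e'. A c a b * phi a' b' e * phi c' e' j))))"
    by (rule tr_cong) (rule tr_comm)
  also have "\<dots> = t (\<lambda>c c'. t (\<lambda>a a'. t (\<lambda>b b'. t (\<lambda>e e'. A c a b * phi a' b' e * phi c' e' j))))"
    by (rule tr_comm)
  also have "\<dots> = t (\<lambda>c c'. t (\<lambda>a a'. t (\<lambda>e e'. t (\<lambda>b b'. A c a b * phi a' b' e * phi c' e' j))))"
    by (rule tr_cong, rule tr_cong) (rule tr_comm)
  also have "\<dots> = t (\<lambda>c c'. t (\<lambda>e e'. t (\<lambda>a a'. t (\<lambda>b b'. A c a b * phi a' b' e * phi c' e' j))))"
    by (rule tr_cong) (rule tr_comm)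
  also have "\<dots> = t (\<lambda>c c'. t (\<lambda>e e'. Um A c e * phi c' e' j))"
    by (simp only: tr_multc Um_def)
  finally show ?thesis .
qed

lemma Ric_Um: "Ric v j = 1 / 6 * t (\<lambda>c c'. t (\<lambda>e e'. Um (DT v) c e * phi c' e' j))"
  using c3_psi[of "DT v" j, OF DT23 DT34] c3_DT_psi[of v j] by simp

section \<open>The trace of the Ricci tensor\<close>

definition c4 :: "(7 \<Rightarrow> 7 \<Rightarrow> 7 \<Rightarrow> 7 \<Rightarrow> real) \<Rightarrow> real" where
  "c4 F = t (\<lambda>a a'. t (\<lambda>b b'. t (\<lambda>c c'. t (\<lambda>d d'. psi a b c d * F a' b' c' d'))))"

lemma c4_swap: "c4 (\<lambda>a b c d. F b a c d) = - c4 F" "c4 (\<lambda>a b c d. F a c b d) = - c4 F" "c4 (\<lambda>a b c d. F a b d c) = - c4 F"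
proof -
  have "c4 (\<lambda>a b c d. F b a c d) = t (\<lambda>b b'. t (\<lambda>a a'. t (\<lambda>c c'. t (\<lambda>d d'. psi a b c d * F b' a' c' d'))))"
    unfolding c4_def by (rule tr_comm)
  also have "\<dots> = t (\<lambda>b b'. t (\<lambda>a a'. t (\<lambda>c c'. t (\<lambda>d d'. - (psi b a c d * F b' a' c' d')))))"
  proof (intro tr_cong)
    show "psi a b c d * F b' a' c' d' = - (psi b a c d * F b' a' c' d')" for a a' b b' c c' d d'
      using psi_swap(1)[of a b c d] by simp
  qed
  finally show "c4 (\<lambda>a b c d. F b a c d) = - c4 F" by (simp only: tr_uminus c4_def)
  have "c4 (\<lambda>a b c d. F a c b d) = t (\<lambda>a a'. t (\<lambda>c c'. t (\<lambda>b b'. t (\<lambda>d d'. psi a b c d * F a' c' b' d'))))"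
    unfolding c4_def by (rule tr_cong) (rule tr_comm)
  also have "\<dots> = t (\<lambda>a a'. t (\<lambda>c c'. t (\<lambda>b b'. t (\<lambda>d d'. - (psi a c b d * F a' c' b' d')))))"
  proof (intro tr_cong)
    show "psi a b c d * F a' c' b' d' = - (psi a c b d * F a' c' b' d')" for a a' b b' c c' d d'
      using psi_swap(2)[of a b c d] by simp
  qed
  finally show "c4 (\<lambda>a b c d. F a c b d) = - c4 F" by (simp only: tr_uminus c4_def)
  have "c4 (\<lambda>a b c d. F a b d c) = t (\<lambda>a a'. t (\<lambda>b b'. t (\<lambda>d d'. t (\<lambda>c c'. psi a b c d * F a' b' d' c'))))"
    unfolding c4_def by (rule tr_cong, rule tr_cong) (rule tr_comm)
  also have "\<dots> = t (\<lambda>a a'. t (\<lambda>b b'. t (\<lambda>d d'. t (\<lambda>c c'. - (psi a b d c * F a' b' d' c')))))"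
  proof (intro tr_cong)
    show "psi a b c d * F a' b' d' c' = - (psi a b d c * F a' b' d' c')" for a a' b b' c c' d d'
      using psi_swap(3)[of a b c d] by simp
  qed
  finally show "c4 (\<lambda>a b c d. F a b d c) = - c4 F" by (simp only: tr_uminus c4_def)
qed

lemma c4_linear: "c4 (\<lambda>a b c d. F a b c d + G a b c d) = c4 F + c4 G"
  "c4 (\<lambda>a b c d. F a b c d - G a b c d) = c4 F - c4 G"
  by (simp_all only: c4_def distrib_left right_diff_distrib tr_add tr_diff)

text \<open>dT = 0 contracted with \<open>psi\<close>: the four derivative terms agree, as do the
  six quadratic ones.\<close>

lemma c4_DT: "2 * c4 DT = - 3 * c4 S"
proof -
  have "c4 (\<lambda>a b c d. DT a b c d - DT b a c d + DT c a b d - DT d a b c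
      + (S a b c d - S a c b d + S a d b c + S b c a d - S b d a c + S c d a b)) = 0"
    by (simp add: closed c4_def tr_0)
  moreover have "c4 (\<lambda>a b c d. DT b a c d) = - c4 DT" by (rule c4_swap)
  moreover have "c4 (\<lambda>a b c d. DT c a b d) = c4 DT"
    using c4_swap(2)[of "\<lambda>a b c d. DT b a c d"] c4_swap(1)[of DT] by simp
  moreover have "c4 (\<lambda>a b c d. DT d a b c) = - c4 DT"
    using c4_swap(3)[of "\<lambda>a b c d. DT c a b d"] c4_swap(2)[of "\<lambda>a b c d. DT b a c d"] c4_swap(1)[of DT] by simp
  moreover have "c4 (\<lambda>a b c d. S a c b d) = - c4 S" by (rule c4_swap)
  moreover have "c4 (\<lambda>a b c d. S a d b c) = c4 S"
    using c4_swap(3)[of "\<lambda>a b c d. S a c b d"] c4_swap(2)[of S] by simp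
  moreover have "c4 (\<lambda>a b c d. S b c a d) = c4 S"
    using c4_swap(1)[of "\<lambda>a b c d. S a c b d"] c4_swap(2)[of S] by simp
  moreover have "c4 (\<lambda>a b c d. S b d a c) = - c4 S"
    using c4_swap(1)[of "\<lambda>a b c d. S a d b c"] c4_swap(3)[of "\<lambda>a b c d. S a c b d"] c4_swap(2)[of S] by simp
  moreover have "c4 (\<lambda>a b c d. S c d a b) = c4 S"
    using S_pair by (simp add: fun_eq_iff[symmetric] c4_def)
  ultimately show ?thesis unfolding c4_linear by simp
qed

text \<open>After \<open>phi_phi\<close>, the product of two phi splits the sum into two copies of
  \<open>Um T\<close>, and each metric term subtracts |T|^2.\<close>

lemma c4_S: "c4 S = t (\<lambda>s s'. t (\<lambda>e e'. Um T s e * Um T s' e')) - 2 * c3 T T"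
proof -
  have psi: "psi a b c d = t (\<lambda>e e'. phi a b e * phi c d e') - g $ a $ c * g $ b $ d + g $ a $ d * g $ b $ c" for a b c d
    using phi_phi[of a b c d] by simp
  have e: "psi a b c d * S a' b' c' d' =
      t (\<lambda>s s'. t (\<lambda>e e'. (T s a' b' * phi a b e) * (T s' c' d' * phi c d e')))
      - g $ a $ c * (g $ b $ d * S a' b' c' d') + g $ b $ c * (g $ a $ d * S a' b' c' d')" for a b c d a' b' c' d'
  proof -
    have "t (\<lambda>e e'. phi a b e * phi c d e') * S a' b' c' d' =
        t (\<lambda>e e'. t (\<lambda>s s'. (T s a' b' * phi a b e) * (T s' c' d' * phi c d e')))"
      unfolding S_def
      by (simp only: tr_multc[symmetric] tr_cmult[symmetric] T_cyc[of _ a' b', symmetric] mult_ac)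
    also have "\<dots> = t (\<lambda>s s'. t (\<lambda>e e'. (T s a' b' * phi a b e) * (T s' c' d' * phi c d e')))"
      by (rule tr_comm)
    finally show ?thesis unfolding psi by (simp add: algebra_simps)
  qed
  have z1: "t (\<lambda>a a'. t (\<lambda>b b'. t (\<lambda>c c'. t (\<lambda>d d'. g $ a $ c * (g $ b $ d * S a' b' c' d'))))) = c3 T T"
  proof -
    have "t (\<lambda>a a'. t (\<lambda>b b'. t (\<lambda>c c'. t (\<lambda>d d'. g $ a $ c * (g $ b $ d * S a' b' c' d'))))) =
        t (\<lambda>a a'. t (\<lambda>b b'. S a' b' a b))"
      by (simp only: tr_cmult tr_metric)
    also have "\<dots> = c3 T T"
    proof -
      have "S a' b' a b = t (\<lambda>s s'. T a b s * T a' b' s')" for a a' b b'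
      proof -
        have "S a' b' a b = t (\<lambda>s s'. T a' b' s' * T s a b)" unfolding S_def by (rule tr_swap)
        then show ?thesis by (simp only: T_cyc[of _ a b] mult.commute)
      qed
      then show ?thesis by (simp only: c3_def)
    qed
    finally show ?thesis .
  qed
  have z2: "t (\<lambda>a a'. t (\<lambda>b b'. t (\<lambda>c c'. t (\<lambda>d d'. g $ b $ c * (g $ a $ d * S a' b' c' d'))))) = - c3 T T"
  proof -
    have "t (\<lambda>a a'. t (\<lambda>b b'. t (\<lambda>c c'. t (\<lambda>d d'. g $ b $ c * (g $ a $ d * S a' b' c' d'))))) =
        t (\<lambda>a a'. t (\<lambda>b b'. S a' b' b a))"
      by (simp only: tr_cmult tr_metric)
    also have "\<dots> = t (\<lambda>a a'. t (\<lambda>b b'. - S a' b' a b))"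
      by (intro tr_cong) (rule S34)
    also have "\<dots> = - t (\<lambda>a a'. t (\<lambda>b b'. t (\<lambda>c c'. t (\<lambda>d d'. g $ a $ c * (g $ b $ d * S a' b' c' d')))))"
      by (simp only: tr_cmult tr_metric tr_uminus)
    finally show ?thesis unfolding z1 .
  qed
  have "c4 S = t (\<lambda>a a'. t (\<lambda>b b'. t (\<lambda>c c'. t (\<lambda>d d'.
      t (\<lambda>s s'. t (\<lambda>e e'. (T s a' b' * phi a b e) * (T s' c' d' * phi c d e'))))))) - c3 T T - c3 T T"
    unfolding c4_def e tr_add tr_diff z1 z2 by simp
  also have "t (\<lambda>a a'. t (\<lambda>b b'. t (\<lambda>c c'. t (\<lambda>d d'.
      t (\<lambda>s s'. t (\<lambda>e e'. (T s a' b' * phi a b e) * (T s' c' d' * phi c d e'))))))) =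
      t (\<lambda>s s'. t (\<lambda>e e'. t (\<lambda>a a'. t (\<lambda>b b'. t (\<lambda>c c'. t (\<lambda>d d'.
      (T s a' b' * phi a b e) * (T s' c' d' * phi c d e')))))))"
  proof -
    let ?f = "\<lambda>a a' b b' c c' d d' s s' e e'. (T s a' b' * phi a b e) * (T s' c' d' * phi c d e')"
    have m: "t (\<lambda>d d'. t (\<lambda>s s'. t (\<lambda>e e'. G d d' s s' e e'))) = t (\<lambda>s s'. t (\<lambda>e e'. t (\<lambda>d d'. G d d' s s' e e')))" for G
    proof -
      have "t (\<lambda>d d'. t (\<lambda>s s'. t (\<lambda>e e'. G d d' s s' e e'))) = t (\<lambda>s s'. t (\<lambda>d d'. t (\<lambda>e e'. G d d' s s' e e')))"
        by (rule tr_comm)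
      also have "\<dots> = t (\<lambda>s s'. t (\<lambda>e e'. t (\<lambda>d d'. G d d' s s' e e')))"
        by (rule tr_cong) (rule tr_comm)
      finally show ?thesis .
    qed
    have "t (\<lambda>a a'. t (\<lambda>b b'. t (\<lambda>c c'. t (\<lambda>d d'. t (\<lambda>s s'. t (\<lambda>e e'. ?f a a' b b' c c' d d' s s' e e')))))) =
        t (\<lambda>a a'. t (\<lambda>b b'. t (\<lambda>c c'. t (\<lambda>s s'. t (\<lambda>e e'. t (\<lambda>d d'. ?f a a' b b' c c' d d' s s' e e'))))))"
      by (rule tr_cong, rule tr_cong, rule tr_cong) (rule m)
    also have "\<dots> = t (\<lambda>a a'. t (\<lambda>b b'. t (\<lambda>s s'. t (\<lambda>e e'. t (\<lambda>c c'. t (\<lambda>d d'. ?f a a' b b' c c' d d' s s' e e'))))))"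
      by (rule tr_cong, rule tr_cong) (rule m)
    also have "\<dots> = t (\<lambda>a a'. t (\<lambda>s s'. t (\<lambda>e e'. t (\<lambda>b b'. t (\<lambda>c c'. t (\<lambda>d d'. ?f a a' b b' c c' d d' s s' e e'))))))"
      by (rule tr_cong) (rule m)
    also have "\<dots> = t (\<lambda>s s'. t (\<lambda>e e'. t (\<lambda>a a'. t (\<lambda>b b'. t (\<lambda>c c'. t (\<lambda>d d'. ?f a a' b b' c c' d d' s s' e e'))))))"
      by (rule m)
    finally show ?thesis .
  qed
  also have "\<dots> = t (\<lambda>s s'. t (\<lambda>e e'. Um T s e * Um T s' e'))"
  proof -
    have sw: "t (\<lambda>a a'. t (\<lambda>b b'. T s a' b' * phi a b e)) = Um T s e" for s e
    proof -
      have "t (\<lambda>a a'. t (\<lambda>b b'. T s a' b' * phi a b e)) = t (\<lambda>a a'. t (\<lambda>b b'. T s a b' * phi a' b e))"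
        by (rule tr_swap)
      also have "\<dots> = Um T s e" unfolding Um_def by (rule tr_cong) (rule tr_swap)
      finally show ?thesis .
    qed
    show ?thesis by (simp only: tr_cmult tr_multc sw)
  qed
  finally show ?thesis by simp
qed

text \<open>The trace of \<open>c3_DT_psi\<close> contracts the derivative of \<open>T\<close> with
  \<open>psi\<close>, and \<open>c4_DT\<close> makes that quadratic in \<open>T\<close>. So no
  derivative remains.\<close>

lemma trace_Ric: "4 * t Ric = 2 * c3 T T - t (\<lambda>s s'. t (\<lambda>e e'. Um T s e * Um T s' e'))"
proof -
  have "- 6 * t Ric = t (\<lambda>v j. c3 (DT v) (\<lambda>a b c. psi a b c j))"
    by (simp add: c3_DT_psi tr_cmult tr_uminus)
  also have "\<dots> = t (\<lambda>v j. c3 (DT j) (\<lambda>a b c. psi a b c v))" by (rule tr_swap)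
  also have "\<dots> = - c4 DT"
  proof -
    have "c3 (DT j) (\<lambda>a b c. psi a b c v) = - t (\<lambda>a a'. t (\<lambda>b b'. t (\<lambda>c c'. psi v a b c * DT j a' b' c')))" for v j
    proof -
      have "c3 (DT j) (\<lambda>a b c. psi a b c v) = t (\<lambda>a a'. t (\<lambda>b b'. t (\<lambda>c c'. DT j a' b' c' * psi a b c v)))"
      proof -
        have "t (\<lambda>a a'. t (\<lambda>b b'. t (\<lambda>c c'. DT j a b c * psi a' b' c' v))) =
            t (\<lambda>a a'. t (\<lambda>b b'. t (\<lambda>c c'. DT j a' b c * psi a b' c' v)))" by (rule tr_swap)
        also have "\<dots> = t (\<lambda>a a'. t (\<lambda>b b'. t (\<lambda>c c'. DT j a' b' c * psi a b c' v)))"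
          by (rule tr_cong) (rule tr_swap)
        also have "\<dots> = t (\<lambda>a a'. t (\<lambda>b b'. t (\<lambda>c c'. DT j a' b' c' * psi a b c v)))"
          by (rule tr_cong, rule tr_cong) (rule tr_swap)
        finally show ?thesis by (simp only: c3_def)
      qed
      also have "\<dots> = t (\<lambda>a a'. t (\<lambda>b b'. t (\<lambda>c c'. - (psi v a b c * DT j a' b' c'))))"
      proof (intro tr_cong)
        show "DT j a' b' c' * psi a b c v = - (psi v a b c * DT j a' b' c')" for a a' b b' c c'
          using psi_swap(3)[of a b c v] psi_swap(2)[of a b v c] psi_swap(1)[of a v b c] by simp
      qed
      finally show ?thesis by (simp only: tr_uminus)
    qed
    then show ?thesis by (simp add: c4_def tr_uminus)
  qed
  finally show ?thesis using c4_DT c4_S by simp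
qed

section \<open>The double divergence of the torsion and the Laplacian of the Lee form\<close>

lemma c3_sym: "c3 A B = c3 B A"
proof -
  have "c3 A B = t (\<lambda>a a'. t (\<lambda>b b'. t (\<lambda>c c'. A a' b c * B a b' c')))" unfolding c3_def by (rule tr_swap)
  also have "\<dots> = t (\<lambda>a a'. t (\<lambda>b b'. t (\<lambda>c c'. A a' b' c * B a b c')))" by (rule tr_cong) (rule tr_swap)
  also have "\<dots> = t (\<lambda>a a'. t (\<lambda>b b'. t (\<lambda>c c'. A a' b' c' * B a b c)))" by (rule tr_cong, rule tr_cong) (rule tr_swap)
  finally show ?thesis by (simp only: c3_def mult.commute)
qed

text \<open>Contracting two of the three torsions in two index pairs leaves a symmetric matrix
  \<open>V\<close>, which meets two skew slots of the third.\<close>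

lemma c3_S: "c3 (\<lambda>a b c. S a b c z) T = 0"
proof -
  define V where "V s c = t (\<lambda>a a'. t (\<lambda>b b'. T a b s * T a' b' c))" for s c
  have V: "V s c = V c s" for s c
  proof -
    have "V s c = t (\<lambda>a a'. t (\<lambda>b b'. T a' b s * T a b' c))" unfolding V_def by (rule tr_swap)
    also have "\<dots> = t (\<lambda>a a'. t (\<lambda>b b'. T a' b' s * T a b c))" by (rule tr_cong) (rule tr_swap)
    finally show ?thesis by (simp only: V_def mult.commute)
  qed
  have "c3 (\<lambda>a b c. S a b c z) T = t (\<lambda>a a'. t (\<lambda>b b'. t (\<lambda>c c'. t (\<lambda>s s'. T a b s * T a' b' c' * T s' c z))))"
    unfolding c3_def S_def by (simp only: tr_multc[symmetric]) (simp only: mult_ac)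
  also have "\<dots> = t (\<lambda>a a'. t (\<lambda>c c'. t (\<lambda>s s'. t (\<lambda>b b'. T a b s * T a' b' c' * T s' c z))))"
  proof (rule tr_cong)
    fix a a'
    have "t (\<lambda>b b'. t (\<lambda>c c'. t (\<lambda>s s'. T a b s * T a' b' c' * T s' c z))) =
        t (\<lambda>c c'. t (\<lambda>b b'. t (\<lambda>s s'. T a b s * T a' b' c' * T s' c z)))" by (rule tr_comm)
    also have "\<dots> = t (\<lambda>c c'. t (\<lambda>s s'. t (\<lambda>b b'. T a b s * T a' b' c' * T s' c z)))" by (rule tr_cong) (rule tr_comm)
    finally show "t (\<lambda>b b'. t (\<lambda>c c'. t (\<lambda>s s'. T a b s * T a' b' c' * T s' c z))) = \<dots>" .
  qed
  also have "\<dots> = t (\<lambda>c c'. t (\<lambda>s s'. t (\<lambda>a a'. t (\<lambda>b b'. T a b s * T a' b' c' * T s' c z))))"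
  proof -
    have "t (\<lambda>a a'. t (\<lambda>c c'. t (\<lambda>s s'. t (\<lambda>b b'. T a b s * T a' b' c' * T s' c z)))) =
        t (\<lambda>c c'. t (\<lambda>a a'. t (\<lambda>s s'. t (\<lambda>b b'. T a b s * T a' b' c' * T s' c z))))" by (rule tr_comm)
    also have "\<dots> = t (\<lambda>c c'. t (\<lambda>s s'. t (\<lambda>a a'. t (\<lambda>b b'. T a b s * T a' b' c' * T s' c z))))" by (rule tr_cong) (rule tr_comm)
    finally show ?thesis .
  qed
  also have "\<dots> = t (\<lambda>c c'. t (\<lambda>s s'. V s c' * T s' c z))" by (simp only: tr_multc V_def)
  also have "\<dots> = t (\<lambda>c c'. t (\<lambda>s s'. V s c * T s' c' z))" by (rule tr_swap)
  also have "\<dots> = 0"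
  proof (rule tr_tr_antisym)
    show "V s c * T s' c' z = - (V c s * T c' s' z)" for c c' s s'
      using V[of s c] T12[of s' c' z] by simp
  qed
  finally show ?thesis .
qed

lemma c3_sigma: "c3 (\<lambda>a b c. sigma a b c z) T = 0"
  using c3_cyc_sum[of T "\<lambda>a b c. S a b c z", OF T_cyc] c3_S[of z] by (simp add: sigma_def)

lemma c3_diff: "c3 (\<lambda>a b c. A a b c - A' a b c) B = c3 A B - c3 A' B"
  by (simp only: c3_def left_diff_distrib tr_diff)

lemma c3_R: "3 * c3 (\<lambda>a b c. R a b c z) T = c3 (DT z) T"
  using c3_cyc_sum[of T "\<lambda>a b c. R a b c z", OF T_cyc] c3_sigma[of z] by (simp add: bianchi' c3_diff)

lemma c3_DT_last: "3 * c3 (\<lambda>a b c. DT c a b z) T = c3 (DT z) T"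
proof -
  have "DT c a b z + DT a b c z + DT b c a z = DT z a b c - 2 * sigma a b c z" for a b c
    using bianchi'[of a b c z] bianchi[of a b c z] unfolding sigma_def by simp
  then have "3 * c3 (\<lambda>a b c. DT c a b z) T = c3 (\<lambda>a b c. DT z a b c - 2 * sigma a b c z) T"
    using c3_cyc_sum[of T "\<lambda>a b c. DT c a b z", OF T_cyc] by simp
  also have "\<dots> = c3 (DT z) T"
  proof -
    have "c3 (\<lambda>a b c. 2 * sigma a b c z) T = 2 * c3 (\<lambda>a b c. sigma a b c z) T"
      by (simp only: c3_def mult.assoc tr_cmult)
    then show ?thesis using c3_sigma[of z] by (simp add: c3_diff)
  qed
  finally show ?thesis .
qed

text \<open>Skewness of \<open>T\<close> changes the sign of the double divergence when its two
  derivatives are exchanged, so it is half their commutator. Two curvature terms give Ric. The third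
  equals one third of \<open>c3 (DT z) T\<close>, and so does the torsion term up to sign; they
  cancel.\<close>

lemma div_div_T:
  assumes D1: "\<And>a b c d z. DDT a b c d z = - DDT a b d c z"
    and D2: "\<And>a c d b z. DDT a c d b z - DDT c a d b z =
      - (t (\<lambda>s u. R a c d s * T u b z) + t (\<lambda>s u. R a c b s * T d u z) + t (\<lambda>s u. R a c z s * T d b u))
      - t (\<lambda>s u. T a c s * DT u d b z)"
  shows "t (\<lambda>a b. t (\<lambda>c d. DDT a c d b z)) = t (\<lambda>a b. t (\<lambda>s u. Ric a s * T b u z))"
proof -
  let ?X = "t (\<lambda>a b. t (\<lambda>c d. DDT a c d b z))" and ?Z = "t (\<lambda>a b. t (\<lambda>s u. Ric a s * T b u z))"
  have Y: "t (\<lambda>a b. t (\<lambda>c d. DDT c a d b z)) = - ?X"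
  proof -
    have "t (\<lambda>a b. t (\<lambda>c d. DDT c a d b z)) = t (\<lambda>a b. t (\<lambda>c d. - DDT c a b d z))"
      by (intro tr_cong) (rule D1)
    also have "\<dots> = - t (\<lambda>a b. t (\<lambda>c d. DDT c a b d z))" by (simp only: tr_uminus)
    also have "t (\<lambda>a b. t (\<lambda>c d. DDT c a b d z)) = t (\<lambda>c d. t (\<lambda>a b. DDT c a b d z))" by (rule tr_comm)
    finally show ?thesis .
  qed
  have A1: "t (\<lambda>a b. t (\<lambda>c d. t (\<lambda>s u. R a c d s * T u b z))) = - ?Z"
  proof -
    have "t (\<lambda>a b. t (\<lambda>c d. t (\<lambda>s u. R a c d s * T u b z))) = t (\<lambda>a b. t (\<lambda>s u. t (\<lambda>c d. R a c d s * T u b z)))"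
      by (rule tr_cong) (rule tr_comm)
    also have "\<dots> = t (\<lambda>a b. t (\<lambda>s u. Ric a s * T u b z))" by (simp only: tr_multc Ric_eq)
    also have "\<dots> = t (\<lambda>a b. t (\<lambda>s u. - (Ric a s * T b u z)))"
    proof (intro tr_cong)
      show "Ric a s * T u b z = - (Ric a s * T b u z)" for a b s u using T12[of u b z] by simp
    qed
    finally show ?thesis by (simp only: tr_uminus)
  qed
  have A2: "t (\<lambda>a b. t (\<lambda>c d. t (\<lambda>s u. R a c b s * T d u z))) = - ?Z"
  proof -
    have "t (\<lambda>a b. t (\<lambda>c d. t (\<lambda>s u. R a c b s * T d u z))) = t (\<lambda>c d. t (\<lambda>a b. t (\<lambda>s u. R a c b s * T d u z)))"
      by (rule tr_comm)
    also have "\<dots> = t (\<lambda>c d. t (\<lambda>s u. t (\<lambda>a b. R a c b s * T d u z)))"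
      by (rule tr_cong) (rule tr_comm)
    also have "\<dots> = t (\<lambda>c d. t (\<lambda>s u. - (Ric c s * T d u z)))" by (simp only: tr_multc Ric_eq mult_minus_left)
    finally show ?thesis by (simp only: tr_uminus)
  qed
  have A3: "t (\<lambda>a b. t (\<lambda>c d. t (\<lambda>s u. R a c z s * T d b u))) = c3 (\<lambda>a b c. R a b c z) T"
    unfolding c3_def
  proof (intro tr_cong)
    show "R a c z s * T d b u = R a c s z * T b d u" for a b c d s u
      using R34[of a c z s] T12[of d b u] by simp
  qed
  have A4: "t (\<lambda>a b. t (\<lambda>c d. t (\<lambda>s u. T a c s * DT u d b z))) = - c3 (\<lambda>a b c. DT c a b z) T"
  proof -
    have "t (\<lambda>a b. t (\<lambda>c d. t (\<lambda>s u. T a c s * DT u d b z))) = t (\<lambda>a b. t (\<lambda>c d. t (\<lambda>s u. - (T a c s * DT u b d z))))"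
    proof (intro tr_cong)
      show "T a c s * DT u d b z = - (T a c s * DT u b d z)" for a b c d s u using DT23[of u d b z] by simp
    qed
    then show ?thesis unfolding c3_sym[of _ T] by (simp only: c3_def tr_uminus)
  qed
  have "t (\<lambda>a b. t (\<lambda>c d. DDT a c d b z - DDT c a d b z)) =
      - (- ?Z + - ?Z + c3 (\<lambda>a b c. R a b c z) T) - - c3 (\<lambda>a b c. DT c a b z) T"
    unfolding D2 tr_diff tr_uminus tr_add A1 A2 A3 A4 ..
  then have "2 * ?X = 2 * ?Z"
    using Y c3_R[of z] c3_DT_last[of z] by (simp add: tr_diff)
  then show ?thesis by simp
qed

text \<open>The free index reaches the first slot in two exchanges: \<open>DB\<close> for the last
  two slots, \<open>DD\<close> for the first two. The double divergence of \<open>T\<close> from the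
  former cancels the torsion term of the latter, and the curvature term becomes Ric.\<close>

lemma laplace_theta:
  fixes th :: "7 \<Rightarrow> real"
  assumes Dth: "\<And>v j. Dth v j = - Ric v j"
    and D1: "\<And>a b c d z. DDT a b c d z = - DDT a b d c z"
    and D2: "\<And>a c d b z. DDT a c d b z - DDT c a d b z =
      - (t (\<lambda>s u. R a c d s * T u b z) + t (\<lambda>s u. R a c b s * T d u z) + t (\<lambda>s u. R a c z s * T d b u))
      - t (\<lambda>s u. T a c s * DT u d b z)"
    and DD: "\<And>a y b. DDth a y b - DDth y a b = - t (\<lambda>s u. R a y b s * th u) - t (\<lambda>s u. T a y s * Dth u b)"
    and DB: "\<And>a b z. DDth a b z - DDth a z b = - t (\<lambda>c d. DDT a c d b z)"
  shows "t (\<lambda>a b. DDth a b z) = t (\<lambda>a b. DDth z a b) - t (\<lambda>a b. Dth z a * th b)"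
proof -
  have 1: "t (\<lambda>a b. DDth a b z) = t (\<lambda>a b. DDth a z b) - t (\<lambda>a b. t (\<lambda>c d. DDT a c d b z))"
  proof -
    have "t (\<lambda>a b. DDth a b z - DDth a z b) = t (\<lambda>a b. - t (\<lambda>c d. DDT a c d b z))" by (simp only: DB)
    then show ?thesis by (simp add: tr_diff tr_uminus)
  qed
  have 2: "t (\<lambda>a b. DDth a z b) = t (\<lambda>a b. DDth z a b) - t (\<lambda>a b. t (\<lambda>s u. R a z b s * th u))
      - t (\<lambda>a b. t (\<lambda>s u. T a z s * Dth u b))"
  proof -
    have "t (\<lambda>a b. DDth a z b - DDth z a b) =
        t (\<lambda>a b. - t (\<lambda>s u. R a z b s * th u) - t (\<lambda>s u. T a z s * Dth u b))" by (simp only: DD)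
    then show ?thesis by (simp add: tr_diff tr_uminus)
  qed
  have 3: "t (\<lambda>a b. t (\<lambda>s u. R a z b s * th u)) = t (\<lambda>a b. Dth z a * th b)"
  proof -
    have "t (\<lambda>a b. t (\<lambda>s u. R a z b s * th u)) = t (\<lambda>s u. t (\<lambda>a b. R a z b s * th u))" by (rule tr_comm)
    also have "\<dots> = t (\<lambda>s u. - Ric z s * th u)" by (simp only: tr_multc Ric_eq)
    finally show ?thesis by (simp only: Dth)
  qed
  have 4: "t (\<lambda>a b. t (\<lambda>s u. T a z s * Dth u b)) = t (\<lambda>a b. t (\<lambda>s u. Dth a s * T b u z))"
  proof -
    have "t (\<lambda>a b. t (\<lambda>s u. T a z s * Dth u b)) = t (\<lambda>s u. t (\<lambda>a b. T a z s * Dth u b))" by (rule tr_comm)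
    also have "\<dots> = t (\<lambda>s u. t (\<lambda>a b. T a z u * Dth s b))" by (rule tr_swap)
    also have "\<dots> = t (\<lambda>s u. t (\<lambda>a b. T b z u * Dth s a))" by (rule tr_cong) (rule tr_swap)
    also have "\<dots> = t (\<lambda>s u. t (\<lambda>a b. Dth s a * T u b z))"
      by (simp only: T_cyc[of _ _ z] mult.commute)
    finally show ?thesis .
  qed
  have 5: "t (\<lambda>a b. t (\<lambda>c d. DDT a c d b z)) = - t (\<lambda>a b. t (\<lambda>s u. Dth a s * T b u z))"
    unfolding div_div_T[OF D1 D2] Dth by (simp add: tr_uminus)
  show ?thesis unfolding 1 2 3 4 5 by simp
qed

end

section \<open>Identities in a chart\<close>

lemma (in metric_pt) lower_sum: "t (\<lambda>a b. (\<Sum>s\<in>UNIV. g $ a $ s * v s) * F b) = (\<Sum>s\<in>UNIV. v s * F s)"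
proof -
  have "t (\<lambda>a b. (\<Sum>s\<in>I. g $ a $ s * v s) * F b) = (\<Sum>s\<in>I. v s * F s)" for I
  proof (induction I rule: infinite_finite_induct)
    case (insert x I)
    have "t (\<lambda>a b. (\<Sum>s\<in>insert x I. g $ a $ s * v s) * F b) =
        t (\<lambda>a b. v x * (g $ a $ x * F b) + (\<Sum>s\<in>I. g $ a $ s * v s) * F b)"
      using insert by (intro tr_cong) (simp add: algebra_simps)
    then show ?case using insert by (simp add: tr_add tr_cmult tr_metric)
  qed (simp_all add: tr_0)
  then show ?thesis .
qed

context conn_chart
begin

lemma nabla_zero:
  assumes "\<And>z m. z \<in> U \<Longrightarrow> length m = length l \<Longrightarrow> \<alpha> z m = 0" and y: "y \<in> U"
  shows "nabla \<Gamma> \<alpha> y (i # l) = 0"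
proof -
  have "partial i (\<lambda>z. \<alpha> z l) y = partial i (\<lambda>z. 0) y"
    by (rule partial_cong_open[OF U y]) (simp add: assms(1))
  moreover have "act (cf \<Gamma> y i) (\<alpha> y) l = 0" using assms(1)[OF y] by (simp add: act_def)
  ultimately show ?thesis by (simp add: nabla_Cons partial_const)
qed

text \<open>Formulated for one fixed pair of slots, because a covariant derivative inherits skew
  symmetry in the slots of the tensor but not in its direction slot.\<close>

lemma nabla_swap:
  assumes \<alpha>: "smooth_tens U \<alpha>" and y: "y \<in> U"
    and s': "\<And>z xs c d ys'. z \<in> U \<Longrightarrow> length xs = n \<Longrightarrow> length ys' = m \<Longrightarrow> \<alpha> z (xs @ c # d # ys') = - \<alpha> z (xs @ d # c # ys')"
    and l: "length xs = n" "length ys = m"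
  shows "nabla \<Gamma> \<alpha> y (i # xs @ c # d # ys) = - nabla \<Gamma> \<alpha> y (i # xs @ d # c # ys)"
proof -
  have 1: "partial i (\<lambda>z. \<alpha> z (xs @ c # d # ys)) y = - partial i (\<lambda>z. \<alpha> z (xs @ d # c # ys)) y"
  proof -
    have "partial i (\<lambda>z. \<alpha> z (xs @ c # d # ys)) y = partial i (\<lambda>z. - \<alpha> z (xs @ d # c # ys)) y"
      by (rule partial_cong_open[OF U y]) (rule s'[OF _ l])
    also have "\<dots> = - partial i (\<lambda>z. \<alpha> z (xs @ d # c # ys)) y"
      by (rule partial_uminus[OF smooth_tens_differentiable[OF \<alpha> y]])
    finally show ?thesis .
  qed
  let ?G = "cf \<Gamma> y i"
  have 2: "act ?G (\<lambda>m. \<alpha> y (m @ c # d # ys)) xs = - act ?G (\<lambda>m. \<alpha> y (m @ d # c # ys)) xs"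
  proof -
    have "act ?G (\<lambda>m. \<alpha> y (m @ c # d # ys)) xs = act ?G (\<lambda>m. - 1 * \<alpha> y (m @ d # c # ys)) xs"
    proof (rule act_cong)
      show "\<alpha> y (m @ c # d # ys) = - 1 * \<alpha> y (m @ d # c # ys)" if "length m = length xs" for m
        using s'[OF y _ l(2), of m c d] l that by simp
    qed
    then show ?thesis by (simp only: act_cmult)
  qed
  have 3: "act ?G (\<lambda>m. \<alpha> y (xs @ c # d # m)) ys = - act ?G (\<lambda>m. \<alpha> y (xs @ d # c # m)) ys"
  proof -
    have "act ?G (\<lambda>m. \<alpha> y (xs @ c # d # m)) ys = act ?G (\<lambda>m. - 1 * \<alpha> y (xs @ d # c # m)) ys"
    proof (rule act_cong)
      show "\<alpha> y (xs @ c # d # m) = - 1 * \<alpha> y (xs @ d # c # m)" if "length m = length ys" for m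
        using s'[OF y l(1), of m c d] l that by simp
    qed
    then show ?thesis by (simp only: act_cmult)
  qed
  have 4: "(\<Sum>a\<in>UNIV. ?G e a * \<alpha> y (xs @ a # f # ys)) = - (\<Sum>a\<in>UNIV. ?G e a * \<alpha> y (xs @ f # a # ys))" for e f
    unfolding sum_negf[symmetric]
  proof (rule sum.cong[OF refl])
    show "?G e a * \<alpha> y (xs @ a # f # ys) = - (?G e a * \<alpha> y (xs @ f # a # ys))" for a
      using s'[OF y l, of a f] by simp
  qed
  show ?thesis
    unfolding nabla_Cons act_append act_Cons 1 2 3 4[of c d] using 4[of d c] by simp
qed

end

lemma (in conn_chart) nabla_cmult:
  assumes "smooth_tens U \<alpha>" "y \<in> U"
  shows "nabla \<Gamma> (\<lambda>z l. c * \<alpha> z l) y (i # l) = c * nabla \<Gamma> \<alpha> y (i # l)"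
  using assms by (simp add: nabla_Cons act_cmult partial_cmult smooth_tens_differentiable right_diff_distrib)

lemma (in conn_chart) smooth_cmult: "smooth_tens U \<alpha> \<Longrightarrow> smooth_tens U (\<lambda>z l. c * \<alpha> z l)"
  unfolding smooth_tens_def by (intro allI smooth_on_mult U smooth_on_const) auto

section \<open>Torsion and curvature in coordinates\<close>

lemma cov_eq: "cov \<Gamma> V W y $ a = frechet_derivative W (at y) (V y) $ a
    + (\<Sum>i\<in>UNIV. \<Sum>j\<in>UNIV. V y $ i * W y $ j * cf \<Gamma> y i j a)"
  by (simp add: cov_def cf_def sum_component)

lemma cov_coord: "cov \<Gamma> (coord_field i) W y $ a = partial i W y $ a + (\<Sum>j\<in>UNIV. W y $ j * cf \<Gamma> y i j a)"
proof -
  have "(\<Sum>k\<in>UNIV. \<Sum>j\<in>UNIV. axis i 1 $ k * W y $ j * cf \<Gamma> y k j a) =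
      (\<Sum>k\<in>UNIV. axis i 1 $ k * (\<Sum>j\<in>UNIV. W y $ j * cf \<Gamma> y k j a))"
    by (simp only: sum_distrib_left mult.assoc)
  also have "\<dots> = (\<Sum>j\<in>UNIV. W y $ j * cf \<Gamma> y i j a)"
    by (simp add: axis_def if_distrib[of "\<lambda>x. x * _"] cong: if_cong)
  finally show ?thesis by (simp add: cov_eq coord_field_def partial_def)
qed

lemma frechet_coord: "frechet_derivative (coord_field j) (at y) = (\<lambda>v. 0)"
  unfolding coord_field_def by (rule frechet_derivative_eqI[OF has_derivative_const])

lemma cov_coord_coord: "cov \<Gamma> (coord_field i) (coord_field j) y = \<Gamma> y i j"
proof -
  have "cov \<Gamma> (coord_field i) (coord_field j) y $ a = \<Gamma> y i j $ a" for a
    by (simp add: cov_coord partial_def frechet_coord)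
      (simp add: coord_field_def axis_def cf_def if_distrib[of "\<lambda>x. x * _"] cong: if_cong)
  then show ?thesis by (simp add: vec_eq_iff)
qed

lemma bracket_coord: "lie_bracket (coord_field i) (coord_field j) = (\<lambda>y. 0)"
  by (simp add: lie_bracket_def frechet_coord fun_eq_iff)

lemma matrix_inner_axis: "(A *v v) \<bullet> axis k (1::real) = (\<Sum>a\<in>UNIV. A $ k $ a * v $ a)"
  by (simp add: inner_axis matrix_vector_mult_def)

lemma torsion_eq: "torsion g \<Gamma> y [i, j, k] = (\<Sum>a\<in>UNIV. g y $ k $ a * tors \<Gamma> y i j a)"
  unfolding torsion_def Let_def
  by (simp add: cov_coord_coord bracket_coord coord_field_def[of k] matrix_inner_axis tors_def cf_def)

lemma torsion_length: "length l \<noteq> 3 \<Longrightarrow> torsion g \<Gamma> y l = 0"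
  by (simp add: torsion_def)

context conn_chart
begin

lemma curv_eq:
  assumes y: "y \<in> U"
  shows "curv g \<Gamma> y i j k l = (\<Sum>a\<in>UNIV. g y $ l $ a * Kc \<Gamma> y i j k a)"
proof -
  have d: "(\<lambda>z. \<Gamma> z j k) differentiable (at y)" for j k
    by (rule iffD2[OF differentiable_componentwise_within])
      (use cf_differentiable[OF y] in \<open>auto simp: Basis_vec_def inner_axis cf_def\<close>)
  have p: "partial i (\<lambda>z. \<Gamma> z j k) y $ a = partial i (\<lambda>z. cf \<Gamma> z j k a) y" for i j k a
    using partial_vec_nth[OF d] by (simp add: cf_def)
  have "cov \<Gamma> (coord_field i) (cov \<Gamma> (coord_field j) (coord_field k)) y $ a =
      partial i (\<lambda>z. cf \<Gamma> z j k a) y + (\<Sum>s\<in>UNIV. cf \<Gamma> y j k s * cf \<Gamma> y i s a)" for i j a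
  proof -
    have e: "cov \<Gamma> (coord_field j) (coord_field k) = (\<lambda>z. \<Gamma> z j k)" by (simp add: cov_coord_coord fun_eq_iff)
    show ?thesis unfolding e cov_coord p by (simp add: cf_def)
  qed
  moreover have "cov \<Gamma> (\<lambda>y. 0) Z y $ a = frechet_derivative Z (at y) 0 $ a" for Z a
    by (simp add: cov_eq)
  ultimately have "curv_op \<Gamma> (coord_field i) (coord_field j) (coord_field k) y $ a = Kc \<Gamma> y i j k a" for a
    by (simp add: curv_op_def bracket_coord Kc_def frechet_coord)
  then show ?thesis
    unfolding curv_def coord_field_def[of l] matrix_inner_axis by simp
qed

end

locale skew_chart = metric_chart +
  fixes T
  defines "T \<equiv> torsion g \<Gamma>"
  assumes T_alt: "y \<in> U \<Longrightarrow> alternating (T y)"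
begin

lemma smooth_tors: "smooth_on U (\<lambda>z. tors \<Gamma> z i j a)"
  unfolding tors_def by (intro smooth_on_diff U cf)

lemma smooth_T: "smooth_tens U T"
  unfolding smooth_tens_def
proof
  fix l
  show "smooth_on U (\<lambda>z. T z l)"
  proof (cases "length l = 3")
    case True
    then obtain i j k where "l = [i, j, k]" by (rule length_3E)
    then show ?thesis unfolding T_def
      by (simp add: torsion_eq) (intro smooth_on_sum smooth_on_mult U smooth_g smooth_tors)
  next
    case False
    then show ?thesis unfolding T_def by (simp add: torsion_length smooth_on_const)
  qed
qed

lemma smooth_metric: "smooth_tens U (metric_tensor g)"
  unfolding smooth_tens_def metric_tensor_def using smooth_g by blast

definition Rl :: "real^7 \<Rightarrow> 7 \<Rightarrow> 7 \<Rightarrow> 7 \<Rightarrow> 7 \<Rightarrow> real" where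
  "Rl y i j k l = (\<Sum>a\<in>UNIV. g y $ l $ a * Kc \<Gamma> y i j k a)"

lemma R12: "Rl y i j k l = - Rl y j i k l"
proof -
  have "Kc \<Gamma> y i j k a = - Kc \<Gamma> y j i k a" for a by (simp add: Kc_def)
  then show ?thesis by (simp add: Rl_def sum_negf)
qed

lemma sum_Kc:
  assumes y: "y \<in> U"
  shows "(\<Sum>a\<in>UNIV. Kc \<Gamma> y i j k a * F a) = tr (h y) (\<lambda>a b. Rl y i j k a * F b)"
proof -
  interpret pt: metric_pt "h y" "g y" by (rule metric_pt[OF y])
  show ?thesis unfolding Rl_def by (rule pt.lower_sum[symmetric])
qed

lemma sum_tors:
  assumes y: "y \<in> U"
  shows "(\<Sum>a\<in>UNIV. tors \<Gamma> y i j a * F a) = tr (h y) (\<lambda>a b. T y [i, j, a] * F b)"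
proof -
  interpret pt: metric_pt "h y" "g y" by (rule metric_pt[OF y])
  show ?thesis unfolding T_def torsion_eq by (rule pt.lower_sum[symmetric])
qed

text \<open>The metric is parallel, so its Ricci identity leaves only the curvature term.\<close>

lemma R34: assumes y: "y \<in> U" shows "Rl y i j k l = - Rl y i j l k"
proof -
  have n: "nabla \<Gamma> (metric_tensor g) z m = 0" if "z \<in> U" "length m = 3" for z m
    using that compat by (auto elim: length_3E)
  have nn: "nabla \<Gamma> (nabla \<Gamma> (metric_tensor g)) y (i # m) = 0" if "length m = 3" for i m
    by (rule nabla_zero[OF _ y]) (use n that in simp)
  have "act (Kc \<Gamma> y i j) (metric_tensor g y) [k, l] = 0"
    using ricci_identity[OF smooth_metric y, of i j "[k, l]"] by (simp add: nn n[OF y])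
  then have "(\<Sum>a\<in>UNIV. Kc \<Gamma> y i j k a * g y $ a $ l) + (\<Sum>a\<in>UNIV. Kc \<Gamma> y i j l a * g y $ k $ a) = 0"
    by (simp add: act_Cons metric_tensor_def)
  then show ?thesis by (simp add: Rl_def mult.commute g_sym[OF y, of _ l])
qed

text \<open>The covariant derivative of the torsion with its last index raised. In this form the
  Bianchi identity is free of the metric.\<close>

definition Dtors :: "real^7 \<Rightarrow> 7 \<Rightarrow> 7 \<Rightarrow> 7 \<Rightarrow> 7 \<Rightarrow> real" where
  "Dtors y x j k a = partial x (\<lambda>z. tors \<Gamma> z j k a) y + (\<Sum>s\<in>UNIV. cf \<Gamma> y x s a * tors \<Gamma> y j k s)
      - (\<Sum>s\<in>UNIV. cf \<Gamma> y x j s * tors \<Gamma> y s k a) - (\<Sum>s\<in>UNIV. cf \<Gamma> y x k s * tors \<Gamma> y j s a)"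

lemma T_eq: "T z [i, j, k] = (\<Sum>a\<in>UNIV. g z $ k $ a * tors \<Gamma> z i j a)"
  by (simp add: T_def torsion_eq)

lemma nabla_T:
  assumes y: "y \<in> U"
  shows "nabla \<Gamma> T y [x, j, k, l] = (\<Sum>a\<in>UNIV. g y $ l $ a * Dtors y x j k a)"
proof -
  have td: "(\<lambda>z. tors \<Gamma> z i j a) differentiable (at y)" for i j a
    by (rule smooth_on_differentiable[OF smooth_tors y])
  have "partial x (\<lambda>z. T z [j, k, l]) y = (\<Sum>a\<in>UNIV. partial x (\<lambda>z. g z $ l $ a) y * tors \<Gamma> y j k a
      + g y $ l $ a * partial x (\<lambda>z. tors \<Gamma> z j k a) y)"
    unfolding T_eq by (subst partial_sum) (auto intro!: sum.cong partial_mult differentiable_mult g_diff td y)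
  also have "\<dots> = (\<Sum>a\<in>UNIV. (\<Sum>s\<in>UNIV. cf \<Gamma> y x l s * g y $ s $ a) * tors \<Gamma> y j k a)
      + (\<Sum>a\<in>UNIV. (\<Sum>s\<in>UNIV. cf \<Gamma> y x a s * g y $ l $ s) * tors \<Gamma> y j k a)
      + (\<Sum>a\<in>UNIV. g y $ l $ a * partial x (\<lambda>z. tors \<Gamma> z j k a) y)"
    by (simp add: partial_g[OF y] sum.distrib distrib_right)
  also have "(\<Sum>a\<in>UNIV. (\<Sum>s\<in>UNIV. cf \<Gamma> y x l s * g y $ s $ a) * tors \<Gamma> y j k a) =
      (\<Sum>s\<in>UNIV. cf \<Gamma> y x l s * T y [j, k, s])"
    unfolding T_eq sum_distrib_left sum_distrib_right by (subst sum.swap) (simp only: mult.assoc)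
  also have "(\<Sum>a\<in>UNIV. (\<Sum>s\<in>UNIV. cf \<Gamma> y x a s * g y $ l $ s) * tors \<Gamma> y j k a) =
      (\<Sum>a\<in>UNIV. g y $ l $ a * (\<Sum>s\<in>UNIV. cf \<Gamma> y x s a * tors \<Gamma> y j k s))"
    unfolding sum_distrib_left sum_distrib_right by (subst sum.swap) (simp only: mult_ac)
  finally have 1: "partial x (\<lambda>z. T z [j, k, l]) y = (\<Sum>s\<in>UNIV. cf \<Gamma> y x l s * T y [j, k, s])
      + (\<Sum>a\<in>UNIV. g y $ l $ a * (\<Sum>s\<in>UNIV. cf \<Gamma> y x s a * tors \<Gamma> y j k s))
      + (\<Sum>a\<in>UNIV. g y $ l $ a * partial x (\<lambda>z. tors \<Gamma> z j k a) y)" .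
  have 2: "(\<Sum>s\<in>UNIV. cf \<Gamma> y x j s * T y [s, k, l]) = (\<Sum>a\<in>UNIV. g y $ l $ a * (\<Sum>s\<in>UNIV. cf \<Gamma> y x j s * tors \<Gamma> y s k a))"
    "(\<Sum>s\<in>UNIV. cf \<Gamma> y x k s * T y [j, s, l]) = (\<Sum>a\<in>UNIV. g y $ l $ a * (\<Sum>s\<in>UNIV. cf \<Gamma> y x k s * tors \<Gamma> y j s a))"
    unfolding T_eq sum_distrib_left by (subst sum.swap, simp only: mult_ac)+
  show ?thesis
    unfolding nabla_Cons 1 by (simp add: act_Cons 2 Dtors_def distrib_left right_diff_distrib sum.distrib sum_subtractf)
qed

text \<open>With the last index raised, both sides are the same expression in the coefficients and
  their first derivatives. Lowering by \<open>g\<close> commutes with the covariant derivative by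
  \<open>nabla_T\<close>.\<close>

lemma bianchi:
  assumes y: "y \<in> U"
  shows "Rl y x j k l + Rl y j k x l + Rl y k x j l =
    nabla \<Gamma> T y [x, j, k, l] + nabla \<Gamma> T y [j, k, x, l] + nabla \<Gamma> T y [k, x, j, l]
    + (tr (h y) (\<lambda>s s'. T y [x, j, s] * T y [s', k, l]) + tr (h y) (\<lambda>s s'. T y [j, k, s] * T y [s', x, l])
      + tr (h y) (\<lambda>s s'. T y [k, x, s] * T y [s', j, l]))"
proof -
  have SS: "tr (h y) (\<lambda>s s'. T y [i, j, s] * T y [s', k, l]) =
      (\<Sum>a\<in>UNIV. g y $ l $ a * (\<Sum>s\<in>UNIV. tors \<Gamma> y i j s * tors \<Gamma> y s k a))" for i j k
  proof -
    have "tr (h y) (\<lambda>s s'. T y [i, j, s] * T y [s', k, l]) = (\<Sum>s\<in>UNIV. tors \<Gamma> y i j s * T y [s, k, l])"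
      by (rule sum_tors[OF y, symmetric])
    also have "\<dots> = (\<Sum>a\<in>UNIV. g y $ l $ a * (\<Sum>s\<in>UNIV. tors \<Gamma> y i j s * tors \<Gamma> y s k a))"
      unfolding T_eq sum_distrib_left by (subst sum.swap) (simp only: mult_ac)
    finally show ?thesis .
  qed
  have pt: "partial x (\<lambda>z. tors \<Gamma> z j k a) y = partial x (\<lambda>z. cf \<Gamma> z j k a) y - partial x (\<lambda>z. cf \<Gamma> z k j a) y" for x j k a
    unfolding tors_def by (rule partial_diff[OF cf_differentiable[OF y] cf_differentiable[OF y]])
  have "Kc \<Gamma> y x j k a + Kc \<Gamma> y j k x a + Kc \<Gamma> y k x j a =
      Dtors y x j k a + Dtors y j k x a + Dtors y k x j a + ((\<Sum>s\<in>UNIV. tors \<Gamma> y x j s * tors \<Gamma> y s k a)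
      + (\<Sum>s\<in>UNIV. tors \<Gamma> y j k s * tors \<Gamma> y s x a) + (\<Sum>s\<in>UNIV. tors \<Gamma> y k x s * tors \<Gamma> y s j a))" for a
    unfolding Dtors_def pt unfolding Kc_def tors_def
    by (simp add: left_diff_distrib right_diff_distrib sum_subtractf mult.commute)
  then show ?thesis
    unfolding Rl_def nabla_T[OF y] SS sum.distrib[symmetric] distrib_left[symmetric] by simp
qed

lemma T_swap: "y \<in> U \<Longrightarrow> T y [i, j, k] = - T y [j, i, k]" "y \<in> U \<Longrightarrow> T y [i, j, k] = - T y [i, k, j]"
  using alternatingD[OF T_alt, of y "[]" i j "[k]"] alternatingD[OF T_alt, of y "[i]" j k "[]"] by simp_all

lemma alternating_DT: "y \<in> U \<Longrightarrow> alternating (\<lambda>l. nabla \<Gamma> T y (i # l))"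
  by (rule alternating_nabla[OF U]) (auto intro: T_alt smooth_tens_differentiable[OF smooth_T])

lemma DT_swap: "y \<in> U \<Longrightarrow> nabla \<Gamma> T y [i, j, k, l] = - nabla \<Gamma> T y [i, k, j, l]"
  "y \<in> U \<Longrightarrow> nabla \<Gamma> T y [i, j, k, l] = - nabla \<Gamma> T y [i, j, l, k]"
  using alternatingD[OF alternating_DT, of y i "[]" j k "[l]"] alternatingD[OF alternating_DT, of y i "[j]" k l "[]"]
  by simp_all

end

section \<open>Charts of a G_2 structure with parallel form and closed skew torsion\<close>

locale g2_chart = skew_chart +
  fixes \<phi> :: "real^7 \<Rightarrow> tens"
  assumes phi_smooth: "smooth_tens U \<phi>"
    and adapted_ex: "y \<in> U \<Longrightarrow> \<exists>E. adapted E (\<phi> y)"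
    and g_eq: "y \<in> U \<Longrightarrow> g y = g2_metric (\<phi> y)"
    and phi_par: "y \<in> U \<Longrightarrow> nabla \<Gamma> \<phi> y [i, j, k, l] = 0"
    and T_closed: "y \<in> U \<Longrightarrow> ext_d 3 T y m = 0"
begin

text \<open>Chosen at each point separately and without regularity, which suffices for algebra at a
  single point.\<close>

definition E :: "real^7 \<Rightarrow> real^7^7" where "E y = (SOME E. adapted E (\<phi> y))"

lemma adapted_E: "y \<in> U \<Longrightarrow> adapted (E y) (\<phi> y)"
  unfolding E_def using adapted_ex by (rule someI_ex)

lemma adapted_pt: "y \<in> U \<Longrightarrow> adapted_pt (E y) (\<phi> y)"
  by unfold_locales (rule adapted_E)

lemma g_E: "y \<in> U \<Longrightarrow> g y = transpose (E y) ** E y"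
  using g_eq adapted_metric_vol(1)[OF adapted_E] by simp

lemma h_E: "y \<in> U \<Longrightarrow> h y = matrix_inv (transpose (E y) ** E y)"
  by (simp add: h_def g_E)

abbreviation psi :: "real^7 \<Rightarrow> 7 \<Rightarrow> 7 \<Rightarrow> 7 \<Rightarrow> 7 \<Rightarrow> real" where
  "psi y \<equiv> adapted_pt.psi (E y) (\<phi> y)"

lemma g2_pt:
  assumes y: "y \<in> U" shows "g2_pt (h y) (g y) (\<lambda>i j k. \<phi> y [i, j, k]) (psi y)"
proof -
  interpret pt: adapted_pt "E y" "matrix_inv (E y)" "transpose (E y) ** E y" "matrix_inv (transpose (E y) ** E y)" "\<phi> y"
    by (rule adapted_pt[OF y]) simp_all
  show ?thesis using pt.g2_pt_axioms by (simp add: g_E[OF y] h_E[OF y])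
qed

definition Sq :: "real^7 \<Rightarrow> 7 \<Rightarrow> 7 \<Rightarrow> 7 \<Rightarrow> 7 \<Rightarrow> real" where
  "Sq y a b c d = tr (h y) (\<lambda>s s'. T y [a, b, s] * T y [s', c, d])"

lemma curv_pt:
  assumes y: "y \<in> U"
  shows "curv_pt (h y) (g y) (\<lambda>i j k. \<phi> y [i, j, k]) (psi y) (Rl y) (\<lambda>i j k. T y [i, j, k])
    (\<lambda>i j k l. nabla \<Gamma> T y [i, j, k, l]) (Sq y)"
proof -
  interpret g2_pt "h y" "g y" "\<lambda>i j k. \<phi> y [i, j, k]" "psi y" by (rule g2_pt[OF y])
  show ?thesis
  proof
    show "Sq y = (\<lambda>a b c d. tr (h y) (\<lambda>s s'. T y [a, b, s] * T y [s', c, d]))"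
      by (simp add: Sq_def fun_eq_iff)
    fix i j k l m a b c d x
    show "Rl y i j k l = - Rl y j i k l" by (rule R12)
    show "Rl y i j k l = - Rl y i j l k" by (rule R34[OF y])
    show "T y [i, j, k] = - T y [j, i, k]" "T y [i, j, k] = - T y [i, k, j]" by (rule T_swap[OF y])+
    show "nabla \<Gamma> T y [i, j, k, l] = - nabla \<Gamma> T y [i, k, j, l]" "nabla \<Gamma> T y [i, j, k, l] = - nabla \<Gamma> T y [i, j, l, k]"
      by (rule DT_swap[OF y])+
    show "Rl y x j k l + Rl y j k x l + Rl y k x j l =
      nabla \<Gamma> T y [x, j, k, l] + nabla \<Gamma> T y [j, k, x, l] + nabla \<Gamma> T y [k, x, j, l] + (Sq y x j k l + Sq y j k x l + Sq y k x j l)"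
      unfolding Sq_def by (rule bianchi[OF y])
    show "nabla \<Gamma> T y [a, b, c, d] - nabla \<Gamma> T y [b, a, c, d] + nabla \<Gamma> T y [c, a, b, d] - nabla \<Gamma> T y [d, a, b, c] +
       (Sq y a b c d - Sq y a c b d + Sq y a d b c + Sq y b c a d - Sq y b d a c + Sq y c d a b) = 0"
      using ext_d_3[where \<alpha> = T and y = y, OF T_alt[OF y], where \<Gamma> = \<Gamma> and a = a and b = b and c = c and d = d] T_closed[OF y, of "[a, b, c, d]"]
      unfolding Sq_def sum_tors[OF y] by simp
    \<comment> \<open>The form is parallel too, so its Ricci identity says that the curvature
      annihilates it.\<close>
    have n: "nabla \<Gamma> \<phi> z m = 0" if "z \<in> U" "length m = 4" for z m
      using that phi_par by (auto elim: length_4E)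
    have nn: "nabla \<Gamma> (nabla \<Gamma> \<phi>) y (i # m) = 0" if "length m = 4" for i m
      by (rule nabla_zero[OF _ y]) (use n that in simp)
    have "act (Kc \<Gamma> y i j) (\<phi> y) [k, l, m] = 0"
      using ricci_identity[OF phi_smooth y, of i j "[k, l, m]"] by (simp add: nn n[OF y])
    then show "tr (h y) (\<lambda>a b. Rl y i j k a * \<phi> y [b, l, m]) + tr (h y) (\<lambda>a b. Rl y i j l a * \<phi> y [k, b, m])
        + tr (h y) (\<lambda>a b. Rl y i j m a * \<phi> y [k, l, b]) = 0"
      by (simp add: act_Cons sum_Kc[OF y])
  qed
qed

definition \<theta> :: "real^7 \<Rightarrow> tens" where
  "\<theta> z l = th (h z) (\<phi> z) (T z) l"

lemma smooth_theta: "smooth_tens U \<theta>"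
  unfolding \<theta>_def[abs_def] th_def by (intro smooth_cmult smooth_contr smooth_T phi_smooth)

lemma nabla_contr_phi:
  assumes \<alpha>: "smooth_tens U \<alpha>" and y: "y \<in> U" and l: "length l = Suc p" and k: "k = 2" "p \<le> 1" and kl: "length l + k = 3 + p"
  shows "nabla \<Gamma> (\<lambda>z. contr (h z) p k (\<alpha> z) (\<phi> z)) y (i # l) =
    contr (h y) p k (\<lambda>m. nabla \<Gamma> \<alpha> y (i # m)) (\<phi> y) l"
proof -
  have "contr (h y) p k (\<alpha> y) (\<lambda>n. nabla \<Gamma> \<phi> y (i # n)) l = contr (h y) p k (\<alpha> y) (\<lambda>n. 0) l"
  proof (rule contr_cong)
    fix m :: "7 list" assume "length m = k + length (drop p l)"
    then obtain a b c where "m = [a, b, c]" using l k kl by (auto elim!: length_3E)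
    then show "nabla \<Gamma> \<phi> y (i # m) = 0" using phi_par[OF y] by simp
  qed simp
  also have "\<dots> = 0" by (simp add: contr_def)
  finally show ?thesis using nabla_contr[OF \<alpha> phi_smooth y, of p l k i] l by simp
qed

text \<open>The inverse metric and the form are parallel, so the derivative falls on the torsion
  only.\<close>

lemma nabla_theta:
  assumes y: "y \<in> U"
  shows "nabla \<Gamma> \<theta> y [v, j] = th (h y) (\<phi> y) (\<lambda>m. nabla \<Gamma> T y (v # m)) [j]"
proof -
  have s: "smooth_tens U (\<lambda>z. contr (h z) 1 2 (T z) (\<phi> z))" by (intro smooth_contr smooth_T phi_smooth)
  have "nabla \<Gamma> \<theta> y [v, j] = - (1 / 6) * nabla \<Gamma> (\<lambda>z. contr (h z) 0 2 (contr (h z) 1 2 (T z) (\<phi> z)) (\<phi> z)) y [v, j]"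
    unfolding \<theta>_def[abs_def] th_def by (rule nabla_cmult[OF smooth_contr[OF s phi_smooth] y])
  also have "nabla \<Gamma> (\<lambda>z. contr (h z) 0 2 (contr (h z) 1 2 (T z) (\<phi> z)) (\<phi> z)) y [v, j] =
      contr (h y) 0 2 (\<lambda>m. nabla \<Gamma> (\<lambda>z. contr (h z) 1 2 (T z) (\<phi> z)) y (v # m)) (\<phi> y) [j]"
    by (rule nabla_contr_phi[OF s y]) simp_all
  also have "\<dots> = contr (h y) 0 2 (contr (h y) 1 2 (\<lambda>m. nabla \<Gamma> T y (v # m)) (\<phi> y)) (\<phi> y) [j]"
  proof (rule contr_cong)
    fix m :: "7 list" assume "length m = length (take 0 [j]) + 2"
    then show "nabla \<Gamma> (\<lambda>z. contr (h z) 1 2 (T z) (\<phi> z)) y (v # m) = contr (h y) 1 2 (\<lambda>m. nabla \<Gamma> T y (v # m)) (\<phi> y) m"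
      by (intro nabla_contr_phi[OF smooth_T y]) simp_all
  qed simp
  finally show ?thesis by (simp add: th_def)
qed

lemma ricci_eq: "y \<in> U \<Longrightarrow> ricci g \<Gamma> y i j = curv_pt.Ric (h y) (Rl y) i j"
  using curv_pt.Ric_def[OF curv_pt] by (simp add: ricci_def tr_def curv_eq Rl_def h_def)

lemma th_tr:
  assumes y: "y \<in> U"
  shows "th (h y) (\<phi> y) A [j] = - (1 / 6) * tr (h y) (\<lambda>c c'. tr (h y) (\<lambda>e e'.
    tr (h y) (\<lambda>a a'. tr (h y) (\<lambda>b b'. A [c, a, b] * \<phi> y [a', b', e])) * \<phi> y [c', e', j]))"
proof -
  interpret metric_pt "h y" "g y" by (rule metric_pt[OF y])
  show ?thesis by (simp add: th_def contr_tr)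
qed

lemma ricci_theta:
  assumes y: "y \<in> U" shows "ricci g \<Gamma> y v j = - nabla \<Gamma> \<theta> y [v, j]"
proof -
  interpret curv_pt "h y" "g y" "\<lambda>i j k. \<phi> y [i, j, k]" "psi y" "Rl y" "\<lambda>i j k. T y [i, j, k]"
    "\<lambda>i j k l. nabla \<Gamma> T y [i, j, k, l]" "Sq y" by (rule curv_pt[OF y])
  show ?thesis
    unfolding ricci_eq[OF y] nabla_theta[OF y] th_tr[OF y] Ric_Um[of v j] Um_def by simp
qed

text \<open>\<open>Sd\<close> is the trace of the Ricci tensor of the characteristic connection, by \<open>ricci_theta\<close>.\<close>

definition F :: "real^7 \<Rightarrow> real" where "F z = contr (h z) 0 1 (\<theta> z) (\<theta> z) []"
definition N :: "real^7 \<Rightarrow> real" where "N z = contr (h z) 0 3 (T z) (T z) []"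
definition tau :: "real^7 \<Rightarrow> real" where "tau z = contr (h z) 0 3 (T z) (\<phi> z) []"
definition Sd :: "real^7 \<Rightarrow> real" where "Sd z = - contr (h z) 0 2 (metric_tensor g z) (nabla \<Gamma> \<theta> z) []"

lemma smooth_F: "smooth_on U F" and smooth_N: "smooth_on U N" and smooth_tau: "smooth_on U tau" and smooth_Sd: "smooth_on U Sd"
proof -
  show "smooth_on U F" using smooth_contr[OF smooth_theta smooth_theta] by (simp add: F_def[abs_def] smooth_tens_def)
  show "smooth_on U N" using smooth_contr[OF smooth_T smooth_T] by (simp add: N_def[abs_def] smooth_tens_def)
  show "smooth_on U tau" using smooth_contr[OF smooth_T phi_smooth] by (simp add: tau_def[abs_def] smooth_tens_def)
  have "smooth_on U (\<lambda>z. contr (h z) 0 2 (metric_tensor g z) (nabla \<Gamma> \<theta> z) [])"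
    using smooth_contr[OF smooth_metric smooth_nabla[OF smooth_theta]] by (simp add: smooth_tens_def)
  then show "smooth_on U Sd" unfolding Sd_def[abs_def] by (rule smooth_on_uminus[OF U])
qed

text \<open>A trace written as a contraction against the parallel tensor \<open>g\<close>, so that
  \<open>nabla_contr\<close> also differentiates traces.\<close>

lemma contr_metric_tr:
  assumes y: "y \<in> U"
  shows "contr (h y) 0 2 (metric_tensor g y) \<alpha> l = tr (h y) (\<lambda>a b. \<alpha> (a # b # l))"
proof -
  interpret metric_pt "h y" "g y" by (rule metric_pt[OF y])
  have "contr (h y) 0 2 (metric_tensor g y) \<alpha> l = tr (h y) (\<lambda>a b. tr (h y) (\<lambda>c d. g y $ a $ c * \<alpha> (b # d # l)))"
    by (simp add: contr_tr metric_tensor_def)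
  also have "\<dots> = tr (h y) (\<lambda>a b. \<alpha> (b # a # l))" by (simp only: tr_metric)
  also have "\<dots> = tr (h y) (\<lambda>a b. \<alpha> (a # b # l))" by (rule tr_swap)
  finally show ?thesis .
qed

lemma Sd_tr: "y \<in> U \<Longrightarrow> Sd y = - tr (h y) (\<lambda>a b. nabla \<Gamma> \<theta> y [a, b])"
  by (simp add: Sd_def contr_metric_tr)

lemma nabla_contr_metric:
  assumes \<alpha>: "smooth_tens U \<alpha>" and y: "y \<in> U"
  shows "nabla \<Gamma> (\<lambda>z. contr (h z) 0 2 (metric_tensor g z) (\<alpha> z)) y (i # l) =
    tr (h y) (\<lambda>a b. nabla \<Gamma> \<alpha> y (i # a # b # l))"
proof -
  have "contr (h y) 0 2 (\<lambda>m. nabla \<Gamma> (metric_tensor g) y (i # m)) (\<alpha> y) l = contr (h y) 0 2 (\<lambda>m. 0) (\<alpha> y) l"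
  proof (rule contr_cong)
    fix m :: "7 list" assume "length m = length (take 0 l) + 2"
    then obtain a b where "m = [a, b]" by (auto simp: numeral_2_eq_2 length_Suc_conv)
    then show "nabla \<Gamma> (metric_tensor g) y (i # m) = 0" using compat[OF y] by simp
  qed simp
  also have "\<dots> = 0" by (simp add: contr_def)
  finally show ?thesis
    using nabla_contr[OF smooth_metric \<alpha> y, of 0 l 2 i] by (simp add: contr_metric_tr[OF y])
qed

lemma partial_nabla_Nil: "partial i (\<lambda>z. \<alpha> z []) y = nabla \<Gamma> \<alpha> y [i]"
  by (simp add: nabla_Cons)

lemma partial_tau:
  assumes y: "y \<in> U" shows "partial i tau y = 0"
proof -
  interpret curv_pt "h y" "g y" "\<lambda>i j k. \<phi> y [i, j, k]" "psi y" "Rl y" "\<lambda>i j k. T y [i, j, k]"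
    "\<lambda>i j k l. nabla \<Gamma> T y [i, j, k, l]" "Sq y" by (rule curv_pt[OF y])
  have "contr (h y) 0 3 (T y) (\<lambda>n. nabla \<Gamma> \<phi> y (i # n)) [] = contr (h y) 0 3 (T y) (\<lambda>n. 0) []"
    by (rule contr_cong) (auto elim!: length_3E simp: phi_par[OF y])
  also have "\<dots> = 0" by (simp add: contr_def)
  finally have "partial i tau y = contr (h y) 0 3 (\<lambda>m. nabla \<Gamma> T y (i # m)) (\<phi> y) []"
    unfolding tau_def[abs_def] partial_nabla_Nil[of i "\<lambda>z. contr (h z) 0 3 (T z) (\<phi> z)"]
    using nabla_contr[OF smooth_T phi_smooth y, of 0 "[]" 3 i] by simp
  also have "\<dots> = c3 (\<lambda>j k l. nabla \<Gamma> T y [i, j, k, l]) (\<lambda>i j k. \<phi> y [i, j, k])"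
    by (simp add: contr_tr c3_def)
  also have "\<dots> = 0" by (rule c3_DT_phi)
  finally show ?thesis .
qed

text \<open>Eliminates |Um|^2 between \<open>trace_Ric\<close> and \<open>quadratic\<close>: 4 S = 2
  N - (12 N + 36 F + tau^2) / 9.\<close>

lemma Sd_eq:
  assumes y: "y \<in> U" shows "Sd y = N y / 6 - F y - (tau y)\<^sup>2 / 36"
proof -
  interpret curv_pt "h y" "g y" "\<lambda>i j k. \<phi> y [i, j, k]" "psi y" "Rl y" "\<lambda>i j k. T y [i, j, k]"
    "\<lambda>i j k l. nabla \<Gamma> T y [i, j, k, l]" "Sq y" by (rule curv_pt[OF y])
  interpret pt: adapted_pt "E y" "matrix_inv (E y)" "transpose (E y) ** E y" "matrix_inv (transpose (E y) ** E y)" "\<phi> y"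
    by (rule adapted_pt[OF y]) simp_all
  have Sd: "Sd y = tr (h y) Ric"
  proof -
    have "Ric a b = - nabla \<Gamma> \<theta> y [a, b]" for a b using ricci_theta[OF y, of a b] ricci_eq[OF y, of a b] by simp
    then have "tr (h y) (\<lambda>a b. Ric a b) = - tr (h y) (\<lambda>a b. nabla \<Gamma> \<theta> y [a, b])" by (simp only: tr_uminus)
    then show ?thesis unfolding Sd_tr[OF y] by simp
  qed
  have q: "9 * contr (h y) 0 2 (contr (h y) 1 2 (T y) (\<phi> y)) (contr (h y) 1 2 (T y) (\<phi> y)) [] =
      12 * N y + 36 * F y + (tau y)\<^sup>2"
    using pt.quadratic[OF T_alt[OF y]] unfolding h_E[OF y, symmetric] N_def F_def tau_def \<theta>_def[abs_def]
    by simp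
  have u: "contr (h y) 0 2 (contr (h y) 1 2 (T y) (\<phi> y)) (contr (h y) 1 2 (T y) (\<phi> y)) [] =
      t (\<lambda>s s'. t (\<lambda>e e'. Um (\<lambda>i j k. T y [i, j, k]) s e * Um (\<lambda>i j k. T y [i, j, k]) s' e'))"
    by (simp add: contr_tr Um_def)
  have n: "c3 (\<lambda>i j k. T y [i, j, k]) (\<lambda>i j k. T y [i, j, k]) = N y"
    by (simp add: c3_def N_def contr_tr)
  show ?thesis using trace_Ric q unfolding Sd u n by simp
qed

section \<open>The Bochner formula for the Lee form\<close>

lemma partial_F:
  assumes y: "y \<in> U"
  shows "partial j F y = 2 * tr (h y) (\<lambda>a b. nabla \<Gamma> \<theta> y [j, a] * \<theta> y [b])"
proof -
  interpret metric_pt "h y" "g y" by (rule metric_pt[OF y])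
  have "partial j F y = contr (h y) 0 1 (\<lambda>m. nabla \<Gamma> \<theta> y (j # m)) (\<theta> y) []
      + contr (h y) 0 1 (\<theta> y) (\<lambda>n. nabla \<Gamma> \<theta> y (j # n)) []"
    unfolding F_def[abs_def] partial_nabla_Nil[of j "\<lambda>z. contr (h z) 0 1 (\<theta> z) (\<theta> z)"]
    by (rule nabla_contr[OF smooth_theta smooth_theta y]) simp
  also have "contr (h y) 0 1 (\<theta> y) (\<lambda>n. nabla \<Gamma> \<theta> y (j # n)) [] = tr (h y) (\<lambda>a b. \<theta> y [a] * nabla \<Gamma> \<theta> y [j, b])"
    by (simp add: contr_tr)
  also have "\<dots> = tr (h y) (\<lambda>a b. nabla \<Gamma> \<theta> y [j, a] * \<theta> y [b])"
    by (subst tr_swap) (simp only: mult.commute)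
  finally show ?thesis by (simp add: contr_tr)
qed

text \<open>The left side is the Hessian of \<open>F\<close> for the connection
  \<open>\<Gamma>\<close>. The differential of \<open>F\<close> is rewritten as a tensor
  \<open>H\<close> so that the Leibniz rule applies a second time.\<close>

lemma partial_partial_F:
  assumes y: "y \<in> U"
  shows "partial i (partial j F) y - (\<Sum>a\<in>UNIV. cf \<Gamma> y i j a * partial a F y) =
    2 * tr (h y) (\<lambda>a b. nabla \<Gamma> (nabla \<Gamma> \<theta>) y [i, j, a] * \<theta> y [b])
    + 2 * tr (h y) (\<lambda>a b. nabla \<Gamma> \<theta> y [j, a] * nabla \<Gamma> \<theta> y [i, b])"
proof -
  define H where "H z l = 2 * contr (h z) 1 1 (nabla \<Gamma> \<theta> z) (\<theta> z) l" for z l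
  have H: "partial j F z = H z [j]" if "z \<in> U" for z j
  proof -
    interpret metric_pt "h z" "g z" by (rule metric_pt[OF that])
    show ?thesis unfolding partial_F[OF that] H_def by (simp add: contr_tr)
  qed
  interpret metric_pt "h y" "g y" by (rule metric_pt[OF y])
  have s: "smooth_tens U (\<lambda>z. contr (h z) 1 1 (nabla \<Gamma> \<theta> z) (\<theta> z))"
    by (intro smooth_contr smooth_nabla smooth_theta)
  have "nabla \<Gamma> H y [i, j] = 2 * nabla \<Gamma> (\<lambda>z. contr (h z) 1 1 (nabla \<Gamma> \<theta> z) (\<theta> z)) y [i, j]"
    unfolding H_def[abs_def] by (rule nabla_cmult[OF s y])
  also have "nabla \<Gamma> (\<lambda>z. contr (h z) 1 1 (nabla \<Gamma> \<theta> z) (\<theta> z)) y [i, j] =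
      contr (h y) 1 1 (\<lambda>m. nabla \<Gamma> (nabla \<Gamma> \<theta>) y (i # m)) (\<theta> y) [j]
      + contr (h y) 1 1 (nabla \<Gamma> \<theta> y) (\<lambda>n. nabla \<Gamma> \<theta> y (i # n)) [j]"
    by (rule nabla_contr[OF smooth_nabla[OF smooth_theta] smooth_theta y]) simp
  finally have "nabla \<Gamma> H y [i, j] = 2 * tr (h y) (\<lambda>a b. nabla \<Gamma> (nabla \<Gamma> \<theta>) y [i, j, a] * \<theta> y [b])
    + 2 * tr (h y) (\<lambda>a b. nabla \<Gamma> \<theta> y [j, a] * nabla \<Gamma> \<theta> y [i, b])"
    by (simp add: contr_tr)
  moreover have "partial i (partial j F) y = partial i (\<lambda>z. H z [j]) y"
    by (rule partial_cong_open[OF U y H])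
  ultimately show ?thesis by (simp add: nabla_Cons[of \<Gamma> H] act_Cons H[OF y])
qed

lemma partial_Sd: assumes y: "y \<in> U" shows "partial z Sd y = - tr (h y) (\<lambda>a b. nabla \<Gamma> (nabla \<Gamma> \<theta>) y [z, a, b])"
proof -
  have s: "smooth_tens U (\<lambda>z. contr (h z) 0 2 (metric_tensor g z) (nabla \<Gamma> \<theta> z))"
    by (intro smooth_contr smooth_metric smooth_nabla smooth_theta)
  have "partial z Sd y = - partial z (\<lambda>z. contr (h z) 0 2 (metric_tensor g z) (nabla \<Gamma> \<theta> z) []) y"
    unfolding Sd_def[abs_def] by (rule partial_uminus) (rule smooth_tens_differentiable[OF s y])
  also have "partial z (\<lambda>z. contr (h z) 0 2 (metric_tensor g z) (nabla \<Gamma> \<theta> z) []) y =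
      tr (h y) (\<lambda>a b. nabla \<Gamma> (nabla \<Gamma> \<theta>) y [z, a, b])"
    unfolding partial_nabla_Nil[of z "\<lambda>z. contr (h z) 0 2 (metric_tensor g z) (nabla \<Gamma> \<theta> z)"]
    by (rule nabla_contr_metric[OF smooth_nabla[OF smooth_theta] y])
  finally show ?thesis .
qed

lemma Dtheta_antisym:
  assumes y: "y \<in> U"
  shows "tr (h y) (\<lambda>a b. nabla \<Gamma> T y [a, b, i, j]) = - (nabla \<Gamma> \<theta> y [i, j] - nabla \<Gamma> \<theta> y [j, i])"
proof -
  interpret curv_pt "h y" "g y" "\<lambda>i j k. \<phi> y [i, j, k]" "psi y" "Rl y" "\<lambda>i j k. T y [i, j, k]"
    "\<lambda>i j k l. nabla \<Gamma> T y [i, j, k, l]" "Sq y" by (rule curv_pt[OF y])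
  show ?thesis
    using Ric_antisym[of i j] ricci_theta[OF y, of i j] ricci_theta[OF y, of j i]
      ricci_eq[OF y, of i j] ricci_eq[OF y, of j i] by simp
qed

lemma laplace_theta_chart:
  assumes y: "y \<in> U"
  shows "tr (h y) (\<lambda>a b. nabla \<Gamma> (nabla \<Gamma> \<theta>) y [a, b, z]) =
    tr (h y) (\<lambda>a b. nabla \<Gamma> (nabla \<Gamma> \<theta>) y [z, a, b]) - tr (h y) (\<lambda>a b. nabla \<Gamma> \<theta> y [z, a] * \<theta> y [b])"
proof -
  interpret curv_pt "h y" "g y" "\<lambda>i j k. \<phi> y [i, j, k]" "psi y" "Rl y" "\<lambda>i j k. T y [i, j, k]"
    "\<lambda>i j k l. nabla \<Gamma> T y [i, j, k, l]" "Sq y" by (rule curv_pt[OF y])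
  note sT = smooth_T and sDT = smooth_nabla[OF smooth_T] and sD\<theta> = smooth_nabla[OF smooth_theta]
  show ?thesis
  proof (rule laplace_theta[where DDT = "\<lambda>a b c d z. nabla \<Gamma> (nabla \<Gamma> T) y [a, b, c, d, z]"
        and DDth = "\<lambda>a b c. nabla \<Gamma> (nabla \<Gamma> \<theta>) y [a, b, c]" and Dth = "\<lambda>a b. nabla \<Gamma> \<theta> y [a, b]" and th = "\<lambda>a. \<theta> y [a]"])
    show "nabla \<Gamma> \<theta> y [v, j] = - Ric v j" for v j
      using ricci_theta[OF y, of v j] ricci_eq[OF y, of v j] by simp
    show "nabla \<Gamma> (nabla \<Gamma> T) y [a, b, c, d, z] = - nabla \<Gamma> (nabla \<Gamma> T) y [a, b, d, c, z]" for a b c d z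
    proof -
      have "nabla \<Gamma> (nabla \<Gamma> T) y (a # [b] @ c # d # [z]) = - nabla \<Gamma> (nabla \<Gamma> T) y (a # [b] @ d # c # [z])"
      proof (rule nabla_swap[OF sDT y, where n = 1 and m = 1])
        fix w and xs ys :: "7 list" and c d :: 7 assume "w \<in> U" "length xs = 1" "length ys = 1"
        then show "nabla \<Gamma> T w (xs @ c # d # ys) = - nabla \<Gamma> T w (xs @ d # c # ys)"
          using DT_swap(1)[of w _ c d] by (auto simp: length_Suc_conv)
      qed simp_all
      then show ?thesis by simp
    qed
    show "nabla \<Gamma> (nabla \<Gamma> T) y [a, c, d, b, z] - nabla \<Gamma> (nabla \<Gamma> T) y [c, a, d, b, z] =
      - (t (\<lambda>s u. Rl y a c d s * T y [u, b, z]) + t (\<lambda>s u. Rl y a c b s * T y [d, u, z]) + t (\<lambda>s u. Rl y a c z s * T y [d, b, u]))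
      - t (\<lambda>s u. T y [a, c, s] * nabla \<Gamma> T y [u, d, b, z])" for a c d b z
      using ricci_identity[OF sT y, of a c "[d, b, z]"] by (simp add: act_Cons sum_Kc[OF y] sum_tors[OF y])
    show "nabla \<Gamma> (nabla \<Gamma> \<theta>) y [a, w, b] - nabla \<Gamma> (nabla \<Gamma> \<theta>) y [w, a, b] =
      - t (\<lambda>s u. Rl y a w b s * \<theta> y [u]) - t (\<lambda>s u. T y [a, w, s] * nabla \<Gamma> \<theta> y [u, b])" for a w b
      using ricci_identity[OF smooth_theta y, of a w "[b]"] by (simp add: act_Cons sum_Kc[OF y] sum_tors[OF y])
    show "nabla \<Gamma> (nabla \<Gamma> \<theta>) y [a, b, z] - nabla \<Gamma> (nabla \<Gamma> \<theta>) y [a, z, b] =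
      - t (\<lambda>c d. nabla \<Gamma> (nabla \<Gamma> T) y [a, c, d, b, z])" for a b z
    proof -
      \<comment> \<open>The divergence of the torsion as a tensor field. It equals the skew part of
        the derivative of the Lee form up to sign on the whole chart, so the identity may be
        differentiated.\<close>
      define B where "B w = contr (h w) 0 2 (metric_tensor g w) (nabla \<Gamma> T w)" for w
      have sB: "smooth_tens U B" unfolding B_def by (intro smooth_contr smooth_metric sDT)
      have B: "B w [i, j] = nabla \<Gamma> \<theta> w [j, i] - nabla \<Gamma> \<theta> w [i, j]" if "w \<in> U" for w i j
        unfolding B_def contr_metric_tr[OF that] using Dtheta_antisym[OF that, of i j] by simp
      have "partial a (\<lambda>w. B w [b, z]) y = partial a (\<lambda>w. nabla \<Gamma> \<theta> w [z, b] - nabla \<Gamma> \<theta> w [b, z]) y"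
        by (rule partial_cong_open[OF U y B])
      also have "\<dots> = partial a (\<lambda>w. nabla \<Gamma> \<theta> w [z, b]) y - partial a (\<lambda>w. nabla \<Gamma> \<theta> w [b, z]) y"
        by (intro partial_diff smooth_tens_differentiable[OF sD\<theta> y])
      finally have "nabla \<Gamma> B y [a, b, z] = nabla \<Gamma> (nabla \<Gamma> \<theta>) y [a, z, b] - nabla \<Gamma> (nabla \<Gamma> \<theta>) y [a, b, z]"
        by (simp add: nabla_Cons[of \<Gamma> B] nabla_Cons[of \<Gamma> "nabla \<Gamma> \<theta>"] act_Cons B[OF y] right_diff_distrib sum_subtractf)
      moreover have "nabla \<Gamma> B y [a, b, z] = t (\<lambda>c d. nabla \<Gamma> (nabla \<Gamma> T) y [a, c, d, b, z])"
        unfolding B_def[abs_def] by (rule nabla_contr_metric[OF sDT y])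
      ultimately show ?thesis by simp
    qed
  qed
qed

definition Dsq :: "real^7 \<Rightarrow> real" where
  "Dsq y = tr (h y) (\<lambda>i j. tr (h y) (\<lambda>a b. nabla \<Gamma> \<theta> y [i, a] * nabla \<Gamma> \<theta> y [j, b]))"

text \<open>The Laplacian of the Lee form is paired with the Lee form itself: its gradient term
  gives \<open>Sd\<close>, and its zero order term gives half the differential of
  \<open>F\<close>.\<close>

lemma bochner:
  assumes y: "y \<in> U"
  shows "tr (h y) (\<lambda>i j. partial i (partial j F) y - (\<Sum>a\<in>UNIV. cf \<Gamma> y i j a * partial a F y)) =
    2 * Dsq y - 2 * tr (h y) (\<lambda>a b. partial a Sd y * \<theta> y [b]) - tr (h y) (\<lambda>a b. partial a F y * \<theta> y [b])"
proof -
  interpret metric_pt "h y" "g y" by (rule metric_pt[OF y])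
  have 1: "t (\<lambda>i j. t (\<lambda>a b. nabla \<Gamma> \<theta> y [j, a] * nabla \<Gamma> \<theta> y [i, b])) = Dsq y"
    unfolding Dsq_def by (rule tr_swap)
  have "t (\<lambda>i j. t (\<lambda>a b. nabla \<Gamma> (nabla \<Gamma> \<theta>) y [i, j, a] * \<theta> y [b])) =
      t (\<lambda>a b. t (\<lambda>i j. nabla \<Gamma> (nabla \<Gamma> \<theta>) y [i, j, a] * \<theta> y [b]))" by (rule tr_comm)
  also have "\<dots> = t (\<lambda>a b. (- partial a Sd y - partial a F y / 2) * \<theta> y [b])"
    by (simp add: tr_multc laplace_theta_chart[OF y] partial_Sd[OF y] partial_F[OF y])
  also have "\<dots> = - t (\<lambda>a b. partial a Sd y * \<theta> y [b]) - t (\<lambda>a b. partial a F y * \<theta> y [b]) / 2"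
    by (simp add: left_diff_distrib tr_diff tr_uminus tr_divc)
  finally show ?thesis
    unfolding partial_partial_F[OF y] tr_add tr_cmult 1 by simp
qed

lemma tr_adapted:
  assumes y: "y \<in> U"
  shows "tr (h y) G = (\<Sum>c\<in>UNIV. \<Sum>a\<in>UNIV. \<Sum>b\<in>UNIV. matrix_inv (E y) $ a $ c * matrix_inv (E y) $ b $ c * G a b)"
proof -
  interpret pt: adapted_pt "E y" "matrix_inv (E y)" "transpose (E y) ** E y" "matrix_inv (transpose (E y) ** E y)" "\<phi> y"
    by (rule adapted_pt[OF y]) simp_all
  have "h y = matrix_inv (E y) ** transpose (matrix_inv (E y))" using pt.h_eq h_E[OF y] by simp
  then have "tr (h y) G = (\<Sum>a\<in>UNIV. \<Sum>b\<in>UNIV. \<Sum>c\<in>UNIV. matrix_inv (E y) $ a $ c * matrix_inv (E y) $ b $ c * G a b)"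
    by (simp add: tr_def matrix_matrix_mult_def transpose_def sum_distrib_right)
  also have "\<dots> = (\<Sum>a\<in>UNIV. \<Sum>c\<in>UNIV. \<Sum>b\<in>UNIV. matrix_inv (E y) $ a $ c * matrix_inv (E y) $ b $ c * G a b)"
    by (rule sum.cong[OF refl]) (rule sum.swap)
  also have "\<dots> = (\<Sum>c\<in>UNIV. \<Sum>a\<in>UNIV. \<Sum>b\<in>UNIV. matrix_inv (E y) $ a $ c * matrix_inv (E y) $ b $ c * G a b)"
    by (rule sum.swap)
  finally show ?thesis .
qed

text \<open>The sum of squares gives nonnegativity and the case of equality.\<close>

lemma Dsq_frame:
  assumes y: "y \<in> U"
  defines "P \<equiv> matrix_inv (E y)"
  shows "Dsq y = (\<Sum>c\<in>UNIV. \<Sum>d\<in>UNIV. (pull P (nabla \<Gamma> \<theta> y) [c, d])\<^sup>2)"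
proof -
  have "Dsq y = (\<Sum>c\<in>UNIV. \<Sum>i\<in>UNIV. \<Sum>j\<in>UNIV. P $ i $ c * P $ j $ c *
      (\<Sum>d\<in>UNIV. \<Sum>a\<in>UNIV. \<Sum>b\<in>UNIV. P $ a $ d * P $ b $ d * (nabla \<Gamma> \<theta> y [i, a] * nabla \<Gamma> \<theta> y [j, b])))"
    unfolding Dsq_def tr_adapted[OF y] P_def ..
  also have "\<dots> = (\<Sum>c\<in>UNIV. \<Sum>d\<in>UNIV. (\<Sum>i\<in>UNIV. \<Sum>a\<in>UNIV. P $ i $ c * P $ a $ d * nabla \<Gamma> \<theta> y [i, a])
      * (\<Sum>j\<in>UNIV. \<Sum>b\<in>UNIV. P $ j $ c * P $ b $ d * nabla \<Gamma> \<theta> y [j, b]))"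
  proof (rule sum.cong[OF refl])
    fix c
    let ?D = "\<lambda>i a. nabla \<Gamma> \<theta> y [i, a]"
    have "(\<Sum>i\<in>UNIV. \<Sum>j\<in>UNIV. P $ i $ c * P $ j $ c * (\<Sum>d\<in>UNIV. \<Sum>a\<in>UNIV. \<Sum>b\<in>UNIV. P $ a $ d * P $ b $ d * (?D i a * ?D j b)))
      = (\<Sum>i\<in>UNIV. \<Sum>j\<in>UNIV. \<Sum>d\<in>UNIV. (\<Sum>a\<in>UNIV. P $ i $ c * P $ a $ d * ?D i a) * (\<Sum>b\<in>UNIV. P $ j $ c * P $ b $ d * ?D j b))"
      unfolding sum_product unfolding sum_distrib_left by (intro sum.cong refl) (simp only: mult_ac)
    also have "\<dots> = (\<Sum>i\<in>UNIV. \<Sum>d\<in>UNIV. \<Sum>j\<in>UNIV. (\<Sum>a\<in>UNIV. P $ i $ c * P $ a $ d * ?D i a) * (\<Sum>b\<in>UNIV. P $ j $ c * P $ b $ d * ?D j b))"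
      by (rule sum.cong[OF refl]) (rule sum.swap)
    also have "\<dots> = (\<Sum>d\<in>UNIV. \<Sum>i\<in>UNIV. \<Sum>j\<in>UNIV. (\<Sum>a\<in>UNIV. P $ i $ c * P $ a $ d * ?D i a) * (\<Sum>b\<in>UNIV. P $ j $ c * P $ b $ d * ?D j b))"
      by (rule sum.swap)
    also have "\<dots> = (\<Sum>d\<in>UNIV. (\<Sum>i\<in>UNIV. \<Sum>a\<in>UNIV. P $ i $ c * P $ a $ d * ?D i a) * (\<Sum>j\<in>UNIV. \<Sum>b\<in>UNIV. P $ j $ c * P $ b $ d * ?D j b))"
      by (rule sum.cong[OF refl]) (rule sum_product[symmetric])
    finally show "(\<Sum>i\<in>UNIV. \<Sum>j\<in>UNIV. P $ i $ c * P $ j $ c * (\<Sum>d\<in>UNIV. \<Sum>a\<in>UNIV. \<Sum>b\<in>UNIV. P $ a $ d * P $ b $ d * (?D i a * ?D j b)))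
      = (\<Sum>d\<in>UNIV. (\<Sum>i\<in>UNIV. \<Sum>a\<in>UNIV. P $ i $ c * P $ a $ d * ?D i a) * (\<Sum>j\<in>UNIV. \<Sum>b\<in>UNIV. P $ j $ c * P $ b $ d * ?D j b))" .
  qed
  finally show ?thesis by (simp add: pull_explicit power2_eq_square)
qed

lemma Dsq_nonneg: "y \<in> U \<Longrightarrow> 0 \<le> Dsq y"
  by (simp add: Dsq_frame sum_nonneg)

lemma Dsq_eq_0D:
  assumes y: "y \<in> U" and 0: "Dsq y = 0" shows "nabla \<Gamma> \<theta> y [i, j] = 0"
proof -
  interpret pt: adapted_pt "E y" "matrix_inv (E y)" "transpose (E y) ** E y" "matrix_inv (transpose (E y) ** E y)" "\<phi> y"
    by (rule adapted_pt[OF y]) simp_all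
  let ?p = "pull (matrix_inv (E y)) (nabla \<Gamma> \<theta> y)"
  have "?p [c, d] = 0" for c d
    using 0 by (simp add: Dsq_frame[OF y] sum_nonneg_eq_0_iff sum_nonneg)
  then have "pull (E y) ?p [i, j] = 0" by (simp add: pull_explicit)
  then show ?thesis by (simp add: pt.pull_inverse)
qed

end

section \<open>The Lee form and the Riemannian scalar curvature\<close>

context g2_chart
begin

lemma alternating_phi: "y \<in> U \<Longrightarrow> alternating (\<phi> y)"
  using adapted_pt.alternating_f[OF adapted_pt] .

lemma ext_d_phi:
  assumes y: "y \<in> U"
  defines "S \<equiv> \<lambda>a b c d. tr (h y) (\<lambda>s s'. T y [a, b, s] * \<phi> y [s', c, d])"
  shows "ext_d 3 \<phi> y [a, b, c, d] = S a b c d - S a c b d + S a d b c + S b c a d - S b d a c + S c d a b"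
  using ext_d_3[where \<alpha> = \<phi> and y = y, OF alternating_phi[OF y], where \<Gamma> = \<Gamma> and a = a and b = b and c = c and d = d]
  unfolding S_def sum_tors[OF y] by (simp add: phi_par[OF y])

lemma alternating_ext_d_phi:
  assumes y: "y \<in> U" shows "alternating (ext_d 3 \<phi> y)"
proof (rule alternating_4I)
  fix l :: "7 list" assume "length l \<noteq> 4"
  then show "ext_d 3 \<phi> y l = 0" by (simp add: ext_d_def)
next
  fix a b c d
  define S where "S a b c d = tr (h y) (\<lambda>s s'. T y [a, b, s] * \<phi> y [s', c, d])" for a b c d
  have S12: "S a b c d = - S b a c d" for a b c d
    unfolding S_def using T_swap(1)[OF y, of a b] by (simp add: tr_uminus)
  have S34: "S a b c d = - S a b d c" for a b c d
    unfolding S_def using alternatingD[OF alternating_phi[OF y], of "[_]" c d "[]"] by (simp add: tr_uminus)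
  note e = ext_d_phi[OF y, folded S_def]
  show "ext_d 3 \<phi> y [a, b, c, d] = - ext_d 3 \<phi> y [b, a, c, d]"
    unfolding e using S12[of a b c d] S34[of c d a b] by simp
  show "ext_d 3 \<phi> y [a, b, c, d] = - ext_d 3 \<phi> y [a, c, b, d]"
    unfolding e using S12[of b c a d] S34[of a d b c] by simp
  show "ext_d 3 \<phi> y [a, b, c, d] = - ext_d 3 \<phi> y [a, b, d, c]"
    unfolding e using S12[of c d a b] S34[of a b c d] by simp
qed

text \<open>The -1/18 of \<open>lee_contr\<close> times the 3 of \<open>lee_algebra\<close> is the
  -1/6 in \<open>th\<close>.\<close>

lemma lee_form_eq:
  assumes y: "y \<in> U" shows "lee_form \<phi> y [i] = \<theta> y [i]"
proof -
  interpret g2_pt "h y" "g y" "\<lambda>i j k. \<phi> y [i, j, k]" "psi y" by (rule g2_pt[OF y])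
  interpret pt: adapted_pt "E y" "matrix_inv (E y)" "transpose (E y) ** E y" "matrix_inv (transpose (E y) ** E y)" "\<phi> y"
    by (rule adapted_pt[OF y]) simp_all
  have "lee_form \<phi> y [i] = - (1 / 18) * contr (h y) 0 3 (\<phi> y) (ext_d 3 \<phi> y) [i]"
    unfolding lee_form_def g2_star_def pt.metric_f pt.vol_f pt.lee_contr[OF alternating_ext_d_phi[OF y]] h_E[OF y] ..
  also have "contr (h y) 0 3 (\<phi> y) (ext_d 3 \<phi> y) [i] =
      t (\<lambda>a a'. t (\<lambda>b b'. t (\<lambda>c c'. \<phi> y [a, b, c] * ext_d 3 \<phi> y [a', b', c', i])))"
    by (simp add: contr_tr)
  also have "\<dots> = 3 * t (\<lambda>s s'. t (\<lambda>c c'. t (\<lambda>a a'. t (\<lambda>b b'. T y [s, a, b] * \<phi> y [a', b', c])) * \<phi> y [s', c', i]))"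
    by (rule lee_algebra[where T = "\<lambda>a b c. T y [a, b, c]" and \<eta> = "\<lambda>a b c d. ext_d 3 \<phi> y [a, b, c, d]", OF T_swap[OF y]])
      (rule ext_d_phi[OF y])
  finally show ?thesis unfolding \<theta>_def th_tr[OF y] by simp
qed

lemma lee_form_length: "length l \<noteq> 1 \<Longrightarrow> lee_form \<phi> y l = 0"
  by (simp add: lee_form_def g2_star_def hodge_length)

text \<open>Compatibility splits each metric derivative into two lowered coefficients
  \<open>C\<close>. In the Christoffel formula the differences of \<open>C\<close> are torsions,
  which cancel by skew symmetry and leave the symmetric part.\<close>

lemma levi_civita_eq:
  assumes y: "y \<in> U" shows "cf (levi_civita g) y i j k = cf \<Gamma> y i j k - tors \<Gamma> y i j k / 2"
proof -
  define C where "C i j k = (\<Sum>a\<in>UNIV. cf \<Gamma> y i j a * g y $ a $ k)" for i j k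
  have dg: "partial i (\<lambda>z. g z $ j $ k) y = C i j k + C i k j" for i j k
    unfolding partial_g[OF y] C_def using g_sym[OF y, of j] by simp
  have TC: "T y [i, j, k] = C i j k - C j i k" for i j k
    unfolding T_eq C_def tors_def using g_sym[OF y, of k]
    by (simp add: right_diff_distrib sum_subtractf mult.commute)
  have "cf (levi_civita g) y i j k = (\<Sum>l\<in>UNIV. h y $ k $ l * (C i j l + C i l j + (C j i l + C j l i) - (C l i j + C l j i))) / 2"
    by (simp add: cf_def levi_civita_def dg h_def)
  also have "\<dots> = (\<Sum>l\<in>UNIV. h y $ k $ l * (\<Sum>a\<in>UNIV. g y $ l $ a * (cf \<Gamma> y i j a + cf \<Gamma> y j i a))) / 2"
  proof -
    have "C i j l + C i l j + (C j i l + C j l i) - (C l i j + C l j i) = (\<Sum>a\<in>UNIV. g y $ l $ a * (cf \<Gamma> y i j a + cf \<Gamma> y j i a))" for l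
    proof -
      have "C i j l + C i l j + (C j i l + C j l i) - (C l i j + C l j i) = C i j l + C j i l"
        using TC[of i l j] TC[of j l i] T_swap(2)[OF y, of i l j] T_swap(1)[OF y, of i j l] T_swap(2)[OF y, of j l i] by simp
      also have "\<dots> = (\<Sum>a\<in>UNIV. g y $ l $ a * (cf \<Gamma> y i j a + cf \<Gamma> y j i a))"
        unfolding C_def using g_sym[OF y, of l] by (simp add: distrib_left sum.distrib mult.commute)
      finally show ?thesis .
    qed
    then show ?thesis by simp
  qed
  also have "(\<Sum>l\<in>UNIV. h y $ k $ l * (\<Sum>a\<in>UNIV. g y $ l $ a * (cf \<Gamma> y i j a + cf \<Gamma> y j i a)))
      = (h y ** g y *v (\<chi> a. cf \<Gamma> y i j a + cf \<Gamma> y j i a)) $ k"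
    by (simp add: matrix_vector_mul_assoc[symmetric]) (simp add: matrix_vector_mult_def)
  finally show ?thesis by (simp add: hg[OF y] tors_def field_simps)
qed

text \<open>In the full trace the derivative terms vanish. Two torsion squares survive, with
  coefficients -1/2 and 1/4 and trace \<open>- N y\<close> each, which gives
  \<open>N y / 4\<close>.\<close>

lemma scal_levi_civita:
  assumes y: "y \<in> U" shows "scal g (levi_civita g) y = Sd y + N y / 4"
proof -
  interpret curv_pt "h y" "g y" "\<lambda>i j k. \<phi> y [i, j, k]" "psi y" "Rl y" "\<lambda>i j k. T y [i, j, k]"
    "\<lambda>i j k l. nabla \<Gamma> T y [i, j, k, l]" "Sq y" by (rule curv_pt[OF y])
  let ?L = "levi_civita g"
  have lc: "conn_chart U ?L"
  proof
    fix i j a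
    have "smooth_on U (\<lambda>z. (- 1 / 2) * tors \<Gamma> z i j a)" by (intro smooth_on_mult smooth_on_const U smooth_tors)
    then have "smooth_on U (\<lambda>z. cf \<Gamma> z i j a + (- 1 / 2) * tors \<Gamma> z i j a)"
      by (intro smooth_on_add U cf)
    then show "smooth_on U (\<lambda>z. cf ?L z i j a)"
      by (subst smooth_on_cong[OF U, of _ "\<lambda>z. cf \<Gamma> z i j a + (- 1 / 2) * tors \<Gamma> z i j a"]) (simp_all add: levi_civita_eq)
  qed (rule U)
  interpret L: conn_chart U ?L by (rule lc)
  have dt: "(\<lambda>z. tors \<Gamma> z i j a) differentiable (at y)" for i j a
    by (rule smooth_on_differentiable[OF smooth_tors y])
  have pL: "partial x (\<lambda>z. cf ?L z i j a) y = partial x (\<lambda>z. cf \<Gamma> z i j a) y - partial x (\<lambda>z. tors \<Gamma> z i j a) y / 2" for x i j a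
  proof -
    have "partial x (\<lambda>z. cf ?L z i j a) y = partial x (\<lambda>z. cf \<Gamma> z i j a - 1 / 2 * tors \<Gamma> z i j a) y"
      by (rule partial_cong_open[OF U y]) (simp add: levi_civita_eq)
    also have "\<dots> = partial x (\<lambda>z. cf \<Gamma> z i j a) y - 1 / 2 * partial x (\<lambda>z. tors \<Gamma> z i j a) y"
      by (simp only: partial_diff[OF cf_differentiable[OF y] differentiable_mult[OF differentiable_const dt]] partial_cmult[OF dt])
    finally show ?thesis by simp
  qed
  have K: "Kc ?L y i j k a = Kc \<Gamma> y i j k a - (Dtors y i j k a - Dtors y j i k a) / 2
      - (\<Sum>s\<in>UNIV. tors \<Gamma> y i j s * tors \<Gamma> y s k a) / 2
      + (\<Sum>s\<in>UNIV. tors \<Gamma> y j k s * tors \<Gamma> y i s a) / 4 - (\<Sum>s\<in>UNIV. tors \<Gamma> y i k s * tors \<Gamma> y j s a) / 4" for i j k a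
  proof -
    have "tors \<Gamma> y i j s = cf \<Gamma> y i j s - cf \<Gamma> y j i s" for s by (simp add: tors_def)
    then have 1: "(\<Sum>s\<in>UNIV. tors \<Gamma> y i j s * tors \<Gamma> y s k a) =
        (\<Sum>s\<in>UNIV. cf \<Gamma> y i j s * tors \<Gamma> y s k a) - (\<Sum>s\<in>UNIV. cf \<Gamma> y j i s * tors \<Gamma> y s k a)"
      by (simp add: left_diff_distrib sum_subtractf)
    have 2: "(\<Sum>s\<in>UNIV. (cf \<Gamma> y p k s - tors \<Gamma> y p k s / 2) * (cf \<Gamma> y q s a - tors \<Gamma> y q s a / 2)) =
        (\<Sum>s\<in>UNIV. cf \<Gamma> y p k s * cf \<Gamma> y q s a) - (\<Sum>s\<in>UNIV. cf \<Gamma> y p k s * tors \<Gamma> y q s a) / 2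
        - (\<Sum>s\<in>UNIV. cf \<Gamma> y q s a * tors \<Gamma> y p k s) / 2 + (\<Sum>s\<in>UNIV. tors \<Gamma> y p k s * tors \<Gamma> y q s a) / 4" for p q
      by (simp add: sum_divide_distrib sum.distrib[symmetric] sum_subtractf[symmetric] algebra_simps)
    show ?thesis unfolding Kc_def Dtors_def pL levi_civita_eq[OF y] 1 2 by (simp add: field_simps)
  qed
  have low: "(\<Sum>a\<in>UNIV. g y $ l $ a * (\<Sum>s\<in>UNIV. tors \<Gamma> y p q s * G s a)) =
      tr (h y) (\<lambda>s s'. T y [p, q, s] * (\<Sum>a\<in>UNIV. g y $ l $ a * G s' a))" for G l p q
  proof -
    have "(\<Sum>a\<in>UNIV. g y $ l $ a * (\<Sum>s\<in>UNIV. tors \<Gamma> y p q s * G s a)) =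
        (\<Sum>s\<in>UNIV. tors \<Gamma> y p q s * (\<Sum>a\<in>UNIV. g y $ l $ a * G s a))"
      unfolding sum_distrib_left by (subst sum.swap) (simp only: mult.left_commute)
    then show ?thesis by (simp only: sum_tors[OF y])
  qed
  have Rc: "curv g ?L y i j k l = Rl y i j k l - nabla \<Gamma> T y [i, j, k, l] / 2 + nabla \<Gamma> T y [j, i, k, l] / 2
      - Sq y i j k l / 2 - Sq y j k i l / 4 + Sq y i k j l / 4" for i j k l
  proof -
    have 1: "(\<Sum>a\<in>UNIV. g y $ l $ a * (\<Sum>s\<in>UNIV. tors \<Gamma> y p q s * tors \<Gamma> y s r a)) = Sq y p q r l" for p q r
      unfolding low Sq_def T_eq[symmetric] ..
    have 2: "(\<Sum>a\<in>UNIV. g y $ l $ a * (\<Sum>s\<in>UNIV. tors \<Gamma> y p q s * tors \<Gamma> y r s a)) = - Sq y p q r l" for p q r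
      unfolding low Sq_def T_eq[symmetric] using T_swap(1)[OF y, of r _ l] by (simp add: tr_uminus)
    have 3: "(\<Sum>a\<in>UNIV. g y $ l $ a * (F a / c)) = (\<Sum>a\<in>UNIV. g y $ l $ a * F a) / c" for F :: "7 \<Rightarrow> real" and c
      by (simp add: sum_divide_distrib)
    show ?thesis
      unfolding L.curv_eq[OF y] K distrib_left right_diff_distrib sum.distrib sum_subtractf 3 1 2
      unfolding nabla_T[OF y] Rl_def[symmetric] right_diff_distrib sum_subtractf by (simp add: field_simps)
  qed
  have tS: "t (\<lambda>j k. t (\<lambda>i l. Sq y i j k l)) = - N y"
  proof -
    have "Sq y i j k l = - t (\<lambda>s s'. T y [i, j, s] * T y [l, k, s'])" for i j k l
      using T_swap(1)[OF y, of _ k l] T_swap(2)[OF y, of k _ l] T_swap(1)[OF y, of l k] unfolding Sq_def by (simp add: tr_uminus)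
    then have "t (\<lambda>j k. t (\<lambda>i l. Sq y i j k l)) = - t (\<lambda>j k. t (\<lambda>i l. t (\<lambda>s s'. T y [i, j, s] * T y [l, k, s'])))"
      by (simp only: tr_uminus)
    also have "t (\<lambda>j k. t (\<lambda>i l. t (\<lambda>s s'. T y [i, j, s] * T y [l, k, s']))) = N y"
      by (subst tr_comm) (simp add: N_def contr_tr)
    finally show ?thesis .
  qed
  have tS2: "t (\<lambda>j k. t (\<lambda>i l. Sq y i k j l)) = - N y"
    by (subst tr_swap) (rule tS)
  have tS3: "t (\<lambda>j k. t (\<lambda>i l. Sq y j k i l)) = 0"
  proof (rule tr_antisym)
    show "t (\<lambda>i l. Sq y a b i l) = - t (\<lambda>i l. Sq y b a i l)" for a b
      unfolding tr_uminus[symmetric] by (rule tr_cong) (rule S12)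
  qed
  have tD1: "t (\<lambda>j k. t (\<lambda>i l. nabla \<Gamma> T y [i, j, k, l])) = 0"
  proof (rule tr_antisym)
    show "t (\<lambda>i l. nabla \<Gamma> T y [i, a, b, l]) = - t (\<lambda>i l. nabla \<Gamma> T y [i, b, a, l])" for a b
      unfolding tr_uminus[symmetric] by (rule tr_cong) (rule DT23)
  qed
  have tD2: "t (\<lambda>j k. t (\<lambda>i l. nabla \<Gamma> T y [j, i, k, l])) = 0"
  proof -
    have "t (\<lambda>i l. nabla \<Gamma> T y [j, i, k, l]) = 0" for j k
    proof (rule tr_antisym)
      show "nabla \<Gamma> T y [j, a, k, b] = - nabla \<Gamma> T y [j, b, k, a]" for a b
        using DT23[of j a k b] DT34[of j k a b] DT23[of j k b a] by simp
    qed
    then show ?thesis by (simp add: tr_0)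
  qed
  have "scal g ?L y = t (\<lambda>j k. t (\<lambda>i l. curv g ?L y i j k l))"
    by (simp add: scal_def ricci_def tr_def h_def)
  also have "\<dots> = t (\<lambda>j k. t (\<lambda>i l. Rl y i j k l)) + N y / 4"
    unfolding Rc tr_add tr_diff tr_divc tS tS2 tS3 tD1 tD2 by simp
  also have "t (\<lambda>j k. t (\<lambda>i l. Rl y i j k l)) = Sd y"
  proof -
    have "t (\<lambda>i l. Rl y i j k l) = - nabla \<Gamma> \<theta> y [j, k]" for j k
      using ricci_theta[OF y, of j k] by (simp add: ricci_eq[OF y] Ric_def)
    then show ?thesis unfolding Sd_tr[OF y] by (simp only: tr_uminus)
  qed
  finally show ?thesis .
qed

lemma norm_sq_N: "norm_sq (g y) 3 (T y) = N y"
  by (simp add: norm_sq_contr N_def h_def)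

end

section \<open>The codifferential as a divergence\<close>

text \<open>Antisymmetrization over eight indices from a set of seven vanishes.\<close>

lemma eps0_schouten:
  assumes j: "length j = 8"
  shows "(\<Sum>r<8. (- 1) ^ r * (if j ! r = a then 1 else 0) * eps0 (take r j @ drop (Suc r) j)) = 0"
proof -
  have "wedge 1 7 (covector (axis a 1)) eps0 j = 0"
  proof (rule alternating_not_distinct[OF alternating_wedge])
    show "\<not> distinct j"
    proof
      assume "distinct j"
      then have "card (set j) = 8" using j distinct_card by fastforce
      moreover have "card (set j) \<le> CARD(7)" by (rule card_mono) simp_all
      ultimately show False by simp
    qed
  qed
  also have "wedge 1 7 (covector (axis a 1)) eps0 j =
      (\<Sum>b\<le>7. (if b = 0 then 1 else - 1) * axis a 1 $ (j ! b) * eps0 (tl (j[0 := j ! b, b := j ! 0])))"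
    by (rule wedge_covector[OF alternating_eps0]) (simp add: j)
  also have "\<dots> = (\<Sum>r<8. (- 1) ^ r * (if j ! r = a then 1 else 0) * eps0 (take r j @ drop (Suc r) j))"
  proof (rule sum.cong)
    show "{..7} = {..<8::nat}" by auto
    fix r :: nat assume "r \<in> {..<8}"
    then have r: "r < length j" using j by simp
    obtain x xs where jx: "j = x # xs" using j by (cases j) auto
    have "(if r = 0 then 1 else - 1) * eps0 (tl (j[0 := j ! r, r := j ! 0])) = (- 1) ^ r * eps0 (take r j @ drop (Suc r) j)"
    proof (cases r)
      case 0
      then show ?thesis using jx by (simp add: drop_Suc)
    next
      case (Suc s)
      have s: "s < length xs" using r jx Suc by simp
      have "eps0 (xs[s := x]) = eps0 (take s xs @ x # drop (Suc s) xs)" using s by (simp add: upd_conv_take_nth_drop)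
      also have "\<dots> = (- 1) ^ s * eps0 (x # take s xs @ drop (Suc s) xs)"
        using alternating_move[OF alternating_eps0, of "[]" x "take s xs" "drop (Suc s) xs"] s
        by (simp add: mult.assoc[symmetric] power_mult_distrib[symmetric])
      finally show ?thesis using jx Suc by simp
    qed
    then show "(if r = 0 then 1 else - 1) * axis a 1 $ (j ! r) * eps0 (tl (j[0 := j ! r, r := j ! 0]))
        = (- 1) ^ r * (if j ! r = a then 1 else 0) * eps0 (take r j @ drop (Suc r) j)"
      by (auto simp: axis_def)
  qed
  finally show ?thesis .
qed

lemma sum_length_insert:
  assumes r: "r < Suc p"
  shows "(\<Sum>m::7 list | length m = Suc p. f m) = (\<Sum>a\<in>UNIV. \<Sum>m | length m = p. f (take r m @ a # drop r m))"
proof -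
  have "(\<Sum>m | length m = Suc p. f m) = (\<Sum>m | length m = r + Suc (p - r). f m)" using r by simp
  also have "\<dots> = (\<Sum>m1 | length m1 = r. \<Sum>a\<in>UNIV. \<Sum>m2 | length m2 = p - r. f (m1 @ a # m2))"
    by (simp only: sum_length_add sum_length_Suc)
  also have "\<dots> = (\<Sum>a\<in>UNIV. \<Sum>m1 | length m1 = r. \<Sum>m2 | length m2 = p - r. f (m1 @ a # m2))"
    by (rule sum.swap)
  also have "\<dots> = (\<Sum>a\<in>UNIV. \<Sum>m1 | length m1 = r. \<Sum>m2 | length m2 = p - r. f (take r (m1 @ m2) @ a # drop r (m1 @ m2)))"
    by (intro sum.cong refl) simp
  also have "\<dots> = (\<Sum>a\<in>UNIV. \<Sum>m | length m = r + (p - r). f (take r m @ a # drop r m))"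
    by (simp only: sum_length_add)
  finally show ?thesis using r by simp
qed

lemma sum_lessThan_add: "(\<Sum>r<m + n. f r) = (\<Sum>r<m. f r) + (\<Sum>k<n. f (m + k :: nat) :: real)"
  by (induction n) (simp_all add: add.assoc)

text \<open>\<open>eps0_schouten\<close> for the eight indices \<open>m @ n\<close>. Terms that omit
  an index of \<open>m\<close> are all equal to the divergence; those that omit an index of
  \<open>n\<close> form the exterior derivative.\<close>

lemma antisym_divergence:
  fixes B :: "7 \<Rightarrow> 7 list \<Rightarrow> real"
  assumes B: "\<And>a. alternating (B a)" and n: "length n = 7 - p" and p: "p < 7"
  shows "(\<Sum>k<7 - p. (- 1) ^ k * (\<Sum>m | length m = Suc p. B (n ! k) m * eps0 (m @ take k n @ drop (Suc k) n))) =
    (- 1) ^ p * real (Suc p) * (\<Sum>m | length m = p. (\<Sum>a\<in>UNIV. B a (a # m)) * eps0 (m @ n))"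
proof -
  let ?e = "\<lambda>j r. eps0 (take r j @ drop (Suc r) j)"
  let ?S = "{m::7 list. length m = Suc p}"
  have "0 = (\<Sum>m\<in>?S. \<Sum>r<8. (- 1) ^ r * B ((m @ n) ! r) m * ?e (m @ n) r)"
  proof (rule sum.neutral[symmetric], rule ballI)
    fix m :: "7 list" assume "m \<in> ?S"
    then have l: "length (m @ n) = 8" using n p by simp
    have "(\<Sum>r<8. (- 1) ^ r * B ((m @ n) ! r) m * ?e (m @ n) r) =
        (\<Sum>r<8. \<Sum>a\<in>UNIV. B a m * ((- 1) ^ r * (if (m @ n) ! r = a then 1 else 0) * ?e (m @ n) r))"
      by (intro sum.cong refl) (simp add: if_distrib[of "\<lambda>x. _ * x"] if_distrib[of "\<lambda>x. x * _"] sum.delta cong: if_cong)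
    also have "\<dots> = (\<Sum>a\<in>UNIV. B a m * (\<Sum>r<8. (- 1) ^ r * (if (m @ n) ! r = a then 1 else 0) * ?e (m @ n) r))"
      unfolding sum_distrib_left by (rule sum.swap)
    also have "\<dots> = 0" unfolding eps0_schouten[OF l] by simp
    finally show "(\<Sum>r<8. (- 1) ^ r * B ((m @ n) ! r) m * ?e (m @ n) r) = 0" .
  qed
  also have "\<dots> = (\<Sum>r<8. \<Sum>m\<in>?S. (- 1) ^ r * B ((m @ n) ! r) m * ?e (m @ n) r)" by (rule sum.swap)
  also have "\<dots> = (\<Sum>r<Suc p. \<Sum>m\<in>?S. (- 1) ^ r * B (m ! r) m * eps0 (take r m @ drop (Suc r) m @ n))
      + (\<Sum>k<7 - p. \<Sum>m\<in>?S. (- 1) ^ (Suc p + k) * B (n ! k) m * eps0 (m @ take k n @ drop (Suc k) n))"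
  proof -
    have "{..<8} = {..<Suc p + (7 - p)}" using p by auto
    then have "(\<Sum>r<8. \<Sum>m\<in>?S. (- 1) ^ r * B ((m @ n) ! r) m * ?e (m @ n) r) =
      (\<Sum>r<Suc p. \<Sum>m\<in>?S. (- 1) ^ r * B ((m @ n) ! r) m * ?e (m @ n) r)
      + (\<Sum>k<7 - p. \<Sum>m\<in>?S. (- 1) ^ (Suc p + k) * B ((m @ n) ! (Suc p + k)) m * ?e (m @ n) (Suc p + k))"
      by (simp only: sum_lessThan_add)
    also have "(\<Sum>r<Suc p. \<Sum>m\<in>?S. (- 1) ^ r * B ((m @ n) ! r) m * ?e (m @ n) r) =
        (\<Sum>r<Suc p. \<Sum>m\<in>?S. (- 1) ^ r * B (m ! r) m * eps0 (take r m @ drop (Suc r) m @ n))"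
      by (intro sum.cong refl) (auto simp: nth_append)
    also have "(\<Sum>k<7 - p. \<Sum>m\<in>?S. (- 1) ^ (Suc p + k) * B ((m @ n) ! (Suc p + k)) m * ?e (m @ n) (Suc p + k)) =
        (\<Sum>k<7 - p. \<Sum>m\<in>?S. (- 1) ^ (Suc p + k) * B (n ! k) m * eps0 (m @ take k n @ drop (Suc k) n))"
      by (intro sum.cong refl) (auto simp: nth_append)
    finally show ?thesis .
  qed
  also have "(\<Sum>r<Suc p. \<Sum>m\<in>?S. (- 1) ^ r * B (m ! r) m * eps0 (take r m @ drop (Suc r) m @ n)) =
      (\<Sum>r<Suc p. \<Sum>m | length m = p. (\<Sum>a\<in>UNIV. B a (a # m)) * eps0 (m @ n))"
  proof (rule sum.cong[OF refl])
    fix r assume "r \<in> {..<Suc p}"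
    then have r: "r < Suc p" by simp
    have "(\<Sum>m\<in>?S. (- 1) ^ r * B (m ! r) m * eps0 (take r m @ drop (Suc r) m @ n)) =
        (\<Sum>a\<in>UNIV. \<Sum>m | length m = p. B a (a # m) * eps0 (m @ n))"
      unfolding sum_length_insert[OF r]
    proof (intro sum.cong refl)
      fix a :: 7 and m :: "7 list" assume "m \<in> {m. length m = p}"
      then have l: "length (take r m) = r" using r by simp
      have "B a (take r m @ a # drop r m) = (- 1) ^ r * B a (a # m)"
        using alternating_move[OF B, of a "[]" a "take r m" "drop r m"] l
        by (simp add: mult.assoc[symmetric] power_mult_distrib[symmetric])
      moreover have tk: "take r m @ drop r m @ n = m @ n" by (simp flip: append_assoc)
      ultimately show "(- 1) ^ r * B ((take r m @ a # drop r m) ! r) (take r m @ a # drop r m)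
          * eps0 (take r (take r m @ a # drop r m) @ drop (Suc r) (take r m @ a # drop r m) @ n) = B a (a # m) * eps0 (m @ n)"
        using l by (simp add: tk nth_append mult.assoc[symmetric] power_mult_distrib[symmetric])
    qed
    also have "\<dots> = (\<Sum>m | length m = p. (\<Sum>a\<in>UNIV. B a (a # m)) * eps0 (m @ n))"
      unfolding sum_distrib_right by (rule sum.swap)
    finally show "(\<Sum>m\<in>?S. (- 1) ^ r * B (m ! r) m * eps0 (take r m @ drop (Suc r) m @ n)) =
        (\<Sum>m | length m = p. (\<Sum>a\<in>UNIV. B a (a # m)) * eps0 (m @ n))" .
  qed
  also have "(\<Sum>k<7 - p. \<Sum>m\<in>?S. (- 1) ^ (Suc p + k) * B (n ! k) m * eps0 (m @ take k n @ drop (Suc k) n)) =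
      (- 1) ^ Suc p * (\<Sum>k<7 - p. (- 1) ^ k * (\<Sum>m\<in>?S. B (n ! k) m * eps0 (m @ take k n @ drop (Suc k) n)))"
    by (simp add: sum_distrib_left power_add mult_ac)
  finally have "(- 1) ^ p * (\<Sum>k<7 - p. (- 1) ^ k * (\<Sum>m\<in>?S. B (n ! k) m * eps0 (m @ take k n @ drop (Suc k) n))) =
      real (Suc p) * (\<Sum>m | length m = p. (\<Sum>a\<in>UNIV. B a (a # m)) * eps0 (m @ n))"
    by simp
  then have "(- 1) ^ p * ((- 1) ^ p * (\<Sum>k<7 - p. (- 1) ^ k * (\<Sum>m\<in>?S. B (n ! k) m * eps0 (m @ take k n @ drop (Suc k) n)))) =
      (- 1) ^ p * (real (Suc p) * (\<Sum>m | length m = p. (\<Sum>a\<in>UNIV. B a (a # m)) * eps0 (m @ n)))" by simp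
  then show ?thesis by (simp add: mult.assoc[symmetric] power_mult_distrib[symmetric])
qed

text \<open>Replacing an index by another one creates a repetition, so only diagonal entries
  act.\<close>

lemma act_top:
  assumes \<alpha>: "alternating \<alpha>" and L: "distinct L" "set L = UNIV"
  shows "act G \<alpha> L = (\<Sum>s\<in>UNIV. G s s) * \<alpha> L"
proof -
  have "(\<Sum>a\<in>UNIV. G (L ! m) a * \<alpha> (L[m := a])) = G (L ! m) (L ! m) * \<alpha> L" if m: "m < length L" for m
  proof -
    have "\<alpha> (L[m := a]) = 0" if "a \<noteq> L ! m" for a
    proof (rule alternating_not_distinct[OF \<alpha>])
      have "a \<in> set L" unfolding L(2) by simp
      then obtain k where k: "k < length L" "L ! k = a" unfolding in_set_conv_nth by blast
      then have "k \<noteq> m" using that by auto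
      then have "L[m := a] ! k = L[m := a] ! m" using k m by simp
      then show "\<not> distinct (L[m := a])"
        using k m \<open>k \<noteq> m\<close> nth_eq_iff_index_eq[of "L[m := a]" k m] by auto
    qed
    then have "(\<Sum>a\<in>UNIV. G (L ! m) a * \<alpha> (L[m := a])) = (\<Sum>a\<in>UNIV. if a = L ! m then G (L ! m) (L ! m) * \<alpha> L else 0)"
      by (intro sum.cong refl) auto
    then show ?thesis by (simp add: sum.delta)
  qed
  then have "act G \<alpha> L = (\<Sum>m<length L. G (L ! m) (L ! m) * \<alpha> L)" by (simp add: act_def)
  also have "\<dots> = (\<Sum>s\<in>set L. G s s * \<alpha> L)"
    by (rule sum.reindex_bij_betw[OF bij_betw_nth[OF L(1) refl refl]])
  finally show ?thesis by (simp add: L(2) sum_distrib_right)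
qed

section \<open>The parallel volume form and the divergence formula\<close>

locale g2_chart_vol = g2_chart +
  assumes vol_diff: "y \<in> U \<Longrightarrow> (\<lambda>z. g2_vol (\<phi> z) l) differentiable (at y)"
begin

definition w :: "real^7 \<Rightarrow> tens" where "w z = g2_vol (\<phi> z)"
definition v :: "real^7 \<Rightarrow> real" where "v z = w z [1, 2, 3, 4, 5, 6, 7]"

lemma w_E: "z \<in> U \<Longrightarrow> w z = pull (E z) eps0"
  unfolding w_def by (rule adapted_metric_vol(2)[OF adapted_E])

lemma alternating_w: "z \<in> U \<Longrightarrow> alternating (w z)"
  by (simp add: w_E alternating_pull alternating_eps0)

lemma w_v: assumes z: "z \<in> U" shows "w z l = v z * eps0 l"
proof (cases "length l = 7")
  case True
  then show ?thesis unfolding v_def by (rule alternating_7_eq[OF alternating_w[OF z]])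
next
  case False
  then show ?thesis by (simp add: w_E[OF z] pull_def eps0_length)
qed

lemma w_sq: assumes z: "z \<in> U" shows "contr (h z) 0 7 (w z) (w z) [] = 5040"
proof -
  interpret pt: adapted_pt "E z" "matrix_inv (E z)" "transpose (E z) ** E z" "matrix_inv (transpose (E z) ** E z)" "\<phi> z"
    by (rule adapted_pt[OF z]) simp_all
  show ?thesis using pt.norm_vol by (simp add: w_E[OF z] h_E[OF z])
qed

text \<open>Top forms are one-dimensional, so the derivative is \<open>c\<close> times
  \<open>eps0\<close>. Differentiating the constant norm in \<open>w_sq\<close> forces
  \<open>c = 0\<close>, because the norm is not 0.\<close>

lemma nabla_w:
  assumes y: "y \<in> U" and l: "length l = 7"
  shows "nabla \<Gamma> w y (i # l) = 0"
proof -
  let ?e = "contr (h y) 0 7 eps0 eps0 []"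
  define c where "c = nabla \<Gamma> w y (i # [1, 2, 3, 4, 5, 6, 7])"
  have d: "(\<lambda>z. w z m) differentiable (at y)" for m unfolding w_def by (rule vol_diff[OF y])
  have a: "alternating (\<lambda>l. nabla \<Gamma> w y (i # l))" by (rule alternating_nabla[OF U y alternating_w d])
  have n: "nabla \<Gamma> w y (i # m) = c * eps0 m" if "length m = 7" for m
    unfolding c_def by (rule alternating_7_eq[OF a that])
  have e: "contr (h y) 0 7 (\<lambda>m. a * eps0 m) (\<lambda>m. b * eps0 m) [] = a * b * ?e" for a b
    unfolding contr_def by (simp add: sum_distrib_left mult_ac)
  have "0 = partial i (\<lambda>z. contr (h z) 0 7 (w z) (w z) []) y"
    using partial_cong_open[OF U y w_sq, where i = i] by (simp add: partial_const)
  also have "\<dots> = contr (h y) 0 7 (\<lambda>m. nabla \<Gamma> w y (i # m)) (w y) [] + contr (h y) 0 7 (w y) (\<lambda>m. nabla \<Gamma> w y (i # m)) []"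
    unfolding partial_nabla_Nil[of i "\<lambda>z. contr (h z) 0 7 (w z) (w z)"] by (rule nabla_contr_diff[OF d d y]) simp
  also have "contr (h y) 0 7 (\<lambda>m. nabla \<Gamma> w y (i # m)) (w y) [] = contr (h y) 0 7 (\<lambda>m. c * eps0 m) (\<lambda>m. v y * eps0 m) []"
    by (rule contr_cong) (simp_all add: n w_v[OF y])
  also have "contr (h y) 0 7 (w y) (\<lambda>m. nabla \<Gamma> w y (i # m)) [] = contr (h y) 0 7 (\<lambda>m. v y * eps0 m) (\<lambda>m. c * eps0 m) []"
    by (rule contr_cong) (simp_all add: n w_v[OF y])
  finally have "c * v y * ?e = 0" unfolding e by simp
  moreover have "v y * v y * ?e = 5040"
    using w_sq[OF y] unfolding w_v[OF y, abs_def] e .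
  ultimately have "c = 0" by auto
  then show ?thesis using n[OF l] by simp
qed

lemma v_diff: "y \<in> U \<Longrightarrow> v differentiable (at y)"
  unfolding v_def[abs_def] w_def by (rule vol_diff)

lemma partial_v:
  assumes y: "y \<in> U" shows "partial i v y = (\<Sum>s\<in>UNIV. cf \<Gamma> y i s s) * v y"
proof -
  let ?L = "[1, 2, 3, 4, 5, 6, 7 :: 7]"
  have "partial i v y = act (cf \<Gamma> y i) (w y) ?L"
    using nabla_w[OF y, of ?L i] by (simp add: nabla_Cons v_def[abs_def])
  also have "\<dots> = (\<Sum>s\<in>UNIV. cf \<Gamma> y i s s) * w y ?L"
  proof (rule act_top[OF alternating_w[OF y]])
    show "set ?L = UNIV" unfolding UNIV7 by simp
  qed simp
  finally show ?thesis by (simp add: v_def)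
qed

definition up :: "(real^7 \<Rightarrow> tens) \<Rightarrow> real^7 \<Rightarrow> tens" where
  "up \<alpha> z = pull (h z) (\<alpha> z)"

lemma lk_h_sym: "z \<in> U \<Longrightarrow> length n = length m \<Longrightarrow> lk (h z) n m = lk (h z) m n"
  using lk_transpose[of n m "h z"] h_sym by (simp add: lk_def)

lemma up_diff:
  assumes \<alpha>: "smooth_tens U \<alpha>" and y: "y \<in> U"
  shows "(\<lambda>z. up \<alpha> z n) differentiable (at y)"
  unfolding up_def pull_def
  by (intro differentiable_sum ballI finite_length_eq differentiable_mult smooth_on_differentiable[OF smooth_lk y] smooth_tens_differentiable[OF \<alpha> y])

lemma partial_up:
  assumes \<alpha>: "smooth_tens U \<alpha>" and y: "y \<in> U"
  shows "partial i (\<lambda>z. up \<alpha> z n) y = pull (h y) (\<lambda>m. nabla \<Gamma> \<alpha> y (i # m)) n - act (\<lambda>j a. cf \<Gamma> y i a j) (up \<alpha> y) n"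
proof -
  let ?S = "{m::7 list. length m = length n}" and ?G = "\<lambda>j a. cf \<Gamma> y i a j"
  note dl = smooth_on_differentiable[OF smooth_lk y] and d\<alpha> = smooth_tens_differentiable[OF \<alpha> y]
  have "partial i (\<lambda>z. up \<alpha> z n) y = (\<Sum>m\<in>?S. partial i (\<lambda>z. lk (h z) m n) y * \<alpha> y m + lk (h y) m n * partial i (\<lambda>z. \<alpha> z m) y)"
    unfolding up_def pull_def
    by (subst partial_sum[OF differentiable_mult[OF dl d\<alpha>]]) (intro sum.cong refl partial_mult[OF dl d\<alpha>])
  also have "\<dots> = (\<Sum>m\<in>?S. lk (h y) m n * partial i (\<lambda>z. \<alpha> z m) y)
      - (\<Sum>m\<in>?S. act ?G (\<lambda>m. lk (h y) m n) m * \<alpha> y m) - (\<Sum>m\<in>?S. act ?G (\<lambda>n. lk (h y) m n) n * \<alpha> y m)"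
    unfolding sum_subtractf[symmetric] by (intro sum.cong refl) (simp add: partial_lk[OF y] algebra_simps)
  also have "(\<Sum>m\<in>?S. act ?G (\<lambda>m. lk (h y) m n) m * \<alpha> y m) = (\<Sum>m\<in>?S. lk (h y) m n * act (cf \<Gamma> y i) (\<alpha> y) m)"
    by (rule sum_act_transpose)
  also have "(\<Sum>m\<in>?S. act ?G (\<lambda>n. lk (h y) m n) n * \<alpha> y m) = act ?G (up \<alpha> y) n"
  proof -
    have "act ?G (up \<alpha> y) n = act ?G (\<lambda>n'. \<Sum>m\<in>?S. \<alpha> y m * lk (h y) m n') n"
      by (rule act_cong) (simp add: up_def pull_def mult.commute)
    then show ?thesis by (simp add: act_sum act_cmult mult.commute)
  qed
  finally show ?thesis
    by (simp add: pull_def nabla_Cons right_diff_distrib sum_subtractf)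
qed

lemma pull_h_Cons_trace:
  assumes y: "y \<in> U"
  shows "(\<Sum>a\<in>UNIV. pull (h y) (\<beta> a) (a # m)) = pull (h y) (\<lambda>n. tr (h y) (\<lambda>a b. \<beta> a (b # n))) m"
proof -
  have "(\<Sum>a\<in>UNIV. pull (h y) (\<beta> a) (a # m)) =
      (\<Sum>a\<in>UNIV. \<Sum>b\<in>UNIV. \<Sum>n | length n = length m. lk (h y) n m * (h y $ a $ b * \<beta> a (b # n)))"
    by (simp add: pull_def sum_length_Suc h_sym[OF y, of _ "_ :: 7"] mult_ac)
  also have "\<dots> = (\<Sum>a\<in>UNIV. \<Sum>n | length n = length m. \<Sum>b\<in>UNIV. lk (h y) n m * (h y $ a $ b * \<beta> a (b # n)))"
    by (rule sum.cong[OF refl]) (rule sum.swap)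
  also have "\<dots> = (\<Sum>n | length n = length m. \<Sum>a\<in>UNIV. \<Sum>b\<in>UNIV. lk (h y) n m * (h y $ a $ b * \<beta> a (b # n)))"
    by (rule sum.swap)
  finally show ?thesis by (simp add: pull_def tr_def sum_distrib_left)
qed

lemma tors_eq:
  assumes y: "y \<in> U" shows "tors \<Gamma> y a b c = (\<Sum>s\<in>UNIV. h y $ s $ c * T y [a, b, s])"
  using sum_tors[OF y, of a b "\<lambda>s. if s = c then 1 else 0"]
  by (simp add: tr_def if_distrib[of "\<lambda>x. _ * x"] cong: if_cong)

text \<open>Skew torsion is traceless; this removes it from the divergence formula.\<close>

lemma tors_trace:
  assumes y: "y \<in> U" shows "(\<Sum>a\<in>UNIV. tors \<Gamma> y b a a) = 0"
proof -
  interpret metric_pt "h y" "g y" by (rule metric_pt[OF y])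
  have "(\<Sum>a\<in>UNIV. tors \<Gamma> y b a a) = t (\<lambda>s a. T y [b, a, s])"
    unfolding tors_eq[OF y] tr_def by (rule sum.swap)
  also have "\<dots> = 0"
  proof (rule tr_antisym)
    show "T y [b, c, a] = - T y [b, a, c]" for a c by (rule T_swap(2)[OF y])
  qed
  finally show ?thesis .
qed

text \<open>The density \<open>v\<close> absorbs the trace of the coefficients. A derivation in the
  remaining slots \<open>m\<close> is left over: it is empty for 1-forms and vanishes for the
  torsion.\<close>

lemma divergence:
  assumes \<alpha>: "smooth_tens U \<alpha>" and y: "y \<in> U"
  shows "(\<Sum>a\<in>UNIV. partial a (\<lambda>z. v z * up \<alpha> z (a # m)) y) =
    v y * (pull (h y) (\<lambda>n. tr (h y) (\<lambda>a b. nabla \<Gamma> \<alpha> y (a # b # n))) m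
      - (\<Sum>a\<in>UNIV. act (\<lambda>j b. cf \<Gamma> y a b j) (\<lambda>n. up \<alpha> y (a # n)) m))"
proof -
  have 1: "partial a (\<lambda>z. v z * up \<alpha> z (a # m)) y = v y * ((\<Sum>s\<in>UNIV. cf \<Gamma> y a s s * up \<alpha> y (a # m))
      - (\<Sum>b\<in>UNIV. cf \<Gamma> y a b a * up \<alpha> y (b # m)) + pull (h y) (\<lambda>m. nabla \<Gamma> \<alpha> y (a # m)) (a # m)
      - act (\<lambda>j b. cf \<Gamma> y a b j) (\<lambda>n. up \<alpha> y (a # n)) m)" for a
    unfolding partial_mult[OF v_diff[OF y] up_diff[OF \<alpha> y]] partial_v[OF y] partial_up[OF \<alpha> y] act_Cons
      sum_distrib_right[symmetric]
    by (simp add: algebra_simps)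
  have "(\<Sum>a\<in>UNIV. \<Sum>s\<in>UNIV. cf \<Gamma> y a s s * up \<alpha> y (a # m)) - (\<Sum>a\<in>UNIV. \<Sum>b\<in>UNIV. cf \<Gamma> y a b a * up \<alpha> y (b # m)) =
      (\<Sum>a\<in>UNIV. \<Sum>s\<in>UNIV. cf \<Gamma> y a s s * up \<alpha> y (a # m)) - (\<Sum>b\<in>UNIV. \<Sum>a\<in>UNIV. cf \<Gamma> y a b a * up \<alpha> y (b # m))"
    by (simp only: sum.swap[of "\<lambda>a b. cf \<Gamma> y a b a * up \<alpha> y (b # m)"])
  also have "\<dots> = (\<Sum>b\<in>UNIV. (\<Sum>a\<in>UNIV. tors \<Gamma> y b a a) * up \<alpha> y (b # m))"
    by (simp add: tors_def sum_distrib_right left_diff_distrib sum_subtractf)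
  also have "\<dots> = 0" by (simp add: tors_trace[OF y])
  finally show ?thesis
    unfolding 1 sum_distrib_left[symmetric] by (simp add: sum.distrib sum_subtractf pull_h_Cons_trace[OF y])
qed

lemma hodge_up:
  assumes z: "z \<in> U" and l: "length l + p = 7"
  shows "hodge (g2_metric (\<phi> z)) (g2_vol (\<phi> z)) p (\<alpha> z) l =
    (\<Sum>m | length m = p. v z * up \<alpha> z m * eps0 (m @ l)) / fact p"
proof -
  have "hodge (g2_metric (\<phi> z)) (g2_vol (\<phi> z)) p (\<alpha> z) l = contr (h z) 0 p (\<alpha> z) (w z) l / fact p"
    by (simp add: hodge_contr[OF l] g_eq[OF z, symmetric] h_def w_def)
  also have "contr (h z) 0 p (\<alpha> z) (w z) l = (\<Sum>m | length m = p. \<Sum>n | length n = p. lk (h z) n m * \<alpha> z m * w z (n @ l))"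
    by (simp add: contr_def)
  also have "\<dots> = (\<Sum>n | length n = p. \<Sum>m | length m = p. lk (h z) n m * \<alpha> z m * w z (n @ l))"
    by (rule sum.swap)
  also have "\<dots> = (\<Sum>n | length n = p. v z * up \<alpha> z n * eps0 (n @ l))"
    by (intro sum.cong refl) (simp add: up_def pull_def w_v[OF z] sum_distrib_left sum_distrib_right lk_h_sym[OF z] mult_ac)
  finally show ?thesis .
qed

text \<open>The star is a density times raised components against the constant \<open>eps0\<close>.
  Its differential is thus an antisymmetrized derivative, which \<open>antisym_divergence\<close>
  converts.\<close>

lemma ext_d_hodge:
  assumes \<alpha>: "smooth_tens U \<alpha>" and alt: "\<And>z. z \<in> U \<Longrightarrow> alternating (\<alpha> z)" and y: "y \<in> U" and n: "length n = 7 - p" and p: "p < 7"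
  shows "ext_d (6 - p) (\<lambda>z. hodge (g2_metric (\<phi> z)) (g2_vol (\<phi> z)) (Suc p) (\<alpha> z)) y n =
    (- 1) ^ p / fact p * (\<Sum>m | length m = p. (\<Sum>a\<in>UNIV. partial a (\<lambda>z. v z * up \<alpha> z (a # m)) y) * eps0 (m @ n))"
proof -
  define B where "B a m = partial a (\<lambda>z. v z * up \<alpha> z m) y" for a m
  note d = differentiable_mult[OF v_diff[OF y] up_diff[OF \<alpha> y]]
  have B: "alternating (B a)" for a
    unfolding alternating_def
  proof (intro allI)
    fix xs ys and b c :: 7
    have "B a (xs @ b # c # ys) = partial a (\<lambda>z. - (v z * up \<alpha> z (xs @ c # b # ys))) y"
      unfolding B_def
    proof (rule partial_cong_open[OF U y])
      fix z assume "z \<in> U"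
      then show "v z * up \<alpha> z (xs @ b # c # ys) = - (v z * up \<alpha> z (xs @ c # b # ys))"
        using alternatingD[OF alternating_pull[OF alt], of z "h z" xs b c ys] by (simp add: up_def)
    qed
    then show "B a (xs @ b # c # ys) = - B a (xs @ c # b # ys)" by (simp add: partial_uminus[OF d] B_def)
  qed
  have ph: "partial a (\<lambda>z. hodge (g2_metric (\<phi> z)) (g2_vol (\<phi> z)) (Suc p) (\<alpha> z) l) y =
      (\<Sum>m | length m = Suc p. B a m * eps0 (m @ l)) / fact (Suc p)" if l: "length l + Suc p = 7" for a l
  proof -
    have "partial a (\<lambda>z. hodge (g2_metric (\<phi> z)) (g2_vol (\<phi> z)) (Suc p) (\<alpha> z) l) y =
        partial a (\<lambda>z. \<Sum>m | length m = Suc p. (eps0 (m @ l) / fact (Suc p)) * (v z * up \<alpha> z m)) y"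
      by (rule partial_cong_open[OF U y]) (simp add: hodge_up[OF _ l] sum_divide_distrib mult_ac)
    also have "\<dots> = (\<Sum>m | length m = Suc p. (eps0 (m @ l) / fact (Suc p)) * B a m)"
      unfolding B_def by (subst partial_sum[OF differentiable_mult[OF differentiable_const d]]) (simp only: partial_cmult[OF d])
    finally show ?thesis by (simp add: sum_divide_distrib mult_ac)
  qed
  have "ext_d (6 - p) (\<lambda>z. hodge (g2_metric (\<phi> z)) (g2_vol (\<phi> z)) (Suc p) (\<alpha> z)) y n =
    (\<Sum>k<7 - p. (- 1) ^ k * ((\<Sum>m | length m = Suc p. B (n ! k) m * eps0 (m @ take k n @ drop (Suc k) n)) / fact (Suc p)))"
  proof -
    have "{..6 - p} = {..<7 - p}" using p by auto
    moreover have "length n = Suc (6 - p)" using n p by simp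
    ultimately show ?thesis unfolding ext_d_def by (auto intro!: sum.cong simp: ph n)
  qed
  also have "\<dots> = (\<Sum>k<7 - p. (- 1) ^ k * (\<Sum>m | length m = Suc p. B (n ! k) m * eps0 (m @ take k n @ drop (Suc k) n))) / fact (Suc p)"
    by (subst sum_divide_distrib) (simp only: times_divide_eq_right)
  also have "\<dots> = ((- 1) ^ p * real (Suc p) * (\<Sum>m | length m = p. (\<Sum>a\<in>UNIV. B a (a # m)) * eps0 (m @ n))) / fact (Suc p)"
    by (rule arg_cong[OF antisym_divergence[OF B n p]])
  finally show ?thesis unfolding B_def by (simp add: divide_simps)
qed

lemma codiff_length: "length l + (8 - p) \<noteq> 7 \<Longrightarrow> g2_codiff \<phi> p \<alpha> y l = 0"
  by (simp add: g2_codiff_def codiff_def hodge_length)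

lemma codiff_lee:
  assumes y: "y \<in> U" shows "g2_codiff \<phi> 1 (lee_form \<phi>) y [] = Sd y"
proof -
  \<comment> \<open>\<open>lee_form_eq\<close> speaks of lists of length 1 only; truncating
    \<open>\<theta>\<close> makes the comparison hold for all lists.\<close>
  have lee: "lee_form \<phi> z n = (if length n = 1 then \<theta> z n else 0)" if "z \<in> U" for z n
    using lee_form_eq[OF that] lee_form_length by (cases n) (auto simp: length_Suc_conv)
  have a1: "alternating (\<lambda>l. if length l = 1 then F l else 0)" for F :: tens
    by (simp add: alternating_def)
  define \<alpha> where "\<alpha> z n = (if length n = 1 then \<theta> z n else 0)" for z and n :: "7 list"
  have s: "smooth_tens U \<alpha>"
    unfolding smooth_tens_def
  proof
    show "smooth_on U (\<lambda>z. \<alpha> z l)" for l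
      using smooth_theta by (cases "length l = 1") (simp_all add: \<alpha>_def smooth_tens_def smooth_on_const)
  qed
  have e: "ext_d 6 (\<lambda>z. hodge (g2_metric (\<phi> z)) (g2_vol (\<phi> z)) 1 (lee_form \<phi> z)) y n = - Sd y * w y n" if n: "length n = 7" for n
  proof -
    have "ext_d 6 (\<lambda>z. hodge (g2_metric (\<phi> z)) (g2_vol (\<phi> z)) 1 (lee_form \<phi> z)) y n =
        ext_d 6 (\<lambda>z. hodge (g2_metric (\<phi> z)) (g2_vol (\<phi> z)) (Suc 0) (\<alpha> z)) y n"
      unfolding ext_d_def
      by (intro if_cong refl sum.cong arg_cong[of _ _ "\<lambda>x. _ * x"] partial_cong_open[OF U y])
        (simp add: hodge_def raise_def \<alpha>_def lee)
    also have "\<dots> = (\<Sum>a\<in>UNIV. partial a (\<lambda>z. v z * up \<alpha> z [a]) y) * eps0 n"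
    proof -
      have "alternating (\<alpha> z)" for z unfolding \<alpha>_def[abs_def] by (rule a1)
      from ext_d_hodge[OF s this y, of n 0] n show ?thesis by (simp add: sum_length_0 del: length_0_conv)
    qed
    also have "(\<Sum>a\<in>UNIV. partial a (\<lambda>z. v z * up \<alpha> z [a]) y) = v y * tr (h y) (\<lambda>a b. nabla \<Gamma> \<alpha> y [a, b])"
      using divergence[OF s y, of "[]"] by simp
    also have "tr (h y) (\<lambda>a b. nabla \<Gamma> \<alpha> y [a, b]) = - Sd y"
    proof -
      have "nabla \<Gamma> \<alpha> y [a, b] = nabla \<Gamma> \<theta> y [a, b]" for a b by (simp add: nabla_Cons act_Cons \<alpha>_def)
      then show ?thesis by (simp add: Sd_tr[OF y])
    qed
    finally show ?thesis by (simp add: w_v[OF y])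
  qed
  have "hodge (g2_metric (\<phi> y)) (g2_vol (\<phi> y)) 7 (\<lambda>n. - Sd y * w y n) [] = - Sd y * (contr (h y) 0 7 (w y) (w y) [] / fact 7)"
    by (simp add: hodge_contr g_eq[OF y, symmetric] h_def[symmetric] w_def[symmetric] contr_def sum_distrib_left sum_negf mult_ac)
  also have "\<dots> = - Sd y" unfolding w_sq[OF y] by (simp add: fact_numeral)
  finally have hd: "hodge (g2_metric (\<phi> y)) (g2_vol (\<phi> y)) 7 (\<lambda>n. - Sd y * w y n) [] = - Sd y" .
  have "g2_codiff \<phi> 1 (lee_form \<phi>) y [] =
      - hodge (g2_metric (\<phi> y)) (g2_vol (\<phi> y)) 7 (ext_d 6 (\<lambda>z. hodge (g2_metric (\<phi> z)) (g2_vol (\<phi> z)) 1 (lee_form \<phi> z)) y) []"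
    by (simp add: g2_codiff_def codiff_def)
  also have "hodge (g2_metric (\<phi> y)) (g2_vol (\<phi> y)) 7 (ext_d 6 (\<lambda>z. hodge (g2_metric (\<phi> z)) (g2_vol (\<phi> z)) 1 (lee_form \<phi> z)) y) [] =
      hodge (g2_metric (\<phi> y)) (g2_vol (\<phi> y)) 7 (\<lambda>n. - Sd y * w y n) []"
    by (simp add: hodge_contr) (rule contr_cong, use e in simp_all)
  finally show ?thesis unfolding hd by simp
qed

lemma codiff_T:
  assumes y: "y \<in> U" and 0: "\<And>j k. tr (h y) (\<lambda>a b. nabla \<Gamma> T y [a, b, j, k]) = 0"
  shows "g2_codiff \<phi> 3 T y l = 0"
proof (cases "length l = 2")
  case True
  interpret metric_pt "h y" "g y" by (rule metric_pt[OF y])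
  \<comment> \<open>Skew symmetry of the raised torsion turns the coefficients into torsion. Each of
    the two slots then contributes the same symmetric expression in \<open>j\<close> and
    \<open>k\<close>, with opposite signs.\<close>
  have tt: "(\<Sum>a\<in>UNIV. act (\<lambda>j b. cf \<Gamma> y a b j) (\<lambda>n. up T y (a # n)) [j, k]) = 0" for j k
  proof -
    define u where "u = up T y"
    have au: "alternating u" unfolding u_def up_def by (rule alternating_pull[OF T_alt[OF y]])
    have asy: "(\<Sum>a\<in>UNIV. \<Sum>b\<in>UNIV. cf \<Gamma> y a b j * u [a, b, k]) = (\<Sum>a\<in>UNIV. \<Sum>b\<in>UNIV. tors \<Gamma> y a b j * u [a, b, k]) / 2" for j k
    proof -
      have "(\<Sum>a\<in>UNIV. \<Sum>b\<in>UNIV. cf \<Gamma> y b a j * u [a, b, k]) = (\<Sum>a\<in>UNIV. \<Sum>b\<in>UNIV. cf \<Gamma> y a b j * u [b, a, k])"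
        by (rule sum.swap)
      also have "\<dots> = - (\<Sum>a\<in>UNIV. \<Sum>b\<in>UNIV. cf \<Gamma> y a b j * u [a, b, k])"
        unfolding sum_negf[symmetric]
      proof (intro sum.cong refl)
        show "cf \<Gamma> y a b j * u [b, a, k] = - (cf \<Gamma> y a b j * u [a, b, k])" for a b
          using alternatingD[OF au, of "[]" b a "[k]"] by simp
      qed
      finally show ?thesis by (simp add: tors_def left_diff_distrib sum_subtractf)
    qed
    have T3: "(\<Sum>a\<in>UNIV. \<Sum>b\<in>UNIV. tors \<Gamma> y a b j * u [a, b, k]) = (\<Sum>a\<in>UNIV. \<Sum>b\<in>UNIV. tors \<Gamma> y a b k * u [a, b, j])" for j k
    proof -
      have u: "u [a, b, k] = (\<Sum>a'\<in>UNIV. \<Sum>b'\<in>UNIV. h y $ a $ a' * (h y $ b $ b' * tors \<Gamma> y a' b' k))" for a b k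
        unfolding tors_eq[OF y] by (simp add: u_def up_def pull_def sum_length_Suc sum_length_0 del: length_0_conv add: h_sym[of _ a] h_sym[of _ b] sum_distrib_left mult_ac)
      have tu: "(\<Sum>a\<in>UNIV. \<Sum>b\<in>UNIV. tors \<Gamma> y a b j * u [a, b, k]) = t (\<lambda>a a'. t (\<lambda>b b'. tors \<Gamma> y a b j * tors \<Gamma> y a' b' k))" for j k
      proof -
        have "(\<Sum>b\<in>UNIV. tors \<Gamma> y a b j * u [a, b, k]) =
            (\<Sum>a'\<in>UNIV. \<Sum>b\<in>UNIV. \<Sum>b'\<in>UNIV. h y $ a $ a' * (h y $ b $ b' * (tors \<Gamma> y a b j * tors \<Gamma> y a' b' k)))" for a
          unfolding u sum_distrib_left by (subst sum.swap) (intro sum.cong refl, simp only: mult_ac)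
        then show ?thesis by (simp add: tr_def sum_distrib_left)
      qed
      have "t (\<lambda>a a'. t (\<lambda>b b'. tors \<Gamma> y a b j * tors \<Gamma> y a' b' k)) = t (\<lambda>a a'. t (\<lambda>b b'. tors \<Gamma> y a' b j * tors \<Gamma> y a b' k))"
        by (rule tr_swap)
      also have "\<dots> = t (\<lambda>a a'. t (\<lambda>b b'. tors \<Gamma> y a' b' j * tors \<Gamma> y a b k))"
        by (rule tr_cong) (rule tr_swap)
      finally show ?thesis unfolding tu by (simp only: mult.commute)
    qed
    have "(\<Sum>a\<in>UNIV. act (\<lambda>j b. cf \<Gamma> y a b j) (\<lambda>n. u (a # n)) [j, k]) =
        (\<Sum>a\<in>UNIV. \<Sum>b\<in>UNIV. cf \<Gamma> y a b j * u [a, b, k]) + (\<Sum>a\<in>UNIV. \<Sum>b\<in>UNIV. cf \<Gamma> y a b k * u [a, j, b])"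
      by (simp add: act_Cons sum.distrib)
    also have "(\<Sum>a\<in>UNIV. \<Sum>b\<in>UNIV. cf \<Gamma> y a b k * u [a, j, b]) = - (\<Sum>a\<in>UNIV. \<Sum>b\<in>UNIV. cf \<Gamma> y a b k * u [a, b, j])"
      unfolding sum_negf[symmetric]
    proof (intro sum.cong refl)
      show "cf \<Gamma> y a b k * u [a, j, b] = - (cf \<Gamma> y a b k * u [a, b, j])" for a b
        using alternatingD[OF au, of "[a]" j b "[]"] by simp
    qed
    finally show ?thesis unfolding u_def[symmetric] asy T3[of j k] by simp
  qed
  have "ext_d 4 (\<lambda>z. hodge (g2_metric (\<phi> z)) (g2_vol (\<phi> z)) 3 (T z)) y n = 0" if n: "length n = 5" for n
  proof -
    have "ext_d (6 - 2) (\<lambda>z. hodge (g2_metric (\<phi> z)) (g2_vol (\<phi> z)) (Suc 2) (T z)) y n =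
      (- 1) ^ 2 / fact 2 * (\<Sum>m | length m = 2. (\<Sum>a\<in>UNIV. partial a (\<lambda>z. v z * up T z (a # m)) y) * eps0 (m @ n))"
      by (rule ext_d_hodge[OF smooth_T T_alt y]) (simp_all add: n)
    also have "\<dots> = 0"
      unfolding divergence[OF smooth_T y] length_numeral_sums tt by (simp add: pull_explicit 0)
    finally show ?thesis by simp
  qed
  then have "contr (h y) 0 5 (ext_d 4 (\<lambda>z. hodge (g2_metric (\<phi> z)) (g2_vol (\<phi> z)) 3 (T z)) y) (w y) l = contr (h y) 0 5 (\<lambda>n. 0) (w y) l"
    by (intro contr_cong) simp_all
  also have "\<dots> = 0" by (simp add: contr_def)
  finally show ?thesis
    using True by (simp add: g2_codiff_def codiff_def hodge_contr g_eq[OF y, symmetric] h_def[symmetric] w_def[symmetric])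
next
  case False
  then show ?thesis by (intro codiff_length) simp
qed

end

section \<open>The strong maximum principle\<close>

lemma partial_at_max:
  fixes W :: "real^7 \<Rightarrow> real"
  assumes V: "open V" "x \<in> V" and d: "W differentiable (at x)" and max: "\<And>y. y \<in> V \<Longrightarrow> W y \<le> W x"
  shows "partial i W x = 0"
proof -
  obtain e where e: "e > 0" "ball x e \<subseteq> V" using V open_contains_ball by blast
  have D: "((\<lambda>s. W (x + s *\<^sub>R axis i 1)) has_real_derivative partial i W x) (at 0)"
    using axis_line_has_derivative[of W x 0 i] d by simp
  show ?thesis
  proof (rule DERIV_local_max[OF D e(1)])
    show "\<forall>s. \<bar>0 - s\<bar> < e \<longrightarrow> W (x + s *\<^sub>R axis i 1) \<le> W (x + 0 *\<^sub>R axis i 1)"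
      using e(2) max by (auto simp: dist_norm subset_iff)
  qed
qed

text \<open>If the second derivative along \<open>v\<close> were positive, the first derivative on
  that line would be positive just after \<open>x\<close>, and \<open>W\<close> would exceed its
  maximum.\<close>

lemma hessian_at_max:
  fixes W :: "real^7 \<Rightarrow> real"
  assumes V: "open V" "x \<in> V" and d: "\<And>y. y \<in> V \<Longrightarrow> W differentiable (at y)"
    and dd: "\<And>j. partial j W differentiable (at x)" and max: "\<And>y. y \<in> V \<Longrightarrow> W y \<le> W x"
  shows "(\<Sum>i\<in>UNIV. \<Sum>j\<in>UNIV. v $ i * v $ j * partial i (partial j W) x) \<le> 0"
proof (rule ccontr)
  define G where "G y = (\<Sum>j\<in>UNIV. v $ j * partial j W y)" for y
  assume "\<not> ?thesis"
  moreover have "(\<Sum>i\<in>UNIV. \<Sum>j\<in>UNIV. v $ i * v $ j * partial i (partial j W) x) = (\<Sum>i\<in>UNIV. v $ i * partial i G x)"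
  proof -
    have "partial i G x = (\<Sum>j\<in>UNIV. v $ j * partial i (partial j W) x)" for i
      unfolding G_def by (subst partial_sum[OF differentiable_mult[OF differentiable_const dd]]) (simp only: partial_cmult[OF dd])
    then show ?thesis by (simp add: sum_distrib_left mult.assoc)
  qed
  ultimately have pos: "0 < (\<Sum>i\<in>UNIV. v $ i * partial i G x)" by simp
  have "G differentiable (at x)"
    unfolding G_def[abs_def] by (intro differentiable_sum ballI differentiable_mult differentiable_const dd finite)
  then have "((\<lambda>s. G (x + s *\<^sub>R v)) has_real_derivative (\<Sum>i\<in>UNIV. v $ i * partial i G x)) (at 0)"
    using line_has_derivative[of G x 0 v] by simp
  from DERIV_pos_inc_right[OF this pos] obtain e1 where e1: "e1 > 0" and
    inc: "\<And>s. 0 < s \<Longrightarrow> s < e1 \<Longrightarrow> G x < G (x + s *\<^sub>R v)" by auto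
  have G0: "G x = 0" unfolding G_def by (simp add: partial_at_max[OF V d[OF V(2)] max])
  obtain e where e: "e > 0" "ball x e \<subseteq> V" using V open_contains_ball by blast
  have "v \<noteq> 0" using pos by auto
  define s where "s = min e1 (e / norm v) / 2"
  have s: "0 < s" "s < e1" "s * norm v < e"
  proof -
    show "0 < s" using e1 e \<open>v \<noteq> 0\<close> by (simp add: s_def)
    have "s \<le> e1 / 2" unfolding s_def by (intro divide_right_mono) auto
    then show "s < e1" using e1 by simp
    have "s * norm v \<le> (e / norm v) / 2 * norm v" unfolding s_def by (intro mult_right_mono) auto
    also have "\<dots> < e" using e \<open>v \<noteq> 0\<close> by simp
    finally show "s * norm v < e" .
  qed
  have inV: "x + u *\<^sub>R v \<in> V" if "0 \<le> u" "u \<le> s" for u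
  proof -
    have "u * norm v \<le> s * norm v" using that by (intro mult_right_mono) auto
    then show ?thesis using e(2) s(3) that by (auto simp: dist_norm subset_iff)
  qed
  have "W (x + 0 *\<^sub>R v) < W (x + s *\<^sub>R v)"
  proof (rule DERIV_pos_imp_increasing_open[OF s(1)])
    fix u assume u: "0 < u" "u < s"
    have "((\<lambda>u. W (x + u *\<^sub>R v)) has_real_derivative G (x + u *\<^sub>R v)) (at u)"
      unfolding G_def by (rule line_has_derivative[OF d]) (use inV u in simp)
    moreover have "0 < G (x + u *\<^sub>R v)" using inc[of u] u s(2) G0 by simp
    ultimately show "\<exists>y. ((\<lambda>u. W (x + u *\<^sub>R v)) has_real_derivative y) (at u) \<and> 0 < y" by blast
  next
    show "continuous_on {0..s} (\<lambda>u. W (x + u *\<^sub>R v))"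
    proof (intro continuous_at_imp_continuous_on ballI)
      fix u assume "u \<in> {0..s}"
      then have "((\<lambda>u. W (x + u *\<^sub>R v)) has_real_derivative (\<Sum>i\<in>UNIV. v $ i * partial i W (x + u *\<^sub>R v))) (at u)"
        by (intro line_has_derivative d inV) auto
      then show "isCont (\<lambda>u. W (x + u *\<^sub>R v)) u" by (rule DERIV_isCont)
    qed
  qed
  then show False using max[of "x + s *\<^sub>R v"] inV[of s] s(1) by simp
qed

section \<open>The Gaussian barrier and positive quadratic forms\<close>

definition barrier :: "real \<Rightarrow> real^7 \<Rightarrow> real^7 \<Rightarrow> real" where
  "barrier k z x = exp (- k * ((x - z) \<bullet> (x - z)))"

lemma barrier_has_derivative:
  "(barrier k z has_derivative (\<lambda>v. - 2 * k * ((x - z) \<bullet> v) * barrier k z x)) (at x)"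
  unfolding barrier_def[abs_def] by (auto intro!: derivative_eq_intros simp: inner_commute algebra_simps)

lemma partial_barrier: "partial j (barrier k z) x = - 2 * k * (x - z) $ j * barrier k z x"
  using partial_eqI[OF barrier_has_derivative] by (simp add: inner_axis)

lemma partial_barrier_has_derivative:
  "(partial j (barrier k z) has_derivative
    (\<lambda>v. (4 * k\<^sup>2 * (x - z) $ j * ((x - z) \<bullet> v) - 2 * k * v $ j) * barrier k z x)) (at x)"
proof -
  have "((\<lambda>x. - 2 * k * (x - z) $ j * barrier k z x) has_derivative
    (\<lambda>v. (4 * k\<^sup>2 * (x - z) $ j * ((x - z) \<bullet> v) - 2 * k * v $ j) * barrier k z x)) (at x)"
    by (auto intro!: derivative_eq_intros barrier_has_derivative bounded_linear_imp_has_derivative bounded_linear_vec_nth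
      simp: power2_eq_square algebra_simps)
  then show ?thesis by (simp add: partial_barrier[abs_def])
qed

lemma partial_partial_barrier:
  "partial i (partial j (barrier k z)) x =
    (4 * k\<^sup>2 * (x - z) $ i * (x - z) $ j - (if i = j then 2 * k else 0)) * barrier k z x"
proof -
  have "axis i 1 $ j = (if i = j then 1 else 0 :: real)" by (simp add: axis_def)
  then show ?thesis unfolding partial_eqI[OF partial_barrier_has_derivative] by (simp add: inner_axis algebra_simps)
qed

lemma sum_frame_square:
  fixes P :: "real^7^7"
  assumes "\<And>i j. A i j = (\<Sum>c\<in>UNIV. P $ i $ c * P $ j $ c)"
  shows "(\<Sum>i\<in>UNIV. \<Sum>j\<in>UNIV. A i j * H i j) = (\<Sum>c\<in>UNIV. \<Sum>i\<in>UNIV. \<Sum>j\<in>UNIV. P $ i $ c * P $ j $ c * H i j)"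
proof -
  have "(\<Sum>i\<in>UNIV. \<Sum>j\<in>UNIV. A i j * H i j) = (\<Sum>i\<in>UNIV. \<Sum>c\<in>UNIV. \<Sum>j\<in>UNIV. P $ i $ c * P $ j $ c * H i j)"
    unfolding assms sum_distrib_right by (rule sum.cong[OF refl]) (rule sum.swap)
  also have "\<dots> = (\<Sum>c\<in>UNIV. \<Sum>i\<in>UNIV. \<Sum>j\<in>UNIV. P $ i $ c * P $ j $ c * H i j)" by (rule sum.swap)
  finally show ?thesis .
qed

lemma frame_square_pos:
  fixes P :: "real^7^7"
  assumes P: "invertible P" and A: "\<And>i j. A i j = (\<Sum>c\<in>UNIV. P $ i $ c * P $ j $ c)" and w: "w \<noteq> 0"
  shows "0 < (\<Sum>i\<in>UNIV. \<Sum>j\<in>UNIV. A i j * (w $ i * w $ j))"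
proof -
  have "transpose P *v w \<noteq> 0"
  proof
    assume "transpose P *v w = 0"
    then have "transpose (matrix_inv P) *v (transpose P *v w) = 0" by simp
    moreover have "transpose (matrix_inv P) ** transpose P = mat 1"
      by (simp add: matrix_transpose_mul[symmetric] invertible_matrix_inv(1)[OF P])
    ultimately show False using w by (simp only: matrix_vector_mul_assoc matrix_vector_mul_lid)
  qed
  then obtain c where "(transpose P *v w) $ c \<noteq> 0" by (auto simp: vec_eq_iff)
  then have "0 < (\<Sum>c\<in>UNIV. ((transpose P *v w) $ c)\<^sup>2)"
    by (intro sum_pos2[of _ c]) auto
  also have "\<dots> = (\<Sum>i\<in>UNIV. \<Sum>j\<in>UNIV. A i j * (w $ i * w $ j))"
    unfolding sum_frame_square[OF A]
    by (simp add: matrix_vector_mult_def transpose_def power2_eq_square sum_product mult_ac)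
  finally show ?thesis .
qed

text \<open>
  A ball free of maximum points that touches one of them is replaced by a smaller ball, tangent from
  inside, so that the maximum is attained on it at the touching point only. Near that point a small
  multiple of the barrier makes the maximum of the perturbed function interior.
\<close>

theorem strong_maximum_principle:
  fixes f :: "real^7 \<Rightarrow> real" and a :: "real^7 \<Rightarrow> 7 \<Rightarrow> 7 \<Rightarrow> real" and b :: "real^7 \<Rightarrow> 7 \<Rightarrow> real"
  assumes U: "open U" and f: "smooth_on U f"
    and frame: "\<And>y. y \<in> U \<Longrightarrow> \<exists>P::real^7^7. invertible P \<and> (\<forall>i j. a y i j = (\<Sum>c\<in>UNIV. P $ i $ c * P $ j $ c))"
    and a: "\<And>i j. continuous_on U (\<lambda>y. a y i j)" and b: "\<And>i. continuous_on U (\<lambda>y. b y i)"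
    and sub: "\<And>y. y \<in> U \<Longrightarrow> 0 \<le> (\<Sum>i\<in>UNIV. \<Sum>j\<in>UNIV. a y i j * partial i (partial j f) y) + (\<Sum>i\<in>UNIV. b y i * partial i f y)"
    and max: "\<And>y. y \<in> U \<Longrightarrow> f y \<le> M" and y0: "y0 \<in> U" "f y0 = M"
  shows "\<exists>e>0. \<forall>y\<in>ball y0 e. y \<in> U \<and> f y = M"
proof -
  obtain R' where R': "R' > 0" "cball y0 R' \<subseteq> U" using U y0(1) open_contains_cball by blast
  define R where "R = R' / 3"
  have R: "R > 0" "cball y0 (3 * R) \<subseteq> U" using R' by (auto simp: R_def)
  have "f z = M" if zR: "z \<in> ball y0 R" for z
  proof (rule ccontr)
    assume fz: "f z \<noteq> M"
    \<comment> \<open>Radius \<open>2 * R\<close> puts the maximum point nearest to \<open>z\<close>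
      strictly inside; the room up to \<open>3 * R\<close> holds the neighborhood
      \<open>K\<close>.\<close>
    define Z where "Z = {x \<in> cball y0 (2 * R). f x = M}"
    have cU: "cball y0 (2 * R) \<subseteq> U" using R by (auto simp: subset_iff)
    have cf: "continuous_on U f" by (rule smooth_on_continuous_on[OF f])
    have "closed Z" unfolding Z_def
      by (rule continuous_closed_preimage_constant[OF continuous_on_subset[OF cf cU]]) simp
    moreover have "bounded Z" unfolding Z_def by (rule bounded_subset[OF bounded_cball]) auto
    ultimately have "compact Z" by (simp add: compact_eq_bounded_closed)
    moreover have y0Z: "y0 \<in> Z" using R y0 by (simp add: Z_def)
    ultimately obtain x0 where x0: "x0 \<in> Z" and x0min: "\<And>x. x \<in> Z \<Longrightarrow> dist z x0 \<le> dist z x"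
      using continuous_attains_inf[of Z "dist z"] continuous_on_dist[OF continuous_on_const continuous_on_id, of Z z] by auto
    define d where "d = dist z x0"
    have dR: "d < R" using x0min[OF y0Z] zR by (simp add: d_def dist_commute)
    have d0: "d > 0" using x0 fz by (auto simp: d_def Z_def)
    define r where "r = d / 2"
    \<comment> \<open>The ball with diameter from \<open>z\<close> to \<open>x0\<close> meets the
      sphere of radius \<open>d\<close> about \<open>z\<close> only in \<open>x0\<close>.\<close>
    define y1 where "y1 = midpoint z x0"
    define s where "s = r / 2"
    have r: "r > 0" "s > 0" "r = 2 * s" "d = 4 * s" using d0 by (auto simp: r_def s_def)
    have y1: "dist x0 y1 = r" "dist z y1 = r" by (auto simp: y1_def r_def d_def dist_midpoint dist_commute)
    define K where "K = cball x0 s"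
    have x0y0: "dist y0 x0 < 2 * R"
      using dist_triangle[of y0 x0 z] zR dR by (simp add: d_def)
    have KU: "K \<subseteq> U"
    proof
      fix x assume "x \<in> K"
      then have "dist y0 x \<le> 3 * R" using dist_triangle[of y0 x x0] x0y0 dR r by (simp add: K_def)
      then show "x \<in> U" using R by auto
    qed
    have x0U: "x0 \<in> U" and fx0: "f x0 = M" using KU r x0 by (auto simp: K_def Z_def)
    \<comment> \<open>By the parallelogram law every other point of the small ball is closer to
      \<open>z\<close> than \<open>x0\<close> is, hence is not a maximum point.\<close>
    have lessM: "f x < M" if x: "dist y1 x \<le> r" "x \<noteq> x0" for x
    proof -
      have parallelogram: "norm (u - v) ^ 2 = 2 * norm u ^ 2 + 2 * norm v ^ 2 - norm (u + v) ^ 2" for u v :: "real^7"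
        by (simp add: power2_norm_eq_inner inner_diff_left inner_diff_right inner_add_left inner_add_right inner_commute)
      have "(x - y1) - (x0 - y1) \<noteq> 0" using x by simp
      moreover have zy: "y1 - z = x0 - y1" by (simp add: y1_def midpoint_def vec_eq_iff field_simps)
      ultimately have "0 < norm ((x - y1) - (x0 - y1)) ^ 2" by simp
      also have "\<dots> = 2 * norm (x - y1) ^ 2 + 2 * norm (x0 - y1) ^ 2 - norm ((x - y1) + (x0 - y1)) ^ 2"
        by (rule parallelogram)
      also have "norm (x - y1) ^ 2 \<le> r ^ 2" using x r by (intro power_mono) (auto simp: dist_norm norm_minus_commute)
      also have "norm (x0 - y1) ^ 2 = r ^ 2" using y1 by (simp add: dist_norm)
      also have "(x - y1) + (x0 - y1) = x - z" using zy by (simp add: algebra_simps)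
      finally have "norm (x - z) ^ 2 < d ^ 2" by (simp add: r_def power_divide)
      then have dz: "dist z x < d" using d0 power_less_imp_less_base[of "norm (x - z)" 2 d]
        by (simp add: dist_norm norm_minus_commute)
      have "dist y0 x \<le> 2 * R" using dist_triangle[of y0 x z] zR dR dz by simp
      then have "x \<in> cball y0 (2 * R)" "x \<in> U" using cU by auto
      moreover have "f x \<noteq> M" using x0min[of x] dz \<open>x \<in> cball y0 (2 * R)\<close> by (auto simp: Z_def d_def)
      ultimately show ?thesis using max[of x] by simp
    qed
    have yK: "x - y1 \<noteq> 0" if "x \<in> K" for x
      using that y1(1) r by (auto simp: K_def)
    define A where "A x = (\<Sum>i\<in>UNIV. \<Sum>j\<in>UNIV. a x i j * ((x - y1) $ i * (x - y1) $ j))" for x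
    define B where "B x = (\<Sum>i\<in>UNIV. a x i i) + (\<Sum>i\<in>UNIV. b x i * (x - y1) $ i)" for x
    have A0: "0 < A x" if x: "x \<in> K" for x
    proof -
      obtain P :: "real^7^7" where "invertible P" "\<And>i j. a x i j = (\<Sum>c\<in>UNIV. P $ i $ c * P $ j $ c)"
        using frame[of x] KU x by blast
      then show ?thesis unfolding A_def using yK[OF x] by (rule frame_square_pos)
    qed
    have aK: "continuous_on K (\<lambda>y. a y i j)" "continuous_on K (\<lambda>y. b y i)" for i j
      by (rule continuous_on_subset[OF _ KU], rule a b)+
    have cA: "continuous_on K A" and cB: "continuous_on K B"
      unfolding A_def[abs_def] B_def[abs_def] by (intro continuous_intros aK)+
    have K: "compact K" "K \<noteq> {}" using r by (auto simp: K_def)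
    obtain xm where xm: "xm \<in> K" "\<And>x. x \<in> K \<Longrightarrow> A xm \<le> A x" using continuous_attains_inf[OF K cA] by blast
    obtain xM where xM: "\<And>x. x \<in> K \<Longrightarrow> B x \<le> B xM" using continuous_attains_sup[OF K cB] by blast
    define C where "C = \<bar>B xM\<bar>"
    \<comment> \<open>Large enough for the quadratic term of the operator on the barrier to dominate
      the lower terms \<open>B\<close> on \<open>K\<close>. \<open>A\<close> has a positive minimum
      there because \<open>K\<close> avoids the center \<open>y1\<close>.\<close>
    define k where "k = (C + 1) / A xm"
    have k: "k > 0" using A0[OF xm(1)] by (simp add: k_def C_def)
    have Lq: "0 < 4 * k\<^sup>2 * A x - 2 * k * B x" if x: "x \<in> K" for x
    proof -
      have "C + 1 = k * A xm" using A0[OF xm(1)] by (simp add: k_def)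
      also have "\<dots> \<le> k * A x" using k xm(2)[OF x] by simp
      finally have "B x < 2 * (k * A x)" using xM[OF x] unfolding C_def by linarith
      then have "0 < 2 * k * (2 * (k * A x) - B x)" using k by simp
      then show ?thesis by (simp add: power2_eq_square algebra_simps)
    qed
    obtain \<eta> where \<eta>: "\<eta> > 0" "\<And>x. x \<in> sphere x0 s \<inter> cball y1 r \<Longrightarrow> f x \<le> M - \<eta>"
    proof (cases "sphere x0 s \<inter> cball y1 r = {}")
      case True
      then show ?thesis using that[of 1] by simp
    next
      case False
      have "compact (sphere x0 s \<inter> cball y1 r)" by (intro compact_Int compact_sphere compact_cball)
      moreover have "sphere x0 s \<inter> cball y1 r \<subseteq> U" using KU by (auto simp: K_def)
      ultimately obtain xs where xs: "xs \<in> sphere x0 s \<inter> cball y1 r" "\<And>x. x \<in> sphere x0 s \<inter> cball y1 r \<Longrightarrow> f x \<le> f xs"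
        using continuous_attains_sup[OF _ False continuous_on_subset[OF cf]] by blast
      have "f xs < M" using lessM[of xs] xs(1) r by (auto simp: sphere_def)
      then show ?thesis using that[of "M - f xs"] xs(2) by simp
    qed
    \<comment> \<open>The value of the barrier on the sphere about \<open>y1\<close> through
      \<open>x0\<close>. Outside that sphere the perturbation is negative; inside it is less than
      \<open>\<eta> / 2\<close>, half the gap of \<open>f\<close> on the boundary of
      \<open>K\<close>. So the maximum of \<open>W\<close> is interior.\<close>
    define c where "c = exp (- k * r\<^sup>2)"
    define W where "W x = f x + \<eta> / 2 * (barrier k y1 x - c)" for x
    have bar: "barrier k y1 x = exp (- k * (dist y1 x)\<^sup>2)" for x
      by (simp add: barrier_def power2_norm_eq_inner[symmetric] dist_norm norm_minus_commute)
    have Wx0: "W x0 = M" using y1 by (simp add: W_def fx0 bar c_def dist_commute)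
    have cW: "continuous_on K W"
      unfolding W_def[abs_def] barrier_def by (intro continuous_intros continuous_on_subset[OF cf KU])
    obtain x where x: "x \<in> K" and xmax: "\<And>y. y \<in> K \<Longrightarrow> W y \<le> W x" using continuous_attains_sup[OF K cW] by blast
    have Wx: "M \<le> W x" using xmax[of x0] r Wx0 by (simp add: K_def)
    have xV: "x \<in> ball x0 s"
    proof (rule ccontr)
      assume "x \<notin> ball x0 s"
      then have xs: "x \<in> sphere x0 s" using x by (auto simp: K_def)
      show False
      proof (cases "dist y1 x \<le> r")
        case True
        then have "f x \<le> M - \<eta>" using \<eta>(2) xs by auto
        moreover have "barrier k y1 x - c < 1"
        proof -
          have "barrier k y1 x \<le> 1" unfolding bar using k by simp
          moreover have "c > 0" by (simp add: c_def)
          ultimately show ?thesis by simp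
        qed
        then have "\<eta> / 2 * (barrier k y1 x - c) < \<eta> / 2 * 1" using \<eta>(1) by (intro mult_strict_left_mono) auto
        ultimately show False using Wx \<eta>(1) unfolding W_def by linarith
      next
        case False
        then have "r\<^sup>2 < (dist y1 x)\<^sup>2" using r by (intro power_strict_mono) auto
        then have "barrier k y1 x < c" unfolding bar c_def using k by simp
        then have "\<eta> / 2 * (barrier k y1 x - c) < 0" using \<eta>(1) by (intro mult_pos_neg) auto
        then show False using Wx max[of x] KU x by (auto simp: W_def)
      qed
    qed
    have xU: "x \<in> U" using KU x by blast
    let ?q = "barrier k y1"
    have df: "f differentiable (at y)" "partial j f differentiable (at y)" if "y \<in> U" for y j
      using smooth_on_differentiable[OF f that] smooth_on_differentiable[OF smooth_on_partial[OF f] that] by auto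
    have dq: "?q differentiable (at y)" "partial j ?q differentiable (at y)" for y j
      using barrier_has_derivative partial_barrier_has_derivative by (blast intro: differentiableI)+
    have dW: "W differentiable (at y)" if "y \<in> U" for y
      unfolding W_def[abs_def] by (intro differentiable_add differentiable_mult differentiable_diff differentiable_const df dq that)
    have pW: "partial j W y = partial j f y + \<eta> / 2 * partial j ?q y" if "y \<in> U" for j y
      unfolding W_def[abs_def]
        partial_add[OF df(1)[OF that] differentiable_mult[OF differentiable_const differentiable_diff[OF dq(1) differentiable_const]]]
        partial_cmult[OF differentiable_diff[OF dq(1) differentiable_const]] partial_diff[OF dq(1) differentiable_const] partial_const
      by simp
    have dpW: "partial j W differentiable (at x)" for j
    proof -
      have "(\<lambda>y. partial j f y + \<eta> / 2 * partial j ?q y) differentiable (at x)"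
        by (intro differentiable_add differentiable_mult differentiable_const df dq xU)
      then obtain D where "((\<lambda>y. partial j f y + \<eta> / 2 * partial j ?q y) has_derivative D) (at x)"
        unfolding differentiable_def by blast
      moreover have "(partial j W has_derivative D) (at x) \<longleftrightarrow> ((\<lambda>y. partial j f y + \<eta> / 2 * partial j ?q y) has_derivative D) (at x)"
        by (rule has_derivative_cong_open[OF U xU]) (rule pW)
      ultimately have "(partial j W has_derivative D) (at x)" by (rule iffD2[rotated])
      then show ?thesis by (rule differentiableI)
    qed
    have ppW: "partial i (partial j W) x = partial i (partial j f) x + \<eta> / 2 * partial i (partial j ?q) x" for i j
    proof -
      have "partial i (partial j W) x = partial i (\<lambda>y. partial j f y + \<eta> / 2 * partial j ?q y) x"
        by (rule partial_cong_open[OF U xU]) (rule pW)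
      then show ?thesis
        unfolding partial_add[OF df(2)[OF xU] differentiable_mult[OF differentiable_const dq(2)]] partial_cmult[OF dq(2)] .
    qed
    obtain P :: "real^7^7" where P: "\<And>i j. a x i j = (\<Sum>c\<in>UNIV. P $ i $ c * P $ j $ c)"
      using frame[OF xU] by blast
    have V: "W y \<le> W x" if "y \<in> ball x0 s" for y using xmax[of y] that by (simp add: K_def)
    have VU: "y \<in> U" if "y \<in> ball x0 s" for y using KU that by (auto simp: K_def)
    \<comment> \<open>The trace against \<open>a\<close> is a sum of second derivatives along the
      columns of \<open>P\<close>.\<close>
    have "(\<Sum>i\<in>UNIV. \<Sum>j\<in>UNIV. a x i j * partial i (partial j W) x) \<le> 0"
      unfolding sum_frame_square[OF P]
    proof (rule sum_nonpos)
      fix c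
      show "(\<Sum>i\<in>UNIV. \<Sum>j\<in>UNIV. P $ i $ c * P $ j $ c * partial i (partial j W) x) \<le> 0"
        using hessian_at_max[OF open_ball xV dW[OF VU] dpW V, of "\<chi> i. P $ i $ c"] by simp
    qed
    moreover have "partial i W x = 0" for i by (rule partial_at_max[OF open_ball xV dW[OF xU] V])
    ultimately have e1: "(\<Sum>i\<in>UNIV. \<Sum>j\<in>UNIV. a x i j * partial i (partial j W) x) + (\<Sum>i\<in>UNIV. b x i * partial i W x) \<le> 0"
      by simp
    have e2: "(\<Sum>i\<in>UNIV. \<Sum>j\<in>UNIV. a x i j * partial i (partial j W) x) + (\<Sum>i\<in>UNIV. b x i * partial i W x) =
        ((\<Sum>i\<in>UNIV. \<Sum>j\<in>UNIV. a x i j * partial i (partial j f) x) + (\<Sum>i\<in>UNIV. b x i * partial i f x))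
        + \<eta> / 2 * ((\<Sum>i\<in>UNIV. \<Sum>j\<in>UNIV. a x i j * partial i (partial j ?q) x) + (\<Sum>i\<in>UNIV. b x i * partial i ?q x))"
      unfolding ppW pW[OF xU] by (simp add: distrib_left sum.distrib sum_distrib_left mult.left_commute)
    have e3: "(\<Sum>i\<in>UNIV. \<Sum>j\<in>UNIV. a x i j * partial i (partial j ?q) x) + (\<Sum>i\<in>UNIV. b x i * partial i ?q x) =
        (4 * k\<^sup>2 * A x - 2 * k * B x) * ?q x"
    proof -
      have "(\<Sum>i\<in>UNIV. \<Sum>j\<in>UNIV. a x i j * partial i (partial j ?q) x) =
          (\<Sum>i\<in>UNIV. \<Sum>j\<in>UNIV. 4 * k\<^sup>2 * ?q x * (a x i j * ((x - y1) $ i * (x - y1) $ j)) - (if i = j then 2 * k * ?q x * a x i j else 0))"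
        unfolding partial_partial_barrier by (intro sum.cong refl) (simp add: algebra_simps)
      also have "\<dots> = 4 * k\<^sup>2 * ?q x * A x - 2 * k * ?q x * (\<Sum>i\<in>UNIV. a x i i)"
        unfolding sum_subtractf A_def by (simp add: sum_distrib_left sum.delta)
      finally have 1: "(\<Sum>i\<in>UNIV. \<Sum>j\<in>UNIV. a x i j * partial i (partial j ?q) x) = \<dots>" .
      have 2: "(\<Sum>i\<in>UNIV. b x i * partial i ?q x) = - 2 * k * ?q x * (\<Sum>i\<in>UNIV. b x i * (x - y1) $ i)"
        unfolding partial_barrier sum_distrib_left by (intro sum.cong refl) (simp only: mult_ac)
      show ?thesis unfolding 1 2 B_def by algebra
    qed
    have "0 < (4 * k\<^sup>2 * A x - 2 * k * B x) * ?q x" using Lq[OF x] by (simp add: barrier_def)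
    then have e4: "0 < \<eta> / 2 * ((4 * k\<^sup>2 * A x - 2 * k * B x) * ?q x)" by (rule mult_pos_pos[OF half_gt_zero[OF \<eta>(1)]])
    show False using e1 e4 sub[OF xU] unfolding e2 e3 by linarith
  qed
  then show ?thesis using R by (intro exI[of _ R]) (auto simp: subset_iff)
qed

lemma partial_zero_locally_constant:
  fixes f :: "real^7 \<Rightarrow> real"
  assumes U: "open U" "y \<in> U" and d: "\<And>z. z \<in> U \<Longrightarrow> f differentiable (at z)"
    and 0: "\<And>z i. z \<in> U \<Longrightarrow> partial i f z = 0"
  shows "\<exists>e>0. \<forall>z\<in>ball y e. z \<in> U \<and> f z = f y"
proof -
  obtain e where e: "e > 0" "ball y e \<subseteq> U" using U open_contains_ball by blast
  have "(f has_derivative (\<lambda>v. 0)) (at z within ball y e)" if "z \<in> ball y e" for z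
    using has_derivative_at_withinI[OF has_derivative_partial[OF d]] 0 e that by (auto simp: subset_iff)
  then obtain c where "\<forall>z\<in>ball y e. f z = c"
    using has_derivative_zero_constant[OF convex_ball] by blast
  then show ?thesis using e by (intro exI[of _ e]) auto
qed

section \<open>The maximum principle applied to the norm of the Lee form\<close>

context g2_chart
begin

definition flat :: bool where "flat \<longleftrightarrow> (\<forall>y\<in>U. \<forall>i j. nabla \<Gamma> \<theta> y [i, j] = 0)"

text \<open>Under \<open>dS\<close> the Bochner formula involves \<open>F\<close> alone: its
  Laplacian plus \<open>1 + 2 * \<mu>\<close> times its derivative along the Lee form equals
  \<open>2 * Dsq\<close>, which is nonnegative.\<close>

lemma F_locally_max:
  assumes dS: "\<And>y a. y \<in> U \<Longrightarrow> partial a Sd y = \<mu> * partial a F y"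
    and max: "\<And>y. y \<in> U \<Longrightarrow> F y \<le> M" and y0: "y0 \<in> U" "F y0 = M"
  shows "\<exists>e>0. \<forall>y\<in>ball y0 e. y \<in> U \<and> F y = M"
proof (rule strong_maximum_principle[OF U smooth_F _ _ _ _ max y0,
    where a = "\<lambda>y i j. h y $ i $ j" and b = "\<lambda>y a. (1 + 2 * \<mu>) * (\<Sum>b\<in>UNIV. h y $ a $ b * \<theta> y [b])
      - (\<Sum>i\<in>UNIV. \<Sum>j\<in>UNIV. h y $ i $ j * cf \<Gamma> y i j a)"])
  fix y assume y: "y \<in> U"
  interpret pt: adapted_pt "E y" "matrix_inv (E y)" "transpose (E y) ** E y" "matrix_inv (transpose (E y) ** E y)" "\<phi> y"
    by (rule adapted_pt[OF y]) simp_all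
  show "\<exists>P::real^7^7. invertible P \<and> (\<forall>i j. h y $ i $ j = (\<Sum>c\<in>UNIV. P $ i $ c * P $ j $ c))"
  proof (intro exI conjI allI)
    show "invertible (matrix_inv (E y))" using pt.EP by (auto simp: invertible_def)
    show "h y $ i $ j = (\<Sum>c\<in>UNIV. matrix_inv (E y) $ i $ c * matrix_inv (E y) $ j $ c)" for i j
      unfolding h_E[OF y] pt.h_eq by (simp add: matrix_matrix_mult_def transpose_def)
  qed
  let ?c = "\<lambda>a. \<Sum>i\<in>UNIV. \<Sum>j\<in>UNIV. h y $ i $ j * cf \<Gamma> y i j a"
  have split: "(\<Sum>a\<in>UNIV. (k * S a - C a) * G a) = k * (\<Sum>a\<in>UNIV. S a * G a) - (\<Sum>a\<in>UNIV. C a * G a)"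
    for k :: real and S C G :: "7 \<Rightarrow> real"
    by (simp add: left_diff_distrib sum_subtractf sum_distrib_left mult.assoc)
  have "0 \<le> 2 * Dsq y" using Dsq_nonneg[OF y] by simp
  also have "\<dots> = tr (h y) (\<lambda>i j. partial i (partial j F) y - (\<Sum>a\<in>UNIV. cf \<Gamma> y i j a * partial a F y))
      + (1 + 2 * \<mu>) * tr (h y) (\<lambda>a b. partial a F y * \<theta> y [b])"
  proof -
    have "tr (h y) (\<lambda>a b. partial a Sd y * \<theta> y [b]) = \<mu> * tr (h y) (\<lambda>a b. partial a F y * \<theta> y [b])"
      by (simp add: dS[OF y] tr_cmult[symmetric] mult.assoc)
    then show ?thesis using bochner[OF y] by (simp add: algebra_simps)
  qed
  also have "tr (h y) (\<lambda>i j. partial i (partial j F) y - (\<Sum>a\<in>UNIV. cf \<Gamma> y i j a * partial a F y)) =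
      (\<Sum>i\<in>UNIV. \<Sum>j\<in>UNIV. h y $ i $ j * partial i (partial j F) y) - (\<Sum>a\<in>UNIV. ?c a * partial a F y)"
  proof -
    have "(\<Sum>i\<in>UNIV. \<Sum>j\<in>UNIV. h y $ i $ j * (\<Sum>a\<in>UNIV. cf \<Gamma> y i j a * partial a F y)) =
        (\<Sum>i\<in>UNIV. \<Sum>a\<in>UNIV. \<Sum>j\<in>UNIV. h y $ i $ j * cf \<Gamma> y i j a * partial a F y)"
      unfolding sum_distrib_left mult.assoc by (rule sum.cong[OF refl]) (rule sum.swap)
    also have "\<dots> = (\<Sum>a\<in>UNIV. ?c a * partial a F y)"
      unfolding sum_distrib_right by (rule sum.swap)
    finally show ?thesis unfolding tr_diff by (simp add: tr_def)
  qed
  also have "tr (h y) (\<lambda>a b. partial a F y * \<theta> y [b]) = (\<Sum>a\<in>UNIV. (\<Sum>b\<in>UNIV. h y $ a $ b * \<theta> y [b]) * partial a F y)"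
    unfolding tr_def sum_distrib_right by (intro sum.cong refl) (simp only: mult_ac)
  finally show "0 \<le> (\<Sum>i\<in>UNIV. \<Sum>j\<in>UNIV. h y $ i $ j * partial i (partial j F) y)
      + (\<Sum>a\<in>UNIV. ((1 + 2 * \<mu>) * (\<Sum>b\<in>UNIV. h y $ a $ b * \<theta> y [b]) - ?c a) * partial a F y)"
    unfolding split by linarith
next
  have h: "continuous_on U (\<lambda>y. h y $ i $ j)" for i j by (rule smooth_on_continuous_on[OF smooth_h])
  have c: "continuous_on U (\<lambda>y. cf \<Gamma> y i j a)" for i j a by (rule smooth_on_continuous_on[OF cf])
  have t: "continuous_on U (\<lambda>y. \<theta> y [b])" for b
    using smooth_theta by (auto simp: smooth_tens_def intro: smooth_on_continuous_on)
  show "continuous_on U (\<lambda>y. h y $ i $ j)" for i j by (rule h)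
  show "continuous_on U (\<lambda>y. (1 + 2 * \<mu>) * (\<Sum>b\<in>UNIV. h y $ a $ b * \<theta> y [b])
      - (\<Sum>i\<in>UNIV. \<Sum>j\<in>UNIV. h y $ i $ j * cf \<Gamma> y i j a))" for a
    by (intro continuous_intros h c t)
qed

lemma F_diff: "y \<in> U \<Longrightarrow> F differentiable (at y)" and Sd_diff: "y \<in> U \<Longrightarrow> Sd differentiable (at y)"
  and N_diff: "y \<in> U \<Longrightarrow> N differentiable (at y)" and tau_diff: "y \<in> U \<Longrightarrow> tau differentiable (at y)"
  using smooth_F smooth_Sd smooth_N smooth_tau by (auto intro: smooth_on_differentiable)

text \<open>All derivatives of \<open>F\<close> and \<open>Sd\<close> drop out of
  \<open>bochner\<close>, so \<open>Dsq\<close> vanishes.\<close>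

lemma flat_if_F_constant:
  assumes dS: "\<And>y a. y \<in> U \<Longrightarrow> partial a Sd y = \<mu> * partial a F y" and F: "\<And>y. y \<in> U \<Longrightarrow> F y = M"
  shows flat
  unfolding flat_def
proof (intro ballI allI)
  fix y i j assume y: "y \<in> U"
  have 0: "partial i F z = 0" if "z \<in> U" for z i
    using partial_cong_open[OF U that F, where i = i] by (simp add: partial_const)
  have 00: "partial i (partial j F) y = 0" for i j
    using partial_cong_open[OF U y 0, where i = i] by (simp add: partial_const)
  have "2 * Dsq y = 0"
    using bochner[OF y] by (simp add: 0[OF y] 00 dS[OF y] tr_0)
  then show "nabla \<Gamma> \<theta> y [i, j] = 0" by (intro Dsq_eq_0D[OF y]) simp
qed

lemma flat_ricci: "flat \<longleftrightarrow> (\<forall>y\<in>U. \<forall>i j. ricci g \<Gamma> y i j = 0)"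
  unfolding flat_def by (auto simp: ricci_theta)

lemma flat_Sd: "flat \<Longrightarrow> y \<in> U \<Longrightarrow> Sd y = 0"
  by (simp add: Sd_tr flat_def tr_0)

lemma partial_Sd_N:
  assumes y: "y \<in> U" shows "partial i Sd y = partial i N y / 6 - partial i F y"
proof -
  have "partial i Sd y = partial i (\<lambda>z. 1 / 6 * N z - F z - 1 / 36 * (tau z * tau z)) y"
    by (rule partial_cong_open[OF U y]) (simp add: Sd_eq power2_eq_square)
  also have "\<dots> = 1 / 6 * partial i N y - partial i F y - 1 / 36 * (partial i tau y * tau y + tau y * partial i tau y)"
    using N_diff[OF y] F_diff[OF y] tau_diff[OF y]
    by (simp only: partial_diff partial_cmult partial_mult differentiable_mult differentiable_diff differentiable_const)
  finally show ?thesis by (simp add: partial_tau[OF y])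
qed

text \<open>\<open>Sd\<close> and \<open>F\<close> both have zero differential, and
  \<open>partial_Sd_N\<close> then leaves only that of \<open>N\<close>.\<close>

lemma flat_partial_N:
  assumes flat and y: "y \<in> U" shows "partial i N y = 0"
proof -
  have "partial i Sd y = partial i (\<lambda>z. 0) y" by (rule partial_cong_open[OF U y]) (rule flat_Sd[OF \<open>flat\<close>])
  moreover have "partial i F y = 0" using \<open>flat\<close> y by (simp add: partial_F flat_def tr_0)
  ultimately show ?thesis using partial_Sd_N[OF y, of i] by (simp add: partial_const)
qed

lemma N_nonneg: assumes y: "y \<in> U" shows "0 \<le> N y"
proof -
  interpret pt: adapted_pt "E y" "matrix_inv (E y)" "transpose (E y) ** E y" "matrix_inv (transpose (E y) ** E y)" "\<phi> y"
    by (rule adapted_pt[OF y]) simp_all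
  have "N y = contr (mat 1) 0 3 (pull (matrix_inv (E y)) (T y)) (pull (matrix_inv (E y)) (T y)) []"
    using contr_pull[OF pt.h_eq', of 0 "[]" 3 "T y" "T y"] by (simp add: N_def h_E[OF y])
  then show ?thesis by (simp add: contr_mat_1 sum_nonneg)
qed

end

lemma (in g2_chart_vol) flat_codiff_T: "flat \<Longrightarrow> y \<in> U \<Longrightarrow> g2_codiff \<phi> 3 T y l = 0"
  by (intro codiff_T) (simp_all add: Dtheta_antisym flat_def)

section \<open>Coordinate changes\<close>

definition jmat :: "'a chart \<Rightarrow> 'a chart \<Rightarrow> real^7 \<Rightarrow> real^7^7" where
  "jmat c d y = (\<chi> a i. jac c d y a i)"

locale atlas7 =
  fixes X :: "'a topology" and A :: "'a chart set"
  assumes manifold: "smooth_manifold7 X A"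
begin

lemma chart: "c \<in> A \<Longrightarrow> chart_on X c"
  using manifold by (simp add: smooth_manifold7_def)

lemma openin_domain: "c \<in> A \<Longrightarrow> openin X (fst c)"
  and open_image: "c \<in> A \<Longrightarrow> open (chart_image c)"
  and homeo: "c \<in> A \<Longrightarrow> homeomorphic_map (subtopology X (fst c)) (top_of_set (chart_image c)) (snd c)"
  using chart by (auto simp: chart_on_def)

lemma topspace_domain: "c \<in> A \<Longrightarrow> topspace (subtopology X (fst c)) = fst c"
  using openin_subset[OF openin_domain, of c] by (simp add: Int_absorb1)

lemma chart_inj: "c \<in> A \<Longrightarrow> inj_on (snd c) (fst c)"
  using homeomorphic_imp_injective_map[OF homeo] topspace_domain by simp

lemma transition_eq: "c \<in> A \<Longrightarrow> x \<in> fst c \<Longrightarrow> transition c d (snd c x) = snd d x"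
  by (simp add: transition_def inv_into_f_f chart_inj)

lemma overlap_subset: "overlap c d \<subseteq> chart_image c"
  by (auto simp: overlap_def chart_image_def)

lemma open_overlap: assumes c: "c \<in> A" and d: "d \<in> A" shows "open (overlap c d)"
proof -
  have "openin (subtopology X (fst c)) (fst c \<inter> fst d)"
    using openin_domain[OF d] by (auto simp: openin_subtopology)
  then have "openin (top_of_set (chart_image c)) (overlap c d)"
    unfolding overlap_def
    by (subst homeomorphic_map_openness[OF homeo[OF c]]) (simp_all add: topspace_domain[OF c] del: topspace_subtopology)
  then show ?thesis by (rule openin_open_trans[OF _ open_image[OF c]])
qed

lemma openin_preimage:
  assumes c: "c \<in> A" and V: "open V" shows "openin X {x \<in> fst c. snd c x \<in> V}"
proof -
  have "openin (subtopology X (fst c)) {x \<in> topspace (subtopology X (fst c)). snd c x \<in> chart_image c \<inter> V}"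
    using homeomorphic_imp_continuous_map[OF homeo[OF c]] V by (intro openin_continuous_map_preimage) (auto simp: openin_open)
  moreover have "{x \<in> topspace (subtopology X (fst c)). snd c x \<in> chart_image c \<inter> V} = {x \<in> fst c. snd c x \<in> V}"
    unfolding topspace_domain[OF c] chart_image_def by blast
  ultimately have "openin (subtopology X (fst c)) {x \<in> fst c. snd c x \<in> V}" by simp
  then show ?thesis using openin_domain[OF c] by (simp add: openin_open_subtopology)
qed

lemma transition_overlap:
  assumes c: "c \<in> A" and d: "d \<in> A" and y: "y \<in> overlap c d"
  shows "transition c d y \<in> overlap d c" "transition d c (transition c d y) = y"
  using y by (auto simp: overlap_def transition_eq c d)

lemma transition_smooth: "c \<in> A \<Longrightarrow> d \<in> A \<Longrightarrow> smooth_on (overlap c d) (transition c d)"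
  using manifold by (simp add: smooth_manifold7_def)

lemma jmat_matrix: "jmat c d y = matrix (frechet_derivative (transition c d) (at y))"
  by (simp add: jmat_def jac_def partial_def matrix_def)

lemma jmat_inverse:
  assumes c: "c \<in> A" and d: "d \<in> A" and y: "y \<in> overlap c d"
  shows "jmat d c (transition c d y) ** jmat c d y = mat 1"
proof -
  let ?f = "transition c d" and ?g = "transition d c"
  have f: "(?f has_derivative frechet_derivative ?f (at y)) (at y)"
    by (rule has_derivative_frechet[OF smooth_on_differentiable[OF transition_smooth[OF c d] y]])
  have g: "(?g has_derivative frechet_derivative ?g (at (?f y))) (at (?f y))"
    by (rule has_derivative_frechet[OF smooth_on_differentiable[OF transition_smooth[OF d c] transition_overlap(1)[OF c d y]]])
  have "(?g \<circ> ?f has_derivative frechet_derivative ?g (at (?f y)) \<circ> frechet_derivative ?f (at y)) (at y)"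
    by (rule diff_chain_at[OF f g])
  moreover have "(?g \<circ> ?f has_derivative D) (at y) \<longleftrightarrow> ((\<lambda>z. z) has_derivative D) (at y)" for D
    by (rule has_derivative_cong_open[OF open_overlap[OF c d] y]) (simp add: transition_overlap(2)[OF c d])
  ultimately have "frechet_derivative ?g (at (?f y)) \<circ> frechet_derivative ?f (at y) = (\<lambda>z. z)"
    using has_derivative_unique has_derivative_ident by blast
  then have "matrix (frechet_derivative ?g (at (?f y)) \<circ> frechet_derivative ?f (at y)) = mat 1"
    by (simp add: matrix_id_mat_1[unfolded id_def])
  then show ?thesis
    unfolding jmat_matrix using matrix_compose[OF has_derivative_linear[OF f] has_derivative_linear[OF g]] by simp
qed

lemma form_field_pull:
  assumes \<alpha>: "form_field A p \<alpha>" and c: "c \<in> A" and d: "d \<in> A" and y: "y \<in> overlap c d"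
  shows "\<alpha> c y = pull (jmat c d y) (\<alpha> d (transition c d y))"
proof
  fix l
  have yc: "y \<in> chart_image c" and yd: "transition c d y \<in> chart_image d"
    using y transition_overlap(1)[OF c d y] overlap_subset by blast+
  show "\<alpha> c y l = pull (jmat c d y) (\<alpha> d (transition c d y)) l"
  proof (cases "length l = p")
    case True
    then show ?thesis using \<alpha> c d y by (simp add: form_field_def pull_def lk_def jmat_def)
  next
    case False
    then have "\<alpha> c y l = 0" using \<alpha> c yc by (simp add: form_field_def alt_form_def)
    moreover have "\<alpha> d (transition c d y) m = 0" if "length m = length l" for m
      using \<alpha> d yd False that by (simp add: form_field_def alt_form_def)
    ultimately show ?thesis by (simp add: pull_def)
  qed
qed

text \<open>The level set of \<open>f x\<close> is clopen. The value type is arbitrary, so truth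
  values are allowed.\<close>

lemma locally_constant_constant:
  fixes f :: "'a \<Rightarrow> 'b"
  assumes f: "\<And>x. x \<in> topspace X \<Longrightarrow> \<exists>V. openin X V \<and> x \<in> V \<and> (\<forall>z\<in>V. f z = f x)"
    and x: "x \<in> topspace X" "y \<in> topspace X"
  shows "f x = f y"
proof -
  let ?S = "\<lambda>P. {z \<in> topspace X. P (f z)}"
  have o: "openin X (?S P)" for P
  proof (subst openin_subopen, intro ballI)
    fix z assume z: "z \<in> ?S P"
    then obtain V where V: "openin X V" "z \<in> V" "\<forall>w\<in>V. f w = f z" using f by blast
    moreover have "V \<subseteq> ?S P" using V z openin_subset by fastforce
    ultimately show "\<exists>T. openin X T \<and> z \<in> T \<and> T \<subseteq> ?S P" by blast
  qed
  have "topspace X - ?S (\<lambda>v. v = f x) = ?S (\<lambda>v. v \<noteq> f x)" by auto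
  then have "closedin X (?S (\<lambda>v. v = f x))" unfolding closedin_def using o by auto
  moreover have "connected_space X" using manifold by (simp add: smooth_manifold7_def)
  ultimately have "?S (\<lambda>v. v = f x) = {} \<or> ?S (\<lambda>v. v = f x) = topspace X"
    using o[of "\<lambda>v. v = f x"] by (simp only: connected_space_clopen_in)
  then have "y \<in> ?S (\<lambda>v. v = f x)" using x by blast
  then show ?thesis by simp
qed

end

lemma th_pull:
  assumes h: "h = P ** h' ** transpose P"
  shows "pull P (th h f T) l = th h' (pull P f) (pull P T) l"
proof -
  have "pull P (th h f T) l = - (1 / 6) * pull P (contr h 0 2 (contr h 1 2 T f) f) l"
    by (simp add: pull_def th_def sum_distrib_left sum_negf mult_ac)
  also have "pull P (contr h 0 2 (contr h 1 2 T f) f) l = contr h' 0 2 (pull P (contr h 1 2 T f)) (pull P f) l"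
    by (rule contr_pull[OF h]) simp
  also have "\<dots> = contr h' 0 2 (contr h' 1 2 (pull P T) (pull P f)) (pull P f) l"
    by (rule contr_cong) (auto intro!: contr_pull[OF h])
  finally show ?thesis by (simp only: th_def[of h'])
qed

lemma adapted_pull:
  assumes E: "adapted E f" and J: "invertible J"
  shows "adapted (E ** J) (pull J f)"
  using E J by (simp add: adapted_def g2_form_pull pull_pull invertible_mult)

text \<open>\<open>E ** J\<close> is adapted to the pulled back form, which turns the frame
  description of the metric into its transformation law.\<close>

lemma matrix_inv_metric_pull:
  assumes E: "adapted E f" and J: "invertible J"
  shows "matrix_inv (g2_metric f) = J ** matrix_inv (g2_metric (pull J f)) ** transpose J"
proof -
  interpret a: adapted_pt E "matrix_inv E" "transpose E ** E" "matrix_inv (transpose E ** E)" f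
    by (rule adapted_pt.intro[OF E]) simp_all
  interpret b: adapted_pt "E ** J" "matrix_inv (E ** J)" "transpose (E ** J) ** (E ** J)"
    "matrix_inv (transpose (E ** J) ** (E ** J))" "pull J f"
    by (rule adapted_pt.intro[OF adapted_pull[OF E J]]) simp_all
  let ?P = "matrix_inv (E ** J)"
  have "matrix_inv E = J ** ?P" by (rule matrix_inv_unique) (use b.EP in \<open>simp add: matrix_mul_assoc\<close>)
  then show ?thesis
    unfolding a.metric_f b.metric_f a.h_eq b.h_eq by (simp add: matrix_transpose_mul matrix_mul_assoc)
qed

lemma differentiable_cong_open:
  assumes "open S" "x \<in> S" "\<And>y. y \<in> S \<Longrightarrow> f y = f' y" "f' differentiable (at x)"
  shows "f differentiable (at x)"
  using assms(4) has_derivative_cong_open[OF assms(1-3)] by (auto simp: differentiable_def)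

section \<open>From charts to the manifold\<close>

locale g2_manifold = atlas7 +
  fixes \<phi> :: "'a chart \<Rightarrow> real^7 \<Rightarrow> tens" and \<Gamma> :: "'a chart \<Rightarrow> conn"
  assumes g2: "g2_structure X A \<phi>" and char: "characteristic_connection A \<phi> \<Gamma>"
    and closed: "closed_form A 3 (\<lambda>c. g2_torsion (\<phi> c) (\<Gamma> c))"
begin

abbreviation g where "g c \<equiv> \<lambda>y. g2_metric (\<phi> c y)"
abbreviation T where "T c \<equiv> torsion (g c) (\<Gamma> c)"
abbreviation \<theta> where "\<theta> c \<equiv> g2_chart.\<theta> (\<Gamma> c) (g c) (\<phi> c)"
abbreviation F where "F c \<equiv> g2_chart.F (\<Gamma> c) (g c) (\<phi> c)"
abbreviation N where "N c \<equiv> g2_chart.N (\<Gamma> c) (g c)"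
abbreviation Sd where "Sd c \<equiv> g2_chart.Sd (\<Gamma> c) (g c) (\<phi> c)"
abbreviation flat where "flat c \<equiv> g2_chart.flat (chart_image c) (\<Gamma> c) (g c) (\<phi> c)"

lemma phi_form: "form_field A 3 \<phi>"
  using g2 by (simp add: g2_structure_def)

lemma T_form: "form_field A 3 T"
  using char by (simp add: characteristic_connection_def g2_torsion_def)

lemma invertible_jmat:
  assumes "c \<in> A" "d \<in> A" "y \<in> overlap c d" shows "invertible (jmat c d y)"
  using jmat_inverse[OF assms] invertible_left_inverse by blast

text \<open>A coframe is given only in some chart around each point; the Jacobian carries it into
  the chart \<open>c\<close>. Differentiability at \<open>y\<close> is recorded, as the chart locale
  requires.\<close>

lemma local_frame:
  assumes c: "c \<in> A" and y: "y \<in> chart_image c"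
  obtains V B where "open V" "y \<in> V" "V \<subseteq> chart_image c" "\<And>z. z \<in> V \<Longrightarrow> adapted (B z) (\<phi> c z)"
    "\<And>a i. (\<lambda>z. B z $ a $ i) differentiable (at y)"
proof -
  obtain x where x: "x \<in> fst c" "y = snd c x" using y by (auto simp: chart_image_def)
  then have "x \<in> topspace X" using openin_subset[OF openin_domain[OF c]] by blast
  then obtain d W E where d: "d \<in> A" "x \<in> fst d" and W: "open W" "snd d x \<in> W" "W \<subseteq> chart_image d"
    and E: "smooth_on W E" "\<And>z. z \<in> W \<Longrightarrow> adapted (E z) (\<phi> d z)"
    using g2 unfolding g2_structure_def by metis
  let ?t = "transition c d"
  have ty: "?t y \<in> W" and yo: "y \<in> overlap c d" using x d W by (auto simp: transition_eq c overlap_def)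
  note o = open_overlap[OF c d(1)] and ts = transition_smooth[OF c d(1)]
  define V where "V = overlap c d \<inter> ?t -` W"
  define B where "B z = E (?t z) ** jmat c d z" for z
  show ?thesis
  proof (rule that[of V B])
    show "open V" unfolding V_def
      by (rule continuous_open_preimage[OF smooth_on_continuous_on[OF ts] o W(1)])
    show "y \<in> V" using ty yo by (simp add: V_def)
    show "V \<subseteq> chart_image c" unfolding V_def using overlap_subset[of c d] by blast
    show "adapted (B z) (\<phi> c z)" if "z \<in> V" for z
    proof -
      have z: "z \<in> overlap c d" "?t z \<in> W" using that by (auto simp: V_def)
      show ?thesis
        unfolding B_def form_field_pull[OF phi_form c d(1) z(1)]
        by (rule adapted_pull[OF E(2)[OF z(2)] invertible_jmat[OF c d(1) z(1)]])
    qed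
    show "(\<lambda>z. B z $ a $ i) differentiable (at y)" for a i
    proof -
      have "(\<lambda>w. E w $ a $ b) differentiable (at (?t y))" for b
        using E(1) ty by (intro smooth_on_differentiable[OF _ ty] smooth_on_vec_nth W)
      then have "(\<lambda>z. E (?t z) $ a $ b) differentiable (at y)" for b
        using differentiable_chain_at[OF smooth_on_differentiable[OF ts yo], of "\<lambda>w. E w $ a $ b"] by (simp add: comp_def)
      moreover have "(\<lambda>z. jac c d z b i) differentiable (at y)" for b
        unfolding jac_def by (intro smooth_on_differentiable[OF _ yo] smooth_on_vec_nth o smooth_on_partial ts)
      ultimately have "(\<lambda>z. \<Sum>b\<in>UNIV. E (?t z) $ a $ b * jac c d z b i) differentiable (at y)"
        by (intro differentiable_sum ballI differentiable_mult finite) auto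
      then show ?thesis by (simp add: B_def matrix_matrix_mult_def jmat_def)
    qed
  qed
qed

lemma g2_chart_vol:
  assumes c: "c \<in> A" shows "g2_chart_vol (chart_image c) (\<Gamma> c) (g c) (\<phi> c)"
proof
  show U: "open (chart_image c)" by (rule open_image[OF c])
  show "smooth_on (chart_image c) (\<lambda>y. cf (\<Gamma> c) y i j a)" for i j a
    using char c U by (auto simp: characteristic_connection_def connection_def cf_def intro: smooth_on_vec_nth)
  show "smooth_tens (chart_image c) (\<phi> c)"
    using phi_form c by (simp add: form_field_def smooth_tens_def)
  fix y assume y: "y \<in> chart_image c"
  obtain V B where V: "open V" "y \<in> V" "V \<subseteq> chart_image c" and B: "\<And>z. z \<in> V \<Longrightarrow> adapted (B z) (\<phi> c z)"
    and dB: "\<And>a i. (\<lambda>z. B z $ a $ i) differentiable (at y)" by (rule local_frame[OF c y]) blast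
  interpret a: adapted_pt "B y" "matrix_inv (B y)" "transpose (B y) ** B y" "matrix_inv (transpose (B y) ** B y)" "\<phi> c y"
    by (rule adapted_pt.intro[OF B[OF V(2)]]) simp_all
  show "g c y $ i $ j = g c y $ j $ i" for i j unfolding a.metric_f by (rule a.g_sym)
  show "invertible (g c y)" unfolding a.metric_f using a.gh a.hg invertible_def by blast
  show "(\<lambda>z. g c z $ i $ j) differentiable (at y)" for i j
  proof (rule differentiable_cong_open[OF V(1,2)])
    show "g c z $ i $ j = (\<Sum>k\<in>UNIV. B z $ k $ i * B z $ k $ j)" if "z \<in> V" for z
      by (simp add: adapted_metric_vol(1)[OF B[OF that]] matrix_matrix_mult_def transpose_def)
    show "(\<lambda>z. \<Sum>k\<in>UNIV. B z $ k $ i * B z $ k $ j) differentiable (at y)"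
      by (intro differentiable_sum ballI differentiable_mult dB finite)
  qed
  show "(\<lambda>z. g2_vol (\<phi> c z) l) differentiable (at y)" for l
  proof (rule differentiable_cong_open[OF V(1,2)])
    show "g2_vol (\<phi> c z) l = (\<Sum>m | length m = length l. (\<Prod>k<length l. B z $ (m ! k) $ (l ! k)) * eps0 m)" if "z \<in> V" for z
      by (simp add: adapted_metric_vol(2)[OF B[OF that]] pull_def lk_def)
    show "(\<lambda>z. \<Sum>m | length m = length l. (\<Prod>k<length l. B z $ (m ! k) $ (l ! k)) * eps0 m) differentiable (at y)"
      by (intro differentiable_sum ballI differentiable_mult differentiable_prod dB finite_length_eq differentiable_const finite_lessThan)
  qed
  show "nabla (\<Gamma> c) (metric_tensor (g c)) y [i, j, k] = 0" for i j k
    using char c y cov_tensor_nabla[of "\<Gamma> c" "[j, k]" "metric_tensor (g c)" y i] by (simp add: characteristic_connection_def numeral_eq_Suc)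
  show "nabla (\<Gamma> c) (\<phi> c) y [i, j, k, l] = 0" for i j k l
    using char c y cov_tensor_nabla[of "\<Gamma> c" "[j, k, l]" "\<phi> c" y i] by (simp add: characteristic_connection_def numeral_eq_Suc)
  show "alternating (T c y)"
    using T_form c y by (auto simp: form_field_def intro: alt_form_alternating)
  show "ext_d 3 (T c) y m = 0" for m
    using closed c y by (simp add: closed_form_def g2_torsion_def)
  show "\<exists>E. adapted E (\<phi> c y)" using B[OF V(2)] by blast
qed simp

lemma g2_chart: "c \<in> A \<Longrightarrow> g2_chart (chart_image c) (\<Gamma> c) (g c) (\<phi> c)"
  using g2_chart_vol by (simp add: g2_chart_vol_def)

text \<open>Full contractions of tensors that transform by pullback do not depend on the chart, by
  \<open>contr_pull\<close>.\<close>

lemma transition_F_N: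
  assumes c: "c \<in> A" and d: "d \<in> A" and y: "y \<in> overlap c d"
  shows "F c y = F d (transition c d y)" "N c y = N d (transition c d y)"
proof -
  define y' J where "y' = transition c d y" and "J = jmat c d y"
  have yc: "y \<in> chart_image c" and yd: "y' \<in> chart_image d"
    unfolding y'_def using y transition_overlap(1)[OF c d y] overlap_subset[of c d] overlap_subset[of d c] by blast+
  interpret C: g2_chart "chart_image c" "\<Gamma> c" "g c" "T c" "\<phi> c" by (rule g2_chart[OF c]) simp
  interpret D: g2_chart "chart_image d" "\<Gamma> d" "g d" "T d" "\<phi> d" by (rule g2_chart[OF d]) simp
  have p: "\<phi> c y = pull J (\<phi> d y')" "T c y = pull J (T d y')"
    unfolding J_def y'_def by (rule form_field_pull[OF _ c d y] phi_form T_form)+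
  have h: "D.h y' = J ** C.h y ** transpose J"
    unfolding C.h_def D.h_def p(1) J_def
    by (rule matrix_inv_metric_pull[OF D.adapted_E[OF yd] invertible_jmat[OF c d y]])
  have th: "pull J (D.\<theta> y') = C.\<theta> y"
    unfolding C.\<theta>_def[abs_def] D.\<theta>_def[abs_def] p by (rule ext) (rule th_pull[OF h])
  have "D.F y' = contr (C.h y) 0 1 (pull J (D.\<theta> y')) (pull J (D.\<theta> y')) []"
    using contr_pull[OF h, of 0 "[]" 1 "D.\<theta> y'" "D.\<theta> y'"] by (simp add: D.F_def)
  then show "C.F y = D.F (transition c d y)" unfolding y'_def[symmetric] by (simp only: C.F_def th)
  have "D.N y' = contr (C.h y) 0 3 (pull J (T d y')) (pull J (T d y')) []"
    using contr_pull[OF h, of 0 "[]" 3 "T d y'" "T d y'"] by (simp add: D.N_def)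
  then show "C.N y = D.N (transition c d y)" unfolding y'_def[symmetric] by (simp only: C.N_def p)
qed

text \<open>A scalar read in some chart around the point; for chart independent families
  \<open>glob_eq\<close> makes the choice harmless.\<close>

definition glob :: "('a chart \<Rightarrow> real^7 \<Rightarrow> real) \<Rightarrow> 'a \<Rightarrow> real" where
  "glob u x = (let c = SOME c. c \<in> A \<and> x \<in> fst c in u c (snd c x))"

lemma glob_eq:
  assumes u: "\<And>c d y. c \<in> A \<Longrightarrow> d \<in> A \<Longrightarrow> y \<in> overlap c d \<Longrightarrow> u c y = u d (transition c d y)"
    and c: "c \<in> A" and x: "x \<in> fst c"
  shows "glob u x = u c (snd c x)"
proof -
  let ?d = "SOME d. d \<in> A \<and> x \<in> fst d"
  have d: "?d \<in> A \<and> x \<in> fst ?d" by (rule someI[of _ c]) (use c x in simp)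
  have "u c (snd c x) = u ?d (transition c ?d (snd c x))" by (rule u) (use c x d in \<open>auto simp: overlap_def\<close>)
  then show ?thesis using d by (simp add: glob_def Let_def transition_eq[OF c x])
qed

lemma in_domain: "x \<in> topspace X \<Longrightarrow> \<exists>c\<in>A. x \<in> fst c"
  using manifold by (auto simp: smooth_manifold7_def)

lemma domain_topspace: "c \<in> A \<Longrightarrow> x \<in> fst c \<Longrightarrow> x \<in> topspace X"
  using openin_subset[OF openin_domain] by blast

text \<open>\<open>P\<close> covers two uses: the truth value of being the maximum, and the identity
  for a locally constant function.\<close>

lemma glob_constant:
  assumes u: "\<And>c d y. c \<in> A \<Longrightarrow> d \<in> A \<Longrightarrow> y \<in> overlap c d \<Longrightarrow> u c y = u d (transition c d y)"
    and l: "\<And>c y. c \<in> A \<Longrightarrow> y \<in> chart_image c \<Longrightarrow> \<exists>e>0. \<forall>z\<in>ball y e. z \<in> chart_image c \<and> P (u c z) = P (u c y)"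
    and x: "x \<in> topspace X" "y \<in> topspace X"
  shows "P (glob u x) = P (glob u y)"
proof (rule locally_constant_constant[OF _ x])
  fix x assume "x \<in> topspace X"
  then obtain c where c: "c \<in> A" "x \<in> fst c" using in_domain by blast
  then have "snd c x \<in> chart_image c" by (simp add: chart_image_def)
  from l[OF c(1) this] obtain e where e: "e > 0" "\<forall>z\<in>ball (snd c x) e. z \<in> chart_image c \<and> P (u c z) = P (u c (snd c x))"
    by blast
  have gl: "glob u z = u c (snd c z)" if "z \<in> fst c" for z by (rule glob_eq[OF u c(1) that])
  show "\<exists>V. openin X V \<and> x \<in> V \<and> (\<forall>z\<in>V. P (glob u z) = P (glob u x))"
  proof (intro exI conjI ballI)
    show "openin X {z \<in> fst c. snd c z \<in> ball (snd c x) e}" by (rule openin_preimage[OF c(1) open_ball])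
    show "x \<in> {z \<in> fst c. snd c z \<in> ball (snd c x) e}" using c e by simp
    fix z assume "z \<in> {z \<in> fst c. snd c z \<in> ball (snd c x) e}"
    then show "P (glob u z) = P (glob u x)" using e(2) c(2) by (simp add: gl)
  qed
qed

lemma glob_continuous:
  assumes u: "\<And>c d y. c \<in> A \<Longrightarrow> d \<in> A \<Longrightarrow> y \<in> overlap c d \<Longrightarrow> u c y = u d (transition c d y)"
    and s: "\<And>c. c \<in> A \<Longrightarrow> continuous_on (chart_image c) (u c)"
  shows "continuous_map X euclideanreal (glob u)"
proof (rule pasting_lemma[of A X fst _ "\<lambda>c x. u c (snd c x)"])
  show "openin X (fst c)" if "c \<in> A" for c by (rule openin_domain[OF that])
  show "continuous_map (subtopology X (fst c)) euclideanreal (\<lambda>x. u c (snd c x))" if c: "c \<in> A" for c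
    using continuous_map_compose[OF homeomorphic_imp_continuous_map[OF homeo[OF c]], of euclideanreal "u c"] s[OF c]
    by (simp add: comp_def)
  show "u c (snd c x) = u d (snd d x)" if "c \<in> A" "d \<in> A" "x \<in> topspace X \<inter> fst c \<inter> fst d" for c d x
    using that u[of c d "snd c x"] by (auto simp: overlap_def transition_eq)
  show "\<exists>c. c \<in> A \<and> x \<in> fst c \<and> glob u x = u c (snd c x)" if "x \<in> topspace X" for x
    using in_domain[OF that] glob_eq[OF u] by blast
qed

lemma flat_global:
  assumes compact: "compact_space X"
    and dS: "\<And>c y a. c \<in> A \<Longrightarrow> y \<in> chart_image c \<Longrightarrow> partial a (Sd c) y = \<mu> * partial a (F c) y"
    and c: "c \<in> A"
  shows "flat c"
proof (cases "topspace X = {}")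
  case True
  then have "chart_image c = {}" using domain_topspace[OF c] by (auto simp: chart_image_def)
  then show ?thesis unfolding g2_chart.flat_def[OF g2_chart[OF c]] by simp
next
  case False
  let ?G = "glob F"
  have cont: "continuous_map X euclideanreal ?G"
  proof (rule glob_continuous[OF transition_F_N(1)])
    show "continuous_on (chart_image c) (F c)" if "c \<in> A" for c
      by (rule smooth_on_continuous_on[OF g2_chart.smooth_F[OF g2_chart[OF that]]])
  qed
  have "compact (?G ` topspace X)"
    using image_compactin[OF _ cont] compact by (simp add: compact_space_def)
  then obtain xm where xm: "xm \<in> topspace X" "\<And>x. x \<in> topspace X \<Longrightarrow> ?G x \<le> ?G xm"
    using compact_attains_sup[of "?G ` topspace X"] False by auto
  define M where "M = ?G xm"
  have Fc: "F c y \<le> M" if c: "c \<in> A" and y: "y \<in> chart_image c" for c y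
  proof -
    obtain x where "x \<in> fst c" "y = snd c x" using y by (auto simp: chart_image_def)
    then show ?thesis
      using xm(2)[OF domain_topspace[OF c], of x] glob_eq[OF transition_F_N(1) c, of x] by (simp add: M_def)
  qed
  \<comment> \<open>Attaining the maximum is an open condition by \<open>F_locally_max\<close>, and
    failing to attain it is open by continuity.\<close>
  have "(?G x = M) = (?G xm = M)" if x: "x \<in> topspace X" for x
  proof (rule glob_constant[OF transition_F_N(1) _ x xm(1)])
    fix c y assume c: "c \<in> A" and y: "y \<in> chart_image c"
    interpret C: g2_chart "chart_image c" "\<Gamma> c" "g c" "T c" "\<phi> c" by (rule g2_chart[OF c]) simp
    show "\<exists>e>0. \<forall>z\<in>ball y e. z \<in> chart_image c \<and> (C.F z = M) = (C.F y = M)"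
    proof (cases "C.F y = M")
      case True
      then show ?thesis using C.F_locally_max[of \<mu> M y, OF dS[OF c] Fc[OF c] y] by auto
    next
      case False
      have "open (chart_image c \<inter> C.F -` (- {M}))"
        by (rule continuous_open_preimage[OF smooth_on_continuous_on[OF C.smooth_F] C.U]) auto
      then obtain e where "e > 0" "ball y e \<subseteq> chart_image c \<inter> C.F -` (- {M})"
        using open_contains_ball y False by blast
      then show ?thesis using False by blast
    qed
  qed
  then have G: "?G x = M" if "x \<in> topspace X" for x using that by (simp add: M_def)
  interpret C: g2_chart "chart_image c" "\<Gamma> c" "g c" "T c" "\<phi> c" by (rule g2_chart[OF c]) simp
  show ?thesis
  proof (rule C.flat_if_F_constant[OF dS[OF c]])
    show "C.F y = M" if "y \<in> chart_image c" for y
      using that G domain_topspace[OF c] by (auto simp: chart_image_def glob_eq[OF transition_F_N(1) c, symmetric])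
  qed
qed

section \<open>The four conditions and the parallel Lee form\<close>

lemma ricci_flat_iff: "ricci_flat A \<phi> \<Gamma> \<longleftrightarrow> (\<forall>c\<in>A. flat c)"
  by (auto simp: ricci_flat_def g2_ricci_def g2_chart.flat_ricci[OF g2_chart])

lemma gauduchon_iff: "gauduchon_g2 A \<phi> \<longleftrightarrow> (\<forall>c\<in>A. \<forall>y\<in>chart_image c. Sd c y = 0)"
proof -
  have "(\<forall>l. g2_codiff (\<phi> c) 1 (lee_form (\<phi> c)) y l = 0) \<longleftrightarrow> Sd c y = 0" if c: "c \<in> A" and y: "y \<in> chart_image c" for c y
  proof -
    interpret C: g2_chart_vol "chart_image c" "\<Gamma> c" "g c" "T c" "\<phi> c" by (rule g2_chart_vol[OF c]) simp
    have "g2_codiff (\<phi> c) 1 (lee_form (\<phi> c)) y l = (if l = [] then C.Sd y else 0)" for l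
      using C.codiff_lee[OF y] C.codiff_length[of l 1] by auto
    then show ?thesis by simp
  qed
  then show ?thesis by (auto simp: gauduchon_g2_def coclosed_form_def)
qed

lemma norm_constant_iff:
  "torsion_norm_constant A \<phi> \<Gamma> \<longleftrightarrow> (\<forall>c\<in>A. \<forall>y\<in>chart_image c. \<forall>i. partial i (N c) y = 0)"
proof -
  have "partial i (g2_norm_sq (\<phi> c) 3 (g2_torsion (\<phi> c) (\<Gamma> c))) y = partial i (N c) y" if c: "c \<in> A" and y: "y \<in> chart_image c" for c y i
  proof -
    interpret C: g2_chart_vol "chart_image c" "\<Gamma> c" "g c" "T c" "\<phi> c" by (rule g2_chart_vol[OF c]) simp
    show ?thesis
      by (rule partial_cong_open[OF C.U y]) (simp add: g2_norm_sq_def g2_torsion_def C.norm_sq_N)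
  qed
  then show ?thesis by (simp add: torsion_norm_constant_def)
qed

lemma scal_eq: "c \<in> A \<Longrightarrow> y \<in> chart_image c \<Longrightarrow> g2_scal (\<phi> c) y = Sd c y + N c y / 4"
  by (simp add: g2_scal_def Let_def g2_chart.scal_levi_civita[OF g2_chart])

text \<open>Here \<open>Sd\<close> is the codifferential of the Lee form and vanishes, so
  \<open>\<mu>\<close> is 0.\<close>

lemma gauduchon_flat:
  assumes "compact_space X" "gauduchon_g2 A \<phi>" "c \<in> A" shows "flat c"
proof (rule flat_global[where \<mu> = 0, OF assms(1) _ assms(3)])
  fix c y a assume c: "c \<in> A" and y: "y \<in> chart_image c"
  have "partial a (Sd c) y = partial a (\<lambda>z. 0) y"
    by (rule partial_cong_open[OF open_image[OF c] y]) (use assms(2) c in \<open>simp add: gauduchon_iff\<close>)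
  then show "partial a (Sd c) y = 0 * partial a (F c) y" by (simp add: partial_const)
qed

text \<open>In dS = dN/6 - dF the first term vanishes, so \<open>\<mu>\<close> is -1.\<close>

lemma norm_constant_flat:
  assumes "compact_space X" "torsion_norm_constant A \<phi> \<Gamma>" "c \<in> A" shows "flat c"
proof (rule flat_global[where \<mu> = "- 1", OF assms(1) _ assms(3)])
  fix c y a assume c: "c \<in> A" and y: "y \<in> chart_image c"
  show "partial a (Sd c) y = - 1 * partial a (F c) y"
    using g2_chart.partial_Sd_N[OF g2_chart[OF c] y, of a] assms(2) c y by (simp add: norm_constant_iff)
qed

text \<open>Constancy of S + N/4 gives dN = -4 dS. Inserted into dS = dN/6 - dF, this is (5/3) dS =
  - dF.\<close>

lemma scal_constant_flat:
  assumes "compact_space X" "scal_nonneg_constant A \<phi>" "c \<in> A" shows "flat c"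
proof (rule flat_global[where \<mu> = "- 3 / 5", OF assms(1) _ assms(3)])
  fix c y a assume c: "c \<in> A" and y: "y \<in> chart_image c"
  interpret C: g2_chart "chart_image c" "\<Gamma> c" "g c" "T c" "\<phi> c" by (rule g2_chart[OF c]) simp
  obtain k where k: "C.Sd z + C.N z / 4 = k" if "z \<in> chart_image c" for z
    using assms(2) c by (auto simp: scal_nonneg_constant_def scal_eq)
  have "0 = partial a (\<lambda>z. C.Sd z + 1 / 4 * C.N z) y"
    using partial_cong_open[OF C.U y, of "\<lambda>z. C.Sd z + 1 / 4 * C.N z" "\<lambda>z. k"] k by (simp add: partial_const)
  also have "\<dots> = partial a C.Sd y + 1 / 4 * partial a C.N y"
    using C.Sd_diff[OF y] C.N_diff[OF y]
    by (simp only: partial_add partial_cmult differentiable_mult differentiable_const)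
  finally show "partial a C.Sd y = - 3 / 5 * partial a C.F y"
    using C.partial_Sd_N[OF y, of a] by simp
qed

text \<open>With a parallel Lee form S vanishes and N is locally constant, so the scalar curvature
  is N/4, a sum of squares in an adapted frame.\<close>

lemma flat_scal_constant:
  assumes flat: "\<And>c. c \<in> A \<Longrightarrow> flat c" shows "scal_nonneg_constant A \<phi>"
proof (cases "topspace X = {}")
  case True
  then have "chart_image c = {}" if "c \<in> A" for c using domain_topspace[OF that] by (auto simp: chart_image_def)
  then show ?thesis by (auto simp: scal_nonneg_constant_def)
next
  case False
  then obtain x0 where x0: "x0 \<in> topspace X" by blast
  have const: "id (glob N x) = id (glob N x0)" if "x \<in> topspace X" for x
  proof (rule glob_constant[OF transition_F_N(2) _ that x0])
    fix c y assume c: "c \<in> A" and y: "y \<in> chart_image c"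
    interpret C: g2_chart "chart_image c" "\<Gamma> c" "g c" "T c" "\<phi> c" by (rule g2_chart[OF c]) simp
    show "\<exists>e>0. \<forall>z\<in>ball y e. z \<in> chart_image c \<and> id (C.N z) = id (C.N y)"
      unfolding id_def by (rule partial_zero_locally_constant[OF C.U y C.N_diff C.flat_partial_N[OF flat[OF c]]])
  qed
  have N: "N c y = glob N x0" if c: "c \<in> A" and y: "y \<in> chart_image c" for c y
  proof -
    obtain x where x: "x \<in> fst c" "y = snd c x" using y by (auto simp: chart_image_def)
    show ?thesis using const[OF domain_topspace[OF c x(1)]] glob_eq[OF transition_F_N(2) c x(1)] x by simp
  qed
  have "0 \<le> glob N x0 / 4"
  proof -
    obtain c where c: "c \<in> A" "x0 \<in> fst c" using in_domain[OF x0] by blast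
    then have y: "snd c x0 \<in> chart_image c" by (simp add: chart_image_def)
    show ?thesis using g2_chart.N_nonneg[OF g2_chart[OF c(1)] y] N[OF c(1) y] by simp
  qed
  moreover have "g2_scal (\<phi> c) y = glob N x0 / 4" if "c \<in> A" "y \<in> chart_image c" for c y
    using that by (simp add: scal_eq N g2_chart.flat_Sd[OF g2_chart flat])
  ultimately show ?thesis unfolding scal_nonneg_constant_def by blast
qed

lemma flat_harmonic:
  assumes flat: "\<And>c. c \<in> A \<Longrightarrow> flat c"
  shows "harmonic_form A \<phi> 3 (\<lambda>c. g2_torsion (\<phi> c) (\<Gamma> c))"
  unfolding harmonic_form_def coclosed_form_def
proof (intro conjI closed ballI allI)
  fix c y l assume c: "c \<in> A" and y: "y \<in> chart_image c"
  show "g2_codiff (\<phi> c) 3 (g2_torsion (\<phi> c) (\<Gamma> c)) y l = 0"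
    using g2_chart_vol.flat_codiff_T[OF g2_chart_vol[OF c] flat[OF c] y] by (simp add: g2_torsion_def)
qed

end

theorem theorem1p4:
  fixes X :: "'a topology" and A :: "'a chart set"
    and \<phi> :: "'a chart \<Rightarrow> real^7 \<Rightarrow> tens" and \<Gamma> :: "'a chart \<Rightarrow> conn"
  assumes "smooth_manifold7 X A" and "compact_space X"
    and "g2_structure X A \<phi>" and "integrable_g2 A \<phi>"
    and "characteristic_connection A \<phi> \<Gamma>"
    and "closed_form A 3 (\<lambda>c. g2_torsion (\<phi> c) (\<Gamma> c))"
  shows "(ricci_flat A \<phi> \<Gamma> \<longleftrightarrow> gauduchon_g2 A \<phi>) \<and>
         (gauduchon_g2 A \<phi> \<longleftrightarrow> torsion_norm_constant A \<phi> \<Gamma>) \<and>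
         (torsion_norm_constant A \<phi> \<Gamma> \<longleftrightarrow> scal_nonneg_constant A \<phi>) \<and>
         (ricci_flat A \<phi> \<Gamma> \<or> gauduchon_g2 A \<phi> \<or> torsion_norm_constant A \<phi> \<Gamma> \<or> scal_nonneg_constant A \<phi> \<longrightarrow>
            harmonic_form A \<phi> 3 (\<lambda>c. g2_torsion (\<phi> c) (\<Gamma> c)))"
proof -
  interpret g2_manifold X A \<phi> \<Gamma>
    using assms by unfold_locales
  \<comment> \<open>A parallel Lee form is the common condition through which the four are
    compared.\<close>
  let ?flat = "\<forall>c\<in>A. flat c"
  have "gauduchon_g2 A \<phi> \<longleftrightarrow> ?flat"
    using gauduchon_flat[OF assms(2)] by (auto simp: gauduchon_iff g2_chart.flat_Sd[OF g2_chart])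
  moreover have "torsion_norm_constant A \<phi> \<Gamma> \<longleftrightarrow> ?flat"
    using norm_constant_flat[OF assms(2)] by (auto simp: norm_constant_iff g2_chart.flat_partial_N[OF g2_chart])
  moreover have "scal_nonneg_constant A \<phi> \<longleftrightarrow> ?flat"
    using scal_constant_flat[OF assms(2)] flat_scal_constant by blast
  moreover note ricci_flat_iff flat_harmonic
  ultimately show ?thesis by blast
qed

end
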